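(* Let $N\ge3$ and assume (K0), (K$\infty$), (F0), (F$\infty$). Assume $p>\max\{p_S(\alpha),p_S(\beta)\}$. Then exactly one of the following holds: (1) $(E_\mu)$ has no singular solution for every $\mu\ge0$. (2) There are finitely many numbers $0\le\mu_1<\mu_2<\dots<\mu_{N_f}<\infty$, $N_f\ge1$, such that: (a) for each $\mu\in\{\mu_1,\dots,\mu_{N_f}\}$, $(E_\mu)$ has a singular fast-decay solution; (b) for each $i\in\{1,\dots,N_f-1\}$, either $(E_\mu)$ has a singular slow-decay solution for every $\mu\in(\mu_i,\mu_{i+1})$, or $(E_\mu)$ has no singular solution for every $\mu\in(\mu_i,\mu_{i+1})$; moreover, if $\mu_1>0$, the same dichotomy holds for the interval $[0,\mu_1)$; (c) for every $\mu>\mu_{N_f}$, $(E_\mu)$ has no singular solution.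
   Context: $N\ge3$, $p>1$. $K:(0,\infty)\to(0,\infty)$ is continuous and satisfies (K0): $K(r)=(k_0+o(1))r^{\alpha}$ as $r\to0$ for some $\alpha>-2$, $k_0>0$; (K$\infty$): $K(r)=(k_\infty+o(1))r^{\beta}$ as $r\to\infty$ for some $\beta>-2$, $k_\infty>0$. $f:(0,\infty)\to[0,\infty)$ is continuous, not identically zero, and satisfies (F0): $f(r)=O(r^{\nu})$ as $r\to0$ for some $\nu>-2$; (F$\infty$): $f(r)=O(r^{-q})$ as $r\to\infty$ for some $q>N$. For $\mu\ge0$, $(E_\mu)$ is $u''+\frac{N-1}{r}u'+K(r)u^p+\mu f(r)=0$, $u>0$ for $r>0$. A singular solution is $u\in C^2(0,\infty)$ satisfying $(E_\mu)$ pointwise on $(0,\infty)$ with $\lim_{r\to0}u(r)=\infty$. A solution $u$ is fast-decay if $\limsup_{r\to\infty}r^{N-2}u(r)<\infty$ and slow-decay if $\limsup_{r\to\infty}r^{N-2}u(r)=\infty$. $p_S(s):=\frac{N+2+2s}{N-2}$. *)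

theory Defs
  imports "HOL-Analysis.Analysis" "HOL-Library.Landau_Symbols"
begin

definition p_S :: "nat \<Rightarrow> real \<Rightarrow> real" where
  "p_S N s = (real N + 2 + 2 * s) / (real N - 2)"

definition singular_solution ::
  "nat \<Rightarrow> (real \<Rightarrow> real) \<Rightarrow> (real \<Rightarrow> real) \<Rightarrow> real \<Rightarrow> real \<Rightarrow> (real \<Rightarrow> real) \<Rightarrow> bool" where
  "singular_solution N K f p \<mu> u \<longleftrightarrow>
     (\<exists>u' u''.
        (\<forall>r>0. (u has_real_derivative u' r) (at r)) \<and>
        (\<forall>r>0. (u' has_real_derivative u'' r) (at r)) \<and>
        continuous_on {0<..} u'' \<and>
        (\<forall>r>0. u'' r + (real N - 1) / r * u' r + K r * (u r) powr p + \<mu> * f r = 0) \<and>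
        (\<forall>r>0. u r > 0)) \<and>
     filterlim u at_top (at_right 0)"

definition fast_decay :: "nat \<Rightarrow> (real \<Rightarrow> real) \<Rightarrow> bool" where
  "fast_decay N u \<longleftrightarrow> Limsup at_top (\<lambda>r. ereal (r ^ (N - 2) * u r)) < \<infinity>"

definition slow_decay :: "nat \<Rightarrow> (real \<Rightarrow> real) \<Rightarrow> bool" where
  "slow_decay N u \<longleftrightarrow> Limsup at_top (\<lambda>r. ereal (r ^ (N - 2) * u r)) = \<infinity>"

end

theory Submission
 imports Defs "HOL-Complex_Analysis.Complex_Analysis"
begin

text \<open>
With $t = \ln r$, $U(t) = u(e^t)$, $\kappa(t) = e^{2t}K(e^t)$, $\varphi(t) = e^{2t}f(e^t)$ and $n = N - 2$ the
equation becomes $U'' + nU' + \kappa U^p + \mu\varphi = 0$. Near either end a rescaled solution $e^{\theta t}U$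
satisfies an asymptotically autonomous damped equation (the damping is positive because $p$ is supercritical),
and an energy traps it near the positive equilibrium.

At $-\infty$ this forces every singular solution to converge to the equilibrium, so that each $\mu$ has exactly one
candidate; it is the fixed point of a contraction and depends continuously, in fact analytically, on $\mu$.
The set of $\mu$ for which the candidate stays positive is bounded; its complement is open, and so is the set of
slowly decaying ones, since slow decay means being trapped at $+\infty$. Fast decay means that the candidate
matches a bounded solution of the Kelvin-transformed equation, whose family is analytic in $\mu$ as well. The
fast parameters are therefore locally the real zeros of a holomorphic function: were they to accumulate, a
whole half-line would consist of fast parameters, contradicting boundedness. So there are finitely many of
them, and by connectedness nothing changes on the intervals in between.
\<close>

section \<open>Convolutions depending holomorphically on a parameter\<close>

text \<open>Supercriticality enters through one identity: \<theta>^2 - \<theta> (n - \<theta>) = -(n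
  - 2 \<theta>) \<theta> is negative. Since U decreases, the scaled solution w = e^(\<theta> t) U
  rises with speed at most \<theta> w; crossing a low level upwards thus leaves it with negative
  energy, and damping keeps it from returning to 0. What remains to be excluded is permanent
  smallness, where the linear part dominates and the solution is regular at that end. Two obstacles
  shape the analytic part. The linearisation at the equilibrium may be a focus, so its
  characteristic roots can be complex and even the real branch comes from a complex fixed point. And
  w^p is not analytic at 0, so holomorphic families exist only along a positive solution and up to a
  finite time R. The family from the other end perturbs y'' + n y' = 0, whose constants are
  undamped: bounded solutions are labelled by their value at R, and fast decay becomes the vanishing
  of a single derivative mismatch there.\<close>

lemma holomorphic_integral_parameter:
 fixes f :: "complex => real => complex"
 assumes D: "open D"
  and cont: "!!z. z \<in> D ==> continuous_on {a..b} (f z)"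
  and hol: "!!s. s \<in> {a..b} ==> (%z. f z s) holomorphic_on D"
  and bd: "!!z s. z \<in> D ==> s \<in> {a..b} ==> norm (f z s) <= M"
 shows "(%z. integral {a..b} (f z)) holomorphic_on D"
proof (cases "a <= b")
 case False
 then show ?thesis by simp
next
 case ab: True
 have "(%z. integral {a..b} (f z)) field_differentiable at z0" if z0: "z0 \<in> D" for z0
 proof -
  obtain r where r: "0 < r" "cball z0 (2 * r) \<subseteq> D"
  proof -
   obtain e where "e > 0" "cball z0 e \<subseteq> D" using D z0 open_contains_cball by blast
   then show ?thesis using that[of "e / 2"] by simp
  qed
  have sub: "cball z r \<subseteq> D" if "z \<in> ball z0 r" for z
  proof
   fix y assume "y \<in> cball z r"
   then have "dist z0 y <= dist z0 z + dist z y" "dist z y <= r" by (auto intro: dist_triangle)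
   then have "dist z0 y <= 2 * r" using that by auto
   then show "y \<in> D" using r by auto
  qed
  have M0: "0 <= M" using bd[OF z0, of a] ab norm_ge_zero[of "f z0 a"] by (meson atLeastAtMost_iff order_refl order_trans)
  \<comment> \<open>\<open>C\<close> comes from the Cauchy bound for the second derivative on discs
    of radius r; such discs around points of \<open>ball z0 r\<close> stay in \<open>D\<close>
    because \<open>cball z0 (2 * r)\<close> does. It does not depend on \<open>s\<close>, so the
    difference quotients converge uniformly in \<open>s\<close>.\<close>
  define C where "C = 2 * M / r ^ 2"
  define d where "d s = deriv (%z. f z s) z0" for s
  have taylor: "norm (f z s - f z0 s - d s * (z - z0)) <= C * norm (z - z0) ^ 2"
   if z: "z \<in> ball z0 r" and s: "s \<in> {a..b}" for z s
  proof -
   define g where "g = (%z. f z s)"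
   have hg: "g holomorphic_on D" using hol[OF s] g_def by simp
   have h1: "deriv g holomorphic_on D" using hg D holomorphic_deriv by blast
   have bnd: "cmod ((deriv ^^ 2) g x) <= C" if x: "x \<in> ball z0 r" for x
   proof -
    have "cmod ((deriv ^^ 2) g x) <= fact 2 * M / r ^ 2"
    proof (rule Cauchy_inequality)
     show "g holomorphic_on ball x r" using hg sub[OF x] by (meson ball_subset_cball holomorphic_on_subset order_trans)
     show "continuous_on (cball x r) g" using hg sub[OF x] holomorphic_on_imp_continuous_on holomorphic_on_subset by blast
     show "0 < r" by fact
     show "cmod (g y) <= M" if "cmod (x - y) = r" for y
     proof -
      have "y \<in> cball x r" using that by (simp add: dist_norm)
      then show ?thesis using sub[OF x] bd[OF _ s] g_def by blast
     qed
    qed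
    then show ?thesis by (simp add: C_def fact_2)
   qed
   have "cmod ((deriv ^^ 0) g z - (\<Sum>i\<le>1. (deriv ^^ i) g z0 * (z - z0) ^ i / fact i))
     <= C * cmod (z - z0) ^ Suc 1 / fact 1"
   proof (rule complex_Taylor[where S = "ball z0 r" and f = "%i. (deriv ^^ i) g"])
    show "((deriv ^^ i) g has_field_derivative (deriv ^^ Suc i) g x) (at x within ball z0 r)"
     if "x \<in> ball z0 r" "i <= 1" for i x
    proof -
     have xD: "x \<in> D" using sub[OF that(1)] r by auto
     have "(deriv ^^ i) g holomorphic_on D" using hg D holomorphic_higher_deriv by blast
     then have "((deriv ^^ i) g has_field_derivative deriv ((deriv ^^ i) g) x) (at x)" using D xD holomorphic_derivI by blast
     then show ?thesis by (simp add: has_field_derivative_at_within)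
    qed
   qed (use bnd z r in \<open>auto simp: numeral_2_eq_2\<close>)
   then show ?thesis by (simp add: g_def d_def power2_eq_square algebra_simps)
  qed
  \<comment> \<open>\<open>d\<close> is known only as a pointwise derivative. Its continuity in
    \<open>s\<close>, hence its integrability, comes from writing it as the uniform limit of
    difference quotients along one sequence \<open>zs k\<close> tending to
    \<open>z0\<close>.\<close>
  have dcont: "continuous_on {a..b} d"
  proof -
   define zs where "zs k = z0 + of_real (r / (real k + 2))" for k :: nat
   have nz: "norm (zs k - z0) = r / (real k + 2)" for k
   proof -
    have "norm (of_real (r / (real k + 2)) :: complex) = \<bar>r / (real k + 2)\<bar>" by (rule norm_of_real)
    then show ?thesis using r by (simp add: zs_def)
   qed
   have zb: "zs k \<in> ball z0 r" for k
   proof -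
    have "r / (real k + 2) < r" using r by (simp add: field_simps add_pos_nonneg)
    then show ?thesis using nz[of k] by (simp add: dist_norm norm_minus_commute)
   qed
   have zne: "zs k \<noteq> z0" for k
   proof -
    have "norm (zs k - z0) > 0" unfolding nz using r by simp
    then show ?thesis by auto
   qed
   have zD: "zs k \<in> D" for k using zb[of k] sub[OF zb[of k]] r by auto
   have qb: "norm ((f (zs k) s - f z0 s) / (zs k - z0) - d s) <= C * (r / (real k + 2))"
    if s: "s \<in> {a..b}" for k s
   proof -
    have "(f (zs k) s - f z0 s) / (zs k - z0) - d s = (f (zs k) s - f z0 s - d s * (zs k - z0)) / (zs k - z0)"
     using zne[of k] by (simp add: field_simps)
    then have "norm ((f (zs k) s - f z0 s) / (zs k - z0) - d s)
      <= C * norm (zs k - z0) ^ 2 / norm (zs k - z0)" using taylor[OF zb s] by (simp add: norm_divide divide_right_mono)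
    also have "... = C * norm (zs k - z0)" using zne[of k] by (simp add: power2_eq_square)
    finally show ?thesis by (simp only: nz)
   qed
   have "uniform_limit {a..b} (%k s. (f (zs k) s - f z0 s) / (zs k - z0)) d sequentially" unfolding uniform_limit_iff
   proof (intro allI impI)
    fix e :: real assume e: "e > 0"
    have "(%k. C * (r / (real k + 2))) \<longlonglongrightarrow> 0"
     using tendsto_mult_right_zero[OF LIMSEQ_ignore_initial_segment[OF lim_const_over_n[of r], of 2], of C] by (simp add: add.commute)
    then have "\<forall>\<^sub>F k in sequentially. C * (r / (real k + 2)) < e" using e by (simp add: order_tendstoD)
    then show "\<forall>\<^sub>F k in sequentially. \<forall>s\<in>{a..b}. dist ((f (zs k) s - f z0 s) / (zs k - z0)) (d s) < e"
    proof eventually_elim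
     case (elim k)
     then show ?case using qb[of _ k] unfolding dist_norm by (blast intro: le_less_trans)
    qed
   qed
   then show ?thesis
    by (rule uniform_limit_theorem[rotated]) (use cont zD z0 zne in \<open>auto intro!: always_eventually continuous_intros\<close>)
  qed
  have "((%z. integral {a..b} (f z)) has_field_derivative integral {a..b} d) (at z0)"
   unfolding has_field_derivative_def has_derivative_at_alt
   proof (intro conjI allI impI)
    show "bounded_linear ((*) (integral {a..b} d))" by (rule bounded_linear_mult_right)
    fix e :: real assume e: "e > 0"
    define \<delta> where "\<delta> = min r (e / (C * (b - a) + 1))"
    have C0: "0 <= C * (b - a)" using M0 ab by (simp add: C_def)
    have d0: "\<delta> > 0" using e r C0 by (simp add: \<delta>_def)
    show "\<exists>d'>0. \<forall>y. norm (y - z0) < d' -->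
      norm (integral {a..b} (f y) - integral {a..b} (f z0) - integral {a..b} d * (y - z0)) <= e * norm (y - z0)"
    proof (intro exI conjI allI impI)
     show "\<delta> > 0" by fact
     fix y assume y: "norm (y - z0) < \<delta>"
     then have yb: "y \<in> ball z0 r" by (simp add: \<delta>_def dist_norm norm_minus_commute)
     have yD: "y \<in> D" using yb sub[OF yb] r by auto
     have i1: "f y integrable_on {a..b}" "f z0 integrable_on {a..b}" "d integrable_on {a..b}"
      using cont yD z0 dcont integrable_continuous_real by blast+
     have "integral {a..b} (f y) - integral {a..b} (f z0) - integral {a..b} d * (y - z0)
       = integral {a..b} (%s. f y s - f z0 s - d s * (y - z0))"
      using i1 by (simp add: integral_diff integrable_diff integrable_on_mult_left)
     also have "norm ... <= (C * norm (y - z0) ^ 2) * (b - a)" using ab taylor[OF yb] cont[OF yD] cont[OF z0] dcont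
      by (intro integral_bound) (auto intro!: continuous_intros)
     also have "... = (C * (b - a)) * norm (y - z0) * norm (y - z0)" by (simp add: power2_eq_square)
     also have "... <= e * norm (y - z0)"
     proof (rule mult_right_mono)
      have "C * (b - a) * norm (y - z0) <= (C * (b - a) + 1) * (e / (C * (b - a) + 1))"
       using y C0 by (intro mult_mono) (auto simp: \<delta>_def)
      also have "... = e" using C0 by (simp add: field_simps)
      finally show "C * (b - a) * norm (y - z0) <= e" .
     qed simp
     finally show "norm (integral {a..b} (f y) - integral {a..b} (f z0) - integral {a..b} d * (y - z0)) <= e * norm (y - z0)" .
    qed
   qed
  then show ?thesis using field_differentiable_def by blast
 qed
 then show ?thesis by (simp add: holomorphic_on_def field_differentiable_at_within)
qed

text \<open>The value $\int_{-\infty}^t e^{-l(t-s)}h(s)\,ds$; the limit exists for integrands with a \<open>majorant\<close> below.\<close>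

definition causal :: "complex => (real => complex) => real => complex" where
 "causal l h t = exp (- l * of_real t) * lim (%k::nat. integral {- real k..t} (%s. exp (l * of_real s) * h s))"

text \<open>A function $G$ with $b \le G' + eG$ off a finite set bounds every \<open>causal l h\<close> with $|h| \le b$ and Re $l \ge e$.\<close>

definition majorant :: "real set => real => (real => real) => (real => real) => bool" where
 "majorant I e b G \<longleftrightarrow> continuous_on I G & (\<forall>s\<in>I. 0 <= G s) &
  ((%s. exp (e * s) * G s) \<longlongrightarrow> 0) at_bot &
  (\<exists>G' S. finite S & (\<forall>s\<in>I - S. (G has_real_derivative G' s) (at s)) &
    (\<forall>s\<in>I. b s <= G' s + e * G s))"

text \<open>The two shapes used are the whole line, on which the branch is constructed, and an open
  left half-line, on which the holomorphic families live. Openness provides two-sided derivatives at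
  every point.\<close>

definition lower_ray :: "real set => bool" where
 "lower_ray I \<longleftrightarrow> open I & (\<forall>t\<in>I. {..t} \<subseteq> I)"

lemma lower_ray_UNIV: "lower_ray UNIV" and lower_ray_lessThan: "lower_ray {..<R}" by (auto simp: lower_ray_def)

lemma exp_of_real_has_vector_derivative:
 "((%s. exp (l * of_real s :: complex)) has_vector_derivative l * exp (l * of_real s)) (at s within A)"
proof -
 have "((%z. exp (l * z)) has_field_derivative exp (l * of_real s) * l) (at (of_real s))" by (auto intro!: derivative_eq_intros)
 then have "((%s. exp (l * of_real s)) has_vector_derivative exp (l * of_real s) * l) (at s)" by (rule has_vector_derivative_real_field)
 then show ?thesis by (simp add: has_vector_derivative_at_within mult.commute)
qed

lemma exp_neg_mult_exp_cancel: "exp (- (x::complex)) * (exp x * c) = c" by (simp add: mult.assoc[symmetric] exp_minus)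

context
 fixes I :: "real set" and l :: complex and e :: real
 assumes I: "lower_ray I" and le: "e <= Re l"
begin

lemma below_in_I: "t \<in> I ==> s <= t ==> s \<in> I" using I by (auto simp: lower_ray_def)

lemma interval_in_I: "t \<in> I ==> {a..t} \<subseteq> I" using below_in_I by auto

lemma kernel_integrable:
 assumes "continuous_on I h" "t \<in> I"
 shows "(%s. exp (l * of_real s) * h s) integrable_on {a..t}"
 by (intro integrable_continuous_real continuous_intros continuous_on_subset[OF assms(1)] interval_in_I assms)

text \<open>The function exp (Re l s) G(s) has the derivative exp (Re l s) (G' + Re l G), which
  dominates exp (Re l s) b because e <= Re l and G >= 0. The finitely many points without a
  derivative are harmless since G is continuous.\<close>

lemma majorant_integral_bound:
 assumes h: "continuous_on I h" "!!s. s \<in> I ==> norm (h s) <= b s"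
  and G: "majorant I e b G" and t: "a <= t" "t \<in> I"
 shows "norm (integral {a..t} (%s. exp (l * of_real s) * h s)) <= exp (Re l * t) * G t - exp (Re l * a) * G a"
proof -
 obtain G' S where G': "finite S" "!!s. s \<in> I - S ==> (G has_real_derivative G' s) (at s)"
  "!!s. s \<in> I ==> b s <= G' s + e * G s" using G unfolding majorant_def by blast
 have Gc: "continuous_on I G" "!!s. s \<in> I ==> 0 <= G s" using G by (auto simp: majorant_def)
 have sub: "{a..t} \<subseteq> I" using interval_in_I t by blast
 have FTC: "((%s. exp (Re l * s) * (G' s + Re l * G s)) has_integral
   (exp (Re l * t) * G t - exp (Re l * a) * G a)) {a..t}"
 proof (rule fundamental_theorem_of_calculus_strong[OF G'(1) t(1)])
  fix s assume "s \<in> {a..t} - S"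
  then have "(G has_real_derivative G' s) (at s)" using sub G'(2) by blast
  then show "((%s. exp (Re l * s) * G s) has_vector_derivative exp (Re l * s) * (G' s + Re l * G s)) (at s)"
   unfolding has_real_derivative_iff_has_vector_derivative[symmetric] by (auto intro!: derivative_eq_intros simp: algebra_simps)
 next
  show "continuous_on {a..t} (%s. exp (Re l * s) * G s)" using Gc(1) sub by (intro continuous_intros) (rule continuous_on_subset)
 qed
 have "norm (integral {a..t} (%s. exp (l * of_real s) * h s))
   <= integral {a..t} (%s. exp (Re l * s) * (G' s + Re l * G s))"
 proof (rule integral_norm_bound_integral[OF kernel_integrable[OF h(1) t(2)]])
  show "(%s. exp (Re l * s) * (G' s + Re l * G s)) integrable_on {a..t}" using FTC by blast
  fix s assume "s \<in> {a..t}"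
  then have s: "s \<in> I" using sub by blast
  have "norm (h s) <= G' s + e * G s" using h(2)[OF s] G'(3)[OF s] by simp
  also have "... <= G' s + Re l * G s" using Gc(2)[OF s] le by (simp add: mult_right_mono)
  finally show "norm (exp (l * of_real s) * h s) <= exp (Re l * s) * (G' s + Re l * G s)" by (simp add: norm_mult)
 qed
 then show ?thesis using FTC by (simp add: integral_unique)
qed

lemma majorant_tail:
 assumes "majorant I e b G" "I \<noteq> {}"
 shows "(%k. exp (Re l * - real k) * G (- real k)) \<longlonglongrightarrow> 0"
proof -
 obtain t0 where t0: "t0 \<in> I" using assms by blast
 have l1: "(%k. exp (e * - real k) * G (- real k)) \<longlonglongrightarrow> 0"
 proof -
  have "filterlim (%k. - real k) at_bot sequentially" using filterlim_real_sequentially filterlim_uminus_at_top by blast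
  moreover have "((%s. exp (e * s) * G s) \<longlongrightarrow> 0) at_bot" using assms by (simp add: majorant_def)
  ultimately show ?thesis by (rule filterlim_compose[rotated])
 qed
 show ?thesis
 proof (rule Lim_null_comparison[OF _ l1])
  obtain k0 :: nat where k0: "real k0 >= - t0" using real_arch_simple by blast
  show "\<forall>\<^sub>F k in sequentially. norm (exp (Re l * - real k) * G (- real k)) <= exp (e * - real k) * G (- real k)"
   using eventually_ge_at_top[of k0]
  proof eventually_elim
   case (elim k)
   then have "- real k <= t0" using k0 by linarith
   then have "- real k \<in> I" using below_in_I t0 by blast
   then have "0 <= G (- real k)" using assms by (auto simp: majorant_def)
   moreover have "exp (Re l * - real k) <= exp (e * - real k)" using le by (simp add: mult_right_mono)
   ultimately show ?case by (simp add: mult_right_mono)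
  qed
 qed
qed

text \<open>The integrals form a Cauchy sequence: a piece between two cut-offs is bounded by the
  value of exp (Re l s) G(s) at its right end, which tends to 0.\<close>

lemma causal_limit:
 assumes h: "continuous_on I h" "!!s. s \<in> I ==> norm (h s) <= b s"
  and G: "majorant I e b G" and t: "t \<in> I"
 shows "(%k::nat. integral {- real k..t} (%s. exp (l * of_real s) * h s)) \<longlonglongrightarrow> exp (l * of_real t) * causal l h t"
proof -
 define J where "J k = integral {- real k..t} (%s. exp (l * of_real s) * h s)" for k :: nat
 obtain k0 :: nat where k0: "real k0 >= - t" using real_arch_simple by blast
 have "Cauchy J"
 proof (rule CauchyI)
  fix \<epsilon> :: real assume ep: "\<epsilon> > 0"
  have "\<forall>\<^sub>F k in sequentially. exp (Re l * - real k) * G (- real k) < \<epsilon>"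
   using majorant_tail[OF G] t ep order_tendstoD(2) by fastforce
  then obtain k1 where k1: "!!k. k >= k1 ==> exp (Re l * - real k) * G (- real k) < \<epsilon>"
   by (auto simp: eventually_sequentially)
  have key: "norm (J m - J j) < \<epsilon>" if "j >= max k0 k1" "m >= j" for j m
  proof -
   have jI: "- real j \<in> I" using that k0 by (intro below_in_I[OF t]) auto
   have mI: "- real m \<in> I" using that k0 by (intro below_in_I[OF t]) auto
   have "J m = integral {- real m..- real j} (%s. exp (l * of_real s) * h s) + J j" unfolding J_def using that k0
    by (intro Henstock_Kurzweil_Integration.integral_combine[symmetric] kernel_integrable h t) auto
   then have "norm (J m - J j) <= exp (Re l * - real j) * G (- real j) - exp (Re l * - real m) * G (- real m)"
    using majorant_integral_bound[OF h G _ jI, of "- real m"] that by simp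
   also have "... <= exp (Re l * - real j) * G (- real j)" using G mI by (simp add: majorant_def)
   also have "... < \<epsilon>" using k1 that by simp
   finally show ?thesis .
  qed
  show "\<exists>M. \<forall>m\<ge>M. \<forall>n\<ge>M. norm (J m - J n) < \<epsilon>"
  proof (intro exI allI impI)
   fix m n assume "m >= max k0 k1" "n >= max k0 k1"
   then show "norm (J m - J n) < \<epsilon>" using key[of m n] key[of n m] by (cases "m <= n") (auto simp: norm_minus_commute)
  qed
 qed
 then have "J \<longlonglongrightarrow> lim J" by (simp add: Cauchy_convergent_iff convergent_LIMSEQ_iff)
 moreover have "lim J = exp (l * of_real t) * causal l h t"
  unfolding causal_def J_def[abs_def] using exp_neg_mult_exp_cancel[of "- (l * of_real t)"] by simp
 ultimately show ?thesis by (simp add: J_def[abs_def])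
qed

lemma causal_bound:
 assumes h: "continuous_on I h" "!!s. s \<in> I ==> norm (h s) <= b s"
  and G: "majorant I e b G" and t: "t \<in> I"
 shows "norm (causal l h t) <= G t"
proof -
 obtain k0 :: nat where k0: "real k0 >= - t" using real_arch_simple by blast
 have "norm (exp (l * of_real t) * causal l h t) <= exp (Re l * t) * G t"
 proof (rule LIMSEQ_le_const2[OF tendsto_norm[OF causal_limit[OF h G t]]])
  show "\<exists>N. \<forall>n\<ge>N. norm (integral {- real n..t} (%s. exp (l * of_real s) * h s)) <= exp (Re l * t) * G t"
  proof (intro exI allI impI)
   fix k assume "k >= k0"
   then have k: "- real k <= t" using k0 by linarith
   then have "- real k \<in> I" using below_in_I t by blast
   then have "0 <= G (- real k)" using G by (simp add: majorant_def)
   then show "norm (integral {- real k..t} (%s. exp (l * of_real s) * h s)) <= exp (Re l * t) * G t"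
    using majorant_integral_bound[OF h G k t] by (smt (verit) exp_ge_zero mult_nonneg_nonneg)
  qed
 qed
 then show ?thesis by (simp add: norm_mult)
qed

lemma causal_cong:
 assumes "!!s. s \<in> I ==> h s = k s" "t \<in> I"
 shows "causal l h t = causal l k t"
proof -
 have "integral {- real j..t} (%s. exp (l * of_real s) * h s) = integral {- real j..t} (%s. exp (l * of_real s) * k s)" for j
  using interval_in_I[OF assms(2), of "- real j"] assms(1) by (intro integral_cong) auto
 then show ?thesis by (simp add: causal_def)
qed

text \<open>Variation of constants from time a. It trades the limit at -\<infinity> for an integral
  over a compact interval, to which the fundamental theorem applies, and isolates the tail for
  estimates uniform in a parameter.\<close>

lemma causal_split:
 assumes h: "continuous_on I h" "!!s. s \<in> I ==> norm (h s) <= b s"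
  and G: "majorant I e b G" and t: "t \<in> I" "a <= t"
 shows "exp (l * of_real t) * causal l h t =
  exp (l * of_real a) * causal l h a + integral {a..t} (%s. exp (l * of_real s) * h s)"
proof -
 have a: "a \<in> I" using below_in_I t by blast
 obtain k0 :: nat where k0: "real k0 >= - a" using real_arch_simple by blast
 let ?f = "%s. exp (l * of_real s) * h s"
 have "\<forall>\<^sub>F k in sequentially. integral {- real k..a} ?f + integral {a..t} ?f = integral {- real k..t} ?f"
  using eventually_ge_at_top[of k0]
  by eventually_elim (use k0 t in \<open>auto intro!: Henstock_Kurzweil_Integration.integral_combine kernel_integrable h\<close>)
 moreover have "(%k::nat. integral {- real k..a} ?f + integral {a..t} ?f) \<longlonglongrightarrow>
   exp (l * of_real a) * causal l h a + integral {a..t} ?f" by (intro tendsto_intros causal_limit[OF h G a])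
 ultimately have "(%k::nat. integral {- real k..t} ?f) \<longlonglongrightarrow> exp (l * of_real a) * causal l h a + integral {a..t} ?f"
  using tendsto_cong by fastforce
 then show ?thesis using causal_limit[OF h G t(1)] LIMSEQ_unique by blast
qed

lemma causal_has_vector_derivative:
 assumes h: "continuous_on I h" "!!s. s \<in> I ==> norm (h s) <= b s"
  and G: "majorant I e b G" and t: "t \<in> I"
 shows "(causal l h has_vector_derivative (h t - l * causal l h t)) (at t)"
proof -
 let ?f = "%s. exp (l * of_real s) * h s"
 obtain d where d: "d > 0" "ball t d \<subseteq> I" using I t open_contains_ball unfolding lower_ray_def by blast
 define a where "a = t - d / 2"
 define c where "c = t + d / 2"
 have ac: "a < t" "t < c" using d by (auto simp: a_def c_def)
 have cI: "{a..c} \<subseteq> I" using d by (auto simp: a_def c_def subset_iff dist_real_def abs_if)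
 define P where "P u = exp (- l * of_real u) * (exp (l * of_real a) * causal l h a + integral {a..u} ?f)" for u
 have P: "P u = causal l h u" if "u \<in> {a..c}" for u
 proof -
  have "P u = exp (- l * of_real u) * (exp (l * of_real u) * causal l h u)" unfolding P_def using causal_split[OF h G, of u a] that cI by auto
  then show ?thesis by (simp add: exp_neg_mult_exp_cancel)
 qed
 have "((%u. integral {a..u} ?f) has_vector_derivative ?f t) (at t within {a..c})"
  using ac cI by (intro integral_has_vector_derivative continuous_intros continuous_on_subset[OF h(1)]) auto
 then have i: "((%u. integral {a..u} ?f) has_vector_derivative ?f t) (at t)" using ac at_within_Icc_at by fastforce
 have "(P has_vector_derivative (exp (- l * of_real t) * (0 + ?f t) +
   (- l) * exp (- l * of_real t) * (exp (l * of_real a) * causal l h a + integral {a..t} ?f))) (at t)" unfolding P_def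
  by (rule has_vector_derivative_mult exp_of_real_has_vector_derivative has_vector_derivative_add
    has_vector_derivative_const i)+
 moreover have "(exp (- l * of_real t) * (0 + ?f t) +
   (- l) * exp (- l * of_real t) * (exp (l * of_real a) * causal l h a + integral {a..t} ?f)) = h t - l * P t"
  by (simp add: P_def exp_neg_mult_exp_cancel)
 ultimately have "(P has_vector_derivative h t - l * causal l h t) (at t)" using P ac by simp
 then show ?thesis by (rule has_vector_derivative_transform_within_open[where S = "{a<..<c}"]) (use ac P in auto)
qed

text \<open>The growth condition at -\<infinity> excludes the homogeneous solutions, which are
  multiples of exp (-l s). Convergence comes from q itself: the truncated integrals are evaluated in
  closed form through it.\<close>

lemma causal_unique:
 assumes h: "continuous_on I h"
  and q: "!!s. s \<in> I ==> (q has_vector_derivative (h s - l * q s)) (at s)"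
  and q0: "((%s. exp (Re l * s) * norm (q s)) \<longlongrightarrow> 0) at_bot" and t: "t \<in> I"
 shows "causal l h t = q t"
proof -
 let ?f = "%s. exp (l * of_real s) * h s"
 have F: "integral {a..t} ?f = exp (l * of_real t) * q t - exp (l * of_real a) * q a" if "a <= t" for a
 proof (rule integral_unique, rule fundamental_theorem_of_calculus[OF that])
  fix s assume "s \<in> {a..t}"
  then have s: "s \<in> I" using interval_in_I t by blast
  have "((%s. exp (l * of_real s) * q s) has_vector_derivative
   (exp (l * of_real s) * (h s - l * q s) + l * exp (l * of_real s) * q s)) (at s)"
   by (rule has_vector_derivative_mult exp_of_real_has_vector_derivative q s)+
  then show "((%s. exp (l * of_real s) * q s) has_vector_derivative ?f s) (at s within {a..t})"
   by (simp add: algebra_simps has_vector_derivative_at_within)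
 qed
 obtain k0 :: nat where k0: "real k0 >= - t" using real_arch_simple by blast
 have "filterlim (%k. - real k) at_bot sequentially" using filterlim_real_sequentially filterlim_uminus_at_top by blast
 then have "(%k. exp (Re l * - real k) * norm (q (- real k))) \<longlonglongrightarrow> 0" using q0 by (rule filterlim_compose[rotated])
 then have "(%k. norm (exp (l * of_real (- real k)) * q (- real k))) \<longlonglongrightarrow> 0" by (simp add: norm_mult)
 then have "(%k. exp (l * of_real t) * q t - exp (l * of_real (- real k)) * q (- real k)) \<longlonglongrightarrow> exp (l * of_real t) * q t - 0"
  by (intro tendsto_diff tendsto_const) (rule tendsto_norm_zero_cancel)
 moreover have "\<forall>\<^sub>F k in sequentially. exp (l * of_real t) * q t - exp (l * of_real (- real k)) * q (- real k) = integral {- real k..t} ?f"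
  using eventually_ge_at_top[of k0] by eventually_elim (use F k0 in auto)
 ultimately have "(%k. integral {- real k..t} ?f) \<longlonglongrightarrow> exp (l * of_real t) * q t" using tendsto_cong by fastforce
 then show ?thesis unfolding causal_def by (simp add: limI exp_neg_mult_exp_cancel)
qed

text \<open>Both limits exist by their own majorants; afterwards the integrand h - k can be
  estimated by a sharper one, which is how contraction estimates are obtained.\<close>

lemma causal_diff:
 assumes h: "continuous_on I h" "!!s. s \<in> I ==> norm (h s) <= b s" "majorant I e b G"
  and k: "continuous_on I k" "!!s. s \<in> I ==> norm (k s) <= c s" "majorant I e c H"
  and t: "t \<in> I"
 shows "causal l h t - causal l k t = causal l (%s. h s - k s) t"
proof -
 have "(%j::nat. integral {- real j..t} (%s. exp (l * of_real s) * h s) - integral {- real j..t} (%s. exp (l * of_real s) * k s))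
  \<longlonglongrightarrow> exp (l * of_real t) * causal l h t - exp (l * of_real t) * causal l k t"
  by (intro tendsto_intros causal_limit[OF h t] causal_limit[OF k t])
 then have "(%j::nat. integral {- real j..t} (%s. exp (l * of_real s) * (h s - k s)))
  \<longlonglongrightarrow> exp (l * of_real t) * (causal l h t - causal l k t)"
  by (simp add: integral_diff[symmetric] kernel_integrable h k t right_diff_distrib)
 then show ?thesis unfolding causal_def[of l "%s. h s - k s"] by (simp add: limI exp_neg_mult_exp_cancel)
qed

text \<open>Each truncated integral is holomorphic, and the missing tail is bounded by the majorant
  independently of z, so the limit is locally uniform in z.\<close>

lemma causal_holomorphic:
 assumes D: "open D"
  and h: "!!z. z \<in> D ==> continuous_on I (h z)" "!!s. s \<in> I ==> (%z. h z s) holomorphic_on D"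
   "!!z s. z \<in> D ==> s \<in> I ==> norm (h z s) <= b s"
  and bb: "!!t. t \<in> I ==> \<exists>B. \<forall>s\<le>t. b s <= B"
  and G: "majorant I e b G" and t: "t \<in> I"
 shows "(%z. causal l (h z) t) holomorphic_on D"
proof -
 obtain k0 :: nat where k0: "real k0 >= - t" using real_arch_simple by blast
 \<comment> \<open>Shifting by \<open>k0\<close> keeps every lower limit below t, so that
   \<open>causal_split\<close> applies from the first term on.\<close>
 define J where "J k z = integral {- real (k + k0)..t} (%s. exp (l * of_real s) * h z s)" for k :: nat and z
 have "(%z. exp (l * of_real t) * causal l (h z) t) holomorphic_on D"
 proof (rule holomorphic_uniform_sequence[OF D])
  show "J k holomorphic_on D" for k
  proof -
   obtain B where B: "!!s. s <= t ==> b s <= B" using bb[OF t] by blast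
   define a where "a = - real (k + k0)"
   have "continuous_on {a..t} (%s. exp (l * of_real s))" by (intro continuous_intros)
   then have "compact ((%s. exp (l * of_real s)) ` {a..t})" using compact_continuous_image compact_Icc by blast
   then obtain E where E: "!!s. s \<in> {a..t} ==> norm (exp (l * of_real s)) <= E"
    by (meson bounded_iff compact_imp_bounded imageI)
   show ?thesis unfolding J_def a_def[symmetric]
   proof (rule holomorphic_integral_parameter[OF D, where M = "E * B"])
    show "continuous_on {a..t} (%s. exp (l * of_real s) * h z s)" if "z \<in> D" for z
     by (intro continuous_intros continuous_on_subset[OF h(1)[OF that]] interval_in_I t)
    fix s assume s: "s \<in> {a..t}"
    then have sI: "s \<in> I" using interval_in_I t by blast
    show "(%z. exp (l * of_real s) * h z s) holomorphic_on D" by (intro holomorphic_intros h(2) sI)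
    fix z assume z: "z \<in> D"
    have "norm (h z s) <= B" using h(3)[OF z sI] B[of s] s by auto
    then show "norm (exp (l * of_real s) * h z s) <= E * B"
     unfolding norm_mult using E[OF s] order_trans[OF norm_ge_zero E[OF s]] by (intro mult_mono) auto
   qed
  qed
  fix x assume x: "x \<in> D"
  then obtain d where d: "0 < d" "cball x d \<subseteq> D" using D open_contains_cball by blast
  have "uniform_limit (cball x d) J (%z. exp (l * of_real t) * causal l (h z) t) sequentially" unfolding uniform_limit_iff
  proof (intro allI impI)
   fix \<epsilon> :: real assume ep: "\<epsilon> > 0"
   have "(%k. exp (Re l * - real k) * G (- real k)) \<longlonglongrightarrow> 0" using majorant_tail[OF G] t by blast
   then have "(%k. exp (Re l * - real (k + k0)) * G (- real (k + k0))) \<longlonglongrightarrow> 0" by (rule LIMSEQ_ignore_initial_segment)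
   then have "\<forall>\<^sub>F k in sequentially. exp (Re l * - real (k + k0)) * G (- real (k + k0)) < \<epsilon>"
    using ep by (simp only: order_tendstoD)
   then show "\<forall>\<^sub>F k in sequentially. \<forall>z\<in>cball x d. dist (J k z) (exp (l * of_real t) * causal l (h z) t) < \<epsilon>"
   proof eventually_elim
    case (elim k)
    define a where "a = - real (k + k0)"
    show ?case
    proof
     fix z assume "z \<in> cball x d"
     then have z: "z \<in> D" using d by blast
     have at: "a <= t" using k0 by (simp add: a_def)
     then have aI: "a \<in> I" using below_in_I t by blast
     have "exp (l * of_real t) * causal l (h z) t - J k z = exp (l * of_real a) * causal l (h z) a"
      using causal_split[OF h(1)[OF z] h(3)[OF z] G t at] by (simp add: J_def a_def)
     then have "norm (exp (l * of_real t) * causal l (h z) t - J k z) = exp (Re l * a) * norm (causal l (h z) a)" by (simp add: norm_mult)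
     also have "... <= exp (Re l * a) * G a" using causal_bound[OF h(1)[OF z] h(3)[OF z] G aI] by simp
     also have "... < \<epsilon>" using elim by (simp add: a_def)
     finally show "dist (J k z) (exp (l * of_real t) * causal l (h z) t) < \<epsilon>" by (simp add: dist_norm norm_minus_commute)
    qed
   qed
  qed
  then show "\<exists>d>0. cball x d \<subseteq> D & uniform_limit (cball x d) J (%z. exp (l * of_real t) * causal l (h z) t) sequentially"
   using d by blast
 qed
 then have "(%z. exp (- l * of_real t) * (exp (l * of_real t) * causal l (h z) t)) holomorphic_on D"
  by (rule holomorphic_on_mult[OF holomorphic_on_const])
 then show ?thesis by (simp add: exp_neg_mult_exp_cancel)
qed

end

section \<open>Contractions on spaces of holomorphic families\<close>

text \<open>For a set \<open>D\<close> that is not open, such as a single real parameter, only continuity in time is required.\<close>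

definition holo_family :: "complex set => real set => (complex => real => complex) => bool" where
 "holo_family D I x \<longleftrightarrow> (\<forall>z\<in>D. continuous_on I (x z)) &
  (open D --> (\<forall>t\<in>I. (%z. x z t) holomorphic_on D))"

text \<open>Dividing by \<omega> turns the weighted estimate into uniform convergence over I, which
  gives continuity in time even where \<omega> is unbounded. For fixed t the estimate is uniform in
  z, which gives holomorphy.\<close>

lemma holo_family_limit:
 assumes \<omega>: "continuous_on I \<omega>" "!!t. t \<in> I ==> 0 < \<omega> t"
  and xs: "!!k. holo_family D I (xs k)"
  and lim: "!!k z t. z \<in> D ==> t \<in> I ==> norm (xs k z t - x z t) <= \<rho> * (1/2) ^ k * \<omega> t"
 shows "holo_family D I x"
proof -
 have small: "\<forall>\<^sub>F k in sequentially. \<rho> * (1/2) ^ k * c < e" if "e > 0" for e c :: real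
 proof -
  have "(%k. \<rho> * (1/2) ^ k * c) \<longlonglongrightarrow> \<rho> * 0 * c" by (intro tendsto_intros LIMSEQ_realpow_zero) auto
  then show ?thesis using that by (simp add: order_tendstoD)
 qed
 show ?thesis unfolding holo_family_def
 proof (intro conjI ballI impI)
  fix z assume z: "z \<in> D"
  have "uniform_limit I (%k t. xs k z t / of_real (\<omega> t)) (%t. x z t / of_real (\<omega> t)) sequentially"
   unfolding uniform_limit_iff
  proof (intro allI impI)
   fix e :: real assume "e > 0"
   from small[OF this, of 1] show "\<forall>\<^sub>F k in sequentially. \<forall>t\<in>I. dist (xs k z t / of_real (\<omega> t)) (x z t / of_real (\<omega> t)) < e"
   proof eventually_elim
    case (elim k)
    show ?case
    proof
     fix t assume t: "t \<in> I"
     have "dist (xs k z t / of_real (\<omega> t)) (x z t / of_real (\<omega> t)) = norm (xs k z t - x z t) / \<omega> t"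
      using \<omega>(2)[OF t] by (simp add: dist_norm diff_divide_distrib[symmetric] norm_divide)
     also have "... <= \<rho> * (1/2) ^ k * \<omega> t / \<omega> t" using \<omega>(2)[OF t] lim[OF z t] by (intro divide_right_mono) auto
     also have "... < e" using elim \<omega>(2)[OF t] by simp
     finally show "dist (xs k z t / of_real (\<omega> t)) (x z t / of_real (\<omega> t)) < e" .
    qed
   qed
  qed
  moreover have "continuous_on I (%t. xs k z t / of_real (\<omega> t))" for k
   using xs[of k] z \<omega> by (force simp: holo_family_def intro!: continuous_intros)
  ultimately have "continuous_on I (%t. x z t / of_real (\<omega> t))" by (intro uniform_limit_theorem[where F = sequentially]) auto
  then have "continuous_on I (%t. x z t / of_real (\<omega> t) * of_real (\<omega> t))"
   by (rule continuous_on_mult) (use \<omega> in \<open>auto intro!: continuous_intros\<close>)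
  moreover have "x z t / of_real (\<omega> t) * of_real (\<omega> t) = x z t" if "t \<in> I" for t using \<omega>(2)[OF that] by simp
  ultimately show "continuous_on I (x z)" by (simp cong: continuous_on_cong_simp)
 next
  fix t assume D: "open D" and t: "t \<in> I"
  show "(%z. x z t) holomorphic_on D"
  proof (rule holomorphic_uniform_sequence[OF D])
   show "(%z. xs k z t) holomorphic_on D" for k using xs[of k] t D by (simp add: holo_family_def)
   fix z0 assume "z0 \<in> D"
   then obtain d where d: "0 < d" "cball z0 d \<subseteq> D" using D open_contains_cball by blast
   have "uniform_limit (cball z0 d) (%k z. xs k z t) (%z. x z t) sequentially" unfolding uniform_limit_iff
   proof (intro allI impI)
    fix e :: real assume "e > 0"
    from small[OF this, of "\<omega> t"] show "\<forall>\<^sub>F k in sequentially. \<forall>z\<in>cball z0 d. dist (xs k z t) (x z t) < e"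
    proof eventually_elim
     case (elim k)
     then show ?case using lim[of _ t k] t d unfolding dist_norm by (blast intro: le_less_trans)
    qed
   qed
   then show "\<exists>d>0. cball z0 d \<subseteq> D & uniform_limit (cball z0 d) (%k z. xs k z t) (%z. x z t) sequentially"
    using d by blast
  qed
 qed
qed

definition near :: "complex set => real set => (real => real) => real => (complex => real => complex) => (complex => real => complex) => bool" where
 "near D I \<omega> d x y \<longleftrightarrow> (\<forall>z\<in>D. \<forall>t\<in>I. norm (x z t - y z t) <= d * \<omega> t)"

text \<open>Picard iteration for the weighted distance \<open>near\<close>. A first step of at most
  \<rho>/2 and the contraction factor 1/2 keep the k-th iterate within \<rho> (1 - 2^-k) of
  \<open>x0\<close>, so no iterate leaves the ball on which \<open>T\<close> is controlled.\<close>

lemma holo_family_fixed_point: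
 fixes T :: "(complex => real => complex) => complex => real => complex"
 assumes \<omega>: "continuous_on I \<omega>" "!!t. t \<in> I ==> 0 < \<omega> t" and \<rho>: "0 <= \<rho>"
  and x0: "holo_family D I x0"
  and TX: "!!x. holo_family D I x ==> near D I \<omega> \<rho> x x0 ==> holo_family D I (T x)"
  and Tlip: "!!x y d. holo_family D I x ==> near D I \<omega> \<rho> x x0 ==> holo_family D I y ==> near D I \<omega> \<rho> y x0
    ==> 0 <= d ==> near D I \<omega> d x y ==> near D I \<omega> (d / 2) (T x) (T y)"
  and T0: "near D I \<omega> (\<rho> / 2) (T x0) x0"
 shows "\<exists>x. holo_family D I x & near D I \<omega> \<rho> x x0 & (\<forall>z\<in>D. \<forall>t\<in>I. T x z t = x z t)"
proof -
 define xs where "xs k = (T ^^ k) x0" for k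
 have xs_Suc: "xs (Suc k) = T (xs k)" for k by (simp add: xs_def)
 have ind: "holo_family D I (xs k) & near D I \<omega> (\<rho> * (1 - (1/2) ^ k)) (xs k) x0 &
   near D I \<omega> (\<rho> * (1/2) ^ Suc k) (xs (Suc k)) (xs k)" for k
 proof (induction k)
  case 0
  then show ?case using x0 T0 by (simp add: xs_def near_def)
 next
  case (Suc k)
  have n1: "near D I \<omega> (\<rho> * (1 - (1/2) ^ Suc k)) (xs (Suc k)) x0" unfolding near_def
  proof (intro ballI)
   fix z t assume zt: "z \<in> D" "t \<in> I"
   have "norm (xs (Suc k) z t - x0 z t) <= norm (xs (Suc k) z t - xs k z t) + norm (xs k z t - x0 z t)" by norm
   also have "... <= \<rho> * (1/2) ^ Suc k * \<omega> t + \<rho> * (1 - (1/2) ^ k) * \<omega> t"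
    using Suc.IH zt by (intro add_mono) (auto simp: near_def)
   also have "... = \<rho> * (1 - (1/2) ^ Suc k) * \<omega> t" by (simp add: field_simps)
   finally show "norm (xs (Suc k) z t - x0 z t) <= \<rho> * (1 - (1/2) ^ Suc k) * \<omega> t" .
  qed
  have nr: "near D I \<omega> \<rho> y x0" if "near D I \<omega> (\<rho> * (1 - (1/2) ^ j)) y x0" for y and j :: nat unfolding near_def
  proof (intro ballI)
   fix z t assume zt: "z \<in> D" "t \<in> I"
   have "norm (y z t - x0 z t) <= \<rho> * (1 - (1/2) ^ j) * \<omega> t" using that zt by (simp add: near_def)
   also have "... <= \<rho> * 1 * \<omega> t" using \<rho> \<omega>(2)[OF zt(2)] by (intro mult_right_mono mult_left_mono) auto
   finally show "norm (y z t - x0 z t) <= \<rho> * \<omega> t" by simp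
  qed
  have h1: "holo_family D I (xs (Suc k))" using TX Suc.IH nr unfolding xs_Suc by blast
  have "near D I \<omega> ((\<rho> * (1/2) ^ Suc k) / 2) (T (xs (Suc k))) (T (xs k))"
   using Tlip[OF h1 nr[OF n1], of "xs k" "\<rho> * (1/2) ^ Suc k"] Suc.IH nr \<rho> by auto
  then show ?case using h1 n1 by (simp add: xs_Suc)
 qed
 have nrr: "near D I \<omega> \<rho> (xs k) x0" for k unfolding near_def
 proof (intro ballI)
  fix z t assume zt: "z \<in> D" "t \<in> I"
  have "norm (xs k z t - x0 z t) <= \<rho> * (1 - (1/2) ^ k) * \<omega> t" using ind[of k] zt by (simp add: near_def)
  also have "... <= \<rho> * 1 * \<omega> t" using \<rho> \<omega>(2)[OF zt(2)] by (intro mult_right_mono mult_left_mono) auto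
  finally show "norm (xs k z t - x0 z t) <= \<rho> * \<omega> t" by simp
 qed
 define x where "x z t = lim (%k. xs k z t)" for z t
 have diff: "norm (xs (k + j) z t - xs k z t) <= \<rho> * (1/2) ^ k * (1 - (1/2) ^ j) * \<omega> t"
  if zt: "z \<in> D" "t \<in> I" for z t k j
 proof (induction j)
  case 0 then show ?case by simp
 next
  case (Suc j)
  have "norm (xs (k + Suc j) z t - xs k z t) <= norm (xs (Suc (k + j)) z t - xs (k + j) z t) + norm (xs (k + j) z t - xs k z t)" by (simp, norm)
  also have "... <= \<rho> * (1/2) ^ Suc (k + j) * \<omega> t + \<rho> * (1/2) ^ k * (1 - (1/2) ^ j) * \<omega> t"
   using ind[of "k + j"] zt Suc.IH by (intro add_mono) (auto simp: near_def)
  also have "... = \<rho> * (1/2) ^ k * (1 - (1/2) ^ Suc j) * \<omega> t" by (simp add: power_add field_simps)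
  finally show ?case .
 qed
 have diff': "norm (xs (k + j) z t - xs k z t) <= \<rho> * (1/2) ^ k * \<omega> t"
  if zt: "z \<in> D" "t \<in> I" for z t k j
 proof -
  have "\<rho> * (1/2) ^ k * (1 - (1/2) ^ j) * \<omega> t <= \<rho> * (1/2) ^ k * 1 * \<omega> t"
   using \<rho> \<omega>(2)[OF zt(2)] by (intro mult_right_mono mult_left_mono) auto
  then show ?thesis using diff[OF zt, of k j] by simp
 qed
 have conv: "(%k. xs k z t) \<longlonglongrightarrow> x z t" if zt: "z \<in> D" "t \<in> I" for z t
 proof -
  have "Cauchy (%k. xs k z t)"
  proof (rule CauchyI)
   fix e :: real assume e: "e > 0"
   have "(%k. \<rho> * (1/2) ^ k * \<omega> t) \<longlonglongrightarrow> \<rho> * 0 * \<omega> t"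
    by (intro tendsto_intros LIMSEQ_realpow_zero) auto
   then have "\<forall>\<^sub>F k in sequentially. \<rho> * (1/2) ^ k * \<omega> t < e / 2" using e by (intro order_tendstoD) auto
   then obtain M where M: "\<rho> * (1/2) ^ M * \<omega> t < e / 2" by (auto simp: eventually_sequentially)
   show "\<exists>M. \<forall>m\<ge>M. \<forall>n\<ge>M. norm (xs m z t - xs n z t) < e"
   proof (intro exI allI impI)
    fix m n assume "m >= M" "n >= M"
    then have "norm (xs m z t - xs M z t) < e / 2" "norm (xs n z t - xs M z t) < e / 2"
     using diff'[OF zt, of M "m - M"] diff'[OF zt, of M "n - M"] M by auto
    then show "norm (xs m z t - xs n z t) < e" by norm
   qed
  qed
  then show ?thesis by (simp add: x_def Cauchy_convergent_iff convergent_LIMSEQ_iff)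
 qed
 have xk: "norm (xs k z t - x z t) <= \<rho> * (1/2) ^ k * \<omega> t" if zt: "z \<in> D" "t \<in> I" for z t k
 proof -
  have "(%j. norm (xs (k + j) z t - xs k z t)) \<longlonglongrightarrow> norm (x z t - xs k z t)"
   using LIMSEQ_ignore_initial_segment[OF conv[OF zt], of k] by (intro tendsto_intros) (simp add: add.commute)
  then have "norm (x z t - xs k z t) <= \<rho> * (1/2) ^ k * \<omega> t" by (rule LIMSEQ_le_const2) (use diff'[OF zt] in auto)
  then show ?thesis by (simp add: norm_minus_commute)
 qed
 have hx: "holo_family D I x" by (rule holo_family_limit[OF \<omega> _ xk]) (use ind in auto)
 have nx: "near D I \<omega> \<rho> x x0" using xk[where k = 0] by (auto simp: near_def xs_def norm_minus_commute)
 have "T x z t = x z t" if zt: "z \<in> D" "t \<in> I" for z t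
 proof -
  have b: "norm (T x z t - x z t) <= \<rho> * (1/2) ^ k * \<omega> t" for k
  proof -
   have "near D I \<omega> (\<rho> * (1/2) ^ k) x (xs k)" using xk by (auto simp: near_def norm_minus_commute)
   then have "near D I \<omega> (\<rho> * (1/2) ^ k / 2) (T x) (xs (Suc k))" unfolding xs_Suc using Tlip[OF hx nx _ nrr] ind \<rho> by auto
   then have "norm (T x z t - xs (Suc k) z t) <= \<rho> * (1/2) ^ k / 2 * \<omega> t" using zt by (simp add: near_def)
   moreover have "norm (xs (Suc k) z t - x z t) <= \<rho> * (1/2) ^ Suc k * \<omega> t" by (rule xk[OF zt])
   ultimately have "norm (T x z t - x z t) <= \<rho> * (1/2) ^ k / 2 * \<omega> t + \<rho> * (1/2) ^ Suc k * \<omega> t"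
    using norm_triangle_ineq[of "T x z t - xs (Suc k) z t" "xs (Suc k) z t - x z t"] unfolding add_diff_eq diff_add_cancel by linarith
   then show ?thesis by (simp add: mult_ac)
  qed
  have "(%k. \<rho> * (1/2) ^ k * \<omega> t) \<longlonglongrightarrow> \<rho> * 0 * \<omega> t"
   by (intro tendsto_intros LIMSEQ_realpow_zero) auto
  then have "norm (T x z t - x z t) <= \<rho> * 0 * \<omega> t" by (rule LIMSEQ_le_const) (use b in auto)
  then show ?thesis by simp
 qed
 then show ?thesis using hx nx by blast
qed

section \<open>Weighted norms and the damped second-order equation\<close>

text \<open>exp (m W) is a weight of Bielecki type: flat up to T0, where the nonlinearity is a small
  perturbation anyway, and afterwards growing at the rate of its Lipschitz constant W'. Enlarging m
  restores the contraction without shortening the time interval. At T0 the function W may have a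
  kink.\<close>

definition weight :: "real set => real => (real => real) => (real => real) => bool" where
 "weight I T0 W W' \<longleftrightarrow> continuous_on I W & (\<forall>t\<in>I. 0 <= W t & 0 <= W' t) & (\<forall>t\<le>T0. W t = 0) &
  (\<forall>t\<in>I. \<exists>C. \<forall>s\<le>t. W s <= C & W' s <= C) &
  (\<forall>t\<in>I - {T0}. (W has_real_derivative W' t) (at t))"

lemma weight_limit_at_bot:
 assumes "weight I T0 W W'" "e > 0"
 shows "((%s. exp (e * s) * (c * exp (m * W s))) \<longlongrightarrow> 0) at_bot"
proof -
 have "((%s. c * exp (e * s)) \<longlongrightarrow> c * 0) at_bot" using assms(2) by (intro tendsto_intros filterlim_compose[OF exp_at_bot]
    filterlim_tendsto_pos_mult_at_bot[OF tendsto_const _ filterlim_ident]) auto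
 moreover have "\<forall>\<^sub>F s in at_bot. c * exp (e * s) = exp (e * s) * (c * exp (m * W s))"
  using eventually_le_at_bot[of T0] by eventually_elim (use assms in \<open>simp add: weight_def\<close>)
 ultimately show ?thesis by (simp add: Lim_transform_eventually)
qed

lemma majorant_weight_const:
 assumes W: "weight I T0 W W'" and e: "e > 0" and m: "m >= 0" and B: "B >= 0"
 shows "majorant I e (%s. B * exp (m * W s)) (%s. B / e * exp (m * W s))" unfolding majorant_def
proof (intro conjI exI)
 show "continuous_on I (%s. B / e * exp (m * W s))"
  using W unfolding weight_def by (intro continuous_on_mult continuous_on_const continuous_on_exp) auto
 show "\<forall>s\<in>I. 0 <= B / e * exp (m * W s)" using B e by simp
 show "((%s. exp (e * s) * (B / e * exp (m * W s))) \<longlongrightarrow> 0) at_bot" by (rule weight_limit_at_bot[OF W e])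
 show "finite {T0}" by simp
 show "\<forall>s\<in>I - {T0}. ((%s. B / e * exp (m * W s)) has_real_derivative B / e * (m * W' s * exp (m * W s))) (at s)"
  using W e by (auto simp: weight_def intro!: derivative_eq_intros)
 show "\<forall>s\<in>I. B * exp (m * W s) <= B / e * (m * W' s * exp (m * W s)) + e * (B / e * exp (m * W s))"
  using W B e m by (auto simp: weight_def)
qed

text \<open>The summand W' exp (m W) is the derivative of exp (m W) / m and costs only 1/m, however
  large W' is; the constant summand \<epsilon> costs \<epsilon>/e as in
  \<open>majorant_weight_const\<close>.\<close>

lemma majorant_weight:
 assumes W: "weight I T0 W W'" and e: "e > 0" and m: "m > 0" and d: "d >= 0" "\<epsilon> >= 0"
 shows "majorant I e (%s. d * (\<epsilon> + W' s) * exp (m * W s)) (%s. d * (\<epsilon> / e + 1 / m) * exp (m * W s))"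
 unfolding majorant_def
proof (intro conjI exI)
 show "continuous_on I (%s. d * (\<epsilon> / e + 1 / m) * exp (m * W s))"
  using W unfolding weight_def by (intro continuous_on_mult continuous_on_const continuous_on_exp) auto
 show "\<forall>s\<in>I. 0 <= d * (\<epsilon> / e + 1 / m) * exp (m * W s)" using d e m by simp
 show "((%s. exp (e * s) * (d * (\<epsilon> / e + 1 / m) * exp (m * W s))) \<longlongrightarrow> 0) at_bot"
  by (rule weight_limit_at_bot[OF W e])
 show "finite {T0}" by simp
 show "\<forall>s\<in>I - {T0}. ((%s. d * (\<epsilon> / e + 1 / m) * exp (m * W s)) has_real_derivative
   d * (\<epsilon> / e + 1 / m) * (m * W' s * exp (m * W s))) (at s)" using W by (auto simp: weight_def intro!: derivative_eq_intros)
 show "\<forall>s\<in>I. d * (\<epsilon> + W' s) * exp (m * W s) \<le>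
   d * (\<epsilon> / e + 1 / m) * (m * W' s * exp (m * W s)) + e * (d * (\<epsilon> / e + 1 / m) * exp (m * W s))"
 proof
  fix s assume s: "s \<in> I"
  then have W': "0 <= W' s" using W by (simp add: weight_def)
  have "\<epsilon> + W' s <= (\<epsilon> / e + 1 / m) * m * W' s + e * (\<epsilon> / e + 1 / m)"
  proof -
   have "(\<epsilon> / e + 1 / m) * m * W' s + e * (\<epsilon> / e + 1 / m) = \<epsilon> / e * m * W' s + W' s + \<epsilon> + e / m"
    using e m by (simp add: field_simps)
   then show ?thesis using e m d W' by simp
  qed
  then have "d * exp (m * W s) * (\<epsilon> + W' s) <= d * exp (m * W s) * ((\<epsilon> / e + 1 / m) * m * W' s + e * (\<epsilon> / e + 1 / m))"
   using d by (intro mult_left_mono) auto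
  then show "d * (\<epsilon> + W' s) * exp (m * W s) \<le>
    d * (\<epsilon> / e + 1 / m) * (m * W' s * exp (m * W s)) + e * (d * (\<epsilon> / e + 1 / m) * exp (m * W s))"
   by (simp only: ac_simps distrib_left distrib_right)
 qed
qed

text \<open>The equation x'' + (l1 + l2) x' + l1 l2 (x - A) + H = 0 factors into two first-order
  operators, so solutions bounded at -\<infinity> are fixed points of x = A -
  \<open>causal l1\<close> (\<open>causal l2\<close> H). The ball is centred at an approximate
  solution \<open>xb\<close> with residual \<open>R\<close>; since T xb - xb is minus the double
  convolution of \<open>R\<close>, only this residual has to be small. The first convolution turns d
  (\<epsilon> + W') \<omega> into d (\<epsilon>/e + 1/m) \<omega>, the second divides by e; this is
  the origin of the two smallness conditions.\<close>

lemma second_order_family: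
 fixes H :: "complex => real => complex => complex" and A l1 l2 :: complex and W W' :: "real => real" and m :: real
 defines "\<omega> \<equiv> %s. exp (m * W s)"
 assumes I: "lower_ray I" and e: "0 < e" "e <= Re l1" "e <= Re l2"
  and m: "m > 0" and \<epsilon>: "0 <= \<epsilon>" "(\<epsilon> / e + 1 / m) / e <= 1 / 2"
  and W: "weight I T0 W W'" and \<rho>: "0 <= \<rho>" and B: "0 <= B" and xc: "continuous_on I xb"
  and HX: "!!x. holo_family D I x ==> near D I \<omega> \<rho> x (%z. xb) ==> holo_family D I (%z s. H z s (x z s))"
  and Hlip: "!!z s x y. z \<in> D ==> s \<in> I ==> norm (x - xb s) <= \<rho> * \<omega> s ==> norm (y - xb s) <= \<rho> * \<omega> s
    ==> norm (H z s x - H z s y) <= (\<epsilon> + W' s) * norm (x - y)"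
  and H0: "!!z s. z \<in> D ==> s \<in> I ==> norm (H z s (xb s)) <= B * (1 + W' s) * \<omega> s"
  and xb: "!!s. s \<in> I ==> (xb has_vector_derivative xb1 s) (at s)"
   "!!z s. z \<in> D ==> s \<in> I ==> (xb1 has_vector_derivative
     (- (l1 + l2) * xb1 s - l1 * l2 * (xb s - A) - H z s (xb s) + R z s)) (at s)"
   "!!s. s <= T0 ==> norm (xb s) <= Mb & norm (xb1 s) <= Mb"
  and R: "!!z. z \<in> D ==> continuous_on I (R z)" "0 <= dR" "0 <= eR" "dR * (eR / e + 1 / m) / e <= \<rho> / 2"
   "!!z s. z \<in> D ==> s \<in> I ==> norm (R z s) <= dR * (eR + W' s) * \<omega> s"
 shows "\<exists>x x1. holo_family D I x & holo_family D I x1 & near D I \<omega> \<rho> x (%z. xb) &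
  (\<forall>z\<in>D. \<forall>t\<in>I. (x z has_vector_derivative x1 z t) (at t) &
   (x1 z has_vector_derivative (- (l1 + l2) * x1 z t - l1 * l2 * (x z t - A) - H z t (x z t))) (at t)) &
  (\<exists>C. \<forall>z\<in>D. \<forall>t\<in>I. norm (x1 z t) <= C * \<omega> t)"
proof -
 have W0: "!!s. s \<in> I ==> 0 <= W' s" "!!s. s \<in> I ==> 0 <= W s" and Wc: "continuous_on I W"
  using W by (auto simp: weight_def)
 have oc: "continuous_on I \<omega>" unfolding \<omega>_def using Wc by (intro continuous_intros)
 have op: "0 < \<omega> t" for t by (simp add: \<omega>_def)
 define h where "h x z s = H z s (x z s)" for x and z :: complex and s
 define Y where "Y x z = causal l2 (h x z)" for x and z :: complex
 define T where "T x z t = A - causal l1 (Y x z) t" for x z t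
 \<comment> \<open>A bound for H on the whole ball: \<open>B\<close> at the centre plus the
   Lipschitz variation over a distance \<rho> \<omega>.\<close>
 define B1 where "B1 = B + \<rho> * (\<epsilon> + 1)"
 define b where "b s = B1 * (1 + W' s) * \<omega> s" for s
 define G where "G s = B1 * (1 / e + 1 / m) * \<omega> s" for s
 have B1: "0 <= B1" using B \<rho> \<epsilon> by (simp add: B1_def)
 have mj1: "majorant I e b G" unfolding b_def G_def \<omega>_def using majorant_weight[OF W e(1) m B1, of 1] by simp
 define G2 where "G2 s = B1 * (1 / e + 1 / m) / e * \<omega> s" for s
 have mj2: "majorant I e G G2" unfolding G_def G2_def \<omega>_def using B1 e m by (intro majorant_weight_const[OF W]) auto
 have bb: "\<exists>C. \<forall>s\<le>t. b s <= C" if t: "t \<in> I" for t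
 proof -
  obtain C where C: "!!s. s <= t ==> W s <= C & W' s <= C" using W t unfolding weight_def by meson
  have "b s <= B1 * (1 + C) * exp (m * C)" if s: "s <= t" for s
  proof -
   have sI: "s \<in> I" using I t s by (auto simp: lower_ray_def)
   show ?thesis unfolding b_def \<omega>_def using C[OF s] W0[OF sI] B1 m by (intro mult_mono) auto
  qed
  then show ?thesis by blast
 qed
 have bG: "\<exists>C. \<forall>s\<le>t. G s <= C" if t: "t \<in> I" for t
 proof -
  obtain C where C: "!!s. s <= t ==> W s <= C" using W t unfolding weight_def by meson
  have "G s <= B1 * (1 / e + 1 / m) * exp (m * C)" if "s <= t" for s
   unfolding G_def \<omega>_def using C[OF that] B1 e m by (intro mult_left_mono) auto
  then show ?thesis by blast
 qed
 have hb: "norm (h x z s) <= b s" if x: "near D I \<omega> \<rho> x (%z. xb)" and z: "z \<in> D" and s: "s \<in> I" for x z s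
 proof -
  have n: "norm (x z s - xb s) <= \<rho> * \<omega> s" using x z s by (simp add: near_def)
  have "norm (H z s (x z s) - H z s (xb s)) <= (\<epsilon> + W' s) * norm (x z s - xb s)" using n \<rho> op[of s] by (intro Hlip z s) auto
  also have "... <= (\<epsilon> + W' s) * (\<rho> * \<omega> s)" using n \<epsilon> W0[OF s] by (intro mult_left_mono) auto
  also have "... <= \<rho> * (\<epsilon> + 1) * (1 + W' s) * \<omega> s"
  proof -
   have "\<epsilon> + W' s <= (\<epsilon> + 1) * (1 + W' s)" using \<epsilon> W0[OF s] by (simp add: algebra_simps)
   then have "(\<epsilon> + W' s) * (\<rho> * \<omega> s) <= (\<epsilon> + 1) * (1 + W' s) * (\<rho> * \<omega> s)"
    using \<rho> op[of s] by (intro mult_right_mono) auto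
   then show ?thesis by (simp add: ac_simps)
  qed
  finally have "norm (H z s (x z s) - H z s (xb s)) <= \<rho> * (\<epsilon> + 1) * (1 + W' s) * \<omega> s" .
  then have "norm (H z s (x z s)) <= B * (1 + W' s) * \<omega> s + \<rho> * (\<epsilon> + 1) * (1 + W' s) * \<omega> s"
   using H0[OF z s] norm_triangle_sub[of "H z s (x z s)" "H z s (xb s)"] by linarith
  then show ?thesis by (simp add: h_def b_def B1_def algebra_simps)
 qed
 have hX: "holo_family D I (h x)" if "holo_family D I x" "near D I \<omega> \<rho> x (%z. xb)" for x
  using HX[OF that] by (simp add: h_def[abs_def])
 have hc: "continuous_on I (h x z)" if "holo_family D I x" "near D I \<omega> \<rho> x (%z. xb)" "z \<in> D" for x z
  using hX[OF that(1,2)] that(3) by (simp add: holo_family_def)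
 have Yd: "(Y x z has_vector_derivative (h x z t - l2 * Y x z t)) (at t)" and Yb: "norm (Y x z t) <= G t"
  if "holo_family D I x" "near D I \<omega> \<rho> x (%z. xb)" "z \<in> D" "t \<in> I" for x z t unfolding Y_def
  using causal_has_vector_derivative[OF I e(3) hc[OF that(1-3)] hb[OF that(2,3)] mj1 that(4)]
   causal_bound[OF I e(3) hc[OF that(1-3)] hb[OF that(2,3)] mj1 that(4)] by auto
 have Yc: "continuous_on I (Y x z)" if "holo_family D I x" "near D I \<omega> \<rho> x (%z. xb)" "z \<in> D" for x z
  using Yd[OF that] by (meson continuous_at_imp_continuous_on has_vector_derivative_continuous)
 have Yh: "(%z. Y x z t) holomorphic_on D"
  if "holo_family D I x" "near D I \<omega> \<rho> x (%z. xb)" "t \<in> I" "open D" for x t unfolding Y_def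
  by (rule causal_holomorphic[OF I e(3) that(4) _ _ _ bb mj1 that(3)])
   (use hX[OF that(1,2)] hb[OF that(2)] that(4) in \<open>auto simp: holo_family_def\<close>)
 have Td: "(T x z has_vector_derivative - (Y x z t) - l1 * (T x z t - A)) (at t)"
  if "holo_family D I x" "near D I \<omega> \<rho> x (%z. xb)" "z \<in> D" "t \<in> I" for x z t
 proof -
  have "(causal l1 (Y x z) has_vector_derivative (Y x z t - l1 * causal l1 (Y x z) t)) (at t)"
   by (rule causal_has_vector_derivative[OF I e(2) Yc[OF that(1-3)] Yb[OF that(1-3)] mj2 that(4)])
  then have "(T x z has_vector_derivative (0 - (Y x z t - l1 * causal l1 (Y x z) t))) (at t)"
   unfolding T_def by (intro has_vector_derivative_diff has_vector_derivative_const)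
  then show ?thesis by (simp add: T_def algebra_simps)
 qed
 have TX: "holo_family D I (T x)" if "holo_family D I x" "near D I \<omega> \<rho> x (%z. xb)" for x unfolding holo_family_def
 proof (intro conjI ballI impI)
  show "continuous_on I (T x z)" if z: "z \<in> D" for z
   using Td[OF \<open>holo_family D I x\<close> \<open>near D I \<omega> \<rho> x (%z. xb)\<close> z]
   by (meson continuous_at_imp_continuous_on has_vector_derivative_continuous)
  show "(%z. T x z t) holomorphic_on D" if D: "open D" and t: "t \<in> I" for t unfolding T_def
   by (intro holomorphic_intros causal_holomorphic[OF I e(2) D _ _ _ bG mj2 t] Yc Yh Yb that \<open>holo_family D I x\<close> \<open>near D I \<omega> \<rho> x (%z. xb)\<close>)
 qed
 have half: "d * (\<epsilon> / e + 1 / m) / e <= d / 2" if "0 <= d" for d using mult_left_mono[OF \<epsilon>(2) that] by simp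
 have Tlip: "near D I \<omega> (d / 2) (T x) (T y)"
  if x: "holo_family D I x" "near D I \<omega> \<rho> x (%z. xb)" and y: "holo_family D I y" "near D I \<omega> \<rho> y (%z. xb)"
   and d: "0 <= d" and xy: "near D I \<omega> d x y" for x y d unfolding near_def
 proof (intro ballI)
  fix z t assume z: "z \<in> D" and t: "t \<in> I"
  define c where "c s = d * (\<epsilon> + W' s) * \<omega> s" for s
  have mc: "majorant I e c (%s. d * (\<epsilon> / e + 1 / m) * \<omega> s)"
   unfolding c_def \<omega>_def by (rule majorant_weight[OF W e(1) m d \<epsilon>(1)])
  have hd: "norm (h x z s - h y z s) <= c s" if s: "s \<in> I" for s
  proof -
   have "norm (h x z s - h y z s) <= (\<epsilon> + W' s) * norm (x z s - y z s)"
    unfolding h_def using x(2) y(2) z s by (intro Hlip) (auto simp: near_def)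
   also have "... <= (\<epsilon> + W' s) * (d * \<omega> s)"
    using xy z s \<epsilon> W0[OF s] by (intro mult_left_mono) (auto simp: near_def)
   finally show ?thesis by (simp add: c_def ac_simps)
  qed
  have hdc: "continuous_on I (%s. h x z s - h y z s)" by (intro continuous_intros hc x y z)
  have Yd1: "norm (Y x z s - Y y z s) <= d * (\<epsilon> / e + 1 / m) * \<omega> s" if s: "s \<in> I" for s
  proof -
   have "Y x z s - Y y z s = causal l2 (%s. h x z s - h y z s) s"
    unfolding Y_def by (rule causal_diff[OF I e(3) hc[OF x z] hb[OF x(2) z] mj1 hc[OF y z] hb[OF y(2) z] mj1 s])
   then show ?thesis using causal_bound[OF I e(3) hdc hd mc s] by simp
  qed
  have mc2: "majorant I e (%s. d * (\<epsilon> / e + 1 / m) * \<omega> s) (%s. d * (\<epsilon> / e + 1 / m) / e * \<omega> s)"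
   unfolding \<omega>_def using d e m \<epsilon> by (intro majorant_weight_const[OF W]) auto
  have "causal l1 (Y x z) t - causal l1 (Y y z) t = causal l1 (%s. Y x z s - Y y z s) t"
   by (rule causal_diff[OF I e(2) Yc[OF x z] Yb[OF x z] mj2 Yc[OF y z] Yb[OF y z] mj2 t])
  also have "norm ... <= d * (\<epsilon> / e + 1 / m) / e * \<omega> t"
   by (rule causal_bound[OF I e(2) _ Yd1 mc2 t]) (intro continuous_intros Yc x y z)
  also have "... <= d / 2 * \<omega> t" using half[OF d] op[of t] by (intro mult_right_mono) auto
  finally show "norm (T x z t - T y z t) <= d / 2 * \<omega> t" by (simp add: T_def norm_minus_commute)
 qed
 have xbn: "near D I \<omega> \<rho> (%z. xb) (%z. xb)" using \<rho> op by (auto simp: near_def less_imp_le)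
 have xbh: "holo_family D I (%z. xb)" using xc by (auto simp: holo_family_def)
 have T0: "near D I \<omega> (\<rho> / 2) (T (%z. xb)) (%z. xb)" unfolding near_def
 proof (intro ballI)
  fix z t assume z: "z \<in> D" and t: "t \<in> I"
  define c where "c s = dR * (eR + W' s) * \<omega> s" for s
  have mc: "majorant I e c (%s. dR * (eR / e + 1 / m) * \<omega> s)"
   unfolding c_def \<omega>_def by (rule majorant_weight[OF W e(1) m R(2,3)])
  have mc2: "majorant I e (%s. dR * (eR / e + 1 / m) * \<omega> s) (%s. dR * (eR / e + 1 / m) / e * \<omega> s)"
   unfolding \<omega>_def using R(2,3) e m by (intro majorant_weight_const[OF W]) auto
  have Rb: "norm (R z s) <= c s" if "s \<in> I" for s using R(5)[OF z that] by (simp add: c_def)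
  \<comment> \<open>The first factor applied to -(xb - A). Applying the second factor to
    \<open>q\<close> gives H - R, so two uses of \<open>causal_unique\<close> recover -(xb - A) as a
    double convolution.\<close>
  define q where "q s = - (xb1 s + l1 * (xb s - A))" for s
  have lim0: "((%s. exp (Re l * s) * norm (g s)) \<longlongrightarrow> 0) at_bot"
   if l: "e <= Re l" and g: "!!s. s <= T0 ==> norm (g s) <= K" for l and g :: "real => complex" and K
  proof (rule Lim_null_comparison)
   have "((%s. K * exp (Re l * s)) \<longlongrightarrow> K * 0) at_bot" using l e by (intro tendsto_intros filterlim_compose[OF exp_at_bot]
      filterlim_tendsto_pos_mult_at_bot[OF tendsto_const _ filterlim_ident]) auto
   then show "((%s. K * exp (Re l * s)) \<longlongrightarrow> 0) at_bot" by simp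
   show "\<forall>\<^sub>F s in at_bot. norm (exp (Re l * s) * norm (g s)) <= K * exp (Re l * s)" using eventually_le_at_bot[of T0]
    by eventually_elim (use g in \<open>auto simp: mult.commute intro!: mult_right_mono\<close>)
  qed
  have Rc: "continuous_on I (%s. h (%z. xb) z s - R z s)" by (intro continuous_intros hc xbh xbn z R(1))
  have q1: "causal l2 (%s. h (%z. xb) z s - R z s) s = q s" if s: "s \<in> I" for s
  proof (rule causal_unique[OF I e(3) Rc _ _ s])
   fix s assume s: "s \<in> I"
   have "(q has_vector_derivative - ((- (l1 + l2) * xb1 s - l1 * l2 * (xb s - A) - H z s (xb s) + R z s) + (l1 * (xb1 s - 0)))) (at s)"
    unfolding q_def by (intro has_vector_derivative_minus has_vector_derivative_add has_vector_derivative_mult_right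
      has_vector_derivative_diff has_vector_derivative_const xb z s)
   then show "(q has_vector_derivative (h (%z. xb) z s - R z s - l2 * q s)) (at s)" by (simp add: q_def h_def algebra_simps)
  next
   show "((%s. exp (Re l2 * s) * norm (q s)) \<longlongrightarrow> 0) at_bot"
   proof (rule lim0[OF e(3)])
    fix s assume s: "s <= T0"
    have "norm (q s) <= norm (xb1 s) + norm l1 * (norm (xb s) + norm A)" unfolding q_def norm_minus_cancel
     by (rule order_trans[OF norm_triangle_ineq]) (auto simp: norm_mult intro!: mult_left_mono norm_triangle_ineq4)
    also have "... <= Mb + norm l1 * (Mb + norm A)" using xb(3)[OF s] by (intro add_mono mult_left_mono) auto
    finally show "norm (q s) <= Mb + norm l1 * (Mb + norm A)" .
   qed
  qed
  have YR: "Y (%z. xb) z s - causal l2 (R z) s = q s" if s: "s \<in> I" for s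
   using causal_diff[OF I e(3) hc[OF xbh xbn z] hb[OF xbn z] mj1 R(1)[OF z] Rb mc s] q1[OF s] by (simp add: Y_def)
  have Rcc: "continuous_on I (causal l2 (R z))" using causal_has_vector_derivative[OF I e(3) R(1)[OF z] Rb mc]
   by (meson continuous_at_imp_continuous_on has_vector_derivative_continuous)
  have qc: "continuous_on I q"
   unfolding q_def by (intro continuous_intros xc) (meson continuous_at_imp_continuous_on has_vector_derivative_continuous xb(2) z)
  have "causal l1 (Y (%z. xb) z) t - causal l1 (causal l2 (R z)) t = causal l1 (%s. Y (%z. xb) z s - causal l2 (R z) s) t"
   by (rule causal_diff[OF I e(2) Yc[OF xbh xbn z] Yb[OF xbh xbn z] mj2 Rcc causal_bound[OF I e(3) R(1)[OF z] Rb mc] mc2 t])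
  also have "... = causal l1 q t" by (rule causal_cong[OF I e(2) YR t])
  also have "... = - (xb t - A)"
  proof (rule causal_unique[OF I e(2) qc _ _ t])
   fix s assume s: "s \<in> I"
   have "((%s. - (xb s - A)) has_vector_derivative - (xb1 s - 0)) (at s)"
    by (intro has_vector_derivative_minus has_vector_derivative_diff has_vector_derivative_const xb s)
   then show "((%s. - (xb s - A)) has_vector_derivative q s - l1 * - (xb s - A)) (at s)" by (simp add: q_def algebra_simps)
  next
   show "((%s. exp (Re l1 * s) * norm (- (xb s - A))) \<longlongrightarrow> 0) at_bot"
   proof (rule lim0[OF e(2)])
    fix s assume s: "s <= T0"
    show "norm (- (xb s - A)) <= Mb + norm A" using xb(3)[OF s] norm_triangle_ineq4[of "xb s" A] unfolding norm_minus_cancel by linarith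
   qed
  qed
  finally have "T (%z. xb) z t - xb t = - causal l1 (causal l2 (R z)) t" by (simp add: T_def algebra_simps)
  then have "norm (T (%z. xb) z t - xb t) = norm (causal l1 (causal l2 (R z)) t)" by simp
  also have "... <= dR * (eR / e + 1 / m) / e * \<omega> t"
   by (rule causal_bound[OF I e(2) Rcc causal_bound[OF I e(3) R(1)[OF z] Rb mc] mc2 t])
  also have "... <= \<rho> / 2 * \<omega> t" using R(4) op[of t] by (intro mult_right_mono) auto
  finally show "norm (T (%z. xb) z t - xb t) <= \<rho> / 2 * \<omega> t" .
 qed
 obtain x where x: "holo_family D I x" "near D I \<omega> \<rho> x (%z. xb)"
  and fixp: "!!z t. z \<in> D ==> t \<in> I ==> T x z t = x z t"
  using holo_family_fixed_point[where T = T, OF oc op \<rho> xbh TX Tlip T0] by blast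
 \<comment> \<open>The derivative read off from \<open>Td\<close> at a fixed point. Written through
   \<open>Y\<close>, it is holomorphic in z and bounded by a multiple of \<omega>.\<close>
 define x1 where "x1 z t = - (Y x z t) - l1 * (x z t - A)" for z t
 have dx: "(x z has_vector_derivative x1 z t) (at t)" if z: "z \<in> D" and t: "t \<in> I" for z t
 proof -
  have "(T x z has_vector_derivative x1 z t) (at t)" using Td[OF x z t] fixp[OF z t] by (simp add: x1_def)
  then show ?thesis by (rule has_vector_derivative_transform_within_open) (use I t fixp[OF z] in \<open>auto simp: lower_ray_def\<close>)
 qed
 have dx1: "(x1 z has_vector_derivative (- (l1 + l2) * x1 z t - l1 * l2 * (x z t - A) - H z t (x z t))) (at t)"
  if z: "z \<in> D" and t: "t \<in> I" for z t
 proof -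
  have "(x1 z has_vector_derivative (- (h x z t - l2 * Y x z t) - l1 * (x1 z t - 0))) (at t)" unfolding x1_def[of z, abs_def]
   by (intro has_vector_derivative_minus has_vector_derivative_mult_right
      has_vector_derivative_diff has_vector_derivative_const Yd x z t) (rule dx[OF z t, unfolded x1_def])
  then show ?thesis by (simp add: x1_def h_def algebra_simps)
 qed
 have x1h: "holo_family D I x1" unfolding holo_family_def
 proof (intro conjI ballI impI)
  show "continuous_on I (x1 z)" if "z \<in> D" for z by (meson continuous_at_imp_continuous_on has_vector_derivative_continuous dx1 that)
  show "(%z. x1 z t) holomorphic_on D" if D: "open D" and t: "t \<in> I" for t
   unfolding x1_def using x(1) t D by (intro holomorphic_intros Yh x t D) (auto simp: holo_family_def)
 qed
 have "norm (x1 z t) <= (B1 * (1 / e + 1 / m) + norm l1 * (B1 * (1 / e + 1 / m) / e)) * \<omega> t" if z: "z \<in> D" and t: "t \<in> I" for z t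
 proof -
  have c: "x z t - A = - causal l1 (Y x z) t" using fixp[OF z t] by (simp add: T_def algebra_simps)
  have "norm (x z t - A) <= G2 t" unfolding c norm_minus_cancel by (rule causal_bound[OF I e(2) Yc[OF x z] Yb[OF x z] mj2 t])
  then have "norm l1 * norm (x z t - A) <= norm l1 * G2 t" by (intro mult_left_mono) auto
  moreover have "norm (x1 z t) <= norm (Y x z t) + norm l1 * norm (x z t - A)"
   unfolding x1_def by (rule order_trans[OF norm_triangle_ineq4]) (simp add: norm_mult)
  ultimately have "norm (x1 z t) <= G t + norm l1 * G2 t" using Yb[OF x z t] by linarith
  then show ?thesis by (simp add: G_def G2_def algebra_simps)
 qed
 then show ?thesis using x x1h dx dx1 by blast
qed

section \<open>Comparison lemmas for damped oscillators\<close>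

lemma exp_mult_at_bot:
 assumes "0 < (c::real)"
 shows "((%s. exp (c * s)) \<longlongrightarrow> 0) at_bot"
 by (rule filterlim_compose[OF exp_at_bot filterlim_tendsto_pos_mult_at_bot[OF tendsto_const assms filterlim_ident]])

lemma nonincreasing_on_ray:
 fixes f :: "real => real"
 assumes "!!t. t <= T ==> (f has_real_derivative f' t) (at t)" "!!t. t <= T ==> f' t <= 0" "r <= t" "t <= T"
 shows "f t <= f r"
proof (rule DERIV_nonpos_imp_nonincreasing[OF assms(3)])
 fix x assume "r <= x" "x <= t"
 then have "x <= T" using assms by simp
 then show "\<exists>y. (f has_real_derivative y) (at x) & y <= 0" using assms by blast
qed

lemma nondecreasing_on_ray:
 fixes f :: "real => real"
 assumes "!!t. t <= T ==> (f has_real_derivative f' t) (at t)" "!!t. t <= T ==> 0 <= f' t" "r <= t" "t <= T"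
 shows "f r <= f t"
proof (rule DERIV_nonneg_imp_nondecreasing[OF assms(3)])
 fix x assume "r <= x" "x <= t"
 then have "x <= T" using assms by simp
 then show "\<exists>y. (f has_real_derivative y) (at x) & 0 <= y" using assms by blast
qed

text \<open>exp (\<kappa> r) (y - s/\<kappa>) is nonincreasing, and an upper bound on y leaves it at
  most 0 in the limit at -\<infinity>. Boundedness at -\<infinity> thereby replaces an initial
  condition.\<close>

lemma backward_gronwall:
 fixes y :: "real => real"
 assumes "0 < \<kappa>"
  and y: "!!t. t <= T ==> (y has_real_derivative y' t) (at t)" "!!t. t <= T ==> y' t <= - \<kappa> * y t + s"
   "!!t. t <= T ==> y t <= M"
  and t: "t <= T"
 shows "y t <= s / \<kappa>"
proof -
 define z where "z r = exp (\<kappa> * r) * (y r - s / \<kappa>)" for r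
 have dz: "(z has_real_derivative exp (\<kappa> * r) * (y' r + \<kappa> * y r - s)) (at r)" if "r <= T" for r
  unfolding z_def by (rule derivative_eq_intros y(1)[OF that] refl)+ (use assms(1) in \<open>simp add: field_simps\<close>)
 have zm: "z t <= z r" if "r <= t" for r
 proof (rule nonincreasing_on_ray[OF dz])
  fix u assume u: "u <= T"
  show "exp (\<kappa> * u) * (y' u + \<kappa> * y u - s) <= 0" using y(2)[OF u] by (simp add: mult_le_0_iff)
 qed (use that t in auto)
 have b: "z t <= (M - s / \<kappa>) * exp (\<kappa> * r)" if r: "r <= t" for r
 proof -
  have "exp (\<kappa> * r) * (y r - s / \<kappa>) <= exp (\<kappa> * r) * (M - s / \<kappa>)" using y(3)[of r] r t by (intro mult_left_mono) auto
  then show ?thesis using zm[OF r] unfolding z_def by (simp only: mult.commute)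
 qed
 have "((%r. (M - s / \<kappa>) * exp (\<kappa> * r)) \<longlongrightarrow> (M - s / \<kappa>) * 0) at_bot"
  by (intro tendsto_intros exp_mult_at_bot assms)
 then have "z t <= (M - s / \<kappa>) * 0" by (rule tendsto_lowerbound) (auto intro!: eventually_mono[OF eventually_le_at_bot[of t]] b)
 then show ?thesis by (simp add: z_def mult_le_0_iff)
qed

lemma forward_decay:
 fixes y :: "real => real"
 assumes "0 < \<kappa>" "0 <= s"
  and y: "!!t. a <= t ==> (y has_real_derivative y' t) (at t)" "!!t. a <= t ==> y' t <= - \<kappa> * y t + s"
  and t: "a <= t"
 shows "y t <= exp (- \<kappa> * (t - a)) * \<bar>y a\<bar> + s / \<kappa>"
proof -
 define z where "z r = exp (\<kappa> * (r - a)) * (y r - s / \<kappa>)" for r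
 have dz: "(z has_real_derivative exp (\<kappa> * (r - a)) * (y' r + \<kappa> * y r - s)) (at r)" if "a <= r" for r
  unfolding z_def by (rule derivative_eq_intros y(1)[OF that] refl)+ (use assms(1) in \<open>simp add: field_simps\<close>)
 have "z t <= z a"
 proof (rule DERIV_nonpos_imp_nonincreasing[OF t])
  fix u assume u: "a <= u" "u <= t"
  have "exp (\<kappa> * (u - a)) * (y' u + \<kappa> * y u - s) <= 0" using y(2)[OF u(1)] by (simp add: mult_le_0_iff)
  then show "\<exists>d. (z has_real_derivative d) (at u) & d <= 0" using dz[OF u(1)] by blast
 qed
 moreover have "0 <= s / \<kappa>" using assms by simp
 ultimately have "exp (- \<kappa> * (t - a)) * z t <= exp (- \<kappa> * (t - a)) * \<bar>y a\<bar>" by (intro mult_left_mono) (auto simp: z_def)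
 moreover have "exp (- \<kappa> * (t - a)) * z t = y t - s / \<kappa>" by (simp add: z_def mult.assoc[symmetric] exp_add[symmetric])
 ultimately show ?thesis by linarith
qed

lemma forward_gronwall:
 fixes y :: "real => real"
 assumes "1 <= K" "0 <= s" and y: "!!t. a <= t ==> t <= b ==> (y has_real_derivative y' t) (at t)"
   "!!t. a <= t ==> t <= b ==> y' t <= K * y t + s"
  and t: "a <= t" "t <= b"
 shows "y t <= exp (K * (t - a)) * (y a + s)"
proof -
 define z where "z r = exp (- K * (r - a)) * (y r + s / K)" for r
 have dz: "(z has_real_derivative exp (- K * (r - a)) * (y' r - K * y r - s)) (at r)" if "a <= r" "r <= b" for r
  unfolding z_def by (rule derivative_eq_intros y(1)[OF that] refl)+ (use assms(1) in \<open>simp add: field_simps\<close>)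
 have "z t <= z a"
 proof (rule DERIV_nonpos_imp_nonincreasing[OF t(1)])
  fix u assume u: "a <= u" "u <= t"
  have "exp (- K * (u - a)) * (y' u - K * y u - s) <= 0" using y(2)[of u] u t by (simp add: mult_le_0_iff)
  then show "\<exists>d. (z has_real_derivative d) (at u) & d <= 0" using dz[of u] u t by force
 qed
 then have "exp (K * (t - a)) * z t <= exp (K * (t - a)) * (y a + s / K)" by (intro mult_left_mono) (auto simp: z_def)
 moreover have "exp (K * (t - a)) * z t = y t + s / K" by (simp add: z_def mult.assoc[symmetric] exp_add[symmetric])
 moreover have "0 <= s / K" "s / K <= s" using assms mult_right_mono[of 1 K s] by (auto simp: field_simps)
 moreover have "exp (K * (t - a)) * (y a + s / K) <= exp (K * (t - a)) * (y a + s)" using calculation(4) by (intro mult_left_mono) auto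
 ultimately show ?thesis by linarith
qed

lemma has_real_derivative_inner:
 fixes f g :: "real => 'a::real_inner"
 assumes "(f has_vector_derivative f') (at t)" "(g has_vector_derivative g') (at t)"
 shows "((%t. f t \<bullet> g t) has_real_derivative f t \<bullet> g' + f' \<bullet> g t) (at t)"
 unfolding has_real_derivative_iff_has_vector_derivative using bounded_bilinear.has_vector_derivative[OF bounded_bilinear_inner assms] .

lemma two_mult_le_squares: "2 * x * y <= x^2 + (y::real)^2" using sum_squares_bound[of x y] by simp

lemma inner_le_mult: "x \<bullet> y <= norm x * norm (y :: 'a::real_inner)" by (rule norm_cauchy_schwarz)

text \<open>Gronwall for |d1|^2 + |d|^2; a and c may have any sign, as only finite time spans are
  involved. With \<sigma> = 0 and zero data this is uniqueness for the initial value
  problem.\<close>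

lemma oscillator_growth:
 fixes d d1 h :: "real => 'a::real_inner"
 assumes d: "!!t. r <= t ==> t <= b ==> (d has_vector_derivative d1 t) (at t)"
   "!!t. r <= t ==> t <= b ==> (d1 has_vector_derivative (- (a *\<^sub>R d1 t) - c *\<^sub>R d t + h t)) (at t)"
  and h: "!!t. r <= t ==> t <= b ==> norm (h t) <= C * norm (d t) + \<sigma>" "0 <= C"
  and t: "r <= t" "t <= b"
 shows "(norm (d1 t))^2 + (norm (d t))^2 \<le>
  exp ((2 * \<bar>a\<bar> + \<bar>c\<bar> + C + 2) * (t - r)) * ((norm (d1 r))^2 + (norm (d r))^2 + \<sigma>^2)"
proof -
 define E where "E t = d1 t \<bullet> d1 t + d t \<bullet> d t" for t
 define E' where "E' t = (d1 t \<bullet> (- (a *\<^sub>R d1 t) - c *\<^sub>R d t + h t) + (- (a *\<^sub>R d1 t) - c *\<^sub>R d t + h t) \<bullet> d1 t) +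
   (d t \<bullet> d1 t + d1 t \<bullet> d t)" for t
 have "E t <= exp ((2 * \<bar>a\<bar> + \<bar>c\<bar> + C + 2) * (t - r)) * (E r + \<sigma>^2)"
 proof (rule forward_gronwall[where y' = E' and b = b])
  show "1 <= 2 * \<bar>a\<bar> + \<bar>c\<bar> + C + 2" using h by simp
  fix s assume s: "r <= s" "s <= b"
  show "(E has_real_derivative E' s) (at s)" unfolding E_def[abs_def] E'_def by (intro DERIV_add has_real_derivative_inner d s)
  define x where "x = norm (d1 s)"
  define u where "u = norm (d s)"
  have xu: "0 <= x" "0 <= u" by (auto simp: x_def u_def)
  have e1: "E' s = - 2 * a * x^2 - 2 * c * (d s \<bullet> d1 s) + 2 * (d1 s \<bullet> h s) + 2 * (d s \<bullet> d1 s)"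
   by (simp add: E'_def x_def algebra_simps inner_commute power2_norm_eq_inner)
  have i1: "\<bar>d s \<bullet> d1 s\<bar> <= u * x" by (simp add: u_def x_def Cauchy_Schwarz_ineq2)
  have i2: "d1 s \<bullet> h s <= x * (C * u + \<sigma>)"
   using inner_le_mult[of "d1 s" "h s"] mult_left_mono[OF h(1)[OF s] xu(1)] by (simp add: x_def u_def)
  have t1: "- 2 * a * x^2 <= 2 * \<bar>a\<bar> * x^2" by (intro mult_right_mono) auto
  have t2: "- 2 * c * (d s \<bullet> d1 s) <= \<bar>c\<bar> * (x^2 + u^2)"
  proof -
   have "- 2 * c * (d s \<bullet> d1 s) = - (2 * c * (d s \<bullet> d1 s))" by simp
   also have "... <= \<bar>2 * c * (d s \<bullet> d1 s)\<bar>" by (rule abs_ge_minus_self)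
   also have "... = 2 * \<bar>c\<bar> * \<bar>d s \<bullet> d1 s\<bar>" by (simp only: abs_mult abs_numeral)
   also have "... <= 2 * \<bar>c\<bar> * (u * x)" using i1 by (intro mult_left_mono) auto
   also have "... = \<bar>c\<bar> * (2 * x * u)" by simp
   also have "... <= \<bar>c\<bar> * (x^2 + u^2)" by (intro mult_left_mono two_mult_le_squares) auto
   finally show ?thesis .
  qed
  have t3: "2 * (d s \<bullet> d1 s) <= x^2 + u^2" using i1 two_mult_le_squares[of x u] by (simp add: mult.commute)
  have t4: "2 * (d1 s \<bullet> h s) <= C * (x^2 + u^2) + x^2 + \<sigma>^2"
  proof -
   have "2 * (d1 s \<bullet> h s) <= C * (2 * x * u) + 2 * x * \<sigma>" using i2 by (simp add: algebra_simps)
   moreover have "C * (2 * x * u) <= C * (x^2 + u^2)" using h(2) by (intro mult_left_mono two_mult_le_squares)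
   ultimately show ?thesis using two_mult_le_squares[of x \<sigma>] by linarith
  qed
  have Es: "E s = x^2 + u^2" by (simp add: E_def x_def u_def power2_norm_eq_inner)
  have "2 * \<bar>a\<bar> * x^2 <= 2 * \<bar>a\<bar> * (x^2 + u^2)" by (intro mult_left_mono) auto
  moreover have "(2 * \<bar>a\<bar> + \<bar>c\<bar> + C + 2) * (x^2 + u^2) = 2 * \<bar>a\<bar> * (x^2 + u^2) + \<bar>c\<bar> * (x^2 + u^2) + C * (x^2 + u^2) + (x^2 + u^2) + (x^2 + u^2)"
   by (simp add: algebra_simps)
  moreover have "0 <= u^2" by simp
  ultimately show "E' s <= (2 * \<bar>a\<bar> + \<bar>c\<bar> + C + 2) * E s + \<sigma>^2" unfolding Es using t1 t2 t3 t4 e1 by linarith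
 qed (use t in auto)
 then show ?thesis by (simp add: E_def power2_norm_eq_inner)
qed

text \<open>The energy |d1|^2 + c |d|^2 + \<gamma> d.d1 is coercive and decays at a definite rate:
  damping acts on d1 only, and the cross term adds the decay in d. Boundedness at -\<infinity> then
  leaves a multiple of \<sigma>^2. The constants depend on a and c alone. The inner product space is
  left open because real differences give the dependence on \<mu>, and complex ones the
  identification of a holomorphic family with the real branch.\<close>

lemma oscillator_decay:
 fixes a c :: real
 assumes ac: "0 < a" "0 < c"
 obtains \<epsilon> K where "0 < \<epsilon>" "0 <= K"
  "!!(d :: real => 'a::real_inner) d1 h T M \<sigma> t.
   (!!t. t <= T ==> (d has_vector_derivative d1 t) (at t)) ==>
   (!!t. t <= T ==> (d1 has_vector_derivative (- (a *\<^sub>R d1 t) - c *\<^sub>R d t + h t)) (at t)) ==>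
   (!!t. t <= T ==> norm (h t) <= \<epsilon> * norm (d t) + \<sigma>) ==>
   (!!t. t <= T ==> norm (d t) <= M & norm (d1 t) <= M) ==> t <= T ==>
   (norm (d1 t))^2 + (norm (d t))^2 <= K * \<sigma>^2"
proof -
 \<comment> \<open>The first bound lets the dissipation absorb the mixed term \<gamma> a d.d1
   (\<open>g2\<close>); the others give \<gamma>^2 <= c, so that the cross term cannot spoil
   positivity (\<open>g3\<close>).\<close>
 define \<gamma> where "\<gamma> = min (a / (1 + a^2 / c)) (min 1 c)"
 have g1: "0 < \<gamma>" using ac by (auto simp: \<gamma>_def intro!: divide_pos_pos add_pos_nonneg)
 have g2: "\<gamma> + \<gamma> * a^2 / c <= a"
 proof -
  have p: "0 < 1 + a^2 / c" using ac by (intro add_pos_nonneg) auto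
  have "\<gamma> <= a / (1 + a^2 / c)" by (simp add: \<gamma>_def)
  then have "\<gamma> * (1 + a^2 / c) <= a" using p by (simp add: pos_le_divide_eq)
  then show ?thesis by (simp add: algebra_simps)
 qed
 have g3: "\<gamma>^2 <= c"
 proof -
  have "\<gamma> <= 1" "\<gamma> <= c" by (auto simp: \<gamma>_def)
  then have "\<gamma> * \<gamma> <= c * 1" using g1 ac by (intro mult_mono) auto
  then show ?thesis by (simp add: power2_eq_square)
 qed
 define \<epsilon> where "\<epsilon> = min (a / 4) (\<gamma> * c / 8) / (1 + \<gamma>)"
 have e0: "0 < \<epsilon>" using ac g1 by (simp add: \<epsilon>_def)
 have e1: "\<epsilon> * (1 + \<gamma>) <= a / 4" "\<epsilon> * (1 + \<gamma>) <= \<gamma> * c / 8" using g1 by (auto simp: \<epsilon>_def)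
 define L where "L = 1 + c + \<gamma>"
 define \<kappa> where "\<kappa> = min (a / 2) (\<gamma> * c / 2) / L"
 define S where "S = 4 / a + 2 * \<gamma> / c"
 have L0: "0 < L" and k0: "0 < \<kappa>" and S0: "0 < S" using ac g1 by (auto simp: L_def \<kappa>_def S_def intro!: add_pos_pos)
 define K where "K = (S / \<kappa>) * (2 + 2 / c)"
 show ?thesis
 proof (rule that[OF e0, of K])
  show "0 <= K" using ac k0 S0 by (simp add: K_def)
 next
  fix d :: "real => 'a" and d1 h T M \<sigma> t
  assume d: "!!t. t <= T ==> (d has_vector_derivative d1 t) (at t)"
   "!!t. t <= T ==> (d1 has_vector_derivative (- (a *\<^sub>R d1 t) - c *\<^sub>R d t + h t)) (at t)"
   and h: "!!t. t <= T ==> norm (h t) <= \<epsilon> * norm (d t) + \<sigma>"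
   and M: "!!t. t <= T ==> norm (d t) <= M & norm (d1 t) <= M" and t: "t <= T"
  define y where "y t = d1 t \<bullet> d1 t + c * (d t \<bullet> d t) + \<gamma> * (d t \<bullet> d1 t)" for t
  define q where "q t = - (a *\<^sub>R d1 t) - c *\<^sub>R d t + h t" for t
  define y' where "y' t = d1 t \<bullet> q t + q t \<bullet> d1 t + c * (d t \<bullet> d1 t + d1 t \<bullet> d t) + \<gamma> * (d t \<bullet> q t + d1 t \<bullet> d1 t)" for t
  have dy: "(y has_real_derivative y' s) (at s)" if "s <= T" for s unfolding y_def[abs_def] y'_def q_def
   by (intro DERIV_add DERIV_cmult has_real_derivative_inner d that)
  have i1: "\<bar>d s \<bullet> d1 s\<bar> <= norm (d s) * norm (d1 s)" for s by (rule Cauchy_Schwarz_ineq2)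
  have lo: "(norm (d1 s))^2 / 2 + c * (norm (d s))^2 / 2 <= y s"
   and up: "y s <= L * ((norm (d1 s))^2 + (norm (d s))^2)" for s
  proof -
   define x where "x = norm (d1 s)"
   define u where "u = norm (d s)"
   have xu: "0 <= x" "0 <= u" by (auto simp: x_def u_def)
   have ys: "y s = x^2 + c * u^2 + \<gamma> * (d s \<bullet> d1 s)" by (simp add: y_def x_def u_def power2_norm_eq_inner)
   have "\<bar>\<gamma> * (d s \<bullet> d1 s)\<bar> <= \<gamma> * (u * x)" using i1[of s] g1 by (simp add: abs_mult x_def u_def)
   moreover have "\<gamma> * (u * x) <= x^2 / 2 + c * u^2 / 2"
   proof -
    have "2 * (\<gamma> * u) * x <= (\<gamma> * u)^2 + x^2" by (rule two_mult_le_squares)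
    moreover have "(\<gamma> * u)^2 <= c * u^2" using g3 by (simp add: power_mult_distrib mult_right_mono)
    ultimately show ?thesis by simp
   qed
   moreover have "\<gamma> * (u * x) <= \<gamma> * (x^2 + u^2)"
   proof (rule mult_left_mono)
    have "2 * (u * x) <= u^2 + x^2" using two_mult_le_squares[of u x] by (simp add: mult.assoc)
    then show "u * x <= x^2 + u^2" using mult_nonneg_nonneg[OF xu(2,1)] by linarith
   qed (use g1 in simp)
   moreover have "L * (x^2 + u^2) = x^2 + u^2 + c * x^2 + c * u^2 + \<gamma> * (x^2 + u^2)"
    by (simp add: L_def algebra_simps)
   moreover have "0 <= c * x^2" "0 <= u^2" using ac by auto
   ultimately have "x^2 / 2 + c * u^2 / 2 <= y s" "y s <= L * (x^2 + u^2)" using ys by linarith+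
   then show "(norm (d1 s))^2 / 2 + c * (norm (d s))^2 / 2 <= y s" "y s <= L * ((norm (d1 s))^2 + (norm (d s))^2)"
    by (auto simp: x_def u_def)
  qed
  have "y t <= S * \<sigma>^2 / \<kappa>"
  proof (rule backward_gronwall[OF k0 dy _ _ t])
   fix s assume s: "s <= T"
   have "norm (d s) <= M" "norm (d1 s) <= M" using M[OF s] by auto
   then have "(norm (d1 s))^2 + (norm (d s))^2 <= M^2 + M^2" by (intro add_mono power_mono) auto
   then have "L * ((norm (d1 s))^2 + (norm (d s))^2) <= L * (M^2 + M^2)" using L0 by (intro mult_left_mono) auto
   then show "y s <= L * (M^2 + M^2)" using up[of s] by linarith
   define x where "x = norm (d1 s)"
   define u where "u = norm (d s)"
   define w where "w = d s \<bullet> d1 s"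
   have xu: "0 <= x" "0 <= u" by (auto simp: x_def u_def)
   have e: "y' s = - (2 * a - \<gamma>) * x^2 - \<gamma> * c * u^2 - \<gamma> * a * w + (2 * (d1 s \<bullet> h s) + \<gamma> * (d s \<bullet> h s))"
    by (simp add: y'_def q_def x_def u_def w_def algebra_simps inner_commute power2_norm_eq_inner)
   have t1: "- \<gamma> * a * w <= \<gamma> * c * u^2 / 4 + \<gamma> * a^2 / c * x^2"
   proof -
    have "\<bar>w\<bar> <= u * x" using i1[of s] by (simp add: w_def u_def x_def)
    then have "\<gamma> * a * - w <= \<gamma> * a * (u * x)" using g1 ac by (intro mult_left_mono) auto
    moreover have "a * (u * x) <= c * u^2 / 4 + a^2 / c * x^2"
    proof -
     have "0 <= (c * u / 2 - a * x)^2 / c" using ac by simp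
     also have "... = c * u^2 / 4 + a^2 / c * x^2 - a * (u * x)" using ac by (simp add: power2_eq_square field_simps)
     finally show ?thesis by simp
    qed
    then have "\<gamma> * (a * (u * x)) <= \<gamma> * (c * u^2 / 4 + a^2 / c * x^2)" using g1 by (intro mult_left_mono) auto
    ultimately show ?thesis by (simp add: algebra_simps)
   qed
   have hs: "norm (h s) <= \<epsilon> * u + \<sigma>" using h[OF s] by (simp add: u_def)
   have t2: "2 * (d1 s \<bullet> h s) + \<gamma> * (d s \<bullet> h s) <= (2 * x + \<gamma> * u) * (\<epsilon> * u + \<sigma>)"
   proof -
    have "d1 s \<bullet> h s <= x * (\<epsilon> * u + \<sigma>)"
     using inner_le_mult[of "d1 s" "h s"] mult_left_mono[OF hs xu(1)] by (simp add: x_def)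
    moreover have "d s \<bullet> h s <= u * (\<epsilon> * u + \<sigma>)"
     using inner_le_mult[of "d s" "h s"] mult_left_mono[OF hs xu(2)] by (simp add: u_def)
    then have "\<gamma> * (d s \<bullet> h s) <= \<gamma> * (u * (\<epsilon> * u + \<sigma>))" using g1 by (intro mult_left_mono) auto
    ultimately show ?thesis by (simp add: algebra_simps)
   qed
   have t3: "(2 * x + \<gamma> * u) * (\<epsilon> * u) <= a / 4 * x^2 + \<gamma> * c / 8 * u^2"
   proof -
    have "(2 * x + \<gamma> * u) * (\<epsilon> * u) = \<epsilon> * (2 * x * u) + \<epsilon> * \<gamma> * u^2" by (simp add: power2_eq_square algebra_simps)
    also have "... <= \<epsilon> * (x^2 + u^2) + \<epsilon> * \<gamma> * (x^2 + u^2)"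
     using e0 g1 by (intro add_mono mult_left_mono two_mult_le_squares) auto
    also have "... = (\<epsilon> * (1 + \<gamma>)) * x^2 + (\<epsilon> * (1 + \<gamma>)) * u^2" by (simp add: algebra_simps)
    also have "... <= a / 4 * x^2 + \<gamma> * c / 8 * u^2" using e1 by (intro add_mono mult_right_mono) auto
    finally show ?thesis .
   qed
   have t4: "2 * x * \<sigma> <= a / 4 * x^2 + 4 / a * \<sigma>^2"
   proof -
    have "0 <= (a * x / 2 - 2 * \<sigma>)^2 / a" using ac by simp
    also have "... = a / 4 * x^2 + 4 / a * \<sigma>^2 - 2 * x * \<sigma>" using ac by (simp add: power2_eq_square field_simps)
    finally show ?thesis by simp
   qed
   have t5: "\<gamma> * u * \<sigma> <= \<gamma> * c / 8 * u^2 + 2 * \<gamma> / c * \<sigma>^2"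
   proof -
    have "0 <= \<gamma> * (c * u / 4 - \<sigma>)^2 * 2 / c" using ac g1 by simp
    also have "... = \<gamma> * c / 8 * u^2 + 2 * \<gamma> / c * \<sigma>^2 - \<gamma> * u * \<sigma>" using ac by (simp add: power2_eq_square field_simps)
    finally show ?thesis by simp
   qed
   have t6: "(2 * x + \<gamma> * u) * (\<epsilon> * u + \<sigma>) = (2 * x + \<gamma> * u) * (\<epsilon> * u) + 2 * x * \<sigma> + \<gamma> * u * \<sigma>"
    by (simp add: algebra_simps)
   have t7: "(\<gamma> + \<gamma> * a^2 / c) * x^2 <= a * x^2" using g2 by (intro mult_right_mono) auto
   have y1: "y' s <= - (a / 2) * x^2 - \<gamma> * c / 2 * u^2 + S * \<sigma>^2"
    using t1 t2 t3 t4 t5 t6 t7 e by (simp add: S_def algebra_simps)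
   have "\<kappa> * y s <= \<kappa> * (L * (x^2 + u^2))" using up[of s] k0 by (intro mult_left_mono) (auto simp: x_def u_def)
   also have "... = min (a / 2) (\<gamma> * c / 2) * x^2 + min (a / 2) (\<gamma> * c / 2) * u^2"
   proof -
    have "\<kappa> * L = min (a / 2) (\<gamma> * c / 2)" using L0 by (simp add: \<kappa>_def)
    then have "\<kappa> * (L * (x^2 + u^2)) = min (a / 2) (\<gamma> * c / 2) * (x^2 + u^2)"
     by (simp only: mult.assoc[symmetric])
    then show ?thesis by (simp only: distrib_left)
   qed
   also have "... <= a / 2 * x^2 + \<gamma> * c / 2 * u^2" by (intro add_mono mult_right_mono) auto
   finally show "y' s <= - \<kappa> * y s + S * \<sigma>^2" using y1 by simp
  qed
  then have "(norm (d1 t))^2 / 2 + c * (norm (d t))^2 / 2 <= S / \<kappa> * \<sigma>^2" using lo[of t] by simp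
  then have b: "(norm (d1 t))^2 + c * (norm (d t))^2 <= 2 * (S / \<kappa> * \<sigma>^2)" by simp
  have "0 <= c * (norm (d t))^2" "0 <= (norm (d1 t))^2" using ac by auto
  then have "(norm (d1 t))^2 <= 2 * (S / \<kappa> * \<sigma>^2)" "c * (norm (d t))^2 <= 2 * (S / \<kappa> * \<sigma>^2)" using b by linarith+
  moreover from this(2) have "(norm (d t))^2 <= 2 * (S / \<kappa> * \<sigma>^2) / c" using ac by (subst pos_le_divide_eq) (simp_all add: mult.commute)
  ultimately show "(norm (d1 t))^2 + (norm (d t))^2 <= K * \<sigma>^2" by (simp add: K_def algebra_simps)
 qed
qed

text \<open>Constants solve d'' + n d' = 0, so boundedness at -\<infinity> does not determine d, but
  the value 0 at R does. Since exp (n s) d1 tends to 0 at -\<infinity>, two integrations turn a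
  bound D for |d| into D/2 by the smallness of the coefficient; iterating forces d = 0.\<close>

lemma outer_uniqueness:
 fixes d d1 h :: "real => 'a::real_normed_vector"
 assumes n: "0 < n" and m: "0 < m"
  and d: "!!s. s <= R ==> (d has_vector_derivative d1 s) (at s)"
   "!!s. s <= R ==> (d1 has_vector_derivative (- (n *\<^sub>R d1 s) + h s)) (at s)"
  and h: "!!s. s <= R ==> norm (h s) <= \<kappa> * exp (m * s) * norm (d s)" "0 <= \<kappa>"
  and M: "!!s. s <= R ==> norm (d s) <= M & norm (d1 s) <= M"
  and dR: "d R = 0" and small: "\<kappa> * exp (m * R) <= m * (n + m) / 2" and s: "s <= R"
 shows "d s = 0"
proof -
 have half: "!!s. s <= R ==> norm (d s) <= D / 2" if D: "!!s. s <= R ==> norm (d s) <= D" for D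
 proof -
  have D0: "0 <= D" using D[of R] dR by simp
  define c where "c = \<kappa> * D / (n + m)"
  have nm: "0 < n + m" using n m by simp
  have d1: "norm (d1 s) <= c * exp (m * s)" if s: "s <= R" for s
  proof -
   have key: "norm (exp (n * s) *\<^sub>R d1 s - exp (n * r) *\<^sub>R d1 r) <= c * exp ((n + m) * s) - c * exp ((n + m) * r)"
    if r: "r < s" for r
   proof (rule differentiable_bound_general[OF r, where f' = "%u. exp (n * u) *\<^sub>R h u" and \<phi>' = "%u. c * (n + m) * exp ((n + m) * u)"])
    have der: "((%u. exp (n * u) *\<^sub>R d1 u) has_vector_derivative exp (n * u) *\<^sub>R h u) (at u)" if u: "u <= R" for u
    proof -
     have "((%u. exp (n * u)) has_real_derivative n * exp (n * u)) (at u)" by (auto intro!: derivative_eq_intros)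
     then have "((%u. exp (n * u) *\<^sub>R d1 u) has_vector_derivative
      exp (n * u) *\<^sub>R (- (n *\<^sub>R d1 u) + h u) + (n * exp (n * u)) *\<^sub>R d1 u) (at u)"
      by (intro has_vector_derivative_scaleR d u)
     then show ?thesis by (simp add: algebra_simps)
    qed
    show "continuous_on {r..s} (%u. exp (n * u) *\<^sub>R d1 u)"
     by (rule continuous_on_vector_derivative, rule has_vector_derivative_at_within, rule der) (use s in auto)
    show "continuous_on {r..s} (%u. c * exp ((n + m) * u))" by (intro continuous_intros)
    fix u assume u: "r < u" "u < s"
    show "((%u. exp (n * u) *\<^sub>R d1 u) has_vector_derivative exp (n * u) *\<^sub>R h u) (at u)" using der u s by simp
    show "((%u. c * exp ((n + m) * u)) has_vector_derivative c * (n + m) * exp ((n + m) * u)) (at u)"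
     unfolding has_real_derivative_iff_has_vector_derivative[symmetric] by (auto intro!: derivative_eq_intros)
    have "norm (h u) <= \<kappa> * exp (m * u) * norm (d u)" using h u s by simp
    also have "... <= \<kappa> * exp (m * u) * D" using D[of u] u s h(2) by (intro mult_left_mono) auto
    finally have "exp (n * u) * norm (h u) <= exp (n * u) * (\<kappa> * exp (m * u) * D)" by (intro mult_left_mono) auto
    also have "... = c * (n + m) * exp ((n + m) * u)"
    proof -
     have "c * (n + m) = \<kappa> * D" using nm by (simp add: c_def)
     then show ?thesis by (simp add: exp_add distrib_right)
    qed
    finally show "norm (exp (n * u) *\<^sub>R h u) <= c * (n + m) * exp ((n + m) * u)" by simp
   qed
   have c0: "0 <= c" using h D0 nm by (simp add: c_def)
   have b: "norm (exp (n * s) *\<^sub>R d1 s) <= c * exp ((n + m) * s) + M * exp (n * r)" if r: "r < s" for r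
   proof -
    have "norm (exp (n * r) *\<^sub>R d1 r) <= M * exp (n * r)" using M[of r] r s by (simp add: mult.commute mult_right_mono)
    moreover have "0 <= c * exp ((n + m) * r)" using c0 by simp
    moreover have "norm (exp (n * s) *\<^sub>R d1 s) <= norm (exp (n * s) *\<^sub>R d1 s - exp (n * r) *\<^sub>R d1 r) + norm (exp (n * r) *\<^sub>R d1 r)"
     using norm_triangle_sub by (metis add.commute)
    ultimately show ?thesis using key[OF r] by linarith
   qed
   have "((%r. c * exp ((n + m) * s) + M * exp (n * r)) \<longlongrightarrow> c * exp ((n + m) * s) + M * 0) at_bot"
    by (intro tendsto_intros exp_mult_at_bot n)
   then have "norm (exp (n * s) *\<^sub>R d1 s) <= c * exp ((n + m) * s) + M * 0"
    by (rule tendsto_lowerbound) (rule eventually_mono[OF eventually_le_at_bot[of "s - 1"]], rule b, simp_all)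
   then have "exp (n * s) * norm (d1 s) <= exp (n * s) * (c * exp (m * s))" by (simp add: exp_add algebra_simps)
   then show ?thesis by simp
  qed
  show "norm (d s) <= D / 2" if s: "s <= R" for s
  proof (cases "s = R")
   case True then show ?thesis using dR D0 by simp
  next
   case False
   then have sR: "s < R" using s by simp
   have "norm (d R - d s) <= c / m * exp (m * R) - c / m * exp (m * s)"
   proof (rule differentiable_bound_general[OF sR, where f' = d1 and \<phi>' = "%u. c * exp (m * u)"])
    show "continuous_on {s..R} d" by (rule continuous_on_vector_derivative, rule has_vector_derivative_at_within, rule d(1)) auto
    show "continuous_on {s..R} (%u. c / m * exp (m * u))" by (intro continuous_intros)
    fix u assume u: "s < u" "u < R"
    show "(d has_vector_derivative d1 u) (at u)" using d(1) u by simp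
    show "((%u. c / m * exp (m * u)) has_vector_derivative c * exp (m * u)) (at u)"
     unfolding has_real_derivative_iff_has_vector_derivative[symmetric] using m by (auto intro!: derivative_eq_intros)
    show "norm (d1 u) <= c * exp (m * u)" using d1 u by simp
   qed
   moreover have "0 <= c / m * exp (m * s)" using h D0 nm m by (simp add: c_def)
   moreover have "c / m * exp (m * R) <= D / 2"
   proof -
    have "c / m * exp (m * R) = D * (\<kappa> * exp (m * R)) / (m * (n + m))" using m nm by (simp add: c_def field_simps)
    also have "... <= D * (m * (n + m) / 2) / (m * (n + m))" using small D0 m nm by (intro divide_right_mono mult_left_mono) auto
    also have "... = D / 2" using m nm by simp
    finally show ?thesis .
   qed
   ultimately show ?thesis using dR by (simp only: diff_0 norm_minus_cancel)
  qed
 qed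
 have "norm (d s) <= M * (1/2) ^ j" if "s <= R" for j s using that
 proof (induction j arbitrary: s)
  case 0 then show ?case using M by simp
 next
  case (Suc j)
  then show ?case using half[of "M * (1/2) ^ j"] by simp
 qed
 then have b: "norm (d s) <= M * (1/2) ^ j" for j using s by blast
 have "(%j. M * (1/2) ^ j) \<longlonglongrightarrow> M * 0" by (intro tendsto_intros LIMSEQ_realpow_zero) auto
 then have "norm (d s) <= M * 0" by (rule LIMSEQ_le_const) (use b in auto)
 then show ?thesis by simp
qed

text \<open>At the last time s where y <= c, continuity forces y(s) = c, and the negative derivative
  there pushes y below c just afterwards.\<close>

lemma barrier:
 fixes y :: "real => real"
 assumes y: "!!t. a <= t ==> t <= b ==> (y has_real_derivative y' t) (at t)"
  and neg: "!!t. a <= t ==> t <= b ==> y t = c ==> y' t < 0"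
  and ya: "y a <= c" and t: "a <= t" "t <= b"
 shows "y t <= c"
proof (rule ccontr)
 assume yt: "\<not> y t <= c"
 define S where "S = {r \<in> {a..t}. y r <= c}"
 have cont: "continuous_on {a..t} y" using y t by (intro DERIV_atLeastAtMost_imp_continuous_on) fastforce
 have cl: "closed S" unfolding S_def by (intro continuous_on_closed_Collect_le cont) auto
 have aS: "a \<in> S" using ya t by (simp add: S_def)
 have bdd: "bdd_above S" by (auto simp: S_def intro!: bdd_aboveI[of _ t])
 define s where "s = Sup S"
 have sS: "s \<in> S" unfolding s_def using closed_contains_Sup[OF _ bdd cl] aS by blast
 then have s: "a <= s" "s <= t" "y s <= c" by (auto simp: S_def)
 then have st: "s < t" using yt by (cases "s = t") auto
 have after: "c < y r" if "s < r" "r <= t" for r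
 proof (rule ccontr)
  assume "\<not> c < y r"
  then have "r \<in> S" using that s by (simp add: S_def)
  then have "r <= s" unfolding s_def using bdd cSup_upper by blast
  then show False using that by simp
 qed
 have ys: "y s = c"
 proof (rule antisym[OF s(3)])
  have "continuous (at s) y" using y s t DERIV_isCont by force
  then have "(y \<longlongrightarrow> y s) (at_right s)" by (simp add: continuous_at filterlim_at_split)
  then show "c <= y s"
  proof (rule tendsto_lowerbound)
   show "\<forall>\<^sub>F r in at_right s. c <= y r"
    using eventually_at_right[OF st] after st by (intro eventually_at_rightI[of s t]) (auto intro: less_imp_le)
  qed simp
 qed
 have sb: "s <= b" using s t by simp
 obtain d where d: "d > 0" "!!h. 0 < h ==> h < d ==> y (s + h) < y s"
  using DERIV_neg_dec_right[OF y[OF s(1) sb] neg[OF s(1) sb ys]] by blast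
 define h where "h = min (d / 2) (t - s)"
 have "y (s + h) < c" "c < y (s + h)" using d(2)[of h] after[of "s + h"] d(1) st ys by (auto simp: h_def)
 then show False by simp
qed

lemma exp_neg_cancel: "exp (- a * t) * (exp (a * t) * x) = (x :: real)" by (simp add: mult.assoc[symmetric] exp_add[symmetric])

text \<open>As Q <= \<delta> (n - \<delta>) v, the function X = v' + \<delta> v satisfies X' + (n -
  \<delta>) X >= 0. If X were negative somewhere, v would grow like exp (-(n - \<delta>) t) at
  -\<infinity>, against the assumed bound by a multiple of exp (-\<theta> t). Hence X >= 0, v grows
  no faster than exp (-\<delta> t), Q decays exponentially, and two integrations bound v. The lemma
  serves both ends: with v = U at -\<infinity>, and with the Kelvin transform for
  +\<infinity>.\<close>

lemma regular_end:
 fixes v v1 Q :: "real => real"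
 assumes \<delta>: "0 < \<delta>" "\<delta> < n" and m: "0 < m3" "m3 <= m1 - p * \<delta>" and T: "T <= 0" and C: "0 <= C1" "0 <= C2" and p: "0 <= p"
  and v: "!!s. s <= T ==> (v has_real_derivative v1 s) (at s)"
   "!!s. s <= T ==> (v1 has_real_derivative (- n * v1 s - Q s)) (at s)"
   "!!s. s <= T ==> 0 < v s" "!!s. s <= T ==> v1 s <= 0"
  and Q: "!!s. s <= T ==> Q s <= \<delta> * (n - \<delta>) * v s"
   "!!s. s <= T ==> Q s <= C1 * exp (m1 * s) * v s powr p + C2 * exp (m3 * s)"
  and w: "!!s. s <= T ==> exp (\<theta> * s) * v s <= C0" "\<theta> < n - \<delta>" and s: "s <= T"
 shows "v s <= v T + (C1 * v T powr p + C2) / (m3 * (n + m3))"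
proof -
 have nd: "0 < n - \<delta>" and n: "0 < n" using \<delta> by auto
 define X where "X t = v1 t + \<delta> * v t" for t
 have X0: "0 <= X t1" if t1: "t1 <= T" for t1
 proof (rule ccontr)
  assume neg: "\<not> 0 <= X t1"
  define c where "c = - (exp ((n - \<delta>) * t1) * X t1)"
  have c: "0 < c" using neg by (simp add: c_def mult_less_0_iff)
  have dX: "((%t. exp ((n - \<delta>) * t) * X t) has_real_derivative exp ((n - \<delta>) * t) * (\<delta> * (n - \<delta>) * v t - Q t)) (at t)"
   if "t <= t1" for t
  proof -
   have "t <= T" using that t1 by simp
   from v(1)[OF this] v(2)[OF this] show ?thesis unfolding X_def by (auto intro!: derivative_eq_intros simp: algebra_simps)
  qed
  have v1b: "v1 t <= - c * exp (- (n - \<delta>) * t)" if t: "t <= t1" for t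
  proof -
   have "exp ((n - \<delta>) * t) * X t <= exp ((n - \<delta>) * t1) * X t1"
   proof (rule nondecreasing_on_ray[OF dX])
    fix u assume "u <= t1"
    then show "0 <= exp ((n - \<delta>) * u) * (\<delta> * (n - \<delta>) * v u - Q u)" using Q(1)[of u] t1 by simp
   qed (use t in auto)
   then have "exp ((n - \<delta>) * t) * X t <= - c" by (simp add: c_def)
   then have "exp (- (n - \<delta>) * t) * (exp ((n - \<delta>) * t) * X t) <= exp (- (n - \<delta>) * t) * - c" by (intro mult_left_mono) auto
   then have "X t <= exp (- (n - \<delta>) * t) * - c" by (simp only: exp_neg_cancel)
   then have "X t <= - c * exp (- (n - \<delta>) * t)" by (simp add: mult.commute)
   moreover have "0 <= \<delta> * v t" using \<delta> v(3)[of t] t t1 by simp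
   ultimately show ?thesis by (simp add: X_def)
  qed
  define K where "K = c / (n - \<delta>) * exp (- (n - \<delta>) * t1)"
  have K0: "0 <= K" using c nd by (simp add: K_def)
  have vb: "c / (n - \<delta>) * exp (- (n - \<delta>) * t) <= v t + K" if t: "t <= t1" for t
  proof -
   have "v t1 - c / (n - \<delta>) * exp (- (n - \<delta>) * t1) <= v t - c / (n - \<delta>) * exp (- (n - \<delta>) * t)"
   proof (rule nonincreasing_on_ray[where f = "%u. v u - c / (n - \<delta>) * exp (- (n - \<delta>) * u)" and f' = "%u. v1 u + c * exp (- (n - \<delta>) * u)"])
    fix u assume u: "u <= t1"
    then have "u <= T" using t1 by simp
    show "((%t. v t - c / (n - \<delta>) * exp (- (n - \<delta>) * t)) has_real_derivative v1 u + c * exp (- (n - \<delta>) * u)) (at u)"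
     by (rule derivative_eq_intros v(1)[OF \<open>u <= T\<close>] refl)+ (use nd in \<open>simp add: field_simps\<close>)
    show "v1 u + c * exp (- (n - \<delta>) * u) <= 0" using v1b[OF u] by simp
   qed (use t in auto)
   then show ?thesis using v(3)[OF t1] by (simp add: K_def)
  qed
  have fin: "c / (n - \<delta>) <= K * exp ((n - \<delta>) * t) + C0 * exp ((n - \<delta> - \<theta>) * t)" if t: "t <= t1" for t
  proof -
   have "v t <= C0 * exp (- \<theta> * t)"
   proof -
    have "exp (- \<theta> * t) * (exp (\<theta> * t) * v t) <= exp (- \<theta> * t) * C0" using w(1)[of t] t t1 by (intro mult_left_mono) auto
    then have "v t <= exp (- \<theta> * t) * C0" by (simp only: exp_neg_cancel)
    then show ?thesis by (simp add: mult.commute)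
   qed
   then have "c / (n - \<delta>) * exp (- (n - \<delta>) * t) <= C0 * exp (- \<theta> * t) + K" using vb[OF t] by simp
   then have "exp ((n - \<delta>) * t) * (c / (n - \<delta>) * exp (- (n - \<delta>) * t)) <= exp ((n - \<delta>) * t) * (C0 * exp (- \<theta> * t) + K)"
    by (intro mult_left_mono) auto
   moreover have "exp ((n - \<delta>) * t) * (c / (n - \<delta>) * exp (- (n - \<delta>) * t)) = c / (n - \<delta>)"
   proof -
    have "exp ((n - \<delta>) * t) * exp (- (n - \<delta>) * t) = 1" by (simp add: exp_add[symmetric] algebra_simps)
    then show ?thesis by (metis mult.commute mult.left_commute mult_1)
   qed
   moreover have "exp ((n - \<delta>) * t) * (C0 * exp (- \<theta> * t) + K) = K * exp ((n - \<delta>) * t) + C0 * exp ((n - \<delta> - \<theta>) * t)"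
   proof -
    have "exp ((n - \<delta> - \<theta>) * t) = exp ((n - \<delta>) * t) * exp (- \<theta> * t)" by (simp add: exp_add[symmetric] algebra_simps)
    then show ?thesis by (simp add: algebra_simps)
   qed
   ultimately show ?thesis by (simp only:)
  qed
  have "((%t. K * exp ((n - \<delta>) * t) + C0 * exp ((n - \<delta> - \<theta>) * t)) \<longlongrightarrow> K * 0 + C0 * 0) at_bot"
   using w(2) nd by (intro tendsto_intros exp_mult_at_bot) auto
  then have "c / (n - \<delta>) <= K * 0 + C0 * 0"
   by (rule tendsto_lowerbound) (rule eventually_mono[OF eventually_le_at_bot[of t1]], rule fin, simp_all)
  then show False using c nd by (simp add: divide_le_0_iff)
 qed
 have vexp: "v t <= exp (\<delta> * (T - t)) * v T" if t: "t <= T" for t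
 proof -
  have "exp (\<delta> * t) * v t <= exp (\<delta> * T) * v T"
  proof (rule nondecreasing_on_ray[where f = "%u. exp (\<delta> * u) * v u" and f' = "%u. exp (\<delta> * u) * X u"])
   fix u assume u: "u <= T"
   show "((%t. exp (\<delta> * t) * v t) has_real_derivative exp (\<delta> * u) * X u) (at u)"
    unfolding X_def using v(1)[OF u] by (auto intro!: derivative_eq_intros simp: algebra_simps)
   show "0 <= exp (\<delta> * u) * X u" using X0[OF u] by simp
  qed (use t in auto)
  then have "exp (- \<delta> * t) * (exp (\<delta> * t) * v t) <= exp (- \<delta> * t) * (exp (\<delta> * T) * v T)"
   by (intro mult_left_mono) auto
  moreover have "exp (- \<delta> * t) * (exp (\<delta> * T) * v T) = exp (\<delta> * (T - t)) * v T"
  proof -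
   have "\<delta> * (T - t) = - \<delta> * t + \<delta> * T" by (simp add: algebra_simps)
   then have "exp (\<delta> * (T - t)) = exp (- \<delta> * t) * exp (\<delta> * T)" by (simp only: exp_add)
   then show ?thesis by (simp only: mult.assoc)
  qed
  ultimately show ?thesis by (simp only: exp_neg_cancel)
 qed
 define C' where "C' = C1 * v T powr p + C2"
 have C'0: "0 <= C'" using C by (simp add: C'_def)
 \<comment> \<open>The growth rate \<delta> of v enters Q through v^p as p \<delta>;
   \<open>m3 <= m1 - p * \<delta>\<close> leaves a positive exponent, and T <= 0 fixes the signs
   when the exponents are compared.\<close>
 have Qb: "Q t <= C' * exp (m3 * t)" if t: "t <= T" for t
 proof -
  have "v t powr p <= (exp (\<delta> * (T - t)) * v T) powr p" using vexp[OF t] v(3)[OF t] p by (intro powr_mono2) auto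
  also have "... = exp (p * \<delta> * (T - t)) * v T powr p" using v(3)[OF order_refl] by (simp add: powr_mult powr_def[of "exp _"] mult.assoc)
  finally have "exp (m1 * t) * v t powr p <= exp (m1 * t) * (exp (p * \<delta> * (T - t)) * v T powr p)" by (intro mult_left_mono) auto
  also have "... = exp (m1 * t + p * \<delta> * (T - t)) * v T powr p" by (simp add: exp_add)
  also have "... <= exp (m3 * t) * v T powr p"
  proof -
   have "p * \<delta> * T <= 0" using p \<delta> T by (simp add: mult_nonneg_nonpos)
   moreover have "(m1 - p * \<delta>) * t <= m3 * t" using m t T by (intro mult_right_mono_neg) auto
   ultimately have "m1 * t + p * \<delta> * (T - t) <= m3 * t" by (simp add: algebra_simps)
   then show ?thesis by (intro mult_right_mono) auto
  qed
  finally have "C1 * (exp (m1 * t) * v t powr p) <= C1 * (exp (m3 * t) * v T powr p)" using C by (intro mult_left_mono)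
  then show ?thesis using Q(2)[OF t] by (simp add: C'_def algebra_simps)
 qed
 have nm: "0 < n + m3" using n m by simp
 define Z where "Z t = exp (n * t) * v1 t + C' / (n + m3) * exp ((n + m3) * t)" for t
 have dZ: "(Z has_real_derivative exp (n * t) * (C' * exp (m3 * t) - Q t)) (at t)" if t: "t <= T" for t
 proof -
  have "(Z has_real_derivative n * exp (n * t) * v1 t + exp (n * t) * (- n * v1 t - Q t) + C' / (n + m3) * ((n + m3) * exp ((n + m3) * t))) (at t)"
   unfolding Z_def using v(2)[OF t] by (auto intro!: derivative_eq_intros)
  moreover have "C' / (n + m3) * ((n + m3) * exp ((n + m3) * t)) = C' * (exp (n * t) * exp (m3 * t))"
  proof -
   have "exp ((n + m3) * t) = exp (n * t) * exp (m3 * t)" by (simp add: exp_add distrib_right)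
   then show ?thesis using nm by simp
  qed
  ultimately show ?thesis by (simp add: algebra_simps)
 qed
 \<comment> \<open>\<open>Z\<close> is nondecreasing, and X >= 0 together with \<open>vexp\<close>
   bounds it below by a negative multiple of exp ((n - \<delta>) r), which tends to 0 at
   -\<infinity>; hence Z >= 0.\<close>
 have v1lo: "- (C' / (n + m3)) * exp (m3 * t) <= v1 t" if t: "t <= T" for t
 proof -
  have lb: "- (\<delta> * (exp (\<delta> * T) * v T)) * exp ((n - \<delta>) * r) <= Z t" if r: "r <= t" for r
  proof -
   have rT: "r <= T" using r t by simp
   have "Z r <= Z t" by (rule nondecreasing_on_ray[OF dZ]) (use Qb r t in auto)
   moreover have "- (\<delta> * (exp (\<delta> * T) * v T)) * exp ((n - \<delta>) * r) <= exp (n * r) * v1 r"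
   proof -
    have "- (\<delta> * (exp (\<delta> * (T - r)) * v T)) <= v1 r"
     using X0[OF rT] mult_left_mono[OF vexp[OF rT] less_imp_le[OF \<delta>(1)]] unfolding X_def by linarith
    then have "exp (n * r) * - (\<delta> * (exp (\<delta> * (T - r)) * v T)) <= exp (n * r) * v1 r" by (intro mult_left_mono) auto
    moreover have "exp (n * r) * exp (\<delta> * (T - r)) = exp (\<delta> * T) * exp ((n - \<delta>) * r)"
    proof -
     have "n * r + \<delta> * (T - r) = \<delta> * T + (n - \<delta>) * r" by (simp add: algebra_simps)
     then show ?thesis by (simp only: exp_add[symmetric])
    qed
    then have "\<delta> * v T * (exp (n * r) * exp (\<delta> * (T - r))) = \<delta> * v T * (exp (\<delta> * T) * exp ((n - \<delta>) * r))" by (simp only:)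
    ultimately show ?thesis by (simp only: mult_minus_right mult_minus_left ac_simps)
   qed
   moreover have "0 <= C' / (n + m3) * exp ((n + m3) * r)" using C'0 nm by simp
   ultimately show ?thesis by (simp add: Z_def)
  qed
  have "((%r. - (\<delta> * (exp (\<delta> * T) * v T)) * exp ((n - \<delta>) * r)) \<longlongrightarrow> - (\<delta> * (exp (\<delta> * T) * v T)) * 0) at_bot"
   by (intro tendsto_intros exp_mult_at_bot nd)
  then have "- (\<delta> * (exp (\<delta> * T) * v T)) * 0 <= Z t"
   by (rule tendsto_upperbound) (rule eventually_mono[OF eventually_le_at_bot[of t]], rule lb, simp_all)
  then have "0 <= exp (n * t) * (v1 t + C' / (n + m3) * exp (m3 * t))" by (simp add: Z_def exp_add algebra_simps)
  then have "0 <= v1 t + C' / (n + m3) * exp (m3 * t)" by (simp add: zero_le_mult_iff)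
  then show ?thesis by simp
 qed
 have "v s + C' / (m3 * (n + m3)) * exp (m3 * s) <= v T + C' / (m3 * (n + m3)) * exp (m3 * T)"
 proof (rule nondecreasing_on_ray[where f = "%u. v u + C' / (m3 * (n + m3)) * exp (m3 * u)" and f' = "%u. v1 u + C' / (n + m3) * exp (m3 * u)"])
  fix u assume u: "u <= T"
  show "((%s. v s + C' / (m3 * (n + m3)) * exp (m3 * s)) has_real_derivative v1 u + C' / (n + m3) * exp (m3 * u)) (at u)"
   by (rule derivative_eq_intros v(1)[OF u] refl)+ (use m nm in \<open>simp\<close>)
  show "0 <= v1 u + C' / (n + m3) * exp (m3 * u)" using v1lo[OF u] by simp
 qed (use s in auto)
 moreover have "0 <= C' / (m3 * (n + m3)) * exp (m3 * s)" using C'0 m nm by simp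
 moreover have "C' / (m3 * (n + m3)) * exp (m3 * T) <= C' / (m3 * (n + m3)) * 1"
  using C'0 m nm T by (intro mult_left_mono) (auto simp: mult_nonneg_nonpos)
 ultimately show ?thesis by (simp add: C'_def)
qed

section \<open>Energy landscape of the autonomous limit equation\<close>

text \<open>Potential of w'' + a w' + k w^p - b w = 0; over w > 0 it is minimal at the equilibrium A
  with b = k A^(p-1).\<close>

definition well :: "real => real => real => real => real" where
 "well b k p w = k * w powr (p + 1) / (p + 1) - b * w^2 / 2"

text \<open>Mechanical energy with the cross term \<gamma> (w - A) v, which makes the dissipation
  strict in position as well as in velocity.\<close>

definition lyap :: "real => real => real => real => real => real => real => real" where
 "lyap b k p A \<gamma> w v = v^2 / 2 + well b k p w + \<gamma> * (w - A) * v"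

text \<open>The derivative of \<open>lyap\<close> along w' = v, v' = -a v - (k w^p - b w) - e, where
  e is a perturbation.\<close>

definition lyap' :: "real => real => real => real => real => real => real => real => real => real" where
 "lyap' a b k p A \<gamma> w v e = - (a - \<gamma>) * v^2 - e * v - \<gamma> * a * (w - A) * v
  - \<gamma> * (w - A) * (k * w powr p - b * w) - \<gamma> * (w - A) * e"

lemma well_has_derivative:
 assumes "0 < w" "0 < p"
 shows "(well b k p has_real_derivative k * w powr p - b * w) (at w)"
proof -
 have "(well b k p has_real_derivative k * ((p + 1) * w powr (p + 1 - 1)) / (p + 1) - b * (2 * w) / 2) (at w)" unfolding well_def using assms
  by (auto intro!: derivative_eq_intros has_real_derivative_powr simp: power2_eq_square)
 then show ?thesis using assms by simp
qed

lemma lyap_has_derivative: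
 assumes "0 < w t" "0 < p" "(w has_real_derivative v t) (at t)"
  "(v has_real_derivative - a * v t - (k * w t powr p - b * w t) - e) (at t)"
 shows "((%t. lyap b k p A \<gamma> (w t) (v t)) has_real_derivative lyap' a b k p A \<gamma> (w t) (v t) e) (at t)"
proof -
 have "((%t. well b k p (w t)) has_real_derivative (k * w t powr p - b * w t) * v t) (at t)"
  by (rule DERIV_chain2[OF well_has_derivative assms(3)]) (use assms in auto)
 then have "((%t. lyap b k p A \<gamma> (w t) (v t)) has_real_derivative
   v t * (- a * v t - (k * w t powr p - b * w t) - e) + (k * w t powr p - b * w t) * v t
    + (\<gamma> * v t * v t + \<gamma> * (w t - A) * (- a * v t - (k * w t powr p - b * w t) - e))) (at t)"
  unfolding lyap_def using assms(3,4) by (auto intro!: derivative_eq_intros simp: power2_eq_square)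
 then show ?thesis by (rule DERIV_cong) (simp add: lyap'_def power2_eq_square algebra_simps)
qed

lemma minimum_from_slope:
 fixes f :: "real => real"
 assumes f: "!!x. 0 < x ==> (f has_real_derivative f' x) (at x)"
  and pos: "!!x. min w A <= x ==> x <= max w A ==> 0 < x"
  and slope: "!!x. min w A <= x ==> x <= max w A ==> 0 <= (x - A) * f' x"
  and A: "f' A = 0"
 shows "f A <= f w"
proof (cases "A <= w")
 case True
 show ?thesis
 proof (rule DERIV_nonneg_imp_nondecreasing[OF True])
  fix x assume x: "A <= x" "x <= w"
  have "0 <= f' x"
  proof (cases "x = A")
   case False
   then have "0 < x - A" "0 <= (x - A) * f' x" using slope[of x] x True by auto
   then show ?thesis by (simp add: zero_le_mult_iff)
  qed (use A in simp)
  then show "\<exists>y. (f has_real_derivative y) (at x) & 0 <= y" using f[OF pos] x True by fastforce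
 qed
next
 case False
 then have wA: "w <= A" by simp
 show ?thesis
 proof (rule DERIV_nonpos_imp_nonincreasing[OF wA])
  fix x assume x: "w <= x" "x <= A"
  have "f' x <= 0"
  proof (cases "x = A")
   case False
   then have "x - A < 0" "0 <= (x - A) * f' x" using slope[of x] x wA by auto
   then show ?thesis by (simp add: zero_le_mult_iff)
  qed (use A in simp)
  then show "\<exists>y. (f has_real_derivative y) (at x) & y <= 0" using f[OF pos] x wA by fastforce
 qed
qed

text \<open>By the mean value theorem for w^(p-1), the force k w^p - b w = k w (w^(p-1) - A^(p-1))
  behaves like a linear spring on compact subsets of the open half-line. \<open>q1\<close> and
  \<open>q2\<close> look at both end points because p - 2 can have either sign.\<close>

lemma slope_bounds:
 fixes b k p lo hi A :: real
 assumes k: "0 < k" and p: "1 < p" and A: "0 < A" "b = k * A powr (p - 1)"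
  and lo: "0 < lo" "lo <= A" "A <= hi"
 obtains m1 m2 where "0 < m1" "0 < m2"
  "!!w. lo <= w ==> w <= hi ==> m1 * (w - A)^2 <= (w - A) * (k * w powr p - b * w)"
  "!!w. lo <= w ==> w <= hi ==> m1 * (w - A)^2 / 2 <= well b k p w - well b k p A"
  "!!w. lo <= w ==> w <= hi ==> well b k p w - well b k p A <= m2 * (w - A)^2 / 2"
proof -
 define q1 where "q1 = min (lo powr (p - 2)) (hi powr (p - 2))"
 define q2 where "q2 = max (lo powr (p - 2)) (hi powr (p - 2))"
 define m1 where "m1 = k * lo * (p - 1) * q1"
 define m2 where "m2 = k * hi * (p - 1) * q2"
 have hi: "0 < hi" using lo by simp
 have q: "0 < q1" "0 < q2" using lo hi by (auto simp: q1_def q2_def less_max_iff_disj)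
 have m: "0 < m1" "0 < m2" using q k p lo hi by (auto simp: m1_def m2_def)
 have qb: "q1 <= x powr (p - 2)" "x powr (p - 2) <= q2" if "lo <= x" "x <= hi" for x
 proof -
  have "q1 <= x powr (p - 2) & x powr (p - 2) <= q2"
  proof (cases "0 <= p - 2")
   case True
   then have "lo powr (p - 2) <= x powr (p - 2)" "x powr (p - 2) <= hi powr (p - 2)" using that lo by (auto intro!: powr_mono2)
   then show ?thesis by (auto simp: q1_def q2_def)
  next
   case False
   then have "x powr (p - 2) <= lo powr (p - 2)" "hi powr (p - 2) <= x powr (p - 2)" using that lo by (auto intro!: powr_mono2')
   then show ?thesis by (auto simp: q1_def q2_def)
  qed
  then show "q1 <= x powr (p - 2)" "x powr (p - 2) <= q2" by auto
 qed
 have slope: "m1 * (w - A)^2 <= (w - A) * (k * w powr p - b * w) & (w - A) * (k * w powr p - b * w) <= m2 * (w - A)^2"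
  if w: "lo <= w" "w <= hi" for w
 proof -
  have w0: "0 < w" using w lo by simp
  have pd: "((%x. x powr (p - 1)) has_real_derivative (p - 1) * x powr (p - 1 - 1)) (at x)" if "0 < x" for x
   using that by (rule has_real_derivative_powr)
  have "\<exists>x. lo <= x & x <= hi & w powr (p - 1) - A powr (p - 1) = (w - A) * ((p - 1) * x powr (p - 2))"
  proof (cases w A rule: linorder_cases)
   case equal then show ?thesis using lo by auto
  next
   case less
   have "\<exists>x>w. x < A & A powr (p - 1) - w powr (p - 1) = (A - w) * ((p - 1) * x powr (p - 1 - 1))"
    by (rule MVT2[OF less], rule pd) (use w0 in simp)
   then obtain x where "w < x" "x < A" "A powr (p - 1) - w powr (p - 1) = (A - w) * ((p - 1) * x powr (p - 1 - 1))" by blast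
   then show ?thesis using w lo by (intro exI[of _ x]) (auto simp: algebra_simps)
  next
   case greater
   have "\<exists>x>A. x < w & w powr (p - 1) - A powr (p - 1) = (w - A) * ((p - 1) * x powr (p - 1 - 1))"
    by (rule MVT2[OF greater], rule pd) (use A in simp)
   then obtain x where "A < x" "x < w" "w powr (p - 1) - A powr (p - 1) = (w - A) * ((p - 1) * x powr (p - 1 - 1))" by blast
   then show ?thesis using w lo by (intro exI[of _ x]) auto
  qed
  then obtain x where x: "lo <= x" "x <= hi" "w powr (p - 1) - A powr (p - 1) = (w - A) * ((p - 1) * x powr (p - 2))" by blast
  have wp: "w powr p = w * w powr (p - 1)" using w0 by (simp add: powr_mult_base)
  have "k * w powr p - b * w = k * w * (w powr (p - 1) - A powr (p - 1))" by (simp add: wp A(2) algebra_simps)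
  then have e: "(w - A) * (k * w powr p - b * w) = k * w * (p - 1) * x powr (p - 2) * (w - A)^2" by (simp add: x(3) power2_eq_square)
  have "m1 <= k * w * (p - 1) * x powr (p - 2)" unfolding m1_def using qb[OF x(1,2)] k p w w0 lo q by (intro mult_mono) auto
  moreover have "k * w * (p - 1) * x powr (p - 2) <= m2" unfolding m2_def using qb[OF x(1,2)] k p w w0 lo hi q by (intro mult_mono) auto
  ultimately show ?thesis unfolding e by (auto intro!: mult_right_mono)
 qed
 have hA: "k * A powr p - b * A = 0" using A powr_mult_base[of A "p - 1"] by (simp add: algebra_simps)
 have dW: "((%x. well b k p x - c * (x - A)^2 / 2) has_real_derivative (k * x powr p - b * x) - c * (x - A)) (at x)"
  if "0 < x" for x c using that p by (auto intro!: derivative_eq_intros well_has_derivative simp: power2_eq_square)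
 show ?thesis
 proof (rule that[OF m])
  fix w assume w: "lo <= w" "w <= hi"
  show "m1 * (w - A)^2 <= (w - A) * (k * w powr p - b * w)" using slope[OF w] by blast
  have "well b k p A - m1 * (A - A)^2 / 2 <= well b k p w - m1 * (w - A)^2 / 2"
  proof (rule minimum_from_slope[OF dW])
   fix x assume "min w A <= x" "x <= max w A"
   then have x: "lo <= x" "x <= hi" using w lo by auto
   then show "0 < x" using lo by simp
   show "0 <= (x - A) * ((k * x powr p - b * x) - m1 * (x - A))" using slope[OF x] by (simp add: algebra_simps power2_eq_square)
  qed (use hA in auto)
  then show "m1 * (w - A)^2 / 2 <= well b k p w - well b k p A" by simp
  have "- (well b k p A - m2 * (A - A)^2 / 2) <= - (well b k p w - m2 * (w - A)^2 / 2)"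
  proof (rule minimum_from_slope[OF DERIV_minus[OF dW]])
   fix x assume "min w A <= x" "x <= max w A"
   then have x: "lo <= x" "x <= hi" using w lo by auto
   then show "0 < x" using lo by simp
   show "0 <= (x - A) * - ((k * x powr p - b * x) - m2 * (x - A))" using slope[OF x] by (simp add: algebra_simps power2_eq_square)
  qed (use hA in auto)
  then show "well b k p w - well b k p A <= m2 * (w - A)^2 / 2" by simp
 qed
qed

text \<open>A trajectory rising through the low level \<sigma> has 0 <= v <= \<theta> \<sigma>, so
  kinetic energy and quadratic part add up to at most (\<theta>^2 - b) \<sigma>^2 / 2 = -a \<theta>
  \<sigma>^2 / 2; \<sigma> is so small that the power term returns at most half of this. The
  remaining -a \<theta> \<sigma>^2 / 4 dictates \<eta>, and below the height \<open>w0\<close> the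
  well and the cross term together cannot bring the energy down to -\<eta>.\<close>

lemma well_constants:
 fixes a b k p \<theta> Cw s1 A :: real
 assumes a: "0 < a" and k: "0 < k" and p: "1 < p" and \<theta>: "0 < \<theta>" and th: "\<theta>^2 - b = - a * \<theta>"
  and s1: "0 < s1" and A: "0 < A" "b = k * A powr (p - 1)"
 obtains \<sigma> \<eta> w0 \<gamma> c3 C3 c4 where "0 < \<sigma>" "\<sigma> < s1" "0 < \<eta>" "0 < w0" "w0 <= \<sigma>" "0 < c3" "0 <= C3" "0 < c4"
  "well b k p A < - \<eta>"
  "!!v. 0 <= v ==> v <= \<theta> * \<sigma> ==> lyap b k p A \<gamma> \<sigma> v <= - \<eta>"
  "!!w v. 0 < w ==> lyap b k p A \<gamma> w v <= - \<eta> ==> w0 <= w"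
  "!!w v e \<epsilon>. w0 <= w ==> w <= Cw ==> \<bar>e\<bar> <= \<epsilon> ==>
   lyap' a b k p A \<gamma> w v e <= - c3 * (lyap b k p A \<gamma> w v - well b k p A) + C3 * \<epsilon>^2"
  "!!w v. w0 <= w ==> w <= Cw ==> c4 * (w - A)^2 <= lyap b k p A \<gamma> w v - well b k p A"
proof -
 have b: "0 < b" using A k by simp
 define \<sigma> where "\<sigma> = min (min (s1 / 2) (A / 2)) ((a * \<theta> / (4 * k)) powr (1 / (p - 1)))"
 have \<sigma>: "0 < \<sigma>" "\<sigma> < s1" "\<sigma> < A" using s1 A a \<theta> k by (auto simp: \<sigma>_def min_def)
 have \<sigma>p: "k * \<sigma> powr (p - 1) <= a * \<theta> / 4"
 proof -
  have "\<sigma> powr (p - 1) <= ((a * \<theta> / (4 * k)) powr (1 / (p - 1))) powr (p - 1)"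
   using \<sigma> p by (intro powr_mono2) (auto simp: \<sigma>_def)
  also have "... = a * \<theta> / (4 * k)" using p a \<theta> k by (simp add: powr_powr)
  finally show ?thesis using k by (simp add: field_simps)
 qed
 have wq: "w powr (p + 1) = w^2 * w powr (p - 1)" if "0 < w" for w
 proof -
  have "w powr (p + 1) = w powr (2 + (p - 1))" by (simp add: add.commute)
  also have "... = w powr 2 * w powr (p - 1)" by (rule powr_add)
  finally show ?thesis using that by simp
 qed
 have FA: "well b k p A < 0"
 proof -
  have "well b k p A = b * A^2 * (1 / (p + 1) - 1 / 2)"
  proof -
   have kA: "k * A powr (p + 1) = b * A^2" using wq[OF A(1)] A(2) by simp
   show ?thesis unfolding well_def kA by (simp add: algebra_simps)
  qed
  moreover have "1 / (p + 1) - 1 / 2 < 0" using p by (simp add: field_simps)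
  ultimately show ?thesis using b A by (simp add: mult_less_0_iff)
 qed
 define \<eta> where "\<eta> = min (a * \<theta> * \<sigma>^2 / 4) (- well b k p A / 2)"
 have \<eta>: "0 < \<eta>" "well b k p A < - \<eta>" using a \<theta> \<sigma> FA by (auto simp: \<eta>_def min_def)
 define w0 where "w0 = min \<sigma> (sqrt (\<eta> / b))"
 have w0: "0 < w0" "w0 <= \<sigma>" using \<sigma> \<eta> b by (auto simp: w0_def)
 obtain m1 m2 where m: "0 < m1" "0 < m2" and
  sl: "!!w. w0 <= w ==> w <= max Cw A ==> m1 * (w - A)^2 <= (w - A) * (k * w powr p - b * w)" and
  lo: "!!w. w0 <= w ==> w <= max Cw A ==> m1 * (w - A)^2 / 2 <= well b k p w - well b k p A" and
  up: "!!w. w0 <= w ==> w <= max Cw A ==> well b k p w - well b k p A <= m2 * (w - A)^2 / 2"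
  using slope_bounds[OF k p A, of w0 "max Cw A"] w0 \<sigma> by auto
 \<comment> \<open>Three requirements: the mixed term is absorbed by the damping
   (\<open>g1\<close>), the energy dominates (w - A)^2 (\<open>g2\<close>), and near w = 0 the cross
   term costs at most \<eta>/2 (\<open>g3\<close>).\<close>
 define \<gamma> where "\<gamma> = min (min (a / (2 * (1 + a^2 / m1))) (sqrt m1 / 2)) (sqrt \<eta> / A)"
 have pos: "0 < 1 + a^2 / m1" using m by (intro add_pos_nonneg) auto
 have g: "0 < \<gamma>" using a m \<eta> A pos by (auto simp: \<gamma>_def)
 have g1: "\<gamma> + \<gamma> * a^2 / m1 <= a / 2"
 proof -
  have "\<gamma> <= a / (2 * (1 + a^2 / m1))" by (simp add: \<gamma>_def)
  then have "\<gamma> * (2 * (1 + a^2 / m1)) <= a" using pos by (subst (asm) pos_le_divide_eq) auto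
  then show ?thesis by (simp add: algebra_simps)
 qed
 have g2: "\<gamma>^2 <= m1 / 4"
 proof -
  have "\<gamma> <= sqrt m1 / 2" unfolding \<gamma>_def by (rule min.coboundedI1, rule min.cobounded2)
  then have "\<gamma>^2 <= (sqrt m1 / 2)^2" using g by (intro power_mono) auto
  then show ?thesis using m by (simp add: power_divide)
 qed
 have g3: "\<gamma>^2 * A^2 <= \<eta>"
 proof -
  have "\<gamma> <= sqrt \<eta> / A" unfolding \<gamma>_def by (rule min.cobounded2)
  then have "\<gamma>^2 <= (sqrt \<eta> / A)^2" using g by (intro power_mono) auto
  then show ?thesis using \<eta> A by (simp add: power_divide field_simps)
 qed
 define M where "M = 1 + m2 + \<gamma>"
 define c3 where "c3 = min (a / 4) (\<gamma> * m1 / 2) / M"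
 define C3 where "C3 = 1 / a + \<gamma> / m1"
 have M: "0 < M" and c3: "0 < c3" and C3: "0 <= C3" using m g a by (auto simp: M_def c3_def C3_def)
 show ?thesis
 proof (rule that[OF \<sigma>(1,2) \<eta>(1) w0 c3 C3 _ \<eta>(2), of "m1 / 4"])
  show "0 < m1 / 4" using m by simp
 next
  fix v assume v: "0 <= v" "v <= \<theta> * \<sigma>"
  have "\<gamma> * (\<sigma> - A) * v <= 0" using g \<sigma> v by (simp add: mult_nonneg_nonpos mult_nonpos_nonneg)
  moreover have "v^2 <= (\<theta> * \<sigma>)^2" using v by (intro power_mono)
  moreover have "well b k p \<sigma> <= a * \<theta> / 4 * \<sigma>^2 - b * \<sigma>^2 / 2"
  proof -
   have "k * \<sigma> powr (p + 1) / (p + 1) <= k * \<sigma> powr (p + 1) / 1" using p k by (intro divide_left_mono) auto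
   also have "... = (k * \<sigma> powr (p - 1)) * \<sigma>^2" using wq[OF \<sigma>(1)] by simp
   also have "... <= a * \<theta> / 4 * \<sigma>^2" using \<sigma>p by (intro mult_right_mono) auto
   finally show ?thesis by (simp add: well_def)
  qed
  moreover have "(\<theta> * \<sigma>)^2 - b * \<sigma>^2 = - a * \<theta> * \<sigma>^2"
   using th by (simp add: power_mult_distrib left_diff_distrib[symmetric])
  moreover have "\<eta> <= a * \<theta> * \<sigma>^2 / 4" by (simp add: \<eta>_def)
  ultimately show "lyap b k p A \<gamma> \<sigma> v <= - \<eta>" by (simp add: lyap_def)
 next
  fix w v assume w: "0 < w" and L: "lyap b k p A \<gamma> w v <= - \<eta>"
  show "w0 <= w"
  proof (rule ccontr)
   assume "\<not> w0 <= w"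
   then have ww: "w < w0" by simp
   have "w^2 < (sqrt (\<eta> / b))^2" using ww w by (intro power_strict_mono) (auto simp: w0_def)
   then have w2: "b * w^2 < \<eta>" using \<eta> b by (simp add: field_simps)
   have "(A - w)^2 <= A^2" using ww w w0 \<sigma> by (intro power_mono) auto
   then have "\<gamma>^2 * (w - A)^2 <= \<gamma>^2 * A^2" by (intro mult_left_mono) (auto simp: power2_commute)
   then have "\<gamma>^2 * (w - A)^2 <= \<eta>" using g3 by simp
   moreover have "- (\<gamma>^2 * d^2) / 2 <= v^2 / 2 + \<gamma> * d * v" for d
   proof -
    have "0 <= (v + \<gamma> * d)^2" by simp
    then show ?thesis by (simp add: power2_sum power_mult_distrib algebra_simps)
   qed
   then have "- (\<gamma>^2 * (w - A)^2) / 2 <= v^2 / 2 + \<gamma> * (w - A) * v" by blast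
   moreover have "0 <= k * w powr (p + 1) / (p + 1)" using k p by simp
   ultimately show False using L w2 by (simp add: lyap_def well_def)
  qed
 next
  fix w v e \<epsilon> assume w: "w0 <= w" "w <= Cw" and e: "\<bar>e\<bar> <= (\<epsilon>::real)"
  define d where "d = w - A"
  have w': "w <= max Cw A" using w by simp
  have s: "\<gamma> * (m1 * d^2) <= \<gamma> * (d * (k * w powr p - b * w))"
   using sl[OF w(1) w'] g by (intro mult_left_mono) (auto simp: d_def)
  have e2: "e^2 <= \<epsilon>^2" using e by (simp add: abs_le_square_iff[symmetric])
  have t1: "- \<gamma> * a * d * v <= \<gamma> * m1 * d^2 / 4 + \<gamma> * a^2 / m1 * v^2"
  proof -
   have "0 <= \<gamma> * (m1 * d / 2 + a * v)^2 / m1" using m g by simp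
   also have "... = \<gamma> * m1 * d^2 / 4 + \<gamma> * a^2 / m1 * v^2 + \<gamma> * a * d * v"
    using m by (simp add: power2_eq_square field_simps)
   finally show ?thesis by simp
  qed
  have t2: "- e * v <= a / 4 * v^2 + e^2 / a"
  proof -
   have "0 <= (a * v / 2 + e)^2 / a" using a by simp
   also have "... = a / 4 * v^2 + e^2 / a + e * v" using a by (simp add: power2_eq_square field_simps)
   finally show ?thesis by simp
  qed
  have t3: "- \<gamma> * d * e <= \<gamma> * m1 * d^2 / 4 + \<gamma> / m1 * e^2"
  proof -
   have "0 <= \<gamma> * (m1 * d / 2 + e)^2 / m1" using m g by simp
   also have "... = \<gamma> * m1 * d^2 / 4 + \<gamma> / m1 * e^2 + \<gamma> * d * e" using m by (simp add: power2_eq_square field_simps)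
   finally show ?thesis by simp
  qed
  have t4: "(\<gamma> + \<gamma> * a^2 / m1) * v^2 <= a / 2 * v^2" using g1 by (intro mult_right_mono) auto
  have t5: "C3 * e^2 <= C3 * \<epsilon>^2" using e2 C3 by (intro mult_left_mono)
  have "lyap' a b k p A \<gamma> w v e = - (a - \<gamma>) * v^2 - e * v - \<gamma> * a * d * v - \<gamma> * (d * (k * w powr p - b * w)) - \<gamma> * d * e"
   by (simp add: lyap'_def d_def)
  then have "lyap' a b k p A \<gamma> w v e <= - (a / 4) * v^2 - \<gamma> * m1 / 2 * d^2 + C3 * e^2"
   using s t1 t2 t3 t4 by (simp add: C3_def algebra_simps)
  then have l1: "lyap' a b k p A \<gamma> w v e <= - (a / 4) * v^2 - \<gamma> * m1 / 2 * d^2 + C3 * \<epsilon>^2" using t5 by linarith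
  have "lyap b k p A \<gamma> w v - well b k p A <= M * (v^2 + d^2)"
  proof -
   have "2 * d * v <= d^2 + v^2" by (rule two_mult_le_squares)
   then have "\<gamma> * (2 * d * v) <= \<gamma> * (d^2 + v^2)" using g by (intro mult_left_mono) auto
   moreover have "well b k p w - well b k p A <= m2 * d^2 / 2" using up[OF w(1) w'] by (simp add: d_def)
   moreover have "0 <= v^2" "0 <= d^2" "0 <= m2 * v^2" "0 <= m2 * d^2" "0 <= \<gamma> * v^2" "0 <= \<gamma> * d^2" using m g by auto
   moreover have "M * (v^2 + d^2) = v^2 + d^2 + m2 * v^2 + m2 * d^2 + \<gamma> * v^2 + \<gamma> * d^2"
    by (simp add: M_def algebra_simps)
   moreover have "lyap b k p A \<gamma> w v - well b k p A = v^2 / 2 + (well b k p w - well b k p A) + \<gamma> * d * v"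
    by (simp add: lyap_def d_def)
   moreover have "\<gamma> * (2 * d * v) = 2 * (\<gamma> * d * v)" "\<gamma> * (d^2 + v^2) = \<gamma> * d^2 + \<gamma> * v^2"
    by (simp_all add: algebra_simps)
   ultimately show ?thesis by linarith
  qed
  then have "c3 * (lyap b k p A \<gamma> w v - well b k p A) <= c3 * (M * (v^2 + d^2))" using c3 by (intro mult_left_mono) auto
  also have "... = min (a / 4) (\<gamma> * m1 / 2) * (v^2 + d^2)"
  proof -
   have "c3 * M = min (a / 4) (\<gamma> * m1 / 2)" using M by (simp add: c3_def)
   then show ?thesis by (simp only: mult.assoc[symmetric])
  qed
  also have "... <= a / 4 * v^2 + \<gamma> * m1 / 2 * d^2" unfolding distrib_left by (intro add_mono mult_right_mono) auto
  finally show "lyap' a b k p A \<gamma> w v e <= - c3 * (lyap b k p A \<gamma> w v - well b k p A) + C3 * \<epsilon>^2" using l1 by simp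
 next
  fix w v assume w: "w0 <= w" "w <= Cw"
  define d where "d = w - A"
  have w': "w <= max Cw A" using w by simp
  have "m1 * d^2 / 2 <= well b k p w - well b k p A" using lo[OF w(1) w'] by (simp add: d_def)
  moreover have "- (\<gamma> * d * v) <= v^2 / 2 + m1 * d^2 / 4"
  proof -
   have "2 * (- (\<gamma> * d)) * v <= (- (\<gamma> * d))^2 + v^2" by (rule two_mult_le_squares)
   moreover have "(- (\<gamma> * d))^2 <= m1 / 4 * d^2" using mult_right_mono[OF g2, of "d^2"] by (simp add: power_mult_distrib)
   moreover have "0 <= m1 * d^2" using m by simp
   ultimately show ?thesis by simp
  qed
  ultimately show "m1 / 4 * (w - A)^2 <= lyap b k p A \<gamma> w v - well b k p A" by (simp add: lyap_def d_def[symmetric])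
 qed
qed

section \<open>The equation in logarithmic time\<close>

text \<open>In terms of the radial data, m = 2 + \<alpha>, l = 2 + \<beta>, \<open>m2\<close> is 2 +
  \<nu> and \<open>q2\<close> is q - N. The last two assumptions are p > p_S(\<alpha>) and p >
  p_S(\<beta>): they put the exponents \<open>\<theta>\<close> and \<open>\<theta>1\<close> below
  n/2, so that the scaled equations are damped.\<close>

locale emden_fowler =
 fixes n p m l k0 k1 m2 q2 :: real and \<kappa> \<phi> :: "real => real"
 assumes n: "0 < n" and p: "1 < p" and m: "0 < m" and l: "0 < l" and k0: "0 < k0" and k1: "0 < k1"
  and \<kappa>_cont: "continuous_on UNIV \<kappa>" and \<kappa>_pos: "!!t. 0 < \<kappa> t"
  and \<phi>_cont: "continuous_on UNIV \<phi>" and \<phi>_nonneg: "!!t. 0 <= \<phi> t" and \<phi>_nz: "\<exists>t. 0 < \<phi> t"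
  and \<kappa>_bot: "((%t. \<kappa> t * exp (- m * t)) \<longlongrightarrow> k0) at_bot"
  and \<kappa>_top: "((%t. \<kappa> t * exp (- l * t)) \<longlongrightarrow> k1) at_top"
  and m2: "0 < m2" and \<phi>_bot: "\<exists>C T. \<forall>t\<le>T. \<phi> t <= C * exp (m2 * t)"
  and q2: "0 < q2" and \<phi>_top: "\<exists>C T. \<forall>t\<ge>T. \<phi> t <= C * exp (- (n + q2) * t)"
  and super_bot: "2 * m < n * (p - 1)" and super_top: "2 * l < n * (p - 1)"
begin

text \<open>The exponents at which nonlinear and linear part balance: r^(-\<theta>) is the singular
  profile at 0, and r^(-\<theta>1) the slow profile at infinity.\<close>

definition \<theta> :: real where "\<theta> = m / (p - 1)"
definition \<theta>1 :: real where "\<theta>1 = l / (p - 1)"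

lemma theta: "0 < \<theta>" "2 * \<theta> < n" "\<theta> * (p - 1) = m" "0 < \<theta>1" "2 * \<theta>1 < n" "\<theta>1 * (p - 1) = l"
 using p m l super_bot super_top by (auto simp: \<theta>_def \<theta>1_def field_simps)

text \<open>The truncation \<open>max 0\<close> lets solutions continue beyond a zero.\<close>

definition force :: "real => (real => real) => real => real" where
 "force \<mu> U t = \<kappa> t * (max 0 (U t)) powr p + \<mu> * \<phi> t"

definition solves :: "real => (real => real) => (real => real) => bool" where
 "solves \<mu> U V \<longleftrightarrow> (\<forall>t. (U has_real_derivative V t) (at t) &
  (V has_real_derivative (- n * V t - force \<mu> U t)) (at t))"

text \<open>Positivity is left out: the branch exists for every \<mu> >= 0 and may become negative.
  As U decreases, positivity at one time implies it at all earlier times.\<close>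

definition descending :: "real => (real => real) => (real => real) => bool" where
 "descending \<mu> U V \<longleftrightarrow> 0 <= \<mu> & solves \<mu> U V & (\<forall>t. V t < 0)"

definition singular :: "real => (real => real) => (real => real) => bool" where
 "singular \<mu> U V \<longleftrightarrow> 0 <= \<mu> & solves \<mu> U V & (\<forall>t. 0 < U t) & filterlim U at_top at_bot"

lemma force_nonneg: "0 <= \<mu> ==> 0 <= force \<mu> U t" using \<kappa>_pos[of t] \<phi>_nonneg[of t] by (simp add: force_def)

lemma solvesD:
 assumes "solves \<mu> U V"
 shows "(U has_real_derivative V t) (at t)" "(V has_real_derivative (- n * V t - force \<mu> U t)) (at t)" using assms by (auto simp: solves_def)

lemma flux_derivative:
 assumes "solves \<mu> U V"
 shows "((%t. exp (n * t) * V t) has_real_derivative - exp (n * t) * force \<mu> U t) (at t)"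
 using solvesD[OF assms, of t] by (auto intro!: derivative_eq_intros simp: algebra_simps)

lemma flux_mono:
 assumes "solves \<mu> U V" "0 <= \<mu>" "s <= t"
 shows "exp (n * t) * V t <= exp (n * s) * V s" by (rule nonincreasing_on_ray[OF flux_derivative[OF assms(1)], of t])
  (use force_nonneg[OF assms(2)] assms(3) in auto)

text \<open>If V were nonnegative at t, monotonicity of the flux exp (n t) V would keep it
  nonnegative before t, and U would be bounded by U(t) there.\<close>

lemma singular_descending:
 assumes "singular \<mu> U V"
 shows "descending \<mu> U V"
proof -
 have S: "solves \<mu> U V" "0 <= \<mu>" and top: "filterlim U at_top at_bot" using assms by (auto simp: singular_def)
 have "V t < 0" for t
 proof (rule ccontr)
  assume "\<not> V t < 0"
  then have Vs: "0 <= V s" if "s <= t" for s using flux_mono[OF S that] by (smt (verit) exp_gt_zero mult_nonneg_nonneg zero_le_mult_iff)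
  have le: "U s <= U t" if "s <= t" for s by (rule nondecreasing_on_ray[OF solvesD(1)[OF S(1)], of t]) (use Vs that in auto)
  have "\<forall>\<^sub>F s in at_bot. U t < U s" using top by (simp add: filterlim_at_top_dense)
  then have "\<forall>\<^sub>F s::real in at_bot. False" using eventually_le_at_bot[of t] by eventually_elim (use le in force)
  then show False by simp
 qed
 then show ?thesis using S by (simp add: descending_def)
qed

lemma descending_mono:
 assumes "descending \<mu> U V" "s <= t"
 shows "U t <= U s" by (rule nonincreasing_on_ray[where f = U and f' = V and T = t])
  (use assms in \<open>auto simp: descending_def solves_def intro: less_imp_le\<close>)

text \<open>One unit of time builds up enough flux for -V >= exp (-n) K U^p on [t - 1, t]; over this
  second unit U^(1 - p) increases by (p - 1) exp (-n) K. The bound depends neither on \<mu> nor on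
  the solution.\<close>

lemma apriori:
 assumes D: "descending \<mu> U V" and U: "0 < U t" and K: "0 < K" "!!s. t - 2 <= s ==> s <= t ==> K <= \<kappa> s"
 shows "U t powr (p - 1) <= exp n / ((p - 1) * K)"
proof -
 have S: "solves \<mu> U V" and \<mu>: "0 <= \<mu>" and Vn: "!!t. V t < 0" using D by (auto simp: descending_def)
 have Up: "0 < U s" if "s <= t" for s using descending_mono[OF D that] U by simp
 have V: "V s <= - exp (- n) * K * U s powr p" if s: "t - 1 <= s" "s <= t" for s
 proof -
  define Z where "Z r = exp (n * r) * V r + exp (n * (s - 1)) * K * U s powr p * r" for r
  have "Z s <= Z (s - 1)"
  proof (rule DERIV_nonpos_imp_nonincreasing[where f = Z and a = "s - 1" and b = s])
   fix r assume r: "s - 1 <= r" "r <= s"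
   have "(Z has_real_derivative - exp (n * r) * force \<mu> U r + exp (n * (s - 1)) * K * U s powr p) (at r)"
    unfolding Z_def by (rule derivative_eq_intros flux_derivative[OF S] refl)+ simp
   moreover have "exp (n * (s - 1)) * K * U s powr p <= exp (n * r) * force \<mu> U r"
   proof -
    have "U s powr p <= (max 0 (U r)) powr p" using descending_mono[OF D r(2)] Up[OF s(2)] p by (intro powr_mono2) auto
    then have "K * U s powr p <= \<kappa> r * (max 0 (U r)) powr p" using K(2)[of r] r s K(1) by (intro mult_mono) auto
    also have "... <= force \<mu> U r" using \<mu> \<phi>_nonneg[of r] by (simp add: force_def)
    finally have "exp (n * (s - 1)) * (K * U s powr p) <= exp (n * r) * force \<mu> U r" using n r K(1) by (intro mult_mono) auto
    then show ?thesis by (simp only: mult.assoc)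
   qed
   ultimately show "\<exists>y. (Z has_real_derivative y) (at r) & y <= 0" by fastforce
  qed simp
  then have "exp (n * s) * V s + exp (n * (s - 1)) * K * U s powr p <= exp (n * (s - 1)) * V (s - 1)" by (simp add: Z_def algebra_simps)
  also have "... <= 0" using Vn[of "s - 1"] by (simp add: mult_nonneg_nonpos)
  finally have "exp (- n * s) * (exp (n * s) * V s) <= exp (- n * s) * (- (exp (n * (s - 1)) * K * U s powr p))" by (intro mult_left_mono) auto
  moreover have "exp (- n * s) * exp (n * (s - 1)) = exp (- n)" by (simp add: exp_add[symmetric] algebra_simps)
  then have "exp (- n * s) * (- (exp (n * (s - 1)) * K * U s powr p)) = - exp (- n) * K * U s powr p"
   by (simp only: mult_minus_right mult_minus_left mult.assoc[symmetric])
  ultimately show ?thesis by (simp only: exp_neg_cancel)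
 qed
 define c where "c = (p - 1) * (exp (- n) * K)"
 have c: "0 < c" using p K by (simp add: c_def)
 define Y where "Y r = U r powr (1 - p) - c * r" for r
 have "Y (t - 1) <= Y t"
 proof (rule DERIV_nonneg_imp_nondecreasing[where f = Y and a = "t - 1" and b = t])
  fix s assume s: "t - 1 <= s" "s <= t"
  have "((%x. x powr (1 - p)) has_real_derivative (1 - p) * U s powr (1 - p - 1)) (at (U s))"
   by (rule has_real_derivative_powr) (use Up s in auto)
  then have "((%r. U r powr (1 - p)) has_real_derivative (1 - p) * U s powr (1 - p - 1) * V s) (at s)"
   by (rule DERIV_chain2[OF _ solvesD(1)[OF S]])
  then have "(Y has_real_derivative (1 - p) * U s powr (1 - p - 1) * V s - c) (at s)"
   unfolding Y_def using DERIV_diff[OF _ DERIV_cmult_Id[of c]] by fastforce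
  moreover have "c <= (1 - p) * U s powr (1 - p - 1) * V s"
  proof -
   have "exp (- n) * K * U s powr p <= - V s" using V[OF s] by simp
   then have "(p - 1) * U s powr (- p) * (exp (- n) * K * U s powr p) <= (p - 1) * U s powr (- p) * (- V s)"
    using p by (intro mult_left_mono) auto
   moreover have "U s powr (- p) * U s powr p = 1" using Up[OF s(2)] by (simp add: powr_add[symmetric])
   then have "(p - 1) * U s powr (- p) * (exp (- n) * K * U s powr p) = c" by (simp add: c_def)
   ultimately show ?thesis by (simp add: algebra_simps)
  qed
  ultimately show "\<exists>y. (Y has_real_derivative y) (at s) & 0 <= y" by fastforce
 qed simp
 then have "U (t - 1) powr (1 - p) + c <= U t powr (1 - p)" by (simp add: Y_def algebra_simps)
 then have "c <= U t powr (1 - p)" using powr_ge_zero[of "U (t - 1)" "1 - p"] by linarith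
 then have h: "c <= U t powr (1 - p)" .
 have "U t powr (p - 1) <= 1 / c"
 proof -
  have "U t powr (1 - p) * U t powr (p - 1) = 1" using U by (simp add: powr_add[symmetric])
  moreover have "c * U t powr (p - 1) <= U t powr (1 - p) * U t powr (p - 1)" using h by (intro mult_right_mono) auto
  ultimately show ?thesis using c by (simp add: field_simps)
 qed
 also have "1 / c = exp n / ((p - 1) * K)" by (simp add: c_def exp_minus field_simps)
 finally show ?thesis .
qed

text \<open>The bound of \<open>apriori\<close> for \<kappa> >= (k/2) exp (m' s), in the scaled
  variable; exp (2 m') accounts for the two units of time it looks back.\<close>

definition Wmax :: "real => real => real" where
 "Wmax m' k = (2 * exp (n + 2 * m') / ((p - 1) * k)) powr (1 / (p - 1))"

lemma W_bound:
 assumes D: "descending \<mu> U V" and U: "0 < U t" and k: "0 < k" and m': "0 < m'" and th: "th * (p - 1) = m'"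
  and \<kappa>: "!!s. t - 2 <= s ==> s <= t ==> k / 2 <= \<kappa> s * exp (- m' * s)"
 shows "exp (th * t) * U t <= Wmax m' k"
proof -
 define K where "K = k / 2 * exp (m' * (t - 2))"
 have K0: "0 < K" using k by (simp add: K_def)
 have "K <= \<kappa> s" if s: "t - 2 <= s" "s <= t" for s
 proof -
  have "exp (m' * s) * (k / 2) <= exp (m' * s) * (\<kappa> s * exp (- m' * s))" using \<kappa>[OF s] by (intro mult_left_mono) auto
  also have "... = \<kappa> s" by (simp add: exp_minus)
  finally have "k / 2 * exp (m' * s) <= \<kappa> s" by (simp add: mult.commute)
  moreover have "K <= k / 2 * exp (m' * s)" unfolding K_def using s m' k by (intro mult_left_mono) auto
  ultimately show ?thesis by simp
 qed
 from apriori[OF D U K0 this] have "U t powr (p - 1) <= exp n / ((p - 1) * K)" .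
 then have "exp (m' * t) * U t powr (p - 1) <= exp (m' * t) * (exp n / ((p - 1) * K))" by (intro mult_left_mono) auto
 also have "... = 2 * exp (n + 2 * m') / ((p - 1) * k)"
 proof -
  have "exp (m' * (t - 2)) * exp (2 * m') = exp (m' * t)" by (simp add: exp_add[symmetric] algebra_simps)
  then have "exp (m' * t) / exp (m' * (t - 2)) = exp (2 * m')" by (simp add: field_simps)
  then have e: "exp (m' * t) = exp (2 * m') * exp (m' * (t - 2))" by (simp add: field_simps)
  show ?thesis unfolding e K_def using k p by (simp add: exp_add field_simps)
 qed
 finally have b: "exp (m' * t) * U t powr (p - 1) <= 2 * exp (n + 2 * m') / ((p - 1) * k)" .
 have "(exp (th * t) * U t) powr (p - 1) = exp (m' * t) * U t powr (p - 1)"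
  using U by (simp add: powr_mult powr_def[of "exp _"] th[symmetric] ac_simps)
 then have "((exp (th * t) * U t) powr (p - 1)) powr (1 / (p - 1)) <= Wmax m' k" unfolding Wmax_def using b p by (intro powr_mono2) auto
 then show ?thesis using U p by (simp add: powr_powr)
qed

text \<open>n U + V has the derivative -force <= 0. Once it is at most -c, the function exp (n t) U
  decreases at rate c exp (n t) and becomes negative. In radial terms, r^(N-2) u is nondecreasing
  for a positive u.\<close>

lemma cone:
 assumes D: "descending \<mu> U V" and U: "!!t. 0 < U t"
 shows "0 <= n * U t + V t"
proof (rule ccontr)
 assume neg: "\<not> 0 <= n * U t + V t"
 have S: "solves \<mu> U V" and \<mu>: "0 <= \<mu>" using D by (auto simp: descending_def)
 define c where "c = - (n * U t + V t)"
 have c: "0 < c" using neg by (simp add: c_def)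
 have X: "n * U s + V s <= - c" if "t <= s" for s
 proof -
  have "n * U s + V s <= n * U t + V t"
  proof (rule nonincreasing_on_ray[where f = "%s. n * U s + V s" and f' = "%s. - force \<mu> U s" and T = s])
   fix r show "((%s. n * U s + V s) has_real_derivative - force \<mu> U r) (at r)"
    using solvesD[OF S, of r] by (auto intro!: derivative_eq_intros)
  qed (use that force_nonneg[OF \<mu>] in auto)
  then show ?thesis by (simp add: c_def)
 qed
 have b: "exp (n * s) * U s + c / n * exp (n * s) <= exp (n * t) * U t + c / n * exp (n * t)" if s: "t <= s" for s
 proof (rule DERIV_nonpos_imp_nonincreasing[OF s])
  fix r assume r: "t <= r" "r <= s"
  have "((%s. exp (n * s) * U s + c / n * exp (n * s)) has_real_derivative exp (n * r) * (n * U r + V r + c)) (at r)"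
   using solvesD(1)[OF S, of r] n by (auto intro!: derivative_eq_intros simp: algebra_simps)
  moreover have "exp (n * r) * (n * U r + V r + c) <= 0" using X[OF r(1)] by (simp add: mult_le_0_iff)
  ultimately show "\<exists>y. ((%s. exp (n * s) * U s + c / n * exp (n * s)) has_real_derivative y) (at r) & y <= 0" by blast
 qed
 have le: "c / n * exp (n * s) <= exp (n * t) * U t + c / n * exp (n * t)" if "t <= s" for s
 proof -
  have "0 < exp (n * s) * U s" using U[of s] by simp
  then show ?thesis using b[OF that] by linarith
 qed
 have "filterlim (%s. c / n * exp (n * s)) at_top at_top"
  using c n by (intro filterlim_tendsto_pos_mult_at_top[OF tendsto_const] filterlim_compose[OF exp_at_top]
    filterlim_tendsto_pos_mult_at_top[OF tendsto_const n filterlim_ident]) auto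
 then have "\<forall>\<^sub>F s in at_top. exp (n * t) * U t + c / n * exp (n * t) < c / n * exp (n * s)" by (simp add: filterlim_at_top_dense)
 then have "\<forall>\<^sub>F s::real in at_top. False" using eventually_ge_at_top[of t] by eventually_elim (use le in force)
 then show False by simp
qed

text \<open>What separates the scaled equation for w = exp (th t) U from its autonomous limit: the
  drift of the coefficient and the source.\<close>

definition err :: "real => real => real => real => real => real => real" where
 "err th m' k \<mu> t w = (\<kappa> t * exp (- m' * t) - k) * w powr p + \<mu> * exp (th * t) * \<phi> t"

lemma emden_ode:
 assumes S: "solves \<mu> U V" and U: "0 < U t" and th: "th * (p - 1) = m'"
 shows "((%t. exp (th * t) * U t) has_real_derivative exp (th * t) * (V t + th * U t)) (at t)"
  "((%t. exp (th * t) * (V t + th * U t)) has_real_derivative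
    - (n - 2 * th) * (exp (th * t) * (V t + th * U t))
    - (k * (exp (th * t) * U t) powr p - th * (n - th) * (exp (th * t) * U t))
    - err th m' k \<mu> t (exp (th * t) * U t)) (at t)"
proof -
 show "((%t. exp (th * t) * U t) has_real_derivative exp (th * t) * (V t + th * U t)) (at t)"
  using solvesD(1)[OF S, of t] by (auto intro!: derivative_eq_intros simp: algebra_simps)
 have w: "exp (- m' * t) * (exp (th * t) * U t) powr p = exp (th * t) * U t powr p"
 proof -
  have "(exp (th * t) * U t) powr p = exp (th * t * p) * U t powr p" using U by (simp add: powr_mult powr_def[of "exp _"] ac_simps)
  moreover have "- m' * t + th * t * p = th * t" by (simp add: th[symmetric] algebra_simps)
  then have "exp (- m' * t) * exp (th * t * p) = exp (th * t)" by (simp only: exp_add[symmetric])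
  ultimately show ?thesis by (simp only: mult.assoc[symmetric])
 qed
 have f: "exp (th * t) * force \<mu> U t = k * (exp (th * t) * U t) powr p + err th m' k \<mu> t (exp (th * t) * U t)"
 proof -
  have "exp (th * t) * force \<mu> U t = \<kappa> t * (exp (th * t) * U t powr p) + \<mu> * exp (th * t) * \<phi> t"
   using U by (simp add: force_def algebra_simps)
  also have "... = \<kappa> t * (exp (- m' * t) * (exp (th * t) * U t) powr p) + \<mu> * exp (th * t) * \<phi> t" by (simp only: w)
  finally show ?thesis by (simp add: err_def algebra_simps)
 qed
 have expand: "th * exp (th * t) * (V t + th * U t) + exp (th * t) * ((- n * V t - force \<mu> U t) + th * V t)
  = - (n - 2 * th) * (exp (th * t) * (V t + th * U t)) + th * (n - th) * (exp (th * t) * U t) - exp (th * t) * force \<mu> U t"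
  by (simp add: algebra_simps)
 have "((%t. exp (th * t) * (V t + th * U t)) has_real_derivative
  th * exp (th * t) * (V t + th * U t) + exp (th * t) * ((- n * V t - force \<mu> U t) + th * V t)) (at t)"
  using solvesD[OF S, of t] by (auto intro!: derivative_eq_intros)
 then show "((%t. exp (th * t) * (V t + th * U t)) has_real_derivative
    - (n - 2 * th) * (exp (th * t) * (V t + th * U t))
    - (k * (exp (th * t) * U t) powr p - th * (n - th) * (exp (th * t) * U t))
    - err th m' k \<mu> t (exp (th * t) * U t)) (at t)"
 proof (rule DERIV_cong)
  show "th * exp (th * t) * (V t + th * U t) + exp (th * t) * ((- n * V t - force \<mu> U t) + th * V t)
   = - (n - 2 * th) * (exp (th * t) * (V t + th * U t))
    - (k * (exp (th * t) * U t) powr p - th * (n - th) * (exp (th * t) * U t))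
    - err th m' k \<mu> t (exp (th * t) * U t)" unfolding expand f by simp
 qed
qed

lemma phi_bot_limit: "((%t. exp (th * t) * \<phi> t) \<longlongrightarrow> 0) at_bot" if "0 <= th"
proof -
 obtain C T where C: "!!t. t <= T ==> \<phi> t <= C * exp (m2 * t)" using \<phi>_bot by blast
 have "((%t. C * exp ((th + m2) * t)) \<longlongrightarrow> C * 0) at_bot" using that m2 by (intro tendsto_intros exp_mult_at_bot) auto
 then have lim: "((%t. C * exp ((th + m2) * t)) \<longlongrightarrow> 0) at_bot" by simp
 show ?thesis
 proof (rule Lim_null_comparison[OF _ lim])
  show "\<forall>\<^sub>F t in at_bot. norm (exp (th * t) * \<phi> t) <= C * exp ((th + m2) * t)" using eventually_le_at_bot[of T]
  proof eventually_elim
   case (elim t)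
   have "exp (th * t) * \<phi> t <= exp (th * t) * (C * exp (m2 * t))" using C[OF elim] by (intro mult_left_mono) auto
   then show ?case using \<phi>_nonneg[of t] by (simp add: exp_add algebra_simps)
  qed
 qed
qed

lemma phi_top_limit: "((%t. exp (th * t) * \<phi> t) \<longlongrightarrow> 0) at_top" if "th <= n"
proof -
 obtain C T where C: "!!t. T <= t ==> \<phi> t <= C * exp (- (n + q2) * t)" using \<phi>_top by blast
 have "((%t. exp (- (n + q2 - th) * t)) \<longlongrightarrow> 0) at_top"
  using that q2 by (intro filterlim_compose[OF exp_at_bot] filterlim_tendsto_neg_mult_at_bot[OF tendsto_const _ filterlim_ident]) auto
 then have "((%t. C * exp (- (n + q2 - th) * t)) \<longlongrightarrow> C * 0) at_top" by (intro tendsto_intros)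
 then have lim: "((%t. C * exp (- (n + q2 - th) * t)) \<longlongrightarrow> 0) at_top" by simp
 show ?thesis
 proof (rule Lim_null_comparison[OF _ lim])
  show "\<forall>\<^sub>F t in at_top. norm (exp (th * t) * \<phi> t) <= C * exp (- (n + q2 - th) * t)" using eventually_ge_at_top[of T]
  proof eventually_elim
   case (elim t)
   have "exp (th * t) * \<phi> t <= exp (th * t) * (C * exp (- (n + q2) * t))" using C[OF elim] by (intro mult_left_mono) auto
   also have "... = C * exp (- (n + q2 - th) * t)"
   proof -
    have "th * t + - (n + q2) * t = - (n + q2 - th) * t" by (simp add: algebra_simps)
    then have "exp (th * t) * exp (- (n + q2) * t) = exp (- (n + q2 - th) * t)" by (simp only: exp_add[symmetric])
    then show ?thesis by (simp only: mult.left_commute)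
   qed
   finally show ?case using \<phi>_nonneg[of t] by simp
  qed
 qed
qed

lemma err_small:
 assumes F: "((%t. \<kappa> t * exp (- m' * t)) \<longlongrightarrow> k) F" "((%t. exp (th * t) * \<phi> t) \<longlongrightarrow> 0) F" and C: "0 <= C" and B: "0 <= B" and \<epsilon>: "0 < \<epsilon>"
 shows "\<forall>\<^sub>F t in F. \<forall>\<mu> w. 0 <= \<mu> & \<mu> <= B & 0 <= w & w <= C --> \<bar>err th m' k \<mu> t w\<bar> <= \<epsilon>"
proof -
 have "((%t. \<bar>\<kappa> t * exp (- m' * t) - k\<bar> * C powr p + B * (exp (th * t) * \<phi> t)) \<longlongrightarrow> \<bar>k - k\<bar> * C powr p + B * 0) F"
  by (intro tendsto_intros F)
 then have "\<forall>\<^sub>F t in F. \<bar>\<kappa> t * exp (- m' * t) - k\<bar> * C powr p + B * (exp (th * t) * \<phi> t) < \<epsilon>"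
  using \<epsilon> by (intro order_tendstoD) auto
 then show ?thesis
 proof eventually_elim
  case (elim t)
  show ?case
  proof (intro allI impI)
   fix \<mu> w assume h: "0 <= \<mu> & \<mu> <= B & 0 <= w & w <= C"
   have "\<bar>err th m' k \<mu> t w\<bar> <= \<bar>(\<kappa> t * exp (- m' * t) - k) * w powr p\<bar> + \<bar>\<mu> * exp (th * t) * \<phi> t\<bar>"
    unfolding err_def by (rule abs_triangle_ineq)
   also have "\<bar>(\<kappa> t * exp (- m' * t) - k) * w powr p\<bar> <= \<bar>\<kappa> t * exp (- m' * t) - k\<bar> * C powr p"
    unfolding abs_mult using h p by (intro mult_left_mono) (auto intro!: powr_mono2)
   also have "\<bar>\<mu> * exp (th * t) * \<phi> t\<bar> <= B * (exp (th * t) * \<phi> t)"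
    using h \<phi>_nonneg[of t] by (simp add: abs_mult mult.assoc mult_right_mono)
   finally show "\<bar>err th m' k \<mu> t w\<bar> <= \<epsilon>" using elim by simp
  qed
 qed
qed

end

lemma up_crossing:
 fixes f :: "real => real"
 assumes "!!t. a <= t ==> t <= b ==> (f has_real_derivative f' t) (at t)" "a <= b" "f a <= c" "c < f b"
 obtains t where "a <= t" "t <= b" "f t = c" "0 <= f' t"
proof -
 have "\<exists>t. a <= t & t <= b & f t = c & 0 <= f' t"
 proof (rule ccontr)
  assume "\<not> ?thesis"
  then have "f b <= c" by (intro barrier[of a b f f' c b]) (use assms in force)+
  then show False using assms by simp
 qed
 then show ?thesis using that by blast
qed

lemma exp_mult_neg_cancel: "exp (a * t) * (x * exp (- a * t)) = (x :: real)" by (simp add: exp_minus)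

lemma exp_powr_scale:
 assumes "0 < (u :: real)" "th * q = c"
 shows "(exp (th * t) * u) powr q = exp (c * t) * u powr q"
proof -
 have "exp (th * t) powr q = exp (c * t)" by (simp add: powr_def assms(2)[symmetric])
 then show ?thesis using assms(1) by (simp add: powr_mult)
qed

context emden_fowler
begin

section \<open>Equilibria and trapping at either end\<close>

definition Aeq :: "real => real => real" where
 "Aeq th k = (th * (n - th) / k) powr (1 / (p - 1))"

lemma Aeq:
 assumes "0 < th" "2 * th < n" "0 < k"
 shows "0 < Aeq th k" "th * (n - th) = k * Aeq th k powr (p - 1)" "0 < th * (n - th)"
proof -
 show b: "0 < th * (n - th)" using assms by simp
 show "0 < Aeq th k" using b assms by (simp add: Aeq_def)
 show "th * (n - th) = k * Aeq th k powr (p - 1)" using b assms p by (simp add: Aeq_def powr_powr)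
qed

definition energy :: "real => real => real => (real => real) => (real => real) => real => real" where
 "energy th k \<gamma> U V t = lyap (th * (n - th)) k p (Aeq th k) \<gamma> (exp (th * t) * U t) (exp (th * t) * (V t + th * U t))"

definition bottom :: "real => real => real" where
 "bottom th k = well (th * (n - th)) k p (Aeq th k)"

text \<open>Energy at most $-\eta$ keeps a solution above $w_0$ as long as the error is small; a solution crossing the
low level $\sigma$ upwards has energy at most $-\eta$.\<close>

definition trapping :: "real => real => real => real => real => real => real => real => real => real => bool" where
 "trapping th k Cw \<sigma> \<eta> w0 \<gamma> c3 C3 c4 \<longleftrightarrow>
  0 < \<sigma> & 0 < \<eta> & 0 < w0 & w0 <= \<sigma> & 0 < c3 & 0 <= C3 & 0 < c4 & bottom th k < - \<eta> &
  (\<forall>v. 0 <= v --> v <= th * \<sigma> --> lyap (th * (n - th)) k p (Aeq th k) \<gamma> \<sigma> v <= - \<eta>) &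
  (\<forall>w v. 0 < w --> lyap (th * (n - th)) k p (Aeq th k) \<gamma> w v <= - \<eta> --> w0 <= w) &
  (\<forall>w v e \<epsilon>. w0 <= w --> w <= Cw --> \<bar>e\<bar> <= \<epsilon> --> lyap' (n - 2 * th) (th * (n - th)) k p (Aeq th k) \<gamma> w v e
    <= - c3 * (lyap (th * (n - th)) k p (Aeq th k) \<gamma> w v - bottom th k) + C3 * \<epsilon>^2) &
  (\<forall>w v. w0 <= w --> w <= Cw --> c4 * (w - Aeq th k)^2 <= lyap (th * (n - th)) k p (Aeq th k) \<gamma> w v - bottom th k)"

lemma trapping_exists:
 assumes "0 < th" "2 * th < n" "0 < k" "0 < s1"
 obtains \<sigma> \<eta> w0 \<gamma> c3 C3 c4 where "\<sigma> < s1" "trapping th k Cw \<sigma> \<eta> w0 \<gamma> c3 C3 c4"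
proof -
 have a: "0 < n - 2 * th" using assms by simp
 have e: "th^2 - th * (n - th) = - (n - 2 * th) * th" by (simp add: power2_eq_square algebra_simps)
 show ?thesis
 proof (rule well_constants[OF a assms(3) p assms(1) e assms(4) Aeq(1,2)[OF assms(1-3)], where Cw = Cw])
  fix \<sigma> \<eta> w0 \<gamma> c3 C3 c4
  assume h: "0 < \<sigma>" "\<sigma> < s1" "0 < \<eta>" "0 < w0" "w0 <= \<sigma>" "0 < c3" "0 <= C3" "0 < c4"
   "well (th * (n - th)) k p (Aeq th k) < - \<eta>"
   "!!v. 0 <= v ==> v <= th * \<sigma> ==> lyap (th * (n - th)) k p (Aeq th k) \<gamma> \<sigma> v <= - \<eta>"
   "!!w v. 0 < w ==> lyap (th * (n - th)) k p (Aeq th k) \<gamma> w v <= - \<eta> ==> w0 <= w"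
   "!!w v e \<epsilon>. w0 <= w ==> w <= Cw ==> \<bar>e\<bar> <= \<epsilon> ==>
    lyap' (n - 2 * th) (th * (n - th)) k p (Aeq th k) \<gamma> w v e
    <= - c3 * (lyap (th * (n - th)) k p (Aeq th k) \<gamma> w v - well (th * (n - th)) k p (Aeq th k)) + C3 * \<epsilon>^2"
   "!!w v. w0 <= w ==> w <= Cw ==> c4 * (w - Aeq th k)^2 <= lyap (th * (n - th)) k p (Aeq th k) \<gamma> w v - well (th * (n - th)) k p (Aeq th k)"
  have "trapping th k Cw \<sigma> \<eta> w0 \<gamma> c3 C3 c4" unfolding trapping_def bottom_def by (intro conjI allI impI; (rule h; assumption))
  with h(2) show ?thesis by (rule that)
 qed
qed

lemma energy_derivative:
 assumes "solves \<mu> U V" "0 < U t" "th * (p - 1) = m'"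
 shows "(energy th k \<gamma> U V has_real_derivative
  lyap' (n - 2 * th) (th * (n - th)) k p (Aeq th k) \<gamma> (exp (th * t) * U t) (exp (th * t) * (V t + th * U t))
   (err th m' k \<mu> t (exp (th * t) * U t))) (at t)" unfolding energy_def
 by (rule lyap_has_derivative[OF _ _ emden_ode[OF assms]]) (use assms p in auto)

text \<open>At the level -\<eta> the energy exceeds its minimum by a fixed amount, so the
  dissipation beats an error of size \<epsilon> and the level acts as a barrier.\<close>

lemma trap:
 assumes tr: "trapping th k Cw \<sigma> \<eta> w0 \<gamma> c3 C3 c4" and S: "solves \<mu> U V" and th: "th * (p - 1) = m'"
  and U: "!!s. c <= s ==> s <= t ==> 0 < U s"
  and W: "!!s. c <= s ==> s <= t ==> exp (th * s) * U s <= Cw"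
  and e: "!!s. c <= s ==> s <= t ==> \<bar>err th m' k \<mu> s (exp (th * s) * U s)\<bar> <= \<epsilon>"
  and \<epsilon>: "C3 * \<epsilon>^2 < c3 * (- \<eta> - bottom th k)" and L: "energy th k \<gamma> U V c <= - \<eta>" and t: "c <= t"
 shows "energy th k \<gamma> U V t <= - \<eta>" "w0 <= exp (th * t) * U t"
proof -
 show *: "energy th k \<gamma> U V t <= - \<eta>"
 proof (rule barrier[OF energy_derivative[OF S _ th] _ L t order_refl])
  fix s assume s: "c <= s" "s <= t"
  show "0 < U s" by (rule U[OF s])
  assume eq: "energy th k \<gamma> U V s = - \<eta>"
  have w: "w0 <= exp (th * s) * U s" using tr U[OF s] eq unfolding trapping_def energy_def by (metis exp_gt_zero mult_pos_pos order_refl)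
  have "lyap' (n - 2 * th) (th * (n - th)) k p (Aeq th k) \<gamma> (exp (th * s) * U s) (exp (th * s) * (V s + th * U s))
    (err th m' k \<mu> s (exp (th * s) * U s)) <= - c3 * (energy th k \<gamma> U V s - bottom th k) + C3 * \<epsilon>^2"
   using tr w W[OF s] e[OF s] unfolding trapping_def energy_def by blast
  then show "lyap' (n - 2 * th) (th * (n - th)) k p (Aeq th k) \<gamma> (exp (th * s) * U s) (exp (th * s) * (V s + th * U s))
    (err th m' k \<mu> s (exp (th * s) * U s)) < 0" using \<epsilon> eq by simp
 qed
 show "w0 <= exp (th * t) * U t" using tr U[OF t] * unfolding trapping_def energy_def by (metis exp_gt_zero mult_pos_pos order_refl)
qed

text \<open>At an upward crossing of \<sigma> the scaled velocity is nonnegative, and V < 0 makes it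
  at most th \<sigma>; this is the range in which \<open>trapping\<close> guarantees energy at most
  -\<eta>.\<close>

lemma rise_traps:
 assumes tr: "trapping th k Cw \<sigma> \<eta> w0 \<gamma> c3 C3 c4" and D: "descending \<mu> U V" and th: "th * (p - 1) = m'"
  and U: "!!s. a <= s ==> s <= t ==> 0 < U s"
  and W: "!!s. a <= s ==> s <= t ==> exp (th * s) * U s <= Cw"
  and e: "!!s. a <= s ==> s <= t ==> \<bar>err th m' k \<mu> s (exp (th * s) * U s)\<bar> <= \<epsilon>"
  and \<epsilon>: "C3 * \<epsilon>^2 < c3 * (- \<eta> - bottom th k)"
  and ab: "a <= b" "b <= t" "exp (th * a) * U a <= \<sigma>" "\<sigma> < exp (th * b) * U b"
 shows "energy th k \<gamma> U V t <= - \<eta>" "w0 <= exp (th * t) * U t"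
proof -
 have S: "solves \<mu> U V" and Vn: "!!t. V t < 0" using D by (auto simp: descending_def)
 obtain c where c: "a <= c" "c <= b" "exp (th * c) * U c = \<sigma>" "0 <= exp (th * c) * (V c + th * U c)"
 proof (rule up_crossing[where f = "%s. exp (th * s) * U s" and f' = "%s. exp (th * s) * (V s + th * U s)" and a = a and b = b and c = \<sigma>])
  fix s assume "a <= s" "s <= b"
  then show "((%s. exp (th * s) * U s) has_real_derivative exp (th * s) * (V s + th * U s)) (at s)"
   using U[of s] ab by (intro emden_ode(1)[OF S _ th]) auto
 qed (use ab in auto)
 have "exp (th * c) * (V c + th * U c) <= th * \<sigma>"
 proof -
  have "exp (th * c) * V c <= 0" using Vn[of c] by (simp add: mult_nonneg_nonpos)
  then show ?thesis by (simp add: c(3)[symmetric] algebra_simps)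
 qed
 then have L: "energy th k \<gamma> U V c <= - \<eta>" using tr c(3,4) unfolding trapping_def energy_def by simp
 show "energy th k \<gamma> U V t <= - \<eta>" "w0 <= exp (th * t) * U t" using trap[OF tr S th _ _ _ \<epsilon> L, of t] U W e ab c by auto
qed

lemma kappa_eventually_bot: "\<forall>\<^sub>F t in at_bot. k0 / 2 <= \<kappa> t * exp (- m * t) & \<kappa> t * exp (- m * t) <= 2 * k0"
 using order_tendstoD[OF \<kappa>_bot, of "k0 / 2"] order_tendstoD(2)[OF \<kappa>_bot, of "2 * k0"] k0
 by (auto elim: eventually_elim2 simp: less_imp_le)

lemma kappa_eventually_top: "\<forall>\<^sub>F t in at_top. k1 / 2 <= \<kappa> t * exp (- l * t) & \<kappa> t * exp (- l * t) <= 2 * k1"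
 using order_tendstoD[OF \<kappa>_top, of "k1 / 2"] order_tendstoD(2)[OF \<kappa>_top, of "2 * k1"] k1
 by (auto elim: eventually_elim2 simp: less_imp_le)

section \<open>Small solutions at the two ends, and the limit at -\<infinity>\<close>

text \<open>If the scaled solution stayed below \<open>s1\<close> near -\<infinity>, the force would
  be at most a small multiple of U, \<open>regular_end\<close> would bound U, and U would not blow
  up. The threshold is the same for all \<mu>.\<close>

lemma not_small_bot:
 obtains s1 where "0 < s1" "!!\<mu> U V T. singular \<mu> U V ==> \<exists>t\<le>T. s1 < exp (\<theta> * t) * U t"
proof -
 \<comment> \<open>\<delta> p <= m/2 leaves half of the decay of \<kappa> after U^p has grown, and
   \<delta> < n - \<theta> separates the scaled bound from the growth rate n - \<delta> excluded in
   \<open>regular_end\<close>.\<close>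
 define \<delta> where "\<delta> = min (m / (2 * p)) ((n - \<theta>) / 2)"
 have \<delta>: "0 < \<delta>" "\<delta> < n" "\<theta> < n - \<delta>" "\<delta> * p <= m / 2"
 proof -
  show "0 < \<delta>" using m p theta by (simp add: \<delta>_def)
  have "\<delta> <= (n - \<theta>) / 2" unfolding \<delta>_def by (rule min.cobounded2)
  then show "\<delta> < n" "\<theta> < n - \<delta>" using theta by auto
  have "\<delta> <= m / (2 * p)" unfolding \<delta>_def by (rule min.cobounded1)
  then show "\<delta> * p <= m / 2" using p by (simp add: field_simps)
 qed
 define m3 where "m3 = min (m / 2) m2"
 have m3: "0 < m3" "m3 <= m - p * \<delta>" "m3 <= m2" using m m2 \<delta> by (auto simp: m3_def mult.commute)
 have dn: "0 < \<delta> * (n - \<delta>)" using \<delta> by simp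
 \<comment> \<open>At this level \<kappa> U^(p-1) <= \<delta> (n - \<delta>) / 2, given \<kappa> <=
   2 k0 exp (m t); the other half is reserved for the source, where U >= 1 is used.\<close>
 define s1 where "s1 = (\<delta> * (n - \<delta>) / (4 * k0)) powr (1 / (p - 1))"
 have s1: "0 < s1" using dn k0 \<delta>(1,2) by (simp add: s1_def)
 have s1p: "2 * k0 * s1 powr (p - 1) = \<delta> * (n - \<delta>) / 2" using dn k0 p \<delta>(1,2) by (simp add: s1_def powr_powr)
 show ?thesis
 proof (rule that[OF s1])
  fix \<mu> U V T0
  assume sg: "singular \<mu> U V"
  then have S: "solves \<mu> U V" and \<mu>: "0 <= \<mu>" and U: "!!t. 0 < U t" and top: "filterlim U at_top at_bot"
   by (auto simp: singular_def)
  have Vn: "!!t. V t < 0" using singular_descending[OF sg] by (simp add: descending_def)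
  show "\<exists>t\<le>T0. s1 < exp (\<theta> * t) * U t"
  proof (rule ccontr)
   assume "\<not> ?thesis"
   then have small: "!!t. t <= T0 ==> exp (\<theta> * t) * U t <= s1" by force
   obtain C T' where C: "!!t. t <= T' ==> \<phi> t <= C * exp (m2 * t)" using \<phi>_bot by blast
   have "((%t. \<mu> * (exp (0 * t) * \<phi> t)) \<longlongrightarrow> \<mu> * 0) at_bot" by (intro tendsto_intros phi_bot_limit) simp
   then have "((%t. \<mu> * \<phi> t) \<longlongrightarrow> 0) at_bot" by simp
   then have "\<forall>\<^sub>F t in at_bot. \<mu> * \<phi> t < \<delta> * (n - \<delta>) / 2" using dn by (intro order_tendstoD) auto
   moreover have "\<forall>\<^sub>F t in at_bot. 1 <= U t" using top by (simp add: filterlim_at_top)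
   ultimately have "\<forall>\<^sub>F t in at_bot. \<mu> * \<phi> t < \<delta> * (n - \<delta>) / 2 & 1 <= U t &
     \<kappa> t * exp (- m * t) <= 2 * k0 & t <= T0 & t <= T' & t <= 0"
    using kappa_eventually_bot eventually_le_at_bot[of T0] eventually_le_at_bot[of T'] eventually_le_at_bot[of 0] by eventually_elim auto
   then obtain T where T: "!!t. t <= T ==> \<mu> * \<phi> t < \<delta> * (n - \<delta>) / 2 & 1 <= U t &
     \<kappa> t * exp (- m * t) <= 2 * k0 & t <= T0 & t <= T' & t <= 0" by (auto simp: eventually_at_bot_linorder)
   have kb: "\<kappa> t <= 2 * k0 * exp (m * t)" if "t <= T" for t
   proof -
    have "exp (m * t) * (\<kappa> t * exp (- m * t)) <= exp (m * t) * (2 * k0)" using T[OF that] by (intro mult_left_mono) auto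
    then show ?thesis unfolding exp_mult_neg_cancel by (simp only: mult.commute)
   qed
   define C' where "C' = \<mu> * max 0 C"
   have bd: "U s <= U T + (2 * k0 * U T powr p + C') / (m3 * (n + m3))" if s: "s <= T" for s
   proof (rule regular_end[OF \<delta>(1,2) m3(1,2) _ _ _ _ solvesD[OF S] U less_imp_le[OF Vn] _ _ _ \<delta>(3) s])
    show "T <= 0" using T by blast
    show "0 <= 2 * k0" "0 <= C'" "0 <= p" using k0 \<mu> p by (auto simp: C'_def)
    fix t assume t: "t <= T"
    show "exp (\<theta> * t) * U t <= s1" using small T[OF t] by blast
    have f: "force \<mu> U t = \<kappa> t * U t powr p + \<mu> * \<phi> t" using U[of t] by (simp add: force_def)
    show "force \<mu> U t <= \<delta> * (n - \<delta>) * U t"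
    proof -
     have "U t powr p = U t * U t powr (p - 1)" using U[of t] by (simp add: powr_mult_base)
     moreover have "\<kappa> t * U t powr (p - 1) <= \<delta> * (n - \<delta>) / 2"
     proof -
      have "exp (m * t) * U t powr (p - 1) = (exp (\<theta> * t) * U t) powr (p - 1)" by (rule exp_powr_scale[OF U theta(3), symmetric])
      also have "... <= s1 powr (p - 1)" using small T[OF t] U[of t] p by (intro powr_mono2) auto
      finally have "2 * k0 * (exp (m * t) * U t powr (p - 1)) <= 2 * k0 * s1 powr (p - 1)" using k0 by simp
      moreover have "\<kappa> t * U t powr (p - 1) <= 2 * k0 * exp (m * t) * U t powr (p - 1)" using kb[OF t] by (intro mult_right_mono) auto
      ultimately show ?thesis using s1p by (simp add: mult.assoc)
     qed
     then have "\<kappa> t * U t powr (p - 1) * U t <= \<delta> * (n - \<delta>) / 2 * U t" using U[of t] by (intro mult_right_mono) auto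
     moreover have "\<mu> * \<phi> t <= \<delta> * (n - \<delta>) / 2 * U t"
     proof -
      have "\<delta> * (n - \<delta>) / 2 * 1 <= \<delta> * (n - \<delta>) / 2 * U t" using T[OF t] dn by (intro mult_left_mono) auto
      then show ?thesis using T[OF t] by simp
     qed
     ultimately show ?thesis unfolding f by (simp add: ac_simps)
    qed
    show "force \<mu> U t <= 2 * k0 * exp (m * t) * U t powr p + C' * exp (m3 * t)"
    proof -
     have "\<kappa> t * U t powr p <= 2 * k0 * exp (m * t) * U t powr p" using kb[OF t] by (intro mult_right_mono) auto
     moreover have "\<phi> t <= max 0 C * exp (m3 * t)"
     proof -
      have "\<phi> t <= C * exp (m2 * t)" using C T[OF t] by blast
      also have "... <= max 0 C * exp (m2 * t)" by (intro mult_right_mono) auto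
      also have "... <= max 0 C * exp (m3 * t)" using T[OF t] m3 by (intro mult_left_mono) (auto intro: mult_right_mono_neg)
      finally show ?thesis .
     qed
     then have "\<mu> * \<phi> t <= \<mu> * (max 0 C * exp (m3 * t))" using \<mu> by (intro mult_left_mono)
     ultimately show ?thesis unfolding f by (simp add: C'_def mult.assoc)
    qed
   qed
   have "\<forall>\<^sub>F s in at_bot. U T + (2 * k0 * U T powr p + C') / (m3 * (n + m3)) < U s" using top by (simp add: filterlim_at_top_dense)
   then have "\<forall>\<^sub>F s::real in at_bot. False" using eventually_le_at_bot[of T] by eventually_elim (use bd in force)
   then show False by simp
  qed
 qed
qed

text \<open>The Kelvin transform v(s) = exp (-n s) U(-s) moves +\<infinity> to -\<infinity> and
  again satisfies the hypotheses of \<open>regular_end\<close>. The lower bound \<open>yl\<close>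
  lets the source be absorbed into a multiple of v. T1, D1 and D2 do not depend on \<mu> up to B or
  on the solution, so the estimate survives variation of the parameter.\<close>

lemma small_top:
 obtains s1 where "0 < s1"
  "!!B yl. 0 <= B ==> 0 < yl ==> \<exists>T1 D1 D2. 0 <= D1 & 0 <= D2 & (\<forall>\<mu> U V R t. T1 <= R --> R <= t --> \<mu> <= B --> descending \<mu> U V
   --> (\<forall>t. 0 < U t) --> yl <= exp (n * R) * U R --> (\<forall>t\<ge>R. exp (\<theta>1 * t) * U t <= s1)
   --> exp (n * t) * U t <= exp (n * R) * U R + D1 * (exp (n * R) * U R) powr p + D2)"
proof -
 define m1 where "m1 = n * (p - 1) - l"
 have m1: "0 < m1" using super_top l by (simp add: m1_def)
 define \<delta> where "\<delta> = min (m1 / (2 * p)) (\<theta>1 / 2)"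
 have \<delta>: "0 < \<delta>" "\<delta> < n" "n - \<theta>1 < n - \<delta>" "\<delta> * p <= m1 / 2"
 proof -
  show "0 < \<delta>" using m1 p theta by (simp add: \<delta>_def)
  have "\<delta> <= \<theta>1 / 2" unfolding \<delta>_def by (rule min.cobounded2)
  then show "\<delta> < n" "n - \<theta>1 < n - \<delta>" using theta by auto
  have "\<delta> <= m1 / (2 * p)" unfolding \<delta>_def by (rule min.cobounded1)
  then show "\<delta> * p <= m1 / 2" using p by (simp add: field_simps)
 qed
 define m3 where "m3 = min (m1 / 2) q2"
 have m3: "0 < m3" "m3 <= m1 - p * \<delta>" "m3 <= q2" using m1 q2 \<delta> by (auto simp: m3_def mult.commute)
 have dn: "0 < \<delta> * (n - \<delta>)" using \<delta> by simp
 define s1 where "s1 = (\<delta> * (n - \<delta>) / (4 * k1)) powr (1 / (p - 1))"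
 have s1: "0 < s1" using dn k1 \<delta>(1,2) by (simp add: s1_def)
 have s1p: "2 * k1 * s1 powr (p - 1) = \<delta> * (n - \<delta>) / 2" using dn k1 p \<delta>(1,2) by (simp add: s1_def powr_powr)
 show ?thesis
 proof (rule that[OF s1])
  fix B yl :: real
  assume B: "0 <= B" and yl: "0 < yl"
  obtain C T' where C: "!!t. T' <= t ==> \<phi> t <= C * exp (- (n + q2) * t)" using \<phi>_top by blast
  have "((%t. B * (exp (n * t) * \<phi> t)) \<longlongrightarrow> B * 0) at_top" by (intro tendsto_intros phi_top_limit) simp
  then have "((%t. B * (exp (n * t) * \<phi> t)) \<longlongrightarrow> 0) at_top" by simp
  then have "\<forall>\<^sub>F t in at_top. B * (exp (n * t) * \<phi> t) < \<delta> * (n - \<delta>) / 2 * yl" using dn yl by (intro order_tendstoD) auto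
  then have "\<forall>\<^sub>F t in at_top. B * (exp (n * t) * \<phi> t) < \<delta> * (n - \<delta>) / 2 * yl &
    \<kappa> t * exp (- l * t) <= 2 * k1 & T' <= t & 0 <= t"
   using kappa_eventually_top eventually_ge_at_top[of T'] eventually_ge_at_top[of 0] by eventually_elim auto
  then obtain T1 where T: "!!t. T1 <= t ==> B * (exp (n * t) * \<phi> t) < \<delta> * (n - \<delta>) / 2 * yl &
    \<kappa> t * exp (- l * t) <= 2 * k1 & T' <= t & 0 <= t" by (auto simp: eventually_at_top_linorder)
  have kb: "\<kappa> t <= 2 * k1 * exp (l * t)" if "T1 <= t" for t
  proof -
   have "exp (l * t) * (\<kappa> t * exp (- l * t)) <= exp (l * t) * (2 * k1)" using T[OF that] by (intro mult_left_mono) auto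
   then show ?thesis unfolding exp_mult_neg_cancel by (simp only: mult.commute)
  qed
  define C' where "C' = B * max 0 C"
  define D1 where "D1 = 2 * k1 / (m3 * (n + m3))"
  define D2 where "D2 = C' / (m3 * (n + m3))"
  show "\<exists>T1 D1 D2. 0 <= D1 & 0 <= D2 & (\<forall>\<mu> U V R t. T1 <= R --> R <= t --> \<mu> <= B --> descending \<mu> U V
   --> (\<forall>t. 0 < U t) --> yl <= exp (n * R) * U R --> (\<forall>t\<ge>R. exp (\<theta>1 * t) * U t <= s1)
   --> exp (n * t) * U t <= exp (n * R) * U R + D1 * (exp (n * R) * U R) powr p + D2)"
  proof (intro exI conjI allI impI)
   show "0 <= D1" "0 <= D2" using k1 m3 n B by (auto simp: D1_def D2_def C'_def)
   fix \<mu> U V R t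
   assume R: "T1 <= R" and t: "R <= t" and \<mu>B: "\<mu> <= B" and D: "descending \<mu> U V" and U: "\<forall>t. 0 < U t"
    and y: "yl <= exp (n * R) * U R" and small: "\<forall>t\<ge>R. exp (\<theta>1 * t) * U t <= s1"
   have S: "solves \<mu> U V" and \<mu>: "0 <= \<mu>" using D by (auto simp: descending_def)
   have Up: "0 < U t" for t using U by blast
   define v where "v s = exp (- n * s) * U (- s)" for s
   define v1 where "v1 s = - (exp (- n * s) * (n * U (- s) + V (- s)))" for s
   define Q where "Q s = exp (- n * s) * force \<mu> U (- s)" for s
   have du: "(uminus has_real_derivative - 1) (at s)" for s :: real by (auto intro!: derivative_eq_intros)
   have dU: "((%s. U (- s)) has_real_derivative - V (- s)) (at s)" for s
    using DERIV_chain2[where f = U and g = uminus, OF solvesD(1)[OF S] du[of s]] by simp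
   have dV: "((%s. V (- s)) has_real_derivative n * V (- s) + force \<mu> U (- s)) (at s)" for s
    using DERIV_chain2[where f = V and g = uminus, OF solvesD(2)[OF S] du[of s]] by (simp add: add.commute)
   have dv: "(v has_real_derivative v1 s) (at s)" for s
    unfolding v_def v1_def using dU[of s] by (auto intro!: derivative_eq_intros simp: algebra_simps)
   have dv1: "(v1 has_real_derivative - n * v1 s - Q s) (at s)" for s
    unfolding v1_def Q_def using dU[of s] dV[of s] by (auto intro!: derivative_eq_intros simp: algebra_simps)
   have ymono: "exp (n * R) * U R <= exp (n * r) * U r" if "R <= r" for r
   proof (rule DERIV_nonneg_imp_nondecreasing[where f = "%r. exp (n * r) * U r" and a = R and b = r, OF that])
    fix x
    have "((%r. exp (n * r) * U r) has_real_derivative exp (n * x) * (n * U x + V x)) (at x)"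
     using solvesD(1)[OF S, of x] by (auto intro!: derivative_eq_intros simp: algebra_simps)
    moreover have "0 <= exp (n * x) * (n * U x + V x)" using cone[OF D Up, of x] by simp
    ultimately show "\<exists>y. ((%r. exp (n * r) * U r) has_real_derivative y) (at x) & 0 <= y" by blast
   qed
   have "v (- t) <= v (- R) + (2 * k1 * v (- R) powr p + C') / (m3 * (n + m3))"
   proof (rule regular_end[OF \<delta>(1,2) m3(1,2) _ _ _ _ dv dv1 _ _ _ _ _ \<delta>(3)])
    show "- R <= 0" using T[OF R] by simp
    show "0 <= 2 * k1" "0 <= C'" "0 <= p" using k1 B p by (auto simp: C'_def)
    show "- t <= - R" using t by simp
    fix s assume s: "s <= - R"
    define r where "r = - s"
    have r: "R <= r" "s = - r" using s by (auto simp: r_def)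
    have rT: "T1 <= r" using r R by simp
    show "0 < v s" using Up by (simp add: v_def)
    show "v1 s <= 0" using cone[OF D Up, of "- s"] by (simp add: v1_def)
    show "exp ((n - \<theta>1) * s) * v s <= s1"
    proof -
     have "exp ((n - \<theta>1) * s) * exp (- n * s) = exp (\<theta>1 * r)" by (simp add: r(2) exp_add[symmetric] algebra_simps)
     then have "exp ((n - \<theta>1) * s) * v s = exp (\<theta>1 * r) * U r" unfolding v_def by (simp only: mult.assoc[symmetric]) (simp add: r(2))
     then show ?thesis using small r by simp
    qed
    have vr: "v s = exp (n * r) * U r" by (simp add: v_def r(2))
    have f: "Q s = exp (n * r) * (\<kappa> r * U r powr p + \<mu> * \<phi> r)" using Up[of r] by (simp add: Q_def force_def r(2))
    have "U r powr p = U r * U r powr (p - 1)" using Up[of r] by (simp add: powr_mult_base)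
    moreover have "\<kappa> r * U r powr (p - 1) <= \<delta> * (n - \<delta>) / 2"
    proof -
     have "exp (l * r) * U r powr (p - 1) = (exp (\<theta>1 * r) * U r) powr (p - 1)" by (rule exp_powr_scale[OF Up theta(6), symmetric])
     also have "... <= s1 powr (p - 1)" using small r Up[of r] p by (intro powr_mono2) auto
     finally have "2 * k1 * (exp (l * r) * U r powr (p - 1)) <= 2 * k1 * s1 powr (p - 1)" using k1 by simp
     moreover have "\<kappa> r * U r powr (p - 1) <= 2 * k1 * exp (l * r) * U r powr (p - 1)" using kb[OF rT] by (intro mult_right_mono) auto
     ultimately show ?thesis using s1p by (simp add: mult.assoc)
    qed
    then have "\<kappa> r * U r powr (p - 1) * v s <= \<delta> * (n - \<delta>) / 2 * v s" using Up[of r] vr by (intro mult_right_mono) auto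
    moreover have "\<mu> * (exp (n * r) * \<phi> r) <= \<delta> * (n - \<delta>) / 2 * v s"
    proof -
     have "\<mu> * (exp (n * r) * \<phi> r) <= B * (exp (n * r) * \<phi> r)" using \<mu>B \<phi>_nonneg[of r] by (intro mult_right_mono) auto
     moreover have "\<delta> * (n - \<delta>) / 2 * yl <= \<delta> * (n - \<delta>) / 2 * v s"
      using ymono[OF r(1)] y dn vr by (intro mult_left_mono) auto
     ultimately show ?thesis using T[OF rT] by linarith
    qed
    ultimately show "Q s <= \<delta> * (n - \<delta>) * v s" unfolding f vr by (simp add: algebra_simps)
    show "Q s <= 2 * k1 * exp (m1 * s) * v s powr p + C' * exp (m3 * s)"
    proof -
     have "exp (n * r) * (\<kappa> r * U r powr p) <= exp (n * r) * (2 * k1 * exp (l * r) * U r powr p)"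
      using kb[OF rT] by (intro mult_left_mono mult_right_mono) auto
     also have "... = 2 * k1 * exp (m1 * s) * v s powr p"
     proof -
      have "(exp (n * r) * U r) powr p = exp (n * p * r) * U r powr p" by (rule exp_powr_scale[OF Up refl])
      moreover have "m1 * s + n * p * r = n * r + l * r" by (simp add: m1_def r(2) algebra_simps)
      then have "exp (m1 * s) * exp (n * p * r) = exp (n * r) * exp (l * r)" by (simp only: exp_add[symmetric])
      ultimately have "exp (m1 * s) * v s powr p = exp (n * r) * exp (l * r) * U r powr p" unfolding vr by (simp only: mult.assoc[symmetric])
      then show ?thesis by (simp add: mult.assoc mult.left_commute)
     qed
     finally have a: "exp (n * r) * (\<kappa> r * U r powr p) <= 2 * k1 * exp (m1 * s) * v s powr p" .
     have "exp (n * r) * \<phi> r <= max 0 C * exp (m3 * s)"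
     proof -
      have "exp (n * r) * \<phi> r <= exp (n * r) * (max 0 C * exp (- (n + q2) * r))"
      proof (rule mult_left_mono)
       have "\<phi> r <= C * exp (- (n + q2) * r)" using C T[OF rT] by blast
       also have "... <= max 0 C * exp (- (n + q2) * r)" by (intro mult_right_mono) auto
       finally show "\<phi> r <= max 0 C * exp (- (n + q2) * r)" .
      qed simp
      also have "... = max 0 C * exp (- q2 * r)"
      proof -
       have "n * r + - (n + q2) * r = - q2 * r" by (simp add: algebra_simps)
       then have "exp (n * r) * exp (- (n + q2) * r) = exp (- q2 * r)" by (simp only: exp_add[symmetric])
       then show ?thesis by (simp only: mult.left_commute)
      qed
      also have "... <= max 0 C * exp (m3 * s)" using T[OF rT] m3 by (intro mult_left_mono) (auto simp: r(2) intro: mult_right_mono)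
      finally show ?thesis .
     qed
     then have "\<mu> * (exp (n * r) * \<phi> r) <= B * (max 0 C * exp (m3 * s))"
      by (rule mult_mono[OF \<mu>B _ B]) (use \<phi>_nonneg[of r] in simp)
     then show ?thesis using a unfolding f by (simp add: C'_def algebra_simps)
    qed
   qed
   then show "exp (n * t) * U t <= exp (n * R) * U R + D1 * (exp (n * R) * U R) powr p + D2"
    by (simp add: v_def D1_def D2_def add_divide_distrib)
  qed
 qed
qed

text \<open>In a compact strip away from 0 the energy obeys a differential inequality with damping
  \<open>c3\<close> and an error tending to 0. Being bounded at -\<infinity>, it is as close to the
  bottom of the well as the error is small.\<close>

lemma strip_limit:
 assumes S: "solves \<mu> U V" and \<mu>: "0 <= \<mu>" and wl: "0 < wl"
  and W0: "!!t. t <= Ts ==> 0 < U t & wl <= exp (\<theta> * t) * U t & exp (\<theta> * t) * U t <= Cw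
   & \<bar>exp (\<theta> * t) * (V t + \<theta> * U t)\<bar> <= M1"
 shows "((%t. exp (\<theta> * t) * U t) \<longlongrightarrow> Aeq \<theta> k0) at_bot"
proof -
 define W where "W t = exp (\<theta> * t) * U t" for t
 define W1 where "W1 t = exp (\<theta> * t) * (V t + \<theta> * U t)" for t
 define A where "A = Aeq \<theta> k0"
 have A0: "0 < A" unfolding A_def by (rule Aeq(1)[OF theta(1,2) k0])
 have WW: "0 < U t" "wl <= W t" "W t <= Cw" "\<bar>W1 t\<bar> <= M1" if "t <= Ts" for t using W0[OF that] by (auto simp: W_def W1_def)
 have Cw: "0 <= Cw" "0 <= M1" using WW[of Ts] wl by auto
 obtain \<sigma> \<eta> w0 \<gamma> c3 C3 c4 where \<sigma>s: "\<sigma> < wl" and tr: "trapping \<theta> k0 Cw \<sigma> \<eta> w0 \<gamma> c3 C3 c4"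
  using trapping_exists[OF theta(1,2) k0 wl] by blast
 have c: "0 < c3" "0 <= C3" "0 < c4" "w0 <= \<sigma>" "0 < w0" using tr by (auto simp: trapping_def)
 have ex: "\<exists>T\<le>Ts. \<forall>t\<le>T. \<bar>err \<theta> m k0 \<mu> t (W t)\<bar> <= \<epsilon>" if "0 < \<epsilon>" for \<epsilon>
 proof -
  have "\<forall>\<^sub>F t in at_bot. (\<forall>\<mu>' w. 0 <= \<mu>' & \<mu>' <= \<mu> & 0 <= w & w <= Cw --> \<bar>err \<theta> m k0 \<mu>' t w\<bar> <= \<epsilon>) & t <= Ts"
   using err_small[OF \<kappa>_bot phi_bot_limit Cw(1) \<mu> that, of \<theta>] theta(1) eventually_le_at_bot[of Ts]
   by (auto intro: eventually_conj)
  then obtain T where T: "!!t. t <= T ==> (\<forall>\<mu>' w. 0 <= \<mu>' & \<mu>' <= \<mu> & 0 <= w & w <= Cw --> \<bar>err \<theta> m k0 \<mu>' t w\<bar> <= \<epsilon>) & t <= Ts"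
   by (auto simp: eventually_at_bot_linorder)
  show ?thesis
  proof (intro exI[of _ T] conjI allI impI)
   show "T <= Ts" using T by blast
   fix t assume t: "t <= T"
   then have "t <= Ts" using T by blast
   then show "\<bar>err \<theta> m k0 \<mu> t (W t)\<bar> <= \<epsilon>" using T[OF t] WW[of t] wl \<mu> by (auto simp: less_imp_le)
  qed
 qed
 show ?thesis unfolding W_def[symmetric] A_def[symmetric]
 proof (rule tendstoI)
  fix e :: real assume e: "0 < e"
  \<comment> \<open>Chosen so that the residual energy C3 \<epsilon>^2 / c3 stays below c4 e^2, the
    least energy at distance e from the equilibrium; C3 + 1 covers the case C3 = 0.\<close>
  define \<epsilon> where "\<epsilon> = sqrt (c3 * c4 * e^2 / (4 * (C3 + 1)))"
  have \<epsilon>: "0 < \<epsilon>" using c e by (simp add: \<epsilon>_def)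
  have \<epsilon>2: "C3 * \<epsilon>^2 / c3 < c4 * e^2"
  proof -
   have "C3 * \<epsilon>^2 = C3 / (C3 + 1) * (c3 * c4 * e^2 / 4)" using c e by (simp add: \<epsilon>_def)
   also have "... <= 1 * (c3 * c4 * e^2 / 4)" using c e by (intro mult_right_mono) auto
   also have "... < c3 * (c4 * e^2)" using c e by simp
   finally show ?thesis using c by (simp add: field_simps)
  qed
  obtain T where T: "T <= Ts" "!!t. t <= T ==> \<bar>err \<theta> m k0 \<mu> t (W t)\<bar> <= \<epsilon>" using ex[OF \<epsilon>] by blast
  have b: "dist (W t) A < e" if t: "t <= T" for t
  proof -
   define M where "M = M1^2 / 2 + k0 * Cw powr (p + 1) / (p + 1) + \<bar>\<gamma>\<bar> * (Cw + A) * M1 - bottom \<theta> k0"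
   have "energy \<theta> k0 \<gamma> U V t - bottom \<theta> k0 <= C3 * \<epsilon>^2 / c3"
   proof (rule backward_gronwall[where y = "%t. energy \<theta> k0 \<gamma> U V t - bottom \<theta> k0", OF c(1) _ _ _ t])
    fix s assume s: "s <= T"
    have sT: "s <= Ts" using s T by simp
    show "((%t. energy \<theta> k0 \<gamma> U V t - bottom \<theta> k0) has_real_derivative
     lyap' (n - 2 * \<theta>) (\<theta> * (n - \<theta>)) k0 p (Aeq \<theta> k0) \<gamma> (W s) (W1 s) (err \<theta> m k0 \<mu> s (W s))) (at s)"
     using energy_derivative[OF S WW(1)[OF sT] theta(3), where k = k0 and \<gamma> = \<gamma>] unfolding W_def W1_def
     by (auto intro!: derivative_eq_intros)
    have w: "w0 <= W s" "W s <= Cw" "\<bar>err \<theta> m k0 \<mu> s (W s)\<bar> <= \<epsilon>"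
     using WW[OF sT] T(2)[OF s] \<sigma>s c by auto
    then show "lyap' (n - 2 * \<theta>) (\<theta> * (n - \<theta>)) k0 p (Aeq \<theta> k0) \<gamma> (W s) (W1 s) (err \<theta> m k0 \<mu> s (W s))
      <= - c3 * (energy \<theta> k0 \<gamma> U V s - bottom \<theta> k0) + C3 * \<epsilon>^2"
     using tr unfolding trapping_def energy_def W_def W1_def by blast
    show "energy \<theta> k0 \<gamma> U V s - bottom \<theta> k0 <= M"
    proof -
     have W1c: "\<bar>W1 s\<bar> <= M1" by (rule WW(4)[OF sT])
     have "(W1 s)^2 <= M1^2" using W1c by (metis abs_ge_zero power2_abs power_mono)
     moreover have "k0 * W s powr (p + 1) / (p + 1) <= k0 * Cw powr (p + 1) / (p + 1)"
      using w c p k0 by (intro divide_right_mono mult_left_mono powr_mono2) auto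
     moreover have "0 <= \<theta> * (n - \<theta>) * (W s)^2 / 2" using theta n by simp
     moreover have "\<gamma> * (W s - A) * W1 s <= \<bar>\<gamma>\<bar> * (Cw + A) * M1"
     proof -
      have "\<gamma> * (W s - A) * W1 s <= \<bar>\<gamma> * (W s - A) * W1 s\<bar>" by simp
      also have "... = \<bar>\<gamma>\<bar> * \<bar>W s - A\<bar> * \<bar>W1 s\<bar>" by (simp add: abs_mult)
      also have "... <= \<bar>\<gamma>\<bar> * (Cw + A) * M1" using W1c w c A0 Cw n by (intro mult_mono) auto
      finally show ?thesis .
     qed
     ultimately show ?thesis by (simp add: energy_def lyap_def well_def M_def W_def[symmetric] W1_def[symmetric] A_def[symmetric])
    qed
   qed
   moreover have "c4 * (W t - A)^2 <= energy \<theta> k0 \<gamma> U V t - bottom \<theta> k0"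
    using tr WW(2,3)[of t] \<sigma>s c t T(1) unfolding trapping_def energy_def W_def A_def by auto
   ultimately have "c4 * (W t - A)^2 < c4 * e^2" using \<epsilon>2 by simp
   then have "(W t - A)^2 < e^2" using c by simp
   then show ?thesis using e power2_less_imp_less[of "\<bar>W t - A\<bar>" e] by (simp add: dist_real_def)
  qed
  then show "\<forall>\<^sub>F t in at_bot. dist (W t) A < e" by (auto simp: eventually_at_bot_linorder)
 qed
qed

text \<open>Either the scaled solution stays above \<sigma> near -\<infinity>, or it is at most
  \<sigma> arbitrarily early. As it also exceeds \<open>s1\<close> arbitrarily early, in the second
  case it has crossed \<sigma> upwards before any given early time and is above \<open>w0\<close> at
  that time. Both cases lead to \<open>strip_limit\<close>.\<close>

lemma singular_limit_bot:
 assumes sg: "singular \<mu> U V"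
 shows "((%t. exp (\<theta> * t) * U t) \<longlongrightarrow> Aeq \<theta> k0) at_bot"
proof -
 have S: "solves \<mu> U V" and \<mu>: "0 <= \<mu>" and U: "!!t. 0 < U t" using sg by (auto simp: singular_def)
 have D: "descending \<mu> U V" by (rule singular_descending[OF sg])
 then have Vn: "!!t. V t < 0" by (simp add: descending_def)
 define W where "W t = exp (\<theta> * t) * U t" for t
 define W1 where "W1 t = exp (\<theta> * t) * (V t + \<theta> * U t)" for t
 have Wp: "0 < W t" for t using U[of t] by (simp add: W_def)
 define Cw where "Cw = Wmax m k0"
 obtain s1 where s1: "0 < s1" "!!T. \<exists>t\<le>T. s1 < W t" using not_small_bot sg unfolding W_def by metis
 obtain \<sigma> \<eta> w0 \<gamma> c3 C3 c4 where \<sigma>s: "\<sigma> < s1" and tr: "trapping \<theta> k0 Cw \<sigma> \<eta> w0 \<gamma> c3 C3 c4"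
  using trapping_exists[OF theta(1,2) k0 s1(1)] by blast
 have c: "0 < c3" "0 <= C3" "0 < c4" "bottom \<theta> k0 < - \<eta>" "w0 <= \<sigma>" "0 < w0" using tr by (auto simp: trapping_def)
 define \<epsilon>1 where "\<epsilon>1 = sqrt (c3 * (- \<eta> - bottom \<theta> k0) / (C3 + 1))"
 have q: "0 < c3 * (- \<eta> - bottom \<theta> k0)" using c by simp
 have \<epsilon>1: "0 < \<epsilon>1" "C3 * \<epsilon>1^2 < c3 * (- \<eta> - bottom \<theta> k0)"
  using q c by (auto simp: \<epsilon>1_def field_simps)
 have "\<forall>\<^sub>F t in at_bot. k0 / 2 <= \<kappa> t * exp (- m * t)" using kappa_eventually_bot by eventually_elim auto
 then obtain T' where T': "!!t. t <= T' ==> k0 / 2 <= \<kappa> t * exp (- m * t)" by (auto simp: eventually_at_bot_linorder)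
 have WC: "W t <= Cw" if "t <= T'" for t unfolding W_def Cw_def by (rule W_bound[OF D U k0 m theta(3)]) (use T' that in auto)
 have Cw: "0 <= Cw" using WC[of T'] Wp[of T'] by simp
 have ex: "\<exists>T\<le>T'. \<forall>t\<le>T. \<bar>err \<theta> m k0 \<mu> t (W t)\<bar> <= \<epsilon>" if "0 < \<epsilon>" for \<epsilon>
 proof -
  have "\<forall>\<^sub>F t in at_bot. (\<forall>\<mu>' w. 0 <= \<mu>' & \<mu>' <= \<mu> & 0 <= w & w <= Cw --> \<bar>err \<theta> m k0 \<mu>' t w\<bar> <= \<epsilon>) & t <= T'"
   using err_small[OF \<kappa>_bot phi_bot_limit Cw \<mu> that, of \<theta>] theta(1) eventually_le_at_bot[of T'] by (auto intro: eventually_conj)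
  then obtain T where "!!t. t <= T ==> (\<forall>\<mu>' w. 0 <= \<mu>' & \<mu>' <= \<mu> & 0 <= w & w <= Cw --> \<bar>err \<theta> m k0 \<mu>' t w\<bar> <= \<epsilon>) & t <= T'"
   by (auto simp: eventually_at_bot_linorder)
  then show ?thesis using WC Wp \<mu> by (intro exI[of _ T]) (auto simp: less_imp_le)
 qed
 obtain T1 where T1: "T1 <= T'" "!!t. t <= T1 ==> \<bar>err \<theta> m k0 \<mu> t (W t)\<bar> <= \<epsilon>1" using ex[OF \<epsilon>1(1)] by blast
 have "\<exists>T2\<le>T1. \<forall>t\<le>T2. w0 <= W t"
 proof (cases "\<exists>T\<le>T1. \<forall>t\<le>T. \<sigma> < W t")
  case True
  then show ?thesis using c by force
 next
  case False
  have "w0 <= W t" if t: "t <= T1" for t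
  proof -
   obtain r1 where r1: "r1 <= t" "s1 < W r1" using s1(2) by blast
   obtain r0 where r0: "r0 <= r1" "W r0 <= \<sigma>" using False r1 t by (meson not_le order_trans)
   show ?thesis unfolding W_def by (rule rise_traps(2)[OF tr D theta(3) U _ _ \<epsilon>1(2), where a = r0 and b = r1])
     (use r0 r1 \<sigma>s t T1 WC in \<open>auto simp: W_def\<close>)
  qed
  then show ?thesis by blast
 qed
 then obtain T2 where T2: "T2 <= T1" "!!t. t <= T2 ==> w0 <= W t" by blast
 have W1b: "\<bar>W1 t\<bar> <= n * W t" for t
 proof -
  have "0 <= exp (\<theta> * t) * (n * U t + V t)" using cone[OF D U, of t] by simp
  moreover have "exp (\<theta> * t) * V t <= 0" using Vn[of t] by (simp add: mult_nonneg_nonpos)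
  moreover have "W1 t = exp (\<theta> * t) * V t + \<theta> * W t" "exp (\<theta> * t) * (n * U t + V t) = n * W t + exp (\<theta> * t) * V t"
   by (auto simp: W1_def W_def algebra_simps)
  moreover have "\<theta> * W t <= n * W t" "0 <= \<theta> * W t" using theta n Wp[of t] by (auto intro!: mult_right_mono)
  ultimately show ?thesis by linarith
 qed
 show ?thesis
 proof (rule strip_limit[OF S \<mu> c(6), where Cw = Cw and Ts = T2])
  fix t assume t: "t <= T2"
  then have tT: "t <= T'" using T1 T2 by simp
  have "\<bar>W1 t\<bar> <= n * Cw" using W1b[of t] mult_left_mono[OF WC[OF tT] less_imp_le[OF n]] by linarith
  then show "0 < U t & w0 <= exp (\<theta> * t) * U t & exp (\<theta> * t) * U t <= Cw & \<bar>exp (\<theta> * t) * (V t + \<theta> * U t)\<bar> <= n * Cw"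
   using U[of t] T2(2)[OF t] WC[OF tT] by (simp add: W_def W1_def)
 qed
qed

end

section \<open>The singular branch\<close>

text \<open>For positive a and c both roots lie in the right half-plane, whether they are real or
  conjugate.\<close>

lemma characteristic_roots:
 fixes a c :: real
 assumes "0 < a" "0 < c"
 obtains l1 l2 :: complex and e :: real where "l1 + l2 = of_real a" "l1 * l2 = of_real c" "0 < e" "e <= Re l1" "e <= Re l2"
proof -
 define q where "q = a^2 / 4 - c"
 define r where "r = csqrt (of_real q)"
 have r2: "r^2 = of_real q" by (simp add: r_def)
 have Rr: "0 <= Re r" "Re r < a / 2"
 proof -
  show "0 <= Re r" by (simp add: r_def Re_csqrt)
  show "Re r < a / 2"
  proof (cases "0 <= q")
   case True
   have "q < (a / 2)^2" using assms by (simp add: q_def power_divide)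
   then have "sqrt q < a / 2" using assms by (intro real_less_lsqrt) auto
   then show ?thesis using True by (simp add: r_def csqrt_of_real_nonneg)
  next
   case False
   then show ?thesis using assms by (simp add: r_def csqrt_of_real_nonpos)
  qed
 qed
 show ?thesis
 proof (rule that[of "of_real (a / 2) + r" "of_real (a / 2) - r" "a / 2 - Re r"])
  have "(of_real (a / 2) + r) * (of_real (a / 2) - r) = (of_real (a / 2))^2 - r^2" by (simp add: power2_eq_square algebra_simps)
  also have "... = of_real ((a / 2)^2 - q)" by (simp only: r2 of_real_power of_real_diff)
  also have "(a / 2)^2 - q = c" by (simp add: q_def power_divide)
  finally show "(of_real (a / 2) + r) * (of_real (a / 2) - r) = of_real c" .
 qed (use Rr in auto)
qed

lemma complex_powr_has_derivative:
 assumes "0 < Re z"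
 shows "((%z. z powr of_real p) has_field_derivative of_real p * z powr (of_real p - 1)) (at z)"
proof -
 have "z \<notin> \<real>\<^sub>\<le>\<^sub>0" using assms complex_nonpos_Reals_iff by fastforce
 then show ?thesis by (rule has_field_derivative_powr)
qed

lemma norm_complex_powr: "norm ((z::complex) powr (of_real p - 1)) = norm z powr (p - 1)" using norm_powr_real_powr'[of "of_real (p - 1)" z] by simp

lemma complex_powr_lipschitz:
 assumes p: "1 <= p" and x: "0 < Re x" "norm x <= M" and y: "0 < Re y" "norm y <= M"
 shows "norm (x powr of_real p - y powr of_real p) <= p * M powr (p - 1) * norm (x - y)"
proof (rule field_differentiable_bound[where S = "{z. 0 < Re z} \<inter> cball 0 M"])
 show "convex ({z. 0 < Re z} \<inter> cball 0 M)" by (intro convex_Int convex_cball convex_halfspace_Re_gt)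
 fix z assume z: "z \<in> {z. 0 < Re z} \<inter> cball 0 M"
 then show "((%z. z powr of_real p) has_field_derivative of_real p * z powr (of_real p - 1)) (at z within {z. 0 < Re z} \<inter> cball 0 M)"
  by (intro has_field_derivative_at_within[OF complex_powr_has_derivative]) auto
 have "norm z powr (p - 1) <= M powr (p - 1)" using z p by (intro powr_mono2) auto
 then show "norm (of_real p * z powr (of_real p - 1)) <= p * M powr (p - 1)" using p by (simp add: norm_mult norm_complex_powr mult_left_mono)
qed (use x y in auto)

lemma real_powr_lipschitz:
 assumes p: "1 < p" and x: "0 <= x" "x <= M" and y: "0 <= y" "y <= (M::real)"
 shows "\<bar>x powr p - y powr p\<bar> <= p * M powr (p - 1) * \<bar>x - y\<bar>"
proof -
 have *: "\<bar>v powr p - u powr p\<bar> <= p * M powr (p - 1) * \<bar>v - u\<bar>" if u: "0 <= u" "u < v" "v <= M" for u v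
 proof -
  have der: "((%x. x powr p) has_real_derivative p * x powr (p - 1)) (at x)" if "u < x" "x < v" for x
   using that u by (intro has_real_derivative_powr) auto
  have "\<exists>l z. u < z & z < v & ((%x. x powr p) has_real_derivative l) (at z) & v powr p - u powr p = (v - u) * l"
  proof (rule MVT[OF u(2)])
   show "continuous_on {u..v} (%x. x powr p)" using u p by (intro continuous_on_powr' continuous_intros) auto
   show "(%x. x powr p) differentiable (at x)" if "u < x" "x < v" for x using der[OF that] real_differentiable_def by blast
  qed
  then obtain l' z where z: "u < z" "z < v" "((%x. x powr p) has_real_derivative l') (at z)" "v powr p - u powr p = (v - u) * l'" by blast
  have "l' = p * z powr (p - 1)" using DERIV_unique[OF z(3) der[OF z(1,2)]] .
  moreover have "z powr (p - 1) <= M powr (p - 1)" using z u p by (intro powr_mono2) auto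
  ultimately show ?thesis using z(4) u p by (simp add: abs_mult mult.commute mult_left_mono)
 qed
 show ?thesis using *[of x y] *[of y x] x y by (cases x y rule: linorder_cases) (auto simp: abs_minus_commute)
qed

text \<open>The derivative of k z^p - p k0 A^(p-1) z is continuous in (k, z) and vanishes at k = k0,
  z = A; the mean value inequality on a small disc makes the remainder after linearisation as
  Lipschitz-small as desired.\<close>

lemma complex_small_lipschitz:
 fixes A p k0 \<epsilon> :: real
 assumes p: "1 < p" and A: "0 < A" and k0: "0 < k0" and \<epsilon>: "0 < \<epsilon>"
 obtains \<delta> where "0 < \<delta>" "\<delta> <= A / 2"
  "!!k (x::complex) y. \<bar>k - k0\<bar> <= \<delta> ==> norm (x - of_real A) <= \<delta> ==> norm (y - of_real A) <= \<delta> ==>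
   norm (of_real k * (x powr of_real p - y powr of_real p) - of_real (p * (k0 * A powr (p - 1))) * (x - y)) <= \<epsilon> * norm (x - y)"
proof -
 define L where "L = A powr (p - 1)"
 have L: "0 < L" using A by (simp add: L_def)
 define \<epsilon>' where "\<epsilon>' = \<epsilon> / (2 * p * k0)"
 have \<epsilon>': "0 < \<epsilon>'" using \<epsilon> p k0 by (simp add: \<epsilon>'_def)
 have "isCont (%z::complex. z powr of_real (p - 1)) (of_real A)" by (rule DERIV_isCont[OF complex_powr_has_derivative]) (use A in simp)
 from this[unfolded continuous_at_eps_delta, rule_format, OF \<epsilon>']
 obtain d where d0: "0 < d" "\<forall>z. dist z (complex_of_real A) < d --> dist (z powr of_real (p - 1)) (of_real A powr of_real (p - 1)) < \<epsilon>'"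
  by (elim exE conjE)
 have d: "0 < d" "!!z. dist z (of_real A) < d ==> dist (z powr (complex_of_real p - 1)) (of_real A powr (of_real p - 1)) < \<epsilon>'"
  using d0 unfolding of_real_diff of_real_1 by blast+
 have AL: "(of_real A :: complex) powr (of_real p - 1) = of_real L" using A powr_of_real[of A "p - 1"] by (simp add: L_def)
 define \<delta> where "\<delta> = min (min (A / 2) (d / 2)) (\<epsilon> / (2 * p * (L + \<epsilon>')))"
 have \<delta>: "0 < \<delta>" using A d \<epsilon> p L \<epsilon>' by (simp add: \<delta>_def)
 have \<delta>1: "\<delta> <= A / 2" "\<delta> <= d / 2" "\<delta> <= \<epsilon> / (2 * p * (L + \<epsilon>'))"
  unfolding \<delta>_def by (rule min.coboundedI1, simp, rule min.coboundedI1, simp, rule min.cobounded2)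
 show ?thesis
 proof (rule that[OF \<delta> \<delta>1(1)])
  fix k :: real and x y :: complex
  assume k: "\<bar>k - k0\<bar> <= \<delta>" and x: "norm (x - of_real A) <= \<delta>" and y: "norm (y - of_real A) <= \<delta>"
  define F where "F z = of_real k * z powr of_real p - of_real (p * (k0 * L)) * z" for z :: complex
  have "norm (F x - F y) <= \<epsilon> * norm (x - y)"
  proof (rule field_differentiable_bound[where S = "cball (of_real A) \<delta>"])
   fix z :: complex assume z: "z \<in> cball (of_real A) \<delta>"
   have "\<bar>Re z - A\<bar> <= \<delta>" using z abs_Re_le_cmod[of "z - of_real A"] by (simp add: dist_norm norm_minus_commute)
   then have Rz: "0 < Re z" using \<delta>1 A by linarith
   show "(F has_field_derivative of_real k * (of_real p * z powr (of_real p - 1)) - of_real (p * (k0 * L)) * 1) (at z within cball (of_real A) \<delta>)"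
    unfolding F_def by (intro DERIV_diff DERIV_cmult DERIV_ident has_field_derivative_at_within[OF complex_powr_has_derivative[OF Rz]])
   have zL: "norm (z powr (of_real p - 1) - of_real L) <= \<epsilon>'"
   proof -
    have "dist z (of_real A) < d" using z \<delta>1 d by (simp add: dist_commute)
    from d(2)[OF this] show ?thesis by (simp add: AL dist_norm less_imp_le)
   qed
   have nz: "norm (z powr (of_real p - 1)) <= L + \<epsilon>'" using zL norm_triangle_sub[of "z powr (of_real p - 1)" "of_real L"] L by simp
   have "of_real k * (of_real p * z powr (of_real p - 1)) - of_real (p * (k0 * L)) * 1
    = of_real p * (of_real (k - k0) * z powr (of_real p - 1) + of_real k0 * (z powr (of_real p - 1) - of_real L))" by (simp add: algebra_simps)
   also have "norm ... <= p * (\<bar>k - k0\<bar> * norm (z powr (of_real p - 1)) + k0 * norm (z powr (of_real p - 1) - of_real L))"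
   proof -
    have "norm (of_real (k - k0) * z powr (of_real p - 1) + of_real k0 * (z powr (of_real p - 1) - of_real L))
     <= \<bar>k - k0\<bar> * norm (z powr (of_real p - 1)) + k0 * norm (z powr (of_real p - 1) - of_real L)"
     by (rule order_trans[OF norm_triangle_ineq]) (use k0 in \<open>simp only: norm_mult norm_of_real abs_of_pos order_refl\<close>)
    then show ?thesis using p by (simp only: norm_mult norm_of_real) (simp add: mult_left_mono)
   qed
   also have "... <= p * (\<epsilon> / (2 * p * (L + \<epsilon>')) * (L + \<epsilon>') + k0 * \<epsilon>')"
    using p k0 k \<delta>1(3) nz zL L \<epsilon>' by (intro mult_left_mono add_mono mult_mono) auto
   also have "... = \<epsilon>"
   proof -
    have "L + \<epsilon>' \<noteq> 0" using L \<epsilon>' by simp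
    then have "\<epsilon> / (2 * p * (L + \<epsilon>')) * (L + \<epsilon>') = \<epsilon> / (2 * p)" by simp
    moreover have "k0 * \<epsilon>' = \<epsilon> / (2 * p)" using k0 by (simp add: \<epsilon>'_def)
    ultimately show ?thesis using p by simp
   qed
   finally show "norm (of_real k * (of_real p * z powr (of_real p - 1)) - of_real (p * (k0 * L)) * 1) <= \<epsilon>" .
  qed (use x y in \<open>auto simp: dist_norm norm_minus_commute\<close>)
  then show "norm (of_real k * (x powr of_real p - y powr of_real p) - of_real (p * (k0 * A powr (p - 1))) * (x - y)) <= \<epsilon> * norm (x - y)"
   by (simp add: F_def L_def algebra_simps)
 qed
qed

lemma real_small_lipschitz:
 fixes A p k0 \<epsilon> :: real
 assumes "1 < p" "0 < A" "0 < k0" "0 < \<epsilon>"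
 obtains \<delta> where "0 < \<delta>" "\<delta> <= A / 2"
  "!!k x y. \<bar>k - k0\<bar> <= \<delta> ==> \<bar>x - A\<bar> <= \<delta> ==> \<bar>y - A\<bar> <= \<delta> ==>
   \<bar>k * (x powr p - y powr p) - p * (k0 * A powr (p - 1)) * (x - y)\<bar> <= \<epsilon> * \<bar>x - y\<bar>"
proof -
 obtain \<delta> where \<delta>: "0 < \<delta>" "\<delta> <= A / 2" and
  c: "!!k (x::complex) y. \<bar>k - k0\<bar> <= \<delta> ==> norm (x - of_real A) <= \<delta> ==> norm (y - of_real A) <= \<delta> ==>
   norm (of_real k * (x powr of_real p - y powr of_real p) - of_real (p * (k0 * A powr (p - 1))) * (x - y)) <= \<epsilon> * norm (x - y)"
  using complex_small_lipschitz[OF assms] by blast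
 show ?thesis
 proof (rule that[OF \<delta>])
  fix k x y assume h: "\<bar>k - k0\<bar> <= \<delta>" "\<bar>x - A\<bar> <= \<delta>" "\<bar>y - A\<bar> <= \<delta>"
  have xy: "0 <= x" "0 <= y" using h \<delta> assms(2) by linarith+
  have nx: "norm (complex_of_real x - of_real A) <= \<delta>" "norm (complex_of_real y - of_real A) <= \<delta>"
   using h by (simp_all only: of_real_diff[symmetric] norm_of_real)
  have e: "of_real k * (complex_of_real x powr of_real p - of_real y powr of_real p) - of_real (p * (k0 * A powr (p - 1))) * (of_real x - of_real y)
   = complex_of_real (k * (x powr p - y powr p) - p * (k0 * A powr (p - 1)) * (x - y))" using xy by (simp add: powr_of_real)
  have "norm (complex_of_real (k * (x powr p - y powr p) - p * (k0 * A powr (p - 1)) * (x - y))) <= \<epsilon> * norm (complex_of_real x - of_real y)"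
   using c[OF h(1) nx] unfolding e .
  then show "\<bar>k * (x powr p - y powr p) - p * (k0 * A powr (p - 1)) * (x - y)\<bar> <= \<epsilon> * \<bar>x - y\<bar>"
   by (simp only: of_real_diff[symmetric] norm_of_real)
 qed
qed

lemma difference_identity:
 "(- x * z1 - p1 - r1) - (- x * z2 - p2 - r2) = - x * (z1 - z2) - p1 - r1 + p2 + (r2 :: real)" by (simp add: algebra_simps)

context emden_fowler
begin

definition A0 :: real where "A0 = Aeq \<theta> k0"
definition aa :: real where "aa = n - 2 * \<theta>"
text \<open>The stiffness of the linearisation at the equilibrium, p k0 A0^(p-1) - \<theta> (n -
  \<theta>), simplified by the equilibrium condition; \<open>aa\<close> is its damping.\<close>

definition cc :: real where "cc = (p - 1) * (\<theta> * (n - \<theta>))"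

lemma A0: "0 < A0" "\<theta> * (n - \<theta>) = k0 * A0 powr (p - 1)" "0 < aa" "0 < cc"
 "\<theta> * (n - \<theta>) + cc = p * (k0 * A0 powr (p - 1))"
proof -
 show e: "0 < A0" "\<theta> * (n - \<theta>) = k0 * A0 powr (p - 1)" "0 < aa" using Aeq[OF theta(1,2) k0] theta by (auto simp: A0_def aa_def)
 show "0 < cc" using theta p by (simp add: cc_def)
 show "\<theta> * (n - \<theta>) + cc = p * (k0 * A0 powr (p - 1))" unfolding cc_def e(2) by (simp add: algebra_simps)
qed

lemma A0_powr: "k0 * A0 powr p = \<theta> * (n - \<theta>) * A0"
proof -
 have "A0 powr p = A0 * A0 powr (p - 1)" using A0(1) by (simp add: powr_mult_base)
 then show ?thesis unfolding A0(2) by simp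
qed

text \<open>The candidate for the singular solution, selected by its behaviour at -\<infinity>;
  zeros at later times are allowed. For positive solutions it coincides with
  \<open>singular\<close>, by \<open>singular_branch\<close> and
  \<open>branch_singular\<close>.\<close>

definition branch :: "real => (real => real) => (real => real) => bool" where
 "branch \<mu> U V \<longleftrightarrow> descending \<mu> U V & ((%t. exp (\<theta> * t) * U t) \<longlongrightarrow> A0) at_bot &
  (\<exists>M T. \<forall>t\<le>T. \<bar>exp (\<theta> * t) * (V t + \<theta> * U t)\<bar> <= M)"

lemma scaled_velocity_bound:
 assumes D: "descending \<mu> U V" and U: "!!t. 0 < U t"
 shows "\<bar>exp (\<theta> * t) * (V t + \<theta> * U t)\<bar> <= n * (exp (\<theta> * t) * U t)"
proof -
 have "\<bar>V t + \<theta> * U t\<bar> <= n * U t"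
 proof -
  have "\<theta> * U t <= n * U t" "0 <= \<theta> * U t" using theta n U[of t] by (auto intro!: mult_right_mono)
  moreover have "V t < 0" "0 <= n * U t + V t" using D cone[OF D U, of t] by (auto simp: descending_def)
  ultimately show ?thesis by linarith
 qed
 then have "exp (\<theta> * t) * \<bar>V t + \<theta> * U t\<bar> <= exp (\<theta> * t) * (n * U t)" by (intro mult_left_mono) auto
 then show ?thesis by (simp add: abs_mult mult.left_commute)
qed

lemma singular_branch:
 assumes sg: "singular \<mu> U V"
 shows "branch \<mu> U V"
proof -
 have U: "!!t. 0 < U t" using sg by (simp add: singular_def)
 have D: "descending \<mu> U V" by (rule singular_descending[OF sg])
 have lim: "((%t. exp (\<theta> * t) * U t) \<longlongrightarrow> A0) at_bot" unfolding A0_def by (rule singular_limit_bot[OF sg])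
 then have "\<forall>\<^sub>F t in at_bot. exp (\<theta> * t) * U t < A0 + 1" by (intro order_tendstoD) auto
 then obtain T where T: "!!t. t <= T ==> exp (\<theta> * t) * U t < A0 + 1" by (auto simp: eventually_at_bot_linorder)
 have "\<bar>exp (\<theta> * t) * (V t + \<theta> * U t)\<bar> <= n * (A0 + 1)" if "t <= T" for t
  using scaled_velocity_bound[OF D U, of t] mult_left_mono[OF less_imp_le[OF T[OF that]] less_imp_le[OF n]] by linarith
 then show ?thesis using D lim by (auto simp: branch_def)
qed

lemma branch_singular:
 assumes br: "branch \<mu> U V" and U: "!!t. 0 < U t"
 shows "singular \<mu> U V"
proof -
 have lim: "((%t. exp (\<theta> * t) * U t) \<longlongrightarrow> A0) at_bot" using br by (simp add: branch_def)
 have "filterlim (%t. exp (\<theta> * t) * U t * exp (- \<theta> * t)) at_top at_bot"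
 proof (rule filterlim_tendsto_pos_mult_at_top[OF lim A0(1)])
  have "filterlim (%t. \<theta> * t) at_bot at_bot" by (rule filterlim_tendsto_pos_mult_at_bot[OF tendsto_const theta(1) filterlim_ident])
  then have "filterlim (%t. - \<theta> * t) at_top at_bot" by (simp add: filterlim_uminus_at_top)
  then show "filterlim (%t. exp (- \<theta> * t)) at_top at_bot" by (rule filterlim_compose[OF exp_at_top])
 qed
 then have "filterlim U at_top at_bot" by (simp only: mult.assoc exp_mult_neg_cancel)
 then show ?thesis using br U by (simp add: singular_def branch_def descending_def)
qed

text \<open>Near -\<infinity> both scaled solutions are close to \<open>A0\<close>, so their
  difference satisfies the linearised equation with forcing at most \<epsilon> |d| + |\<mu>1 -
  \<mu>2|, and \<open>oscillator_decay\<close> applies. Equal parameters give uniqueness, different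
  ones Lipschitz dependence. \<open>K\<close> depends neither on T nor on the velocity bound
  M.\<close>

lemma core_difference:
 obtains \<delta> K where "0 < \<delta>" "\<delta> <= A0 / 2" "0 <= K"
  "!!\<mu>1 U1 V1 \<mu>2 U2 V2 M T t. solves \<mu>1 U1 V1 ==> solves \<mu>2 U2 V2 ==>
   (!!t. t <= T ==> \<bar>exp (\<theta> * t) * U1 t - A0\<bar> <= \<delta> & \<bar>exp (\<theta> * t) * U2 t - A0\<bar> <= \<delta> &
    \<bar>\<kappa> t * exp (- m * t) - k0\<bar> <= \<delta> & exp (\<theta> * t) * \<phi> t <= 1 &
    \<bar>exp (\<theta> * t) * (V1 t + \<theta> * U1 t)\<bar> <= M & \<bar>exp (\<theta> * t) * (V2 t + \<theta> * U2 t)\<bar> <= M) ==> t <= T ==>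
   exp (\<theta> * t) * \<bar>U1 t - U2 t\<bar> <= K * \<bar>\<mu>1 - \<mu>2\<bar> & exp (\<theta> * t) * \<bar>V1 t - V2 t\<bar> <= K * \<bar>\<mu>1 - \<mu>2\<bar>"
proof -
 obtain \<epsilon> K where \<epsilon>: "0 < \<epsilon>" and K: "0 <= K" and dec:
  "!!(d :: real => real) d1 h T M \<sigma> t.
   (!!t. t <= T ==> (d has_vector_derivative d1 t) (at t)) ==>
   (!!t. t <= T ==> (d1 has_vector_derivative (- (aa *\<^sub>R d1 t) - cc *\<^sub>R d t + h t)) (at t)) ==>
   (!!t. t <= T ==> norm (h t) <= \<epsilon> * norm (d t) + \<sigma>) ==>
   (!!t. t <= T ==> norm (d t) <= M & norm (d1 t) <= M) ==> t <= T ==>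
   (norm (d1 t))^2 + (norm (d t))^2 <= K * \<sigma>^2" using oscillator_decay[OF A0(3,4), where 'a = real] by blast
 obtain \<delta> where \<delta>: "0 < \<delta>" "\<delta> <= A0 / 2" and lip:
  "!!k x y. \<bar>k - k0\<bar> <= \<delta> ==> \<bar>x - A0\<bar> <= \<delta> ==> \<bar>y - A0\<bar> <= \<delta> ==>
   \<bar>k * (x powr p - y powr p) - p * (k0 * A0 powr (p - 1)) * (x - y)\<bar> <= \<epsilon> * \<bar>x - y\<bar>"
  using real_small_lipschitz[OF p A0(1) k0 \<epsilon>] by blast
 show ?thesis
 proof (rule that[OF \<delta>, of "(1 + \<theta>) * sqrt K"])
  show "0 <= (1 + \<theta>) * sqrt K" using theta K by simp
  fix \<mu>1 U1 V1 \<mu>2 U2 V2 M T t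
  assume S1: "solves \<mu>1 U1 V1" and S2: "solves \<mu>2 U2 V2" and t: "t <= T"
   and h: "!!t. t <= T ==> \<bar>exp (\<theta> * t) * U1 t - A0\<bar> <= \<delta> & \<bar>exp (\<theta> * t) * U2 t - A0\<bar> <= \<delta> &
    \<bar>\<kappa> t * exp (- m * t) - k0\<bar> <= \<delta> & exp (\<theta> * t) * \<phi> t <= 1 &
    \<bar>exp (\<theta> * t) * (V1 t + \<theta> * U1 t)\<bar> <= M & \<bar>exp (\<theta> * t) * (V2 t + \<theta> * U2 t)\<bar> <= M"
  define W1 where "W1 t = exp (\<theta> * t) * U1 t" for t
  define W2 where "W2 t = exp (\<theta> * t) * U2 t" for t
  define Z1 where "Z1 t = exp (\<theta> * t) * (V1 t + \<theta> * U1 t)" for t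
  define Z2 where "Z2 t = exp (\<theta> * t) * (V2 t + \<theta> * U2 t)" for t
  define d where "d t = W1 t - W2 t" for t
  define d1 where "d1 t = Z1 t - Z2 t" for t
  define q where "q t = - aa * d1 t - (k0 * W1 t powr p - \<theta> * (n - \<theta>) * W1 t) - err \<theta> m k0 \<mu>1 t (W1 t)
   + (k0 * W2 t powr p - \<theta> * (n - \<theta>) * W2 t) + err \<theta> m k0 \<mu>2 t (W2 t)" for t
  define hh where "hh t = q t + aa * d1 t + cc * d t" for t
  have Up: "0 < U1 s" "0 < U2 s" if "s <= T" for s
  proof -
   have "0 < exp (\<theta> * s) * U1 s" "0 < exp (\<theta> * s) * U2 s" using h[OF that] \<delta> A0(1) by linarith+
   then show "0 < U1 s" "0 < U2 s" by (auto simp: zero_less_mult_iff)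
  qed
  have "(norm (d1 t))^2 + (norm (d t))^2 <= K * \<bar>\<mu>1 - \<mu>2\<bar>^2"
  proof (rule dec[of T d d1 hh "\<bar>\<mu>1 - \<mu>2\<bar>" "2 * (M + A0 + \<delta>)" t])
   fix s assume s: "s <= T"
   note e1 = emden_ode(1)[OF S1 Up(1)[OF s] theta(3)] emden_ode(2)[OF S1 Up(1)[OF s] theta(3), where k = k0]
   note e2 = emden_ode(1)[OF S2 Up(2)[OF s] theta(3)] emden_ode(2)[OF S2 Up(2)[OF s] theta(3), where k = k0]
   show "(d has_vector_derivative d1 s) (at s)"
    unfolding has_real_derivative_iff_has_vector_derivative[symmetric] d_def[abs_def] d1_def W1_def[abs_def] W2_def[abs_def] Z1_def Z2_def
    by (intro DERIV_diff e1(1) e2(1))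
   have "(d1 has_real_derivative q s) (at s)" unfolding d1_def[abs_def] Z1_def[abs_def] Z2_def[abs_def]
    by (rule DERIV_cong[OF DERIV_diff[OF e1(2) e2(2)]])
     (unfold q_def d1_def W1_def W2_def Z1_def Z2_def aa_def, rule difference_identity)
   then show "(d1 has_vector_derivative (- (aa *\<^sub>R d1 s) - cc *\<^sub>R d s + hh s)) (at s)"
    unfolding has_real_derivative_iff_has_vector_derivative[symmetric] by (simp add: hh_def)
   have hs: "hh s = - (\<kappa> s * exp (- m * s) * (W1 s powr p - W2 s powr p) - p * (k0 * A0 powr (p - 1)) * d s) - (\<mu>1 - \<mu>2) * (exp (\<theta> * s) * \<phi> s)"
    unfolding hh_def q_def A0(5)[symmetric] err_def d_def by (simp add: algebra_simps)
   have "\<bar>\<kappa> s * exp (- m * s) * (W1 s powr p - W2 s powr p) - p * (k0 * A0 powr (p - 1)) * d s\<bar> <= \<epsilon> * \<bar>d s\<bar>"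
    unfolding d_def using h[OF s] by (intro lip) (auto simp: W1_def W2_def)
   moreover have "\<bar>(\<mu>1 - \<mu>2) * (exp (\<theta> * s) * \<phi> s)\<bar> <= \<bar>\<mu>1 - \<mu>2\<bar> * 1"
    unfolding abs_mult using h[OF s] \<phi>_nonneg[of s] by (intro mult_left_mono) (auto simp: abs_mult)
   moreover have "\<bar>- x - y\<bar> <= \<bar>x\<bar> + \<bar>y\<bar>" for x y :: real by linarith
   ultimately show "norm (hh s) <= \<epsilon> * norm (d s) + \<bar>\<mu>1 - \<mu>2\<bar>" unfolding hs real_norm_def by (smt (verit))
   have "\<bar>d s\<bar> <= 2 * \<delta>" "\<bar>d1 s\<bar> <= 2 * M" "0 <= M"
    using h[OF s] unfolding d_def d1_def W1_def W2_def Z1_def Z2_def by linarith+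
   then show "norm (d s) <= 2 * (M + A0 + \<delta>) & norm (d1 s) <= 2 * (M + A0 + \<delta>)" using A0(1) \<delta> by simp
  qed (rule t)
  moreover have "0 <= (norm (d1 t))^2" "0 <= (norm (d t))^2" by simp_all
  ultimately have "(norm (d t))^2 <= K * \<bar>\<mu>1 - \<mu>2\<bar>^2" "(norm (d1 t))^2 <= K * \<bar>\<mu>1 - \<mu>2\<bar>^2" by linarith+
  then have "sqrt ((norm (d t))^2) <= sqrt (K * \<bar>\<mu>1 - \<mu>2\<bar>^2)" "sqrt ((norm (d1 t))^2) <= sqrt (K * \<bar>\<mu>1 - \<mu>2\<bar>^2)"
   by (simp_all only: real_sqrt_le_iff)
  then have dd: "\<bar>d t\<bar> <= sqrt K * \<bar>\<mu>1 - \<mu>2\<bar>" "\<bar>d1 t\<bar> <= sqrt K * \<bar>\<mu>1 - \<mu>2\<bar>"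
   by (simp_all add: real_sqrt_mult)
  have du: "exp (\<theta> * t) * (U1 t - U2 t) = d t" "exp (\<theta> * t) * (V1 t - V2 t) = d1 t - \<theta> * d t"
   by (simp_all add: d_def d1_def W1_def W2_def Z1_def Z2_def algebra_simps)
  have au: "exp (\<theta> * t) * \<bar>U1 t - U2 t\<bar> = \<bar>d t\<bar>" "exp (\<theta> * t) * \<bar>V1 t - V2 t\<bar> = \<bar>d1 t - \<theta> * d t\<bar>"
  proof -
   have e: "exp (\<theta> * t) * \<bar>x\<bar> = \<bar>exp (\<theta> * t) * x\<bar>" for x by (simp add: abs_mult)
   show "exp (\<theta> * t) * \<bar>U1 t - U2 t\<bar> = \<bar>d t\<bar>" "exp (\<theta> * t) * \<bar>V1 t - V2 t\<bar> = \<bar>d1 t - \<theta> * d t\<bar>"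
    unfolding e du by (rule refl)+
  qed
  have "\<bar>\<theta> * d t\<bar> <= \<theta> * (sqrt K * \<bar>\<mu>1 - \<mu>2\<bar>)" using dd(1) theta by (simp add: abs_mult)
  moreover have "0 <= \<theta> * (sqrt K * \<bar>\<mu>1 - \<mu>2\<bar>)" using theta K by simp
  moreover have "\<bar>d1 t - \<theta> * d t\<bar> <= \<bar>d1 t\<bar> + \<bar>\<theta> * d t\<bar>" by (rule abs_triangle_ineq4)
  moreover have "(1 + \<theta>) * sqrt K * \<bar>\<mu>1 - \<mu>2\<bar> = sqrt K * \<bar>\<mu>1 - \<mu>2\<bar> + \<theta> * (sqrt K * \<bar>\<mu>1 - \<mu>2\<bar>)"
   by (simp add: algebra_simps)
  ultimately have "\<bar>d t\<bar> <= (1 + \<theta>) * sqrt K * \<bar>\<mu>1 - \<mu>2\<bar>" "\<bar>d1 t - \<theta> * d t\<bar> <= (1 + \<theta>) * sqrt K * \<bar>\<mu>1 - \<mu>2\<bar>"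
   using dd by linarith+
  then show "exp (\<theta> * t) * \<bar>U1 t - U2 t\<bar> <= (1 + \<theta>) * sqrt K * \<bar>\<mu>1 - \<mu>2\<bar> & exp (\<theta> * t) * \<bar>V1 t - V2 t\<bar> <= (1 + \<theta>) * sqrt K * \<bar>\<mu>1 - \<mu>2\<bar>"
   unfolding au by (rule conjI)
 qed
qed

text \<open>Gronwall on a compact time interval. Upper bounds on U1 and U2 suffice, since the
  truncated power vanishes for negative values.\<close>

lemma forward_difference:
 assumes Mx: "0 <= Mx" and TR: "T <= R"
 obtains K where "0 <= K" "!!\<mu>1 U1 V1 \<mu>2 U2 V2 t. solves \<mu>1 U1 V1 ==> solves \<mu>2 U2 V2 ==>
  (!!t. T <= t ==> t <= R ==> U1 t <= Mx & U2 t <= Mx) ==> T <= t ==> t <= R ==>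
  \<bar>U1 t - U2 t\<bar> <= K * (\<bar>U1 T - U2 T\<bar> + \<bar>V1 T - V2 T\<bar> + \<bar>\<mu>1 - \<mu>2\<bar>) &
  \<bar>V1 t - V2 t\<bar> <= K * (\<bar>U1 T - U2 T\<bar> + \<bar>V1 T - V2 T\<bar> + \<bar>\<mu>1 - \<mu>2\<bar>)"
proof -
 have bd: "\<exists>B\<ge>0. \<forall>t. T <= t & t <= R --> \<bar>f t\<bar> <= B" if "continuous_on UNIV f" for f :: "real => real"
 proof -
  have "compact (f ` {T..R})" by (intro compact_continuous_image continuous_on_subset[OF that]) auto
  then obtain B where "!!t. t \<in> {T..R} ==> \<bar>f t\<bar> <= B" by (metis compact_imp_bounded bounded_iff imageI real_norm_def)
  then show ?thesis by (intro exI[of _ "max B 0"]) (auto simp: max.coboundedI1)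
 qed
 obtain Bk where Bk: "0 <= Bk" "!!t. T <= t ==> t <= R ==> \<kappa> t <= Bk"
  using bd[OF \<kappa>_cont] by (metis abs_le_D1)
 obtain Bp where Bp: "0 <= Bp" "!!t. T <= t ==> t <= R ==> \<phi> t <= Bp"
  using bd[OF \<phi>_cont] by (metis abs_le_D1)
 define C where "C = Bk * (p * Mx powr (p - 1))"
 have C: "0 <= C" using Bk p by (simp add: C_def)
 define E where "E = exp ((2 * \<bar>n\<bar> + \<bar>0\<bar> + C + 2) * (R - T))"
 define K where "K = sqrt E * (2 + Bp)"
 show ?thesis
 proof (rule that[of K])
  show "0 <= K" using Bp by (simp add: K_def E_def)
  fix \<mu>1 U1 V1 \<mu>2 U2 V2 t
  assume S1: "solves \<mu>1 U1 V1" and S2: "solves \<mu>2 U2 V2" and t: "T <= t" "t <= R"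
   and UM: "!!t. T <= t ==> t <= R ==> U1 t <= Mx & U2 t <= Mx"
  define d where "d t = U1 t - U2 t" for t
  define d1 where "d1 t = V1 t - V2 t" for t
  define h where "h t = force \<mu>2 U2 t - force \<mu>1 U1 t" for t
  define \<sigma> where "\<sigma> = \<bar>\<mu>1 - \<mu>2\<bar> * Bp"
  have \<sigma>: "0 <= \<sigma>" using Bp by (simp add: \<sigma>_def)
  have "(norm (d1 t))^2 + (norm (d t))^2 <= exp ((2 * \<bar>n\<bar> + \<bar>0\<bar> + C + 2) * (t - T)) * ((norm (d1 T))^2 + (norm (d T))^2 + \<sigma>^2)"
  proof (rule oscillator_growth[of T R d d1 n 0 h C \<sigma> t, OF _ _ _ C t])
   fix s assume s: "T <= s" "s <= R"
   show "(d has_vector_derivative d1 s) (at s)" unfolding has_real_derivative_iff_has_vector_derivative[symmetric] d_def[abs_def] d1_def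
    by (intro DERIV_diff solvesD(1)[OF S1] solvesD(1)[OF S2])
   show "(d1 has_vector_derivative (- (n *\<^sub>R d1 s) - 0 *\<^sub>R d s + h s)) (at s)"
    unfolding has_real_derivative_iff_has_vector_derivative[symmetric] d1_def[abs_def]
    by (rule DERIV_cong[OF DERIV_diff[OF solvesD(2)[OF S1] solvesD(2)[OF S2]]]) (simp add: h_def algebra_simps)
   have "\<bar>(max 0 (U2 s)) powr p - (max 0 (U1 s)) powr p\<bar> <= p * Mx powr (p - 1) * \<bar>max 0 (U2 s) - max 0 (U1 s)\<bar>"
    using UM[OF s] Mx by (intro real_powr_lipschitz p) auto
   also have "... <= p * Mx powr (p - 1) * \<bar>d s\<bar>" using p by (intro mult_left_mono) (auto simp: d_def)
   finally have "\<kappa> s * \<bar>(max 0 (U2 s)) powr p - (max 0 (U1 s)) powr p\<bar> <= Bk * (p * Mx powr (p - 1) * \<bar>d s\<bar>)"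
    using Bk s \<kappa>_pos[of s] p by (intro mult_mono) (auto intro: mult_nonneg_nonneg)
   moreover have "\<bar>(\<mu>2 - \<mu>1) * \<phi> s\<bar> <= \<sigma>"
    using Bp(2)[OF s] \<phi>_nonneg[of s] by (auto simp: \<sigma>_def abs_mult abs_minus_commute intro!: mult_left_mono)
   moreover have "h s = \<kappa> s * ((max 0 (U2 s)) powr p - (max 0 (U1 s)) powr p) + (\<mu>2 - \<mu>1) * \<phi> s"
    by (simp add: h_def force_def algebra_simps)
   moreover have "\<bar>\<kappa> s * ((max 0 (U2 s)) powr p - (max 0 (U1 s)) powr p)\<bar> = \<kappa> s * \<bar>(max 0 (U2 s)) powr p - (max 0 (U1 s)) powr p\<bar>"
    using \<kappa>_pos[of s] by (simp add: abs_mult)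
   moreover have "\<bar>x + y\<bar> <= \<bar>x\<bar> + \<bar>y\<bar>" for x y :: real by (rule abs_triangle_ineq)
   moreover have "C * \<bar>d s\<bar> = Bk * (p * Mx powr (p - 1) * \<bar>d s\<bar>)" by (simp add: C_def)
   ultimately show "norm (h s) <= C * norm (d s) + \<sigma>" unfolding real_norm_def by (smt (verit))
  qed
  also have "... <= E * ((norm (d1 T))^2 + (norm (d T))^2 + \<sigma>^2)"
   unfolding E_def using t C n by (intro mult_right_mono) auto
  also have "... <= E * (\<bar>d1 T\<bar> + \<bar>d T\<bar> + \<sigma>)^2"
  proof (rule mult_left_mono)
   have "0 <= \<bar>d1 T\<bar> * \<bar>d T\<bar>" "0 <= \<bar>d1 T\<bar> * \<sigma>" "0 <= \<bar>d T\<bar> * \<sigma>" using \<sigma> by simp_all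
   moreover have "(\<bar>d1 T\<bar> + \<bar>d T\<bar> + \<sigma>)^2 = (norm (d1 T))^2 + (norm (d T))^2 + \<sigma>^2 + 2 * (\<bar>d1 T\<bar> * \<bar>d T\<bar>) + 2 * (\<bar>d1 T\<bar> * \<sigma>) + 2 * (\<bar>d T\<bar> * \<sigma>)"
    by (simp add: power2_eq_square algebra_simps)
   ultimately show "(norm (d1 T))^2 + (norm (d T))^2 + \<sigma>^2 <= (\<bar>d1 T\<bar> + \<bar>d T\<bar> + \<sigma>)^2" by linarith
  qed (simp add: E_def)
  finally have b: "(d1 t)^2 + (d t)^2 <= E * (\<bar>d1 T\<bar> + \<bar>d T\<bar> + \<sigma>)^2" by simp
  moreover have "0 <= (d1 t)^2" "0 <= (d t)^2" by simp_all
  ultimately have "(d t)^2 <= E * (\<bar>d1 T\<bar> + \<bar>d T\<bar> + \<sigma>)^2" "(d1 t)^2 <= E * (\<bar>d1 T\<bar> + \<bar>d T\<bar> + \<sigma>)^2" by linarith+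
  then have "sqrt ((d t)^2) <= sqrt (E * (\<bar>d1 T\<bar> + \<bar>d T\<bar> + \<sigma>)^2)" "sqrt ((d1 t)^2) <= sqrt (E * (\<bar>d1 T\<bar> + \<bar>d T\<bar> + \<sigma>)^2)"
   by (simp_all only: real_sqrt_le_iff)
  then have dd: "\<bar>d t\<bar> <= sqrt E * (\<bar>d1 T\<bar> + \<bar>d T\<bar> + \<sigma>)" "\<bar>d1 t\<bar> <= sqrt E * (\<bar>d1 T\<bar> + \<bar>d T\<bar> + \<sigma>)"
   using \<sigma> by (simp_all add: real_sqrt_mult abs_of_nonneg add_nonneg_nonneg)
  have "sqrt E * (\<bar>d1 T\<bar> + \<bar>d T\<bar> + \<sigma>) <= sqrt E * ((2 + Bp) * (\<bar>d T\<bar> + \<bar>d1 T\<bar> + \<bar>\<mu>1 - \<mu>2\<bar>))"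
  proof (rule mult_left_mono)
   have "0 <= Bp * \<bar>d T\<bar>" "0 <= Bp * \<bar>d1 T\<bar>" using Bp by simp_all
   then show "\<bar>d1 T\<bar> + \<bar>d T\<bar> + \<sigma> <= (2 + Bp) * (\<bar>d T\<bar> + \<bar>d1 T\<bar> + \<bar>\<mu>1 - \<mu>2\<bar>)"
    by (simp add: \<sigma>_def algebra_simps)
  qed (simp add: E_def)
  moreover have "sqrt E * ((2 + Bp) * (\<bar>d T\<bar> + \<bar>d1 T\<bar> + \<bar>\<mu>1 - \<mu>2\<bar>)) = K * (\<bar>U1 T - U2 T\<bar> + \<bar>V1 T - V2 T\<bar> + \<bar>\<mu>1 - \<mu>2\<bar>)"
   by (simp add: K_def d_def d1_def)
  ultimately have fin: "sqrt E * (\<bar>d1 T\<bar> + \<bar>d T\<bar> + \<sigma>) <= K * (\<bar>U1 T - U2 T\<bar> + \<bar>V1 T - V2 T\<bar> + \<bar>\<mu>1 - \<mu>2\<bar>)" by (simp only:)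
  show "\<bar>U1 t - U2 t\<bar> <= K * (\<bar>U1 T - U2 T\<bar> + \<bar>V1 T - V2 T\<bar> + \<bar>\<mu>1 - \<mu>2\<bar>) &
  \<bar>V1 t - V2 t\<bar> <= K * (\<bar>U1 T - U2 T\<bar> + \<bar>V1 T - V2 T\<bar> + \<bar>\<mu>1 - \<mu>2\<bar>)"
   using order_trans[OF dd(1) fin] order_trans[OF dd(2) fin] unfolding d_def[of t] d1_def[of t] by (rule conjI)
 qed
qed

text \<open>\<open>rho\<close> and \<open>gg\<close> are the coefficients of the scaled equation; at
  -\<infinity> they tend to \<open>k0\<close> and 0.\<close>

definition rho :: "real => real" where "rho t = \<kappa> t * exp (- m * t)"
definition gg :: "real => real" where "gg t = exp (\<theta> * t) * \<phi> t"

lemma rho_cont: "continuous_on S rho" and gg_cont: "continuous_on S gg"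
 and rho_pos: "0 < rho t" and gg_nonneg: "0 <= gg t" unfolding rho_def gg_def using \<kappa>_pos[of t] \<phi>_nonneg[of t]
 by (auto intro!: continuous_intros continuous_on_subset[OF \<kappa>_cont] continuous_on_subset[OF \<phi>_cont])

lemma near_bot:
 assumes "0 < \<delta>" "0 < \<epsilon>"
 obtains T where "!!t. t <= T ==> \<bar>rho t - k0\<bar> <= \<delta>" "!!t. t <= T ==> gg t <= \<epsilon>"
proof -
 have "\<forall>\<^sub>F t in at_bot. dist (rho t) k0 < \<delta>" using tendstoD[OF \<kappa>_bot assms(1)] by (simp add: rho_def)
 moreover have "\<forall>\<^sub>F t in at_bot. gg t < \<epsilon>"
  using order_tendstoD(2)[OF phi_bot_limit[of \<theta>] assms(2)] theta by (simp add: gg_def)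
 ultimately have "\<forall>\<^sub>F t in at_bot. \<bar>rho t - k0\<bar> <= \<delta> & gg t <= \<epsilon>"
  by eventually_elim (auto simp: dist_real_def)
 then show ?thesis using that by (auto simp: eventually_at_bot_linorder)
qed

lemma unscaled_solution:
 assumes W: "(W has_real_derivative Z t) (at t)"
  "(Z has_real_derivative (- aa * Z t + \<theta> * (n - \<theta>) * W t - rho t * Y powr p - \<mu> * gg t)) (at t)" and Y: "0 <= Y"
 shows "((%t. exp (- \<theta> * t) * W t) has_real_derivative exp (- \<theta> * t) * (Z t - \<theta> * W t)) (at t)"
  "((%t. exp (- \<theta> * t) * (Z t - \<theta> * W t)) has_real_derivative
    - n * (exp (- \<theta> * t) * (Z t - \<theta> * W t)) - (\<kappa> t * (exp (- \<theta> * t) * Y) powr p + \<mu> * \<phi> t)) (at t)"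
proof -
 show "((%t. exp (- \<theta> * t) * W t) has_real_derivative exp (- \<theta> * t) * (Z t - \<theta> * W t)) (at t)"
  using W(1) by (auto intro!: derivative_eq_intros simp: algebra_simps)
 have "((%t. exp (- \<theta> * t) * (Z t - \<theta> * W t)) has_real_derivative
   - \<theta> * exp (- \<theta> * t) * (Z t - \<theta> * W t) + exp (- \<theta> * t) * ((- aa * Z t + \<theta> * (n - \<theta>) * W t - rho t * Y powr p - \<mu> * gg t) - \<theta> * Z t)) (at t)"
  using W by (auto intro!: derivative_eq_intros)
 moreover have "- \<theta> * exp (- \<theta> * t) * (Z t - \<theta> * W t) + exp (- \<theta> * t) * ((- aa * Z t + \<theta> * (n - \<theta>) * W t - rho t * Y powr p - \<mu> * gg t) - \<theta> * Z t)
   = - n * (exp (- \<theta> * t) * (Z t - \<theta> * W t)) - (exp (- \<theta> * t) * rho t * Y powr p + \<mu> * (exp (- \<theta> * t) * gg t))"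
  by (simp add: aa_def algebra_simps)
 moreover have "exp (- \<theta> * t) * gg t = \<phi> t" unfolding gg_def by (rule exp_neg_cancel)
 moreover have "exp (- \<theta> * t) * rho t * Y powr p = \<kappa> t * (exp (- \<theta> * t) * Y) powr p"
 proof -
  have "(exp (- \<theta> * t) * Y) powr p = exp (- \<theta> * p * t) * Y powr p"
  proof (cases "Y = 0")
   case False
   then have "0 < Y" using Y by simp
   then show ?thesis by (rule exp_powr_scale) simp
  qed (use p in simp)
  moreover have "- \<theta> * t + - m * t = - \<theta> * p * t"
  proof -
   have "\<theta> * p = m + \<theta>" using theta(3) by (simp add: algebra_simps)
   then have "- (\<theta> * p) * t = - (m + \<theta>) * t" by (simp only:)
   then show ?thesis by (simp add: algebra_simps)
  qed
  then have "exp (- \<theta> * t) * exp (- m * t) = exp (- \<theta> * p * t)" by (simp only: exp_add[symmetric])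
  ultimately show ?thesis unfolding rho_def by (simp only: ac_simps)
 qed
 ultimately show "((%t. exp (- \<theta> * t) * (Z t - \<theta> * W t)) has_real_derivative
    - n * (exp (- \<theta> * t) * (Z t - \<theta> * W t)) - (\<kappa> t * (exp (- \<theta> * t) * Y) powr p + \<mu> * \<phi> t)) (at t)" by simp
qed

section \<open>Existence of the branch for all times\<close>

text \<open>\<open>second_order_family\<close> is used on the whole line, centred at the constant
  \<open>A0\<close>, whose residual is the nonlinear remainder itself. The power is clamped between
  0 and a growing ceiling to make it Lipschitz at each time; the solution turns out to stay below
  the ceiling, and the clamping at 0 is the truncation in \<open>force\<close>. \<open>Tb\<close> is
  common to all \<mu> up to B, which makes later estimates uniform.\<close>

lemma branch_construct:
 assumes B: "0 <= B" and \<delta>0: "0 < \<delta>0" "\<delta>0 <= A0 / 2"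
 obtains Tb where "!!\<mu>. 0 <= \<mu> ==> \<mu> <= B ==> \<exists>U V M. branch \<mu> U V &
  (\<forall>t\<le>Tb. \<bar>exp (\<theta> * t) * U t - A0\<bar> <= \<delta>0 & \<bar>exp (\<theta> * t) * (V t + \<theta> * U t)\<bar> <= M)"
proof -
 obtain l1 l2 :: complex and e :: real where l: "l1 + l2 = of_real aa" "l1 * l2 = of_real cc" and e: "0 < e" "e <= Re l1" "e <= Re l2"
  using characteristic_roots[OF A0(3,4)] by blast
 define \<epsilon> where "\<epsilon> = e^2 / 4"
 have \<epsilon>: "0 < \<epsilon>" using e by (simp add: \<epsilon>_def)
 obtain \<delta>' where \<delta>': "0 < \<delta>'" "\<delta>' <= A0 / 2" and lip:
  "!!k x y. \<bar>k - k0\<bar> <= \<delta>' ==> \<bar>x - A0\<bar> <= \<delta>' ==> \<bar>y - A0\<bar> <= \<delta>' ==>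
   \<bar>k * (x powr p - y powr p) - p * (k0 * A0 powr (p - 1)) * (x - y)\<bar> <= \<epsilon> * \<bar>x - y\<bar>"
  using real_small_lipschitz[OF p A0(1) k0 \<epsilon>] by blast
 define \<delta> where "\<delta> = min \<delta>0 \<delta>'"
 have \<delta>: "0 < \<delta>" "\<delta> <= \<delta>0" "\<delta> <= \<delta>'" "\<delta> <= A0 / 2" using \<delta>0 \<delta>' by (auto simp: \<delta>_def)
 \<comment> \<open>The two lower bounds on \<open>mm\<close> serve the contraction condition
   \<open>cond1\<close> and the residual condition \<open>cond2\<close>.\<close>
 define mm where "mm = max (4 / e) (4 / (e * \<delta>))"
 have mm: "0 < mm" "1 / mm <= e / 4" "1 / mm <= e * \<delta> / 4"
 proof -
  show m0: "0 < mm" using e by (simp add: mm_def less_max_iff_disj)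
  have "4 / e <= mm" "4 / (e * \<delta>) <= mm" by (auto simp: mm_def)
  then have "inverse mm <= inverse (4 / e)" "inverse mm <= inverse (4 / (e * \<delta>))"
   using e \<delta> by (simp_all only: le_imp_inverse_le divide_pos_pos zero_less_numeral mult_pos_pos)
  moreover have "inverse (4 / e) = e / 4" "inverse (4 / (e * \<delta>)) = e * \<delta> / 4" "inverse mm = 1 / mm"
   by (simp_all add: inverse_eq_divide)
  ultimately show "1 / mm <= e / 4" "1 / mm <= e * \<delta> / 4" by (simp_all only:)
 qed
 define eR where "eR = e^2 * \<delta> / 4"
 have eR: "0 < eR" using e \<delta> by (simp add: eR_def)
 have cond1: "(\<epsilon> / e + 1 / mm) / e <= 1 / 2"
 proof -
  have "\<epsilon> / e + 1 / mm <= e / 4 + e / 4" using mm e by (simp add: \<epsilon>_def power2_eq_square)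
  then have "(\<epsilon> / e + 1 / mm) / e <= (e / 4 + e / 4) / e" using e by (intro divide_right_mono) auto
  then show ?thesis using e by simp
 qed
 have cond2: "1 * (eR / e + 1 / mm) / e <= \<delta> / 2"
 proof -
  have "eR / e = e * \<delta> / 4" using e by (simp add: eR_def power2_eq_square)
  then have "eR / e + 1 / mm <= e * \<delta> / 4 + e * \<delta> / 4" using mm(3) by linarith
  then have "(eR / e + 1 / mm) / e <= (e * \<delta> / 4 + e * \<delta> / 4) / e" using e by (intro divide_right_mono) auto
  then show ?thesis using e by simp
 qed
 \<comment> \<open>The closeness of the coefficients to their limits that makes the residual at
   \<open>A0\<close> at most \<open>eR\<close> before \<open>Tb\<close>.\<close>
 define q where "q = eR / (2 * (A0 powr p + B + 1))"
 have Ap: "0 < A0 powr p" using A0(1) by simp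
 have den: "0 < 2 * (A0 powr p + B + 1)" using Ap B by (intro mult_pos_pos add_nonneg_pos add_nonneg_nonneg) auto
 have q: "0 < q" unfolding q_def by (rule divide_pos_pos[OF eR den])
 obtain Tb where Tb: "!!t. t <= Tb ==> \<bar>rho t - k0\<bar> <= min \<delta>' q" "!!t. t <= Tb ==> gg t <= q"
  using near_bot[of "min \<delta>' q" q] \<delta>' q by auto
 \<comment> \<open>The ceiling is what monotonicity of U will give: W(t) <= exp (\<theta> (t - Tb))
   W(Tb) after \<open>Tb\<close>, with W(Tb) < 2 A0.\<close>
 define hi where "hi t = 2 * A0 * exp (\<theta> * max 0 (t - Tb))" for t
 have hi: "2 * A0 <= hi t" for t using A0(1) theta by (simp add: hi_def)
 have hic: "continuous_on UNIV hi" unfolding hi_def by (intro continuous_intros)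
 define clamp where "clamp t x = max 0 (min x (hi t))" for t x :: real
 \<comment> \<open>The first two summands are a Lipschitz constant of the clamped remainder, the
   last two bound its value at \<open>A0\<close>: one growth rate has to control both contraction
   and residual.\<close>
 define Cs where "Cs t = rho t * (p * hi t powr (p - 1)) + p * (k0 * A0 powr (p - 1)) + \<bar>rho t - k0\<bar> * A0 powr p + B * gg t" for t
 have Csc: "continuous_on UNIV Cs" unfolding Cs_def using hi A0(1) by (intro continuous_intros rho_cont gg_cont hic) (smt (verit))+
 have Cs0: "0 <= Cs t" for t unfolding Cs_def using rho_pos[of t] gg_nonneg[of t] B p k0 by (intro add_nonneg_nonneg mult_nonneg_nonneg) auto
 define Wt where "Wt t = (if t <= Tb then 0 else integral {Tb..t} Cs)" for t
 define Wt' where "Wt' t = (if t < Tb then 0 else Cs t)" for t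
 have Wd: "(Wt has_real_derivative Wt' t) (at t)" if "t \<noteq> Tb" for t
 proof (cases "t < Tb")
  case True
  have "((%t. 0) has_real_derivative 0) (at t)" by simp
  then have "(Wt has_real_derivative 0) (at t)"
   by (rule has_field_derivative_transform_within_open[where S = "{..<Tb}"]) (use True in \<open>simp_all add: Wt_def\<close>)
  then show ?thesis using True by (simp add: Wt'_def)
 next
  case False
  then have t: "Tb < t" using that by simp
  have "((%u. integral {Tb..u} Cs) has_vector_derivative Cs t) (at t within {Tb..t + 1})"
   using t by (intro integral_has_vector_derivative continuous_on_subset[OF Csc]) auto
  then have "((%u. integral {Tb..u} Cs) has_vector_derivative Cs t) (at t)" using t at_within_Icc_at[of Tb t "t + 1"] by simp
  then have "((%u. integral {Tb..u} Cs) has_real_derivative Cs t) (at t)" by (simp add: has_real_derivative_iff_has_vector_derivative)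
  then have "(Wt has_real_derivative Cs t) (at t)"
   by (rule has_field_derivative_transform_within_open[where S = "{Tb<..}"]) (use t in \<open>simp_all add: Wt_def\<close>)
  then show ?thesis using t by (simp add: Wt'_def)
 qed
 have Wmono: "0 <= Wt t" for t
  using integral_nonneg[of Cs "{Tb..t}"] integrable_continuous_real[OF continuous_on_subset[OF Csc]] Cs0 by (auto simp: Wt_def)
 have Wc: "continuous_on UNIV Wt"
 proof -
  have "isCont Wt t" for t
  proof (cases "t = Tb")
   case False then show ?thesis using DERIV_isCont Wd by blast
  next
   case True
   have "continuous_on {Tb..Tb + 1} (%u. integral {Tb..u} Cs)"
    by (intro indefinite_integral_continuous_1 integrable_continuous_real continuous_on_subset[OF Csc]) auto
   then have "((%u. integral {Tb..u} Cs) \<longlongrightarrow> integral {Tb..Tb} Cs) (at Tb within {Tb..Tb + 1})"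
    unfolding continuous_on_def by (rule bspec) simp
   then have "((%u. integral {Tb..u} Cs) \<longlongrightarrow> 0) (at_right Tb)" by (simp add: at_within_Icc_at_right)
   moreover have "\<forall>\<^sub>F u in at_right Tb. integral {Tb..u} Cs = Wt u" by (auto simp: eventually_at_filter Wt_def)
   ultimately have r: "(Wt \<longlongrightarrow> 0) (at_right Tb)" by (simp add: Lim_transform_eventually)
   have "\<forall>\<^sub>F u in at_left Tb. 0 = Wt u" by (auto simp: eventually_at_filter Wt_def)
   then have l: "(Wt \<longlongrightarrow> 0) (at_left Tb)" by (rule Lim_transform_eventually[OF tendsto_const])
   have "(Wt \<longlongrightarrow> 0) (at Tb)" using l r by (simp add: filterlim_at_split)
   then show ?thesis using True by (simp add: isCont_def Wt_def)
  qed
  then show ?thesis by (simp add: continuous_at_imp_continuous_on)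
 qed
 have weight: "weight UNIV Tb Wt Wt'" unfolding weight_def
 proof (intro conjI ballI allI impI)
  show "continuous_on UNIV Wt" by (rule Wc)
  show "0 <= Wt t" for t by (rule Wmono)
  show "0 <= Wt' t" for t using Cs0 by (simp add: Wt'_def)
  show "Wt t = 0" if "t <= Tb" for t using that by (simp add: Wt_def)
  show "(Wt has_real_derivative Wt' t) (at t)" if "t \<in> UNIV - {Tb}" for t using Wd that by simp
  show "\<exists>C. \<forall>s\<le>t. Wt s <= C & Wt' s <= C" for t
  proof -
   have c1: "compact (Cs ` {Tb..t})" and c2: "compact (Wt ` {Tb..t})"
    by (intro compact_continuous_image continuous_on_subset[OF Csc] continuous_on_subset[OF Wc]; simp)+
   obtain C1 where C1: "!!s. s \<in> {Tb..t} ==> norm (Cs s) <= C1" by (meson c1 compact_imp_bounded bounded_iff imageI)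
   obtain C2 where C2: "!!s. s \<in> {Tb..t} ==> norm (Wt s) <= C2" by (meson c2 compact_imp_bounded bounded_iff imageI)
   have "Wt s <= \<bar>C1\<bar> + \<bar>C2\<bar> & Wt' s <= \<bar>C1\<bar> + \<bar>C2\<bar>" if s: "s <= t" for s
   proof (cases "s < Tb")
    case True then show ?thesis by (simp add: Wt_def Wt'_def)
   next
    case False
    then have "s \<in> {Tb..t}" using s by simp
    from C1[OF this] C2[OF this] show ?thesis using False by (auto simp: Wt'_def)
   qed
   then show ?thesis by blast
  qed
 qed
 have small_before: "\<bar>rho t - k0\<bar> * A0 powr p + B * gg t <= eR" if "t <= Tb" for t
 proof -
  have "\<bar>rho t - k0\<bar> * A0 powr p + B * gg t <= q * A0 powr p + B * q"
   using Tb[OF that] Ap B by (intro add_mono mult_right_mono mult_left_mono) auto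
  also have "... <= q * (2 * (A0 powr p + B + 1))" using q Ap B by (simp add: algebra_simps)
  also have "... = eR"
  proof -
   have "x / y * y = x" if "0 < y" for x y :: real using that by simp
   from this[OF den] show ?thesis unfolding q_def .
  qed
  finally show ?thesis .
 qed
 show ?thesis
 proof (rule that[of Tb])
  fix \<mu> assume \<mu>: "0 <= \<mu>" "\<mu> <= B"
  define Hr where "Hr s x = rho s * clamp s x powr p - \<theta> * (n - \<theta>) * x - cc * (x - A0) + \<mu> * gg s" for s x
  \<comment> \<open>Only a real solution is wanted, so the remainder is made to depend on the real
    part alone. The parameter set {0} is not open, hence carries no holomorphy condition.\<close>
  define H where "H z s x = complex_of_real (Hr s (Re x))" for z :: complex and s x
  define om where "om s = exp (mm * Wt s)" for s
  have om1: "1 <= om s" for s using Wmono[of s] mm by (simp add: om_def)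
  have omb: "om s = 1" if "s <= Tb" for s using that by (simp add: om_def Wt_def)
  have clampA: "clamp s A0 = A0" for s using A0(1) hi[of s] by (simp add: clamp_def)
  have HA: "Hr s A0 = (rho s - k0) * A0 powr p + \<mu> * gg s" for s using A0_powr by (simp add: Hr_def clampA algebra_simps)
  have HAb: "\<bar>Hr s A0\<bar> <= \<bar>rho s - k0\<bar> * A0 powr p + B * gg s" for s
  proof -
   have "\<bar>Hr s A0\<bar> <= \<bar>(rho s - k0) * A0 powr p\<bar> + \<bar>\<mu> * gg s\<bar>" unfolding HA by (rule abs_triangle_ineq)
   moreover have "\<bar>\<mu> * gg s\<bar> <= B * gg s" using \<mu> gg_nonneg[of s] by (simp add: abs_mult mult_right_mono)
   ultimately show ?thesis by (simp add: abs_mult)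
  qed
  have HAw: "\<bar>Hr s A0\<bar> <= eR + Wt' s" for s
  proof (cases "s <= Tb")
   case True
   then show ?thesis using HAb[of s] small_before[OF True] Cs0[of s] by (auto simp: Wt'_def)
  next
   case False
   have "0 <= rho s * (p * hi s powr (p - 1)) + p * (k0 * A0 powr (p - 1))" using rho_pos[of s] p k0 by simp
   then show ?thesis using False HAb[of s] eR by (simp add: Wt'_def Cs_def)
  qed
  have Hlip: "\<bar>Hr s x - Hr s y\<bar> <= (\<epsilon> + Wt' s) * \<bar>x - y\<bar>" if xy: "\<bar>x - A0\<bar> <= \<delta> * om s" "\<bar>y - A0\<bar> <= \<delta> * om s" for s x y
  proof (cases "s <= Tb")
   case True
   have b: "\<bar>x - A0\<bar> <= \<delta>" "\<bar>y - A0\<bar> <= \<delta>" using xy omb[OF True] by auto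
   then have "0 <= x" "x <= 2 * A0" "0 <= y" "y <= 2 * A0" using \<delta> A0(1) by linarith+
   then have "clamp s x = x" "clamp s y = y" using hi[of s] by (auto simp: clamp_def)
   then have "Hr s x - Hr s y = rho s * (x powr p - y powr p) - p * (k0 * A0 powr (p - 1)) * (x - y)"
    unfolding A0(5)[symmetric] Hr_def by (simp add: algebra_simps)
   moreover have "\<bar>rho s * (x powr p - y powr p) - p * (k0 * A0 powr (p - 1)) * (x - y)\<bar> <= \<epsilon> * \<bar>x - y\<bar>"
    using Tb(1)[OF True] b \<delta> by (intro lip) auto
   moreover have "\<epsilon> * \<bar>x - y\<bar> <= (\<epsilon> + Wt' s) * \<bar>x - y\<bar>" using Cs0[of s] by (intro mult_right_mono) (auto simp: Wt'_def)
   ultimately show ?thesis by linarith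
  next
   case False
   have c: "0 <= clamp s x" "clamp s x <= hi s" "0 <= clamp s y" "clamp s y <= hi s" using hi[of s] A0(1) by (auto simp: clamp_def)
   have "\<bar>clamp s x powr p - clamp s y powr p\<bar> <= p * hi s powr (p - 1) * \<bar>clamp s x - clamp s y\<bar>"
    by (rule real_powr_lipschitz[OF p c])
   also have "... <= p * hi s powr (p - 1) * \<bar>x - y\<bar>" using p by (intro mult_left_mono) (auto simp: clamp_def)
   finally have "rho s * \<bar>clamp s x powr p - clamp s y powr p\<bar> <= rho s * (p * hi s powr (p - 1) * \<bar>x - y\<bar>)"
    using rho_pos[of s] by (intro mult_left_mono) auto
   then have "\<bar>rho s * (clamp s x powr p - clamp s y powr p)\<bar> <= rho s * (p * hi s powr (p - 1)) * \<bar>x - y\<bar>"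
    using rho_pos[of s] by (simp add: abs_mult mult.assoc)
   moreover have "Hr s x - Hr s y = rho s * (clamp s x powr p - clamp s y powr p) - p * (k0 * A0 powr (p - 1)) * (x - y)"
    unfolding A0(5)[symmetric] Hr_def by (simp add: algebra_simps)
   moreover have "\<bar>p * (k0 * A0 powr (p - 1)) * (x - y)\<bar> = p * (k0 * A0 powr (p - 1)) * \<bar>x - y\<bar>"
    using p k0 by (simp add: abs_mult)
   ultimately have "\<bar>Hr s x - Hr s y\<bar> <= (rho s * (p * hi s powr (p - 1)) + p * (k0 * A0 powr (p - 1))) * \<bar>x - y\<bar>"
    unfolding distrib_right by linarith
   also have "... <= (\<epsilon> + Wt' s) * \<bar>x - y\<bar>"
    using False \<epsilon> gg_nonneg[of s] B by (intro mult_right_mono) (auto simp: Wt'_def Cs_def)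
   finally show ?thesis .
  qed
  have Hcont: "continuous_on UNIV (%s. H z s (x s))" if "continuous_on UNIV x" for z and x :: "real => complex"
  proof -
   have cc: "continuous_on UNIV (%s. clamp s (Re (x s)))" unfolding clamp_def using that by (intro continuous_intros hic)
   show ?thesis unfolding H_def Hr_def using that p by (intro continuous_intros rho_cont gg_cont continuous_on_powr' cc) (auto simp: clamp_def)
  qed
  have "\<exists>x x1. holo_family {0} UNIV x & holo_family {0} UNIV x1 & near {0} UNIV (%s. exp (mm * Wt s)) \<delta> x (%z s. of_real A0) &
   (\<forall>z\<in>{0}. \<forall>t\<in>UNIV. (x z has_vector_derivative x1 z t) (at t) &
   (x1 z has_vector_derivative (- (l1 + l2) * x1 z t - l1 * l2 * (x z t - of_real A0) - H z t (x z t))) (at t)) &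
   (\<exists>C. \<forall>z\<in>{0}. \<forall>t\<in>UNIV. norm (x1 z t) <= C * exp (mm * Wt t))"
  proof (rule second_order_family[OF lower_ray_UNIV e mm(1) _ cond1 weight, where B = "max 1 eR" and ?xb1.0 = "%s. 0"
     and R = "%z s. H z s (of_real A0)" and dR = 1 and eR = eR and Mb = A0])
   show "0 <= \<epsilon>" "0 <= \<delta>" "0 <= max 1 eR" using \<epsilon> \<delta> by auto
   show "continuous_on UNIV (%s. complex_of_real A0)" by simp
   show "holo_family {0} UNIV (%z s. H z s (x z s))" if "holo_family {0} UNIV x" for x
    using that Hcont by (auto simp: holo_family_def not_open_singleton)
   show "norm (H z s x - H z s y) <= (\<epsilon> + Wt' s) * norm (x - y)"
    if "norm (x - of_real A0) <= \<delta> * exp (mm * Wt s)" "norm (y - of_real A0) <= \<delta> * exp (mm * Wt s)" for z s x y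
   proof -
    have "\<bar>Re x - A0\<bar> <= \<delta> * om s" "\<bar>Re y - A0\<bar> <= \<delta> * om s"
     using that abs_Re_le_cmod[of "x - of_real A0"] abs_Re_le_cmod[of "y - of_real A0"] by (auto simp: om_def)
    from Hlip[OF this] have "\<bar>Hr s (Re x) - Hr s (Re y)\<bar> <= (\<epsilon> + Wt' s) * \<bar>Re x - Re y\<bar>" .
    also have "... <= (\<epsilon> + Wt' s) * norm (x - y)"
     using abs_Re_le_cmod[of "x - y"] \<epsilon> Cs0[of s] by (intro mult_left_mono) (auto simp: Wt'_def)
    finally show ?thesis unfolding H_def of_real_diff[symmetric] norm_of_real .
   qed
   show "norm (H z s (of_real A0)) <= max 1 eR * (1 + Wt' s) * exp (mm * Wt s)" for z s
   proof -
    have w0: "0 <= Wt' s" using Cs0 by (simp add: Wt'_def)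
    have "norm (H z s (of_real A0)) <= eR + Wt' s" using HAw[of s] by (simp add: H_def)
    also have "... <= max 1 eR * (1 + Wt' s)"
    proof -
     have "1 * Wt' s <= max 1 eR * Wt' s" using w0 by (intro mult_right_mono) auto
     moreover have "max 1 eR * (1 + Wt' s) = max 1 eR + max 1 eR * Wt' s" by (simp add: distrib_left)
     moreover have "eR <= max 1 eR" by simp
     ultimately show ?thesis by linarith
    qed
    also have "... <= max 1 eR * (1 + Wt' s) * om s" using om1[of s] w0 mult_left_mono[of 1 "om s" "max 1 eR * (1 + Wt' s)"] by simp
    finally show ?thesis by (simp add: om_def)
   qed
   show "((%s. complex_of_real A0) has_vector_derivative 0) (at s)" for s by simp
   show "((%s. 0) has_vector_derivative - (l1 + l2) * 0 - l1 * l2 * (complex_of_real A0 - complex_of_real A0) - H z s (of_real A0) + H z s (of_real A0)) (at s)" for z s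
    by simp
   show "norm (complex_of_real A0) <= A0 & norm (0::complex) <= A0" using A0(1) by simp
   show "continuous_on UNIV (%s. H z s (of_real A0))" for z by (rule Hcont) simp
   show "0 <= (1::real)" "0 <= eR" using eR by auto
   show "1 * (eR / e + 1 / mm) / e <= \<delta> / 2" by (rule cond2)
   show "norm (H z s (of_real A0)) <= 1 * (eR + Wt' s) * exp (mm * Wt s)" for z s
   proof -
    have "0 <= eR + Wt' s" using Cs0[of s] eR by (simp add: Wt'_def)
    then show ?thesis using HAw[of s] om1[of s] mult_left_mono[of 1 "om s" "eR + Wt' s"] by (simp add: H_def om_def)
   qed
  qed
  then obtain x x1 C where nx: "near {0} UNIV (%s. exp (mm * Wt s)) \<delta> x (%z s. of_real A0)"
   and dxx: "\<forall>z\<in>{0}. \<forall>t\<in>UNIV. (x z has_vector_derivative x1 z t) (at t) &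
   (x1 z has_vector_derivative (- (l1 + l2) * x1 z t - l1 * l2 * (x z t - of_real A0) - H z t (x z t))) (at t)"
   and Cx: "\<forall>z\<in>{0}. \<forall>t\<in>UNIV. norm (x1 z t) <= C * exp (mm * Wt t)" by blast
  have x: "norm (x 0 s - of_real A0) <= \<delta> * om s" for s using nx by (simp add: near_def om_def)
  have dx: "(x 0 has_vector_derivative x1 0 t) (at t)"
    "(x1 0 has_vector_derivative (- (l1 + l2) * x1 0 t - l1 * l2 * (x 0 t - of_real A0) - H 0 t (x 0 t))) (at t)" for t using dxx by blast+
  have C: "norm (x1 0 t) <= C * om t" for t using Cx by (simp add: om_def)
  define W where "W t = Re (x 0 t)" for t
  define Z where "Z t = Re (x1 0 t)" for t
  have Wd: "(W has_real_derivative Z t) (at t)" for t unfolding W_def Z_def has_real_derivative_iff_has_vector_derivative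
   using bounded_linear.has_vector_derivative[OF bounded_linear_Re dx(1)] by simp
  have Zd: "(Z has_real_derivative (- aa * Z t + \<theta> * (n - \<theta>) * W t - rho t * clamp t (W t) powr p - \<mu> * gg t)) (at t)" for t
  proof -
   have d: "(Z has_real_derivative Re (- (l1 + l2) * x1 0 t - l1 * l2 * (x 0 t - of_real A0) - H 0 t (x 0 t))) (at t)"
    unfolding Z_def has_real_derivative_iff_has_vector_derivative using bounded_linear.has_vector_derivative[OF bounded_linear_Re dx(2)] by simp
   have e: "Re (- (l1 + l2) * x1 0 t - l1 * l2 * (x 0 t - of_real A0) - H 0 t (x 0 t))
     = - aa * Z t - cc * (W t - A0) - Hr t (W t)" unfolding l by (simp add: H_def W_def Z_def)
   show ?thesis by (rule DERIV_cong[OF d], unfold e Hr_def, simp)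
  qed
  define U where "U t = exp (- \<theta> * t) * W t" for t
  define V where "V t = exp (- \<theta> * t) * (Z t - \<theta> * W t)" for t
  have clamp0: "0 <= clamp t y" for t y by (simp add: clamp_def)
  have Ud: "(U has_real_derivative V t) (at t)" for t unfolding U_def[abs_def] V_def by (rule unscaled_solution(1)[OF Wd Zd clamp0])
  define F where "F t = \<kappa> t * (exp (- \<theta> * t) * clamp t (W t)) powr p + \<mu> * \<phi> t" for t
  have Vd: "(V has_real_derivative - n * V t - F t) (at t)" for t unfolding V_def[abs_def] F_def by (rule unscaled_solution(2)[OF Wd Zd clamp0])
  have F0: "0 <= F t" for t using \<kappa>_pos[of t] \<phi>_nonneg[of t] \<mu> by (simp add: F_def)
  have Wb: "\<bar>W t - A0\<bar> <= \<delta>" if "t <= Tb" for t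
   using x[of t] abs_Re_le_cmod[of "x 0 t - of_real A0"] omb[OF that] by (simp add: W_def)
  have Zb: "\<bar>Z t\<bar> <= C" if "t <= Tb" for t using C[of t] abs_Re_le_cmod[of "x1 0 t"] omb[OF that] by (simp add: Z_def)
  have Wp: "A0 / 2 <= W t" "W t <= 3 / 2 * A0" if "t <= Tb" for t using Wb[OF that] \<delta> A0(1) by linarith+
  have Fp: "0 < F t" if "t <= Tb" for t
  proof -
   have "0 < clamp t (W t)" using Wp[OF that] A0(1) hi[of t] by (simp add: clamp_def less_max_iff_disj)
   then have "0 < \<kappa> t * (exp (- \<theta> * t) * clamp t (W t)) powr p" using \<kappa>_pos[of t] by simp
   moreover have "0 <= \<mu> * \<phi> t" using \<mu> \<phi>_nonneg[of t] by simp
   ultimately show ?thesis unfolding F_def by linarith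
  qed
  have dflux: "((%t. exp (n * t) * V t) has_real_derivative - exp (n * t) * F t) (at t)" for t
   using Vd[of t] by (auto intro!: derivative_eq_intros simp: algebra_simps)
  have fluxmono: "exp (n * t) * V t <= exp (n * s) * V s" if "s <= t" for s t
   by (rule nonincreasing_on_ray[where f = "%t. exp (n * t) * V t" and T = t, OF dflux]) (use F0 that in auto)
  \<comment> \<open>The bounded scaled velocity makes exp (n t) V at most a multiple of exp ((n -
    \<theta>) t) near -\<infinity>, which tends to 0; since the flux is nonincreasing, it is nowhere
    positive.\<close>
  have flux0: "exp (n * t) * V t <= 0" for t
  proof -
   have "exp (n * t) * V t <= (\<bar>C\<bar> + \<theta> * (2 * A0)) * exp ((n - \<theta>) * s)" if s: "s <= min t Tb" for s
   proof -
    have "V s <= exp (- \<theta> * s) * (\<bar>C\<bar> + \<theta> * (2 * A0))"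
    proof -
     have "Z s <= \<bar>C\<bar>" using Zb[of s] s by simp
     moreover have "0 <= \<theta> * W s" "0 <= \<theta> * (2 * A0)" using Wp[of s] s theta A0(1) by simp_all
     ultimately show ?thesis unfolding V_def by (intro mult_left_mono) auto
    qed
    then have "exp (n * s) * V s <= exp (n * s) * (exp (- \<theta> * s) * (\<bar>C\<bar> + \<theta> * (2 * A0)))" by (intro mult_left_mono) auto
    moreover have "n * s + - \<theta> * s = (n - \<theta>) * s" by (simp add: algebra_simps)
    then have "exp (n * s) * exp (- \<theta> * s) = exp ((n - \<theta>) * s)" by (simp only: exp_add[symmetric])
    ultimately have "exp (n * s) * V s <= exp ((n - \<theta>) * s) * (\<bar>C\<bar> + \<theta> * (2 * A0))" by (simp only: mult.assoc[symmetric])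
    then show ?thesis using fluxmono[of s t] s by (simp add: mult.commute)
   qed
   note b = this
   have "((%s. (\<bar>C\<bar> + \<theta> * (2 * A0)) * exp ((n - \<theta>) * s)) \<longlongrightarrow> (\<bar>C\<bar> + \<theta> * (2 * A0)) * 0) at_bot"
    using theta by (intro tendsto_intros exp_mult_at_bot) auto
   then have "exp (n * t) * V t <= (\<bar>C\<bar> + \<theta> * (2 * A0)) * 0"
    by (rule tendsto_lowerbound) (rule eventually_mono[OF eventually_le_at_bot[of "min t Tb"]], rule b, simp_all)
   then show ?thesis by simp
  qed
  \<comment> \<open>Strictness comes from the force being positive before \<open>Tb\<close>, where W
    is close to \<open>A0\<close>.\<close>
  have Vn: "V t < 0" for t
  proof -
   define s where "s = min t Tb"
   have "exp (n * s) * V s < exp (n * (s - 1)) * V (s - 1)"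
   proof (rule DERIV_neg_imp_decreasing[where f = "%t. exp (n * t) * V t" and a = "s - 1" and b = s])
    fix r assume "s - 1 <= r" "r <= s"
    then have "r <= Tb" by (simp add: s_def)
    then have "- exp (n * r) * F r < 0" using Fp by simp
    then show "\<exists>y. ((%t. exp (n * t) * V t) has_real_derivative y) (at r) & y < 0" using dflux by blast
   qed simp
   then have "exp (n * s) * V s < 0" using flux0[of "s - 1"] by linarith
   moreover have "exp (n * t) * V t <= exp (n * s) * V s" by (rule fluxmono) (simp add: s_def)
   ultimately have "exp (n * t) * V t < 0" by linarith
   then show ?thesis by (simp add: mult_less_0_iff)
  qed
  have WU: "exp (\<theta> * t) * U t = W t" for t using exp_neg_cancel[of "- \<theta>" t "W t"] by (simp add: U_def)
  \<comment> \<open>The ceiling is never active, so the clamped equation is the one with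
    \<open>force\<close>.\<close>
  have Whi: "W t <= hi t" for t
  proof (cases "t <= Tb")
   case True then show ?thesis using Wp(2)[OF True] hi[of t] A0(1) by linarith
  next
   case False
   have "U t <= U Tb"
    by (rule nonincreasing_on_ray[where f = U and f' = V and T = t]) (use Ud Vn False in \<open>auto intro: less_imp_le\<close>)
   then have "exp (\<theta> * t) * U t <= exp (\<theta> * t) * (exp (- \<theta> * Tb) * W Tb)" unfolding U_def[of Tb] by (intro mult_left_mono) auto
   moreover have "\<theta> * t + - \<theta> * Tb = \<theta> * (t - Tb)" by (simp add: algebra_simps)
   then have "exp (\<theta> * t) * exp (- \<theta> * Tb) = exp (\<theta> * (t - Tb))" by (simp only: exp_add[symmetric])
   ultimately have "W t <= exp (\<theta> * (t - Tb)) * W Tb" unfolding WU by (simp only: mult.assoc[symmetric])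
   also have "... <= exp (\<theta> * (t - Tb)) * (2 * A0)" using Wp(2)[of Tb] A0(1) by (intro mult_left_mono) auto
   finally show ?thesis using False by (simp add: hi_def mult.commute)
  qed
  have force: "F t = force \<mu> U t" for t
  proof -
   have "clamp t (W t) = max 0 (W t)" using Whi[of t] by (simp add: clamp_def)
   moreover have "exp (- \<theta> * t) * max 0 (W t) = max 0 (U t)" unfolding U_def by (simp add: max_def mult_le_0_iff zero_le_mult_iff)
   ultimately show ?thesis by (simp add: F_def force_def)
  qed
  have S: "solves \<mu> U V" using Ud Vd by (simp add: solves_def force)
  have ZV: "exp (\<theta> * t) * (V t + \<theta> * U t) = Z t" for t
  proof -
   have "exp (\<theta> * t) * V t = Z t - \<theta> * W t" using exp_neg_cancel[of "- \<theta>" t "Z t - \<theta> * W t"] by (simp add: V_def)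
   then show ?thesis using WU[of t] by (simp add: distrib_left mult.left_commute)
  qed
  have D: "descending \<mu> U V" using S \<mu> Vn by (simp add: descending_def)
  have lim: "((%t. exp (\<theta> * t) * U t) \<longlongrightarrow> A0) at_bot" unfolding A0_def
  proof (rule strip_limit[OF S \<mu>(1), of "A0 / 2" Tb "3 / 2 * A0" C])
   show "0 < A0 / 2" using A0(1) by simp
   fix t assume t: "t <= Tb"
   have "0 < U t" using Wp(1)[OF t] A0(1) by (simp add: U_def)
   then show "0 < U t & A0 / 2 <= exp (\<theta> * t) * U t & exp (\<theta> * t) * U t <= 3 / 2 * A0 & \<bar>exp (\<theta> * t) * (V t + \<theta> * U t)\<bar> <= C"
    using Wp[OF t] Zb[OF t] unfolding WU ZV by simp
  qed
  have "branch \<mu> U V" unfolding branch_def using D lim Zb ZV by auto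
  moreover have "\<forall>t\<le>Tb. \<bar>exp (\<theta> * t) * U t - A0\<bar> <= \<delta>0 & \<bar>exp (\<theta> * t) * (V t + \<theta> * U t)\<bar> <= C"
   using Wb Zb \<delta>(2) unfolding WU ZV by force
  ultimately show "\<exists>U V M. branch \<mu> U V &
  (\<forall>t\<le>Tb. \<bar>exp (\<theta> * t) * U t - A0\<bar> <= \<delta>0 & \<bar>exp (\<theta> * t) * (V t + \<theta> * U t)\<bar> <= M)" by blast
 qed
qed

section \<open>Uniqueness of the branch and its dependence on the parameter\<close>

lemma branchD:
 assumes "branch \<mu> U V"
 shows "descending \<mu> U V" "solves \<mu> U V" "0 <= \<mu>" "V t < 0" using assms by (auto simp: branch_def descending_def)

lemma branch_near:
 assumes "branch \<mu> U V" "0 < \<delta>"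
 obtains T M where "!!t. t <= T ==> \<bar>exp (\<theta> * t) * U t - A0\<bar> <= \<delta>" "!!t. t <= T ==> \<bar>exp (\<theta> * t) * (V t + \<theta> * U t)\<bar> <= M"
proof -
 obtain M T1 where M: "!!t. t <= T1 ==> \<bar>exp (\<theta> * t) * (V t + \<theta> * U t)\<bar> <= M" using assms by (auto simp: branch_def)
 have "((%t. exp (\<theta> * t) * U t) \<longlongrightarrow> A0) at_bot" using assms by (simp add: branch_def)
 from tendstoD[OF this assms(2)] obtain T2 where T2: "!!t. t <= T2 ==> dist (exp (\<theta> * t) * U t) A0 < \<delta>"
  by (auto simp: eventually_at_bot_linorder)
 show ?thesis by (rule that[of "min T1 T2" M]) (use M T2 in \<open>auto simp: dist_real_def less_imp_le\<close>)
qed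

text \<open>Equal parameters in \<open>core_difference\<close> give agreement near -\<infinity>, and
  \<open>forward_difference\<close> carries it to every later time.\<close>

lemma branch_unique:
 assumes b1: "branch \<mu> U1 V1" and b2: "branch \<mu> U2 V2"
 shows "U1 t = U2 t & V1 t = V2 t"
proof -
 obtain \<delta> K where \<delta>: "0 < \<delta>" "\<delta> <= A0 / 2" and K: "0 <= K" and core:
  "!!\<mu>1 U1 V1 \<mu>2 U2 V2 M T t. solves \<mu>1 U1 V1 ==> solves \<mu>2 U2 V2 ==>
   (!!t. t <= T ==> \<bar>exp (\<theta> * t) * U1 t - A0\<bar> <= \<delta> & \<bar>exp (\<theta> * t) * U2 t - A0\<bar> <= \<delta> &
    \<bar>\<kappa> t * exp (- m * t) - k0\<bar> <= \<delta> & exp (\<theta> * t) * \<phi> t <= 1 &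
    \<bar>exp (\<theta> * t) * (V1 t + \<theta> * U1 t)\<bar> <= M & \<bar>exp (\<theta> * t) * (V2 t + \<theta> * U2 t)\<bar> <= M) ==> t <= T ==>
   exp (\<theta> * t) * \<bar>U1 t - U2 t\<bar> <= K * \<bar>\<mu>1 - \<mu>2\<bar> & exp (\<theta> * t) * \<bar>V1 t - V2 t\<bar> <= K * \<bar>\<mu>1 - \<mu>2\<bar>"
  by (fact core_difference)
 obtain T0 where T0: "!!t. t <= T0 ==> \<bar>rho t - k0\<bar> <= \<delta>" "!!t. t <= T0 ==> gg t <= 1"
  using near_bot[OF \<delta>(1) zero_less_one] by blast
 obtain T1 M1 where T1: "!!t. t <= T1 ==> \<bar>exp (\<theta> * t) * U1 t - A0\<bar> <= \<delta>" "!!t. t <= T1 ==> \<bar>exp (\<theta> * t) * (V1 t + \<theta> * U1 t)\<bar> <= M1"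
  using branch_near[OF b1 \<delta>(1)] by blast
 obtain T2 M2 where T2: "!!t. t <= T2 ==> \<bar>exp (\<theta> * t) * U2 t - A0\<bar> <= \<delta>" "!!t. t <= T2 ==> \<bar>exp (\<theta> * t) * (V2 t + \<theta> * U2 t)\<bar> <= M2"
  using branch_near[OF b2 \<delta>(1)] by blast
 define T where "T = min (min T0 T1) (min T2 t)"
 have "exp (\<theta> * T) * \<bar>U1 T - U2 T\<bar> <= K * \<bar>\<mu> - \<mu>\<bar> & exp (\<theta> * T) * \<bar>V1 T - V2 T\<bar> <= K * \<bar>\<mu> - \<mu>\<bar>"
 proof (rule core[OF branchD(2)[OF b1] branchD(2)[OF b2], of T "max M1 M2" T])
  fix s assume "s <= T"
  then have s: "s <= T0" "s <= T1" "s <= T2" by (auto simp: T_def)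
  show "\<bar>exp (\<theta> * s) * U1 s - A0\<bar> <= \<delta> & \<bar>exp (\<theta> * s) * U2 s - A0\<bar> <= \<delta> &
    \<bar>\<kappa> s * exp (- m * s) - k0\<bar> <= \<delta> & exp (\<theta> * s) * \<phi> s <= 1 &
    \<bar>exp (\<theta> * s) * (V1 s + \<theta> * U1 s)\<bar> <= max M1 M2 & \<bar>exp (\<theta> * s) * (V2 s + \<theta> * U2 s)\<bar> <= max M1 M2"
   using T0[OF s(1)] T1[OF s(2)] T2[OF s(3)] unfolding rho_def gg_def by (auto simp: max.coboundedI1 max.coboundedI2)
 qed simp
 then have eq: "U1 T = U2 T" "V1 T = V2 T" by (simp_all add: mult_le_0_iff)
 have Tt: "T <= t" by (simp add: T_def)
 define Mx where "Mx = \<bar>U1 T\<bar> + \<bar>U2 T\<bar>"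
 have Mx0: "0 <= Mx" by (simp add: Mx_def)
 have UM: "U1 s <= Mx & U2 s <= Mx" if "T <= s" for s
  using descending_mono[OF branchD(1)[OF b1] that] descending_mono[OF branchD(1)[OF b2] that] by (auto simp: Mx_def)
 obtain K' where K': "0 <= K'" "!!\<mu>1 U1 V1 \<mu>2 U2 V2 s. solves \<mu>1 U1 V1 ==> solves \<mu>2 U2 V2 ==>
  (!!s. T <= s ==> s <= t ==> U1 s <= Mx & U2 s <= Mx) ==> T <= s ==> s <= t ==>
  \<bar>U1 s - U2 s\<bar> <= K' * (\<bar>U1 T - U2 T\<bar> + \<bar>V1 T - V2 T\<bar> + \<bar>\<mu>1 - \<mu>2\<bar>) &
  \<bar>V1 s - V2 s\<bar> <= K' * (\<bar>U1 T - U2 T\<bar> + \<bar>V1 T - V2 T\<bar> + \<bar>\<mu>1 - \<mu>2\<bar>)"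
  by (fact forward_difference[OF Mx0 Tt])
 have "\<bar>U1 t - U2 t\<bar> <= K' * (\<bar>U1 T - U2 T\<bar> + \<bar>V1 T - V2 T\<bar> + \<bar>\<mu> - \<mu>\<bar>) &
  \<bar>V1 t - V2 t\<bar> <= K' * (\<bar>U1 T - U2 T\<bar> + \<bar>V1 T - V2 T\<bar> + \<bar>\<mu> - \<mu>\<bar>)"
  by (rule K'(2)[OF branchD(2)[OF b1] branchD(2)[OF b2]]) (use UM Tt in auto)
 then show ?thesis using eq by simp
qed

definition sol :: "real => (real => real) \<times> (real => real)" where
 "sol \<mu> = (SOME s. branch \<mu> (fst s) (snd s))"

abbreviation "US \<mu> \<equiv> fst (sol \<mu>)"
abbreviation "VS \<mu> \<equiv> snd (sol \<mu>)"

lemma branch_sol: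
 assumes "0 <= \<mu>"
 shows "branch \<mu> (US \<mu>) (VS \<mu>)"
proof -
 have "0 < A0 / 2" "A0 / 2 <= A0 / 2" using A0(1) by auto
 from branch_construct[OF assms this] assms obtain U V where "branch \<mu> U V" by (metis order_refl)
 then have "branch \<mu> (fst (U, V)) (snd (U, V))" by simp
 then show ?thesis unfolding sol_def by (rule someI)
qed

lemma branch_eq_sol: "branch \<mu> U V ==> U = US \<mu> & V = VS \<mu>"
 using branch_unique[OF _ branch_sol] branchD(3) by fastforce

text \<open>The time \<open>Tb\<close> from \<open>branch_construct\<close> has to be common to all
  \<mu> up to B; the velocity bounds may vary, because the constant of
  \<open>core_difference\<close> does not see them. After T the estimate is continued by
  \<open>forward_difference\<close>, with U bounded by its value at T.\<close>

lemma branch_continuity: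
 assumes B: "0 <= B"
 obtains K where "0 <= K" "!!\<mu>1 \<mu>2 t. 0 <= \<mu>1 ==> \<mu>1 <= B ==> 0 <= \<mu>2 ==> \<mu>2 <= B ==> t <= R ==>
  exp (\<theta> * t) * \<bar>US \<mu>1 t - US \<mu>2 t\<bar> <= K * \<bar>\<mu>1 - \<mu>2\<bar> & exp (\<theta> * t) * \<bar>VS \<mu>1 t - VS \<mu>2 t\<bar> <= K * \<bar>\<mu>1 - \<mu>2\<bar>"
proof -
 obtain \<delta> K where \<delta>: "0 < \<delta>" "\<delta> <= A0 / 2" and K: "0 <= K" and core:
  "!!\<mu>1 U1 V1 \<mu>2 U2 V2 M T t. solves \<mu>1 U1 V1 ==> solves \<mu>2 U2 V2 ==>
   (!!t. t <= T ==> \<bar>exp (\<theta> * t) * U1 t - A0\<bar> <= \<delta> & \<bar>exp (\<theta> * t) * U2 t - A0\<bar> <= \<delta> &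
    \<bar>\<kappa> t * exp (- m * t) - k0\<bar> <= \<delta> & exp (\<theta> * t) * \<phi> t <= 1 &
    \<bar>exp (\<theta> * t) * (V1 t + \<theta> * U1 t)\<bar> <= M & \<bar>exp (\<theta> * t) * (V2 t + \<theta> * U2 t)\<bar> <= M) ==> t <= T ==>
   exp (\<theta> * t) * \<bar>U1 t - U2 t\<bar> <= K * \<bar>\<mu>1 - \<mu>2\<bar> & exp (\<theta> * t) * \<bar>V1 t - V2 t\<bar> <= K * \<bar>\<mu>1 - \<mu>2\<bar>"
  by (fact core_difference)
 obtain T0 where T0: "!!t. t <= T0 ==> \<bar>rho t - k0\<bar> <= \<delta>" "!!t. t <= T0 ==> gg t <= 1"
  using near_bot[OF \<delta>(1) zero_less_one] by blast
 obtain Tb where Tb: "!!\<mu>. 0 <= \<mu> ==> \<mu> <= B ==> \<exists>U V M. branch \<mu> U V &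
  (\<forall>t\<le>Tb. \<bar>exp (\<theta> * t) * U t - A0\<bar> <= \<delta> & \<bar>exp (\<theta> * t) * (V t + \<theta> * U t)\<bar> <= M)"
  using branch_construct[OF B \<delta>] by blast
 have Tb': "\<exists>M. \<forall>t\<le>Tb. \<bar>exp (\<theta> * t) * US \<mu> t - A0\<bar> <= \<delta> & \<bar>exp (\<theta> * t) * (VS \<mu> t + \<theta> * US \<mu> t)\<bar> <= M"
  if \<mu>: "0 <= \<mu>" "\<mu> <= B" for \<mu> using Tb[OF \<mu>] branch_eq_sol by blast
 define T where "T = min (min T0 Tb) R"
 define Mx where "Mx = exp (- \<theta> * T) * (2 * A0)"
 have Mx: "0 <= Mx" using A0(1) by (simp add: Mx_def)
 have TR: "T <= R" by (simp add: T_def)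
 obtain K' where K': "0 <= K'" "!!\<mu>1 U1 V1 \<mu>2 U2 V2 t. solves \<mu>1 U1 V1 ==> solves \<mu>2 U2 V2 ==>
  (!!t. T <= t ==> t <= R ==> U1 t <= Mx & U2 t <= Mx) ==> T <= t ==> t <= R ==>
  \<bar>U1 t - U2 t\<bar> <= K' * (\<bar>U1 T - U2 T\<bar> + \<bar>V1 T - V2 T\<bar> + \<bar>\<mu>1 - \<mu>2\<bar>) &
  \<bar>V1 t - V2 t\<bar> <= K' * (\<bar>U1 T - U2 T\<bar> + \<bar>V1 T - V2 T\<bar> + \<bar>\<mu>1 - \<mu>2\<bar>)"
  by (fact forward_difference[OF Mx TR])
 define K2 where "K2 = exp (\<theta> * R) * (K' * (2 * (exp (- \<theta> * T) * K) + 1))"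
 have K2: "0 <= K2" using K K' by (simp add: K2_def)
 show ?thesis
 proof (rule that[of "K + K2"])
  show "0 <= K + K2" using K K2 by simp
  fix \<mu>1 \<mu>2 t assume m1: "0 <= \<mu>1" "\<mu>1 <= B" and m2: "0 <= \<mu>2" "\<mu>2 <= B" and t: "t <= R"
  note b1 = branch_sol[OF m1(1)] and b2 = branch_sol[OF m2(1)]
  obtain M1 where M1: "!!t. t <= Tb ==> \<bar>exp (\<theta> * t) * US \<mu>1 t - A0\<bar> <= \<delta> & \<bar>exp (\<theta> * t) * (VS \<mu>1 t + \<theta> * US \<mu>1 t)\<bar> <= M1"
   using Tb'[OF m1] by blast
  obtain M2 where M2: "!!t. t <= Tb ==> \<bar>exp (\<theta> * t) * US \<mu>2 t - A0\<bar> <= \<delta> & \<bar>exp (\<theta> * t) * (VS \<mu>2 t + \<theta> * US \<mu>2 t)\<bar> <= M2"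
   using Tb'[OF m2] by blast
  have low: "exp (\<theta> * s) * \<bar>US \<mu>1 s - US \<mu>2 s\<bar> <= K * \<bar>\<mu>1 - \<mu>2\<bar> & exp (\<theta> * s) * \<bar>VS \<mu>1 s - VS \<mu>2 s\<bar> <= K * \<bar>\<mu>1 - \<mu>2\<bar>"
   if sT: "s <= T" for s
  proof (rule core[OF branchD(2)[OF b1] branchD(2)[OF b2] _ sT, of "max M1 M2"])
   fix s assume "s <= T"
   then have s: "s <= T0" "s <= Tb" by (auto simp: T_def)
   show "\<bar>exp (\<theta> * s) * US \<mu>1 s - A0\<bar> <= \<delta> & \<bar>exp (\<theta> * s) * US \<mu>2 s - A0\<bar> <= \<delta> &
    \<bar>\<kappa> s * exp (- m * s) - k0\<bar> <= \<delta> & exp (\<theta> * s) * \<phi> s <= 1 &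
    \<bar>exp (\<theta> * s) * (VS \<mu>1 s + \<theta> * US \<mu>1 s)\<bar> <= max M1 M2 & \<bar>exp (\<theta> * s) * (VS \<mu>2 s + \<theta> * US \<mu>2 s)\<bar> <= max M1 M2"
    using T0[OF s(1)] M1[OF s(2)] M2[OF s(2)] unfolding rho_def gg_def by (auto simp: max.coboundedI1 max.coboundedI2)
  qed
  have KK: "K * \<bar>\<mu>1 - \<mu>2\<bar> <= (K + K2) * \<bar>\<mu>1 - \<mu>2\<bar>" "K2 * \<bar>\<mu>1 - \<mu>2\<bar> <= (K + K2) * \<bar>\<mu>1 - \<mu>2\<bar>"
   using K K2 by (auto intro!: mult_right_mono)
  show "exp (\<theta> * t) * \<bar>US \<mu>1 t - US \<mu>2 t\<bar> <= (K + K2) * \<bar>\<mu>1 - \<mu>2\<bar> & exp (\<theta> * t) * \<bar>VS \<mu>1 t - VS \<mu>2 t\<bar> <= (K + K2) * \<bar>\<mu>1 - \<mu>2\<bar>"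
  proof (cases "t <= T")
   case True
   from low[OF this] show ?thesis using KK by linarith
  next
   case False
   have un: "\<bar>x\<bar> <= exp (- \<theta> * T) * K * \<bar>\<mu>1 - \<mu>2\<bar>" if "exp (\<theta> * T) * \<bar>x\<bar> <= K * \<bar>\<mu>1 - \<mu>2\<bar>" for x
   proof -
    have "exp (- \<theta> * T) * (exp (\<theta> * T) * \<bar>x\<bar>) <= exp (- \<theta> * T) * (K * \<bar>\<mu>1 - \<mu>2\<bar>)" using that by (intro mult_left_mono) auto
    then show ?thesis by (simp only: exp_neg_cancel mult.assoc)
   qed
   have UT: "US \<mu> T <= Mx" if "\<bar>exp (\<theta> * T) * US \<mu> T - A0\<bar> <= \<delta>" for \<mu>
   proof -
    have "exp (\<theta> * T) * US \<mu> T <= 2 * A0" using that \<delta> A0(1) by linarith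
    then have "exp (- \<theta> * T) * (exp (\<theta> * T) * US \<mu> T) <= exp (- \<theta> * T) * (2 * A0)" by (intro mult_left_mono) auto
    then show ?thesis by (simp only: exp_neg_cancel Mx_def)
   qed
   have TTb: "T <= Tb" by (simp add: T_def)
   have UM: "US \<mu>1 s <= Mx & US \<mu>2 s <= Mx" if "T <= s" for s
    using descending_mono[OF branchD(1)[OF b1] that] descending_mono[OF branchD(1)[OF b2] that]
     UT[of \<mu>1] UT[of \<mu>2] M1[OF TTb] M2[OF TTb] by linarith
   define Q where "Q = K' * (\<bar>US \<mu>1 T - US \<mu>2 T\<bar> + \<bar>VS \<mu>1 T - VS \<mu>2 T\<bar> + \<bar>\<mu>1 - \<mu>2\<bar>)"
   have f: "\<bar>US \<mu>1 t - US \<mu>2 t\<bar> <= Q" "\<bar>VS \<mu>1 t - VS \<mu>2 t\<bar> <= Q"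
    using K'(2)[OF branchD(2)[OF b1] branchD(2)[OF b2], of t] UM t False by (auto simp: Q_def)
   have "Q <= K' * ((2 * (exp (- \<theta> * T) * K) + 1) * \<bar>\<mu>1 - \<mu>2\<bar>)" unfolding Q_def
   proof (rule mult_left_mono[OF _ K'(1)])
    have "\<bar>US \<mu>1 T - US \<mu>2 T\<bar> <= exp (- \<theta> * T) * K * \<bar>\<mu>1 - \<mu>2\<bar>" "\<bar>VS \<mu>1 T - VS \<mu>2 T\<bar> <= exp (- \<theta> * T) * K * \<bar>\<mu>1 - \<mu>2\<bar>"
     using low[OF order_refl] un by blast+
    then show "\<bar>US \<mu>1 T - US \<mu>2 T\<bar> + \<bar>VS \<mu>1 T - VS \<mu>2 T\<bar> + \<bar>\<mu>1 - \<mu>2\<bar> <= (2 * (exp (- \<theta> * T) * K) + 1) * \<bar>\<mu>1 - \<mu>2\<bar>"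
     by (simp add: algebra_simps)
   qed
   then have Qb: "exp (\<theta> * R) * Q <= K2 * \<bar>\<mu>1 - \<mu>2\<bar>" by (simp add: K2_def mult.assoc)
   have fin: "exp (\<theta> * t) * x <= (K + K2) * \<bar>\<mu>1 - \<mu>2\<bar>" if "x <= Q" "0 <= x" for x
   proof -
    have "exp (\<theta> * t) * x <= exp (\<theta> * R) * Q" using that t theta by (intro mult_mono) auto
    then show ?thesis using Qb KK(2) by linarith
   qed
   show ?thesis using fin[OF f(1)] fin[OF f(2)] by simp
  qed
 qed
qed

lemma sol_isCont:
 assumes "0 <= \<mu>0" "0 < \<epsilon>"
 obtains e where "0 < e" "!!\<mu>. 0 <= \<mu> ==> \<bar>\<mu> - \<mu>0\<bar> < e ==> \<bar>US \<mu> t - US \<mu>0 t\<bar> < \<epsilon> & \<bar>VS \<mu> t - VS \<mu>0 t\<bar> < \<epsilon>"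
proof -
 obtain K where K: "0 <= K" "!!\<mu>1 \<mu>2 s. 0 <= \<mu>1 ==> \<mu>1 <= \<mu>0 + 1 ==> 0 <= \<mu>2 ==> \<mu>2 <= \<mu>0 + 1 ==> s <= t ==>
  exp (\<theta> * s) * \<bar>US \<mu>1 s - US \<mu>2 s\<bar> <= K * \<bar>\<mu>1 - \<mu>2\<bar> & exp (\<theta> * s) * \<bar>VS \<mu>1 s - VS \<mu>2 s\<bar> <= K * \<bar>\<mu>1 - \<mu>2\<bar>"
  by (rule branch_continuity[of "\<mu>0 + 1" t]) (use assms(1) in \<open>auto intro: that\<close>)
 define e where "e = min 1 (\<epsilon> * exp (\<theta> * t) / (K + 1))"
 have e: "0 < e" using assms K by (simp add: e_def)
 show ?thesis
 proof (rule that[OF e])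
  fix \<mu> assume m: "0 <= \<mu>" "\<bar>\<mu> - \<mu>0\<bar> < e"
  have "e <= 1" unfolding e_def by (rule min.cobounded1)
  then have "\<mu> <= \<mu>0 + 1" using m by linarith
  then have h: "exp (\<theta> * t) * \<bar>US \<mu> t - US \<mu>0 t\<bar> <= K * \<bar>\<mu> - \<mu>0\<bar>" "exp (\<theta> * t) * \<bar>VS \<mu> t - VS \<mu>0 t\<bar> <= K * \<bar>\<mu> - \<mu>0\<bar>"
   using K(2)[of \<mu> \<mu>0 t] m assms by auto
  have "K * \<bar>\<mu> - \<mu>0\<bar> < exp (\<theta> * t) * \<epsilon>"
  proof -
   have "K * \<bar>\<mu> - \<mu>0\<bar> <= K * e" using m K by (intro mult_left_mono) auto
   also have "... < (K + 1) * e" using e by simp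
   also have "... <= (K + 1) * (\<epsilon> * exp (\<theta> * t) / (K + 1))" using K by (intro mult_left_mono) (auto simp: e_def)
   also have "... = exp (\<theta> * t) * \<epsilon>" using K by simp
   finally show ?thesis .
  qed
  then have "exp (\<theta> * t) * \<bar>US \<mu> t - US \<mu>0 t\<bar> < exp (\<theta> * t) * \<epsilon>" "exp (\<theta> * t) * \<bar>VS \<mu> t - VS \<mu>0 t\<bar> < exp (\<theta> * t) * \<epsilon>"
   using h by linarith+
  then show "\<bar>US \<mu> t - US \<mu>0 t\<bar> < \<epsilon> & \<bar>VS \<mu> t - VS \<mu>0 t\<bar> < \<epsilon>" by simp
 qed
qed

section \<open>The sets of positive and of fast parameters\<close>

definition Mset :: "real set" where "Mset = {\<mu>. 0 <= \<mu> & (\<forall>t. 0 < US \<mu> t)}"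
text \<open>A bound on exp (n t) U over all t amounts to a finite upper limit at +\<infinity>, since
  this function is nondecreasing for positive solutions (\<open>kelvin_mono\<close>).\<close>

definition fastset :: "real set" where "fastset = {\<mu> \<in> Mset. \<exists>C. \<forall>t. exp (n * t) * US \<mu> t <= C}"

lemma singular_iff: "singular \<mu> U V \<longleftrightarrow> \<mu> \<in> Mset & U = US \<mu> & V = VS \<mu>"
proof
 assume sg: "singular \<mu> U V"
 have "U = US \<mu> & V = VS \<mu>" by (rule branch_eq_sol[OF singular_branch[OF sg]])
 then show "\<mu> \<in> Mset & U = US \<mu> & V = VS \<mu>" using sg by (auto simp: Mset_def singular_def)
next
 assume "\<mu> \<in> Mset & U = US \<mu> & V = VS \<mu>"
 then show "singular \<mu> U V" using branch_singular[OF branch_sol, of \<mu>] by (auto simp: Mset_def)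
qed

lemma MsetD:
 assumes "\<mu> \<in> Mset"
 shows "0 <= \<mu>" "0 < US \<mu> t" "descending \<mu> (US \<mu>) (VS \<mu>)" "solves \<mu> (US \<mu>) (VS \<mu>)"
 using assms branchD[OF branch_sol, of \<mu>] by (auto simp: Mset_def)

lemma kelvin_mono:
 assumes D: "descending \<mu> U V" and U: "!!t. 0 < U t" and st: "s <= t"
 shows "exp (n * s) * U s <= exp (n * t) * U t"
proof (rule nondecreasing_on_ray[where f = "%t. exp (n * t) * U t" and f' = "%t. exp (n * t) * (n * U t + V t)" and T = t, OF _ _ st order_refl])
 have S: "solves \<mu> U V" using D by (simp add: descending_def)
 show "((%t. exp (n * t) * U t) has_real_derivative exp (n * x) * (n * U x + V x)) (at x)" for x
  using solvesD(1)[OF S, of x] by (auto intro!: derivative_eq_intros simp: algebra_simps)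
 show "0 <= exp (n * x) * (n * U x + V x)" for x using cone[OF D U, of x] by simp
qed

text \<open>Where \<phi> >= \<phi>(t0)/2, the source alone lowers the flux exp (n t) V by at least
  \<mu> c between t0 and t1. But -V <= n U by \<open>cone\<close>, and U(t1) is bounded
  independently of \<mu> by \<open>apriori\<close>.\<close>

lemma Mset_bounded:
 obtains B where "0 < B" "!!\<mu>. \<mu> \<in> Mset ==> \<mu> <= B"
proof -
 obtain t0 where t0: "0 < \<phi> t0" using \<phi>_nz by blast
 have "isCont \<phi> t0" using \<phi>_cont by (simp add: continuous_on_eq_continuous_at)
 then have "\<exists>d>0. \<forall>t. dist t t0 < d --> dist (\<phi> t) (\<phi> t0) < \<phi> t0 / 2"
  using t0 unfolding continuous_at_eps_delta by (meson half_gt_zero)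
 then obtain d where d: "0 < d" "!!t. dist t t0 < d ==> dist (\<phi> t) (\<phi> t0) < \<phi> t0 / 2" by blast
 define t1 where "t1 = t0 + d / 2"
 have t01: "t0 < t1" using d by (simp add: t1_def)
 have ph: "\<phi> t0 / 2 <= \<phi> t" if "t0 <= t" "t <= t1" for t
 proof -
  have "dist t t0 < d" using that d by (simp add: t1_def dist_real_def)
  from d(2)[OF this] show ?thesis by (simp add: dist_real_def abs_if split: if_splits)
 qed
 have "compact (\<kappa> ` {t1 - 2..t1})" by (intro compact_continuous_image continuous_on_subset[OF \<kappa>_cont]) auto
 moreover have "\<kappa> ` {t1 - 2..t1} \<noteq> {}" by simp
 ultimately obtain y where y: "y \<in> \<kappa> ` {t1 - 2..t1}" "\<forall>z\<in>\<kappa> ` {t1 - 2..t1}. y <= z" using compact_attains_inf by blast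
 from y(1) obtain x where yx: "y = \<kappa> x" by blast
 have x: "\<kappa> x <= \<kappa> s" if "s \<in> {t1 - 2..t1}" for s using y(2) that unfolding yx by blast
 define CU where "CU = (exp n / ((p - 1) * \<kappa> x)) powr (1 / (p - 1))"
 define c where "c = exp (n * t0) * (\<phi> t0 / 2) * (t1 - t0)"
 have c: "0 < c" unfolding c_def using t0 t01 by (intro mult_pos_pos) auto
 define B where "B = n * CU * exp (n * t1) / c + 1"
 have "\<mu> <= B" if mu: "\<mu> \<in> Mset" for \<mu>
 proof -
  define U where "U = US \<mu>"
  define V where "V = VS \<mu>"
  have D: "descending \<mu> U V" and S: "solves \<mu> U V" and U: "!!t. 0 < U t" and m0: "0 <= \<mu>"
   using MsetD[OF mu] by (auto simp: U_def V_def)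
  have "U t1 powr (p - 1) <= exp n / ((p - 1) * \<kappa> x)" by (rule apriori[OF D U \<kappa>_pos]) (use x in auto)
  then have "(U t1 powr (p - 1)) powr (1 / (p - 1)) <= CU" unfolding CU_def using p by (intro powr_mono2) auto
  then have UC: "U t1 <= CU" using U[of t1] p by (simp add: powr_powr)
  define Z where "Z r = exp (n * r) * V r + exp (n * t0) * (\<mu> * (\<phi> t0 / 2)) * r" for r
  have "Z t1 <= Z t0"
  proof (rule DERIV_nonpos_imp_nonincreasing[where f = Z and a = t0 and b = t1])
   fix r assume r: "t0 <= r" "r <= t1"
   have "(Z has_real_derivative - exp (n * r) * force \<mu> U r + exp (n * t0) * (\<mu> * (\<phi> t0 / 2))) (at r)"
    unfolding Z_def by (rule derivative_eq_intros flux_derivative[OF S] refl)+ simp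
   moreover have "exp (n * t0) * (\<mu> * (\<phi> t0 / 2)) <= exp (n * r) * force \<mu> U r"
   proof (rule mult_mono)
    show "exp (n * t0) <= exp (n * r)" using n r by simp
    have "\<mu> * (\<phi> t0 / 2) <= \<mu> * \<phi> r" using ph[OF r] m0 by (intro mult_left_mono)
    moreover have "0 <= \<kappa> r * (max 0 (U r)) powr p" using \<kappa>_pos[of r] by simp
    ultimately show "\<mu> * (\<phi> t0 / 2) <= force \<mu> U r" by (simp add: force_def)
   qed (use m0 t0 in auto)
   ultimately show "\<exists>y. (Z has_real_derivative y) (at r) & y <= 0" by fastforce
  qed (use t01 in simp)
  moreover have "exp (n * t0) * V t0 < 0" using D by (simp add: descending_def mult_pos_neg)
  moreover have "exp (n * t0) * (\<mu> * (\<phi> t0 / 2)) * t1 - exp (n * t0) * (\<mu> * (\<phi> t0 / 2)) * t0 = \<mu> * c"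
   by (simp add: c_def algebra_simps)
  ultimately have "\<mu> * c <= - (exp (n * t1) * V t1)" unfolding Z_def by linarith
  also have "... <= exp (n * t1) * (n * U t1)"
  proof -
   have "- V t1 <= n * U t1" using cone[OF D U, of t1] by simp
   then have "exp (n * t1) * (- V t1) <= exp (n * t1) * (n * U t1)" by (intro mult_left_mono) auto
   then show ?thesis by simp
  qed
  also have "... <= exp (n * t1) * (n * CU)" using UC n by (intro mult_left_mono) auto
  finally have "\<mu> <= exp (n * t1) * (n * CU) / c" using c by (simp add: pos_le_divide_eq)
  then show ?thesis by (simp add: B_def ac_simps)
 qed
 moreover have "0 < B"
 proof -
  have "0 <= CU" by (simp add: CU_def)
  then have "0 <= n * CU * exp (n * t1) / c" using n c by simp
  then show ?thesis by (simp add: B_def)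
 qed
 ultimately show ?thesis using that by blast
qed

text \<open>Since U decreases strictly, a nonpositive value at t gives a negative one at t + 1,
  which survives small changes of \<mu>.\<close>

lemma complement_open:
 assumes "0 <= \<mu>0" "\<mu>0 \<notin> Mset"
 obtains e where "0 < e" "!!\<mu>. 0 <= \<mu> ==> \<bar>\<mu> - \<mu>0\<bar> < e ==> \<mu> \<notin> Mset"
proof -
 obtain t where t: "US \<mu>0 t <= 0" using assms by (auto simp: Mset_def not_less)
 have br: "branch \<mu>0 (US \<mu>0) (VS \<mu>0)" by (rule branch_sol[OF assms(1)])
 have "US \<mu>0 (t + 1) < US \<mu>0 t" by (rule DERIV_neg_imp_decreasing[where f = "US \<mu>0" and a = t and b = "t + 1"])
   (use solvesD(1)[OF branchD(2)[OF br]] branchD(4)[OF br] in auto)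
 then have neg: "0 < - US \<mu>0 (t + 1)" using t by simp
 obtain e where e: "0 < e" "!!\<mu>. 0 <= \<mu> ==> \<bar>\<mu> - \<mu>0\<bar> < e ==> \<bar>US \<mu> (t + 1) - US \<mu>0 (t + 1)\<bar> < - US \<mu>0 (t + 1) & \<bar>VS \<mu> (t + 1) - VS \<mu>0 (t + 1)\<bar> < - US \<mu>0 (t + 1)"
  using sol_isCont[OF assms(1) neg, of "t + 1"] by blast
 show ?thesis
 proof (rule that[OF e(1)])
  fix \<mu> assume "0 <= \<mu>" "\<bar>\<mu> - \<mu>0\<bar> < e"
  from e(2)[OF this] have "US \<mu> (t + 1) < 0" by linarith
  then show "\<mu> \<notin> Mset" by (auto simp: Mset_def not_less intro!: exI[of _ "t + 1"])
 qed
qed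

end

section \<open>Behaviour at infinity\<close>

lemma exp_mult_unbounded:
 fixes c w C a :: real
 assumes "0 < c" "0 < w"
 obtains t where "a <= t" "C < w * exp (c * t)"
proof -
 have "filterlim (%s. w * exp (c * s)) at_top at_top"
  by (intro filterlim_tendsto_pos_mult_at_top[OF tendsto_const assms(2)] filterlim_compose[OF exp_at_top]
    filterlim_tendsto_pos_mult_at_top[OF tendsto_const assms(1) filterlim_ident])
 then have "\<forall>\<^sub>F s in at_top. C < w * exp (c * s)" by (simp add: filterlim_at_top_dense)
 then have "\<forall>\<^sub>F s in at_top. a <= s & C < w * exp (c * s)" using eventually_ge_at_top[of a] by eventually_elim simp
 then have "\<exists>s. a <= s & C < w * exp (c * s)" using eventually_happens by fastforce
 then show ?thesis using that by blast
qed

context emden_fowler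
begin

text \<open>The constants of the alternative at +\<infinity>, valid for all \<mu> <= B at once: an
  upward crossing of \<sigma> traps, while staying below \<open>s1\<close>, which exceeds \<sigma>,
  forces exp (n t) U to be bounded.\<close>

lemma top_constants:
 assumes B: "0 <= B"
 obtains \<sigma> \<eta> w0 \<gamma> c3 C3 c4 \<epsilon> s1 T where "trapping \<theta>1 k1 (Wmax l k1) \<sigma> \<eta> w0 \<gamma> c3 C3 c4"
  "C3 * \<epsilon>^2 < c3 * (- \<eta> - bottom \<theta>1 k1)" "\<sigma> < s1"
  "!!yl. 0 < yl ==> \<exists>T1 D1 D2. 0 <= D1 & 0 <= D2 & (\<forall>\<mu> U V R t. T1 <= R --> R <= t --> \<mu> <= B --> descending \<mu> U V
   --> (\<forall>t. 0 < U t) --> yl <= exp (n * R) * U R --> (\<forall>t\<ge>R. exp (\<theta>1 * t) * U t <= s1)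
   --> exp (n * t) * U t <= exp (n * R) * U R + D1 * (exp (n * R) * U R) powr p + D2)"
  "!!\<mu> U V t. descending \<mu> U V ==> \<mu> <= B ==> 0 < U t ==> T <= t ==>
   exp (\<theta>1 * t) * U t <= Wmax l k1 & \<bar>err \<theta>1 l k1 \<mu> t (exp (\<theta>1 * t) * U t)\<bar> <= \<epsilon>"
proof -
 obtain s1 where s1: "0 < s1" and sm: "!!B yl. 0 <= B ==> 0 < yl ==> \<exists>T1 D1 D2. 0 <= D1 & 0 <= D2 & (\<forall>\<mu> U V R t. T1 <= R --> R <= t --> \<mu> <= B --> descending \<mu> U V
   --> (\<forall>t. 0 < U t) --> yl <= exp (n * R) * U R --> (\<forall>t\<ge>R. exp (\<theta>1 * t) * U t <= s1)
   --> exp (n * t) * U t <= exp (n * R) * U R + D1 * (exp (n * R) * U R) powr p + D2)" by (fact small_top)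
 obtain \<sigma> \<eta> w0 \<gamma> c3 C3 c4 where \<sigma>s: "\<sigma> < s1" and tr: "trapping \<theta>1 k1 (Wmax l k1) \<sigma> \<eta> w0 \<gamma> c3 C3 c4"
  using trapping_exists[OF theta(4,5) k1 s1] by blast
 have c: "0 < c3" "0 <= C3" "bottom \<theta>1 k1 < - \<eta>" using tr by (auto simp: trapping_def)
 define \<epsilon> where "\<epsilon> = sqrt (c3 * (- \<eta> - bottom \<theta>1 k1) / (C3 + 1))"
 have q: "0 < c3 * (- \<eta> - bottom \<theta>1 k1)" using c by simp
 have \<epsilon>: "0 < \<epsilon>" "C3 * \<epsilon>^2 < c3 * (- \<eta> - bottom \<theta>1 k1)" using q c by (auto simp: \<epsilon>_def field_simps)
 have W0: "0 <= Wmax l k1" by (simp add: Wmax_def)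
 have "\<forall>\<^sub>F t in at_top. \<forall>\<mu> w. 0 <= \<mu> & \<mu> <= B & 0 <= w & w <= Wmax l k1 --> \<bar>err \<theta>1 l k1 \<mu> t w\<bar> <= \<epsilon>"
  using theta by (intro err_small[OF \<kappa>_top phi_top_limit W0 B \<epsilon>(1)]) simp
 then have "\<forall>\<^sub>F t in at_top. (\<forall>\<mu> w. 0 <= \<mu> & \<mu> <= B & 0 <= w & w <= Wmax l k1 --> \<bar>err \<theta>1 l k1 \<mu> t w\<bar> <= \<epsilon>)
   & k1 / 2 <= \<kappa> t * exp (- l * t)" using kappa_eventually_top by eventually_elim simp
 then obtain T where T: "!!t. T <= t ==> (\<forall>\<mu> w. 0 <= \<mu> & \<mu> <= B & 0 <= w & w <= Wmax l k1 --> \<bar>err \<theta>1 l k1 \<mu> t w\<bar> <= \<epsilon>)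
   & k1 / 2 <= \<kappa> t * exp (- l * t)" by (auto simp: eventually_at_top_linorder)
 show ?thesis
 proof (rule that[OF tr \<epsilon>(2) \<sigma>s sm[OF B]])
  fix \<mu> U V t assume D: "descending \<mu> U V" and mB: "\<mu> <= B" and U: "0 < U t" and t: "T + 2 <= t"
  have W: "exp (\<theta>1 * t) * U t <= Wmax l k1" by (rule W_bound[OF D U k1 l theta(6)]) (use T t in auto)
  have "T <= t" using t by simp
  moreover have "0 <= \<mu>" using D by (simp add: descending_def)
  ultimately have "\<bar>err \<theta>1 l k1 \<mu> t (exp (\<theta>1 * t) * U t)\<bar> <= \<epsilon>" using T[of t] mB W U by simp
  then show "exp (\<theta>1 * t) * U t <= Wmax l k1 & \<bar>err \<theta>1 l k1 \<mu> t (exp (\<theta>1 * t) * U t)\<bar> <= \<epsilon>" using W by simp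
 qed
qed

text \<open>A positive lower bound for the scaled solution makes exp (n t) U grow at least like exp
  ((n - \<theta>1) t).\<close>

lemma bounded_below_not_fast:
 assumes "0 < w" "!!t. c <= t ==> w <= exp (\<theta>1 * t) * US \<mu> t"
 shows "\<mu> \<notin> fastset"
proof
 assume "\<mu> \<in> fastset"
 then obtain C where C: "!!t. exp (n * t) * US \<mu> t <= C" by (auto simp: fastset_def)
 have "0 < n - \<theta>1" using theta by simp
 then obtain t where t: "c <= t" "C < w * exp ((n - \<theta>1) * t)" using exp_mult_unbounded[OF _ assms(1)] by blast
 have "exp ((n - \<theta>1) * t) * w <= exp ((n - \<theta>1) * t) * (exp (\<theta>1 * t) * US \<mu> t)"
  using assms(2)[OF t(1)] by (intro mult_left_mono) auto
 also have "... = exp (n * t) * US \<mu> t"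
 proof -
  have "(n - \<theta>1) * t + \<theta>1 * t = n * t" by (simp add: algebra_simps)
  then have "exp ((n - \<theta>1) * t) * exp (\<theta>1 * t) = exp (n * t)" by (simp only: exp_add[symmetric])
  then show ?thesis by (simp only: mult.assoc[symmetric])
 qed
 finally show False using C[of t] t by (simp add: mult.commute)
qed

lemma energy_isCont:
 assumes "0 <= \<mu>0"
 shows "((%\<mu>. US \<mu> c) \<longlongrightarrow> US \<mu>0 c) (at \<mu>0 within {0..})"
  "((%\<mu>. VS \<mu> c) \<longlongrightarrow> VS \<mu>0 c) (at \<mu>0 within {0..})"
proof -
 have *: "\<forall>\<^sub>F \<mu> in at \<mu>0 within {0..}. dist (US \<mu> c) (US \<mu>0 c) < e & dist (VS \<mu> c) (VS \<mu>0 c) < e" if e: "0 < e" for e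
 proof -
  obtain d where d: "0 < d" "!!\<mu>. 0 <= \<mu> ==> \<bar>\<mu> - \<mu>0\<bar> < d ==> \<bar>US \<mu> c - US \<mu>0 c\<bar> < e & \<bar>VS \<mu> c - VS \<mu>0 c\<bar> < e"
   using sol_isCont[OF assms e, of c] by blast
  show ?thesis unfolding eventually_at using d by (intro exI[of _ d]) (auto simp: dist_real_def)
 qed
 show "((%\<mu>. US \<mu> c) \<longlongrightarrow> US \<mu>0 c) (at \<mu>0 within {0..})" by (rule tendstoI, rule eventually_mono[OF *]) auto
 show "((%\<mu>. VS \<mu> c) \<longlongrightarrow> VS \<mu>0 c) (at \<mu>0 within {0..})" by (rule tendstoI, rule eventually_mono[OF *]) auto
qed

text \<open>The solution at \<open>\<mu>0\<close> cannot remain below \<sigma>, by the smallness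
  estimate at +\<infinity>, and so ends up above \<open>w0\<close>. There the energy decays to an
  error level lying below -\<eta>. Energy strictly below -\<eta> at one time is an open condition on
  \<mu>, and it traps the neighbouring solutions, which are therefore positive and not fast.\<close>

lemma slow_open:
 assumes m0: "\<mu>0 \<in> Mset" "\<mu>0 \<notin> fastset"
 obtains e where "0 < e" "!!\<mu>. 0 <= \<mu> ==> \<bar>\<mu> - \<mu>0\<bar> < e ==> \<mu> \<in> Mset - fastset"
proof -
 have \<mu>0: "0 <= \<mu>0" and U0: "!!t. 0 < US \<mu>0 t" and D0: "descending \<mu>0 (US \<mu>0) (VS \<mu>0)" and S0: "solves \<mu>0 (US \<mu>0) (VS \<mu>0)"
  using MsetD[OF m0(1)] by auto
 have B: "0 <= \<mu>0 + 1" using \<mu>0 by simp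
 obtain \<sigma> \<eta> w0 \<gamma> c3 C3 c4 \<epsilon> s1 T where tr: "trapping \<theta>1 k1 (Wmax l k1) \<sigma> \<eta> w0 \<gamma> c3 C3 c4"
  and \<epsilon>: "C3 * \<epsilon>^2 < c3 * (- \<eta> - bottom \<theta>1 k1)" and \<sigma>s: "\<sigma> < s1"
  and sm: "!!yl. 0 < yl ==> \<exists>T1 D1 D2. 0 <= D1 & 0 <= D2 & (\<forall>\<mu> U V R t. T1 <= R --> R <= t --> \<mu> <= \<mu>0 + 1 --> descending \<mu> U V
   --> (\<forall>t. 0 < U t) --> yl <= exp (n * R) * U R --> (\<forall>t\<ge>R. exp (\<theta>1 * t) * U t <= s1)
   --> exp (n * t) * U t <= exp (n * R) * U R + D1 * (exp (n * R) * U R) powr p + D2)"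
  and bd: "!!\<mu> U V t. descending \<mu> U V ==> \<mu> <= \<mu>0 + 1 ==> 0 < U t ==> T <= t ==>
   exp (\<theta>1 * t) * U t <= Wmax l k1 & \<bar>err \<theta>1 l k1 \<mu> t (exp (\<theta>1 * t) * U t)\<bar> <= \<epsilon>"
  by (fact top_constants[OF B])
 have c: "0 < c3" "0 <= C3" "0 < w0" "w0 <= \<sigma>" "0 < \<sigma>" using tr by (auto simp: trapping_def)
 define W where "W t = exp (\<theta>1 * t) * US \<mu>0 t" for t
 have Wb: "W t <= Wmax l k1" "\<bar>err \<theta>1 l k1 \<mu>0 t (W t)\<bar> <= \<epsilon>" if "T <= t" for t
  using bd[OF D0 _ U0 that] by (auto simp: W_def)
 have stay: "\<exists>a\<ge>T. \<forall>t\<ge>a. w0 <= W t"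
 proof (cases "\<exists>a\<ge>T. \<forall>t\<ge>a. \<sigma> < W t")
  case True
  then show ?thesis using c by force
 next
  case False
  then obtain a where a: "T <= a" "W a <= \<sigma>" by (meson not_le order_refl)
  show ?thesis
  proof (cases "\<exists>b\<ge>a. \<sigma> < W b")
   case True
   then obtain b where b: "a <= b" "\<sigma> < W b" by blast
   have "w0 <= W t" if t: "b <= t" for t unfolding W_def by (rule rise_traps(2)[OF tr D0 theta(6) U0 _ _ \<epsilon>, where a = a and b = b])
     (use a b t Wb in \<open>auto simp: W_def\<close>)
   then show ?thesis using a b by (intro exI[of _ b]) auto
  next
   case False
   define yl where "yl = exp (n * a) * US \<mu>0 a"
   have yl: "0 < yl" using U0 by (simp add: yl_def)
   from sm[OF yl] obtain T1 D1 D2 where T1: "!!\<mu> U V R t. T1 <= R ==> R <= t ==> \<mu> <= \<mu>0 + 1 ==> descending \<mu> U V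
   ==> \<forall>t. 0 < U t ==> yl <= exp (n * R) * U R ==> \<forall>t\<ge>R. exp (\<theta>1 * t) * U t <= s1
   ==> exp (n * t) * U t <= exp (n * R) * U R + D1 * (exp (n * R) * U R) powr p + D2" by blast
   define R where "R = max a T1"
   have R: "a <= R" "T1 <= R" by (auto simp: R_def)
   define C where "C = exp (n * R) * US \<mu>0 R + D1 * (exp (n * R) * US \<mu>0 R) powr p + D2"
   have big: "exp (n * t) * US \<mu>0 t <= C" if t: "R <= t" for t unfolding C_def
   proof (rule T1[OF R(2) t _ D0])
    show "yl <= exp (n * R) * US \<mu>0 R" unfolding yl_def by (rule kelvin_mono[OF D0 U0 R(1)])
    show "\<forall>t\<ge>R. exp (\<theta>1 * t) * US \<mu>0 t <= s1"
    proof (intro allI impI)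
     fix s assume "R <= s"
     then have "W s <= \<sigma>" using False R by (meson not_le order_trans)
     then show "exp (\<theta>1 * s) * US \<mu>0 s <= s1" using \<sigma>s by (simp add: W_def)
    qed
   qed (use U0 in auto)
   have "exp (n * t) * US \<mu>0 t <= C" for t
   proof (cases "R <= t")
    case True then show ?thesis by (rule big)
   next
    case False
    then show ?thesis using kelvin_mono[OF D0 U0, of t R] big[OF order_refl] by simp
   qed
   then have "\<mu>0 \<in> fastset" using m0(1) by (auto simp: fastset_def)
   then show ?thesis using m0(2) by simp
  qed
 qed
 then obtain a where a: "T <= a" "!!t. a <= t ==> w0 <= W t" by blast
 define E where "E t = energy \<theta>1 k1 \<gamma> (US \<mu>0) (VS \<mu>0) t - bottom \<theta>1 k1" for t
 have dec: "E t <= exp (- c3 * (t - a)) * \<bar>E a\<bar> + C3 * \<epsilon>^2 / c3" if t: "a <= t" for t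
 proof (rule forward_decay[OF c(1) _ _ _ t])
  show "0 <= C3 * \<epsilon>^2" using c by simp
  fix s assume s: "a <= s"
  show "(E has_real_derivative
    lyap' (n - 2 * \<theta>1) (\<theta>1 * (n - \<theta>1)) k1 p (Aeq \<theta>1 k1) \<gamma> (W s) (exp (\<theta>1 * s) * (VS \<mu>0 s + \<theta>1 * US \<mu>0 s)) (err \<theta>1 l k1 \<mu>0 s (W s))) (at s)"
   unfolding E_def[abs_def] W_def using DERIV_diff[OF energy_derivative[OF S0 U0 theta(6), where k = k1 and \<gamma> = \<gamma>] DERIV_const] by simp
  have "T <= s" using a s by simp
  note w = a(2)[OF s] Wb[OF this]
  show "lyap' (n - 2 * \<theta>1) (\<theta>1 * (n - \<theta>1)) k1 p (Aeq \<theta>1 k1) \<gamma> (W s) (exp (\<theta>1 * s) * (VS \<mu>0 s + \<theta>1 * US \<mu>0 s)) (err \<theta>1 l k1 \<mu>0 s (W s))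
    <= - c3 * E s + C3 * \<epsilon>^2" using tr w unfolding trapping_def energy_def E_def W_def by blast
 qed
 have "C3 * \<epsilon>^2 / c3 < - \<eta> - bottom \<theta>1 k1" using \<epsilon> c by (simp add: field_simps)
 then have gap: "0 < - \<eta> - bottom \<theta>1 k1 - C3 * \<epsilon>^2 / c3" by simp
 \<comment> \<open>A time by which the initial energy is damped below the gap between the error
   level and -\<eta>.\<close>
 then obtain t where t: "a <= t" "exp (c3 * a) * \<bar>E a\<bar> < (- \<eta> - bottom \<theta>1 k1 - C3 * \<epsilon>^2 / c3) * exp (c3 * t)"
  using exp_mult_unbounded[OF c(1)] by blast
 have "exp (- c3 * t) * (exp (c3 * a) * \<bar>E a\<bar>) < exp (- c3 * t) * ((- \<eta> - bottom \<theta>1 k1 - C3 * \<epsilon>^2 / c3) * exp (c3 * t))"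
  using t by (intro mult_strict_left_mono) auto
 also have "... = - \<eta> - bottom \<theta>1 k1 - C3 * \<epsilon>^2 / c3" by (simp add: exp_minus)
 also have "exp (- c3 * t) * (exp (c3 * a) * \<bar>E a\<bar>) = exp (- c3 * (t - a)) * \<bar>E a\<bar>"
 proof -
  have "- c3 * t + c3 * a = - c3 * (t - a)" by (simp add: algebra_simps)
  then have "exp (- c3 * t) * exp (c3 * a) = exp (- c3 * (t - a))" by (simp only: exp_add[symmetric])
  then show ?thesis by (simp only: mult.assoc[symmetric])
 qed
 finally have En: "energy \<theta>1 k1 \<gamma> (US \<mu>0) (VS \<mu>0) t < - \<eta>" using dec[OF t(1)] by (simp add: E_def)
 have "((%\<mu>. energy \<theta>1 k1 \<gamma> (US \<mu>) (VS \<mu>) t) \<longlongrightarrow> energy \<theta>1 k1 \<gamma> (US \<mu>0) (VS \<mu>0) t) (at \<mu>0 within {0..})"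
  unfolding energy_def lyap_def well_def by (intro tendsto_intros energy_isCont[OF \<mu>0]) (use U0[of t] p in auto)
 then have "\<forall>\<^sub>F \<mu> in at \<mu>0 within {0..}. energy \<theta>1 k1 \<gamma> (US \<mu>) (VS \<mu>) t < - \<eta>" using En by (intro order_tendstoD)
 moreover have "\<forall>\<^sub>F \<mu> in at \<mu>0 within {0..}. 0 < US \<mu> t" using energy_isCont(1)[OF \<mu>0] U0[of t] by (intro order_tendstoD)
 ultimately have "\<forall>\<^sub>F \<mu> in at \<mu>0 within {0..}. energy \<theta>1 k1 \<gamma> (US \<mu>) (VS \<mu>) t < - \<eta> & 0 < US \<mu> t" by (rule eventually_conj)
 then obtain d where d0: "0 < d" "\<forall>\<mu>\<in>{0..}. \<mu> \<noteq> \<mu>0 & dist \<mu> \<mu>0 < d --> energy \<theta>1 k1 \<gamma> (US \<mu>) (VS \<mu>) t < - \<eta> & 0 < US \<mu> t"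
  unfolding eventually_at by blast
 have d: "energy \<theta>1 k1 \<gamma> (US \<mu>) (VS \<mu>) t < - \<eta>" "0 < US \<mu> t" if "0 <= \<mu>" "\<bar>\<mu> - \<mu>0\<bar> < d" for \<mu>
  using d0(2) that En U0[of t] by (cases "\<mu> = \<mu>0"; auto simp: dist_real_def)+
 have tT: "T <= t" using a t by simp
 show ?thesis
 proof (rule that[of "min d 1"])
  show "0 < min d 1" using d0 by simp
  fix \<mu> assume m: "0 <= \<mu>" "\<bar>\<mu> - \<mu>0\<bar> < min d 1"
  then have md: "\<bar>\<mu> - \<mu>0\<bar> < d" and mB: "\<mu> <= \<mu>0 + 1" by auto
  note e = d[OF m(1) md]
  have D: "descending \<mu> (US \<mu>) (VS \<mu>)" and S: "solves \<mu> (US \<mu>) (VS \<mu>)" using branchD[OF branch_sol[OF m(1)]] by auto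
  have low: "w0 <= exp (\<theta>1 * s) * US \<mu> s" if s: "t <= s" "0 < US \<mu> s" for s
  proof (rule trap(2)[OF tr S theta(6) _ _ _ \<epsilon> less_imp_le[OF e(1)] s(1)])
   fix r assume r: "t <= r" "r <= s"
   show Ur: "0 < US \<mu> r" using descending_mono[OF D r(2)] s(2) by simp
   have "T <= r" using tT r by simp
   from bd[OF D mB Ur this] show "exp (\<theta>1 * r) * US \<mu> r <= Wmax l k1" "\<bar>err \<theta>1 l k1 \<mu> r (exp (\<theta>1 * r) * US \<mu> r)\<bar> <= \<epsilon>" by auto
  qed
  \<comment> \<open>Losing positivity would require passing through the scaled value w0/2, where U
    is still positive and the scaled solution hence, by \<open>low\<close>, at least
    \<open>w0\<close>.\<close>
  have pos: "0 < US \<mu> s" for s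
  proof (rule ccontr)
   assume neg: "\<not> 0 < US \<mu> s"
   then have ts: "t <= s" using descending_mono[OF D, of s t] e(2) by (cases "t <= s") auto
   have "continuous_on {t..s} (US \<mu>)" by (rule DERIV_atLeastAtMost_imp_continuous_on) (use solvesD(1)[OF S] in blast)
   then have cont: "continuous_on {t..s} (%r. exp (\<theta>1 * r) * US \<mu> r)" by (intro continuous_intros)
   have le: "exp (\<theta>1 * s) * US \<mu> s <= w0 / 2" "w0 / 2 <= exp (\<theta>1 * t) * US \<mu> t"
    using neg low[OF order_refl e(2)] c by (auto simp: mult_le_0_iff not_less intro: order_trans[of _ 0])
   obtain r where r: "t <= r" "r <= s" "exp (\<theta>1 * r) * US \<mu> r = w0 / 2" using IVT2'[OF le ts cont] by blast
   have "0 < exp (\<theta>1 * r) * US \<mu> r" unfolding r(3) using c by simp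
   then have "0 < US \<mu> r" by (simp add: zero_less_mult_iff)
   from low[OF r(1) this] show False unfolding r(3) using c by simp
  qed
  have "\<mu> \<in> Mset" using m pos by (simp add: Mset_def)
  moreover have "\<mu> \<notin> fastset" by (rule bounded_below_not_fast[OF c(3), of t]) (use low pos in auto)
  ultimately show "\<mu> \<in> Mset - fastset" by simp
 qed
qed

text \<open>For \<mu> near \<open>\<mu>0\<close> the scaled solution is below \<sigma> at a fixed
  time R. A fast one cannot exceed \<sigma> later, since this would trap it, so the smallness
  estimate bounds it uniformly in \<mu>. The uniformity allows one common domain for the
  Kelvin-transformed family.\<close>

lemma near_fast:
 assumes m0: "\<mu>0 \<in> fastset"
 obtains yl e R Bd where "0 < yl" "0 < e"
  "!!\<mu> t. \<mu> \<in> fastset ==> \<bar>\<mu> - \<mu>0\<bar> < e ==> R <= t ==> yl <= exp (n * t) * US \<mu> t & exp (n * t) * US \<mu> t <= Bd"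
proof -
 have M0: "\<mu>0 \<in> Mset" using m0 by (simp add: fastset_def)
 have \<mu>0: "0 <= \<mu>0" and U0: "!!t. 0 < US \<mu>0 t" and D0: "descending \<mu>0 (US \<mu>0) (VS \<mu>0)" using MsetD[OF M0] by auto
 obtain C where C: "!!t. exp (n * t) * US \<mu>0 t <= C" using m0 by (auto simp: fastset_def)
 have B: "0 <= \<mu>0 + 1" using \<mu>0 by simp
 obtain \<sigma> \<eta> w0 \<gamma> c3 C3 c4 \<epsilon> s1 T where tr: "trapping \<theta>1 k1 (Wmax l k1) \<sigma> \<eta> w0 \<gamma> c3 C3 c4"
  and \<epsilon>: "C3 * \<epsilon>^2 < c3 * (- \<eta> - bottom \<theta>1 k1)" and \<sigma>s: "\<sigma> < s1"
  and sm: "!!yl. 0 < yl ==> \<exists>T1 D1 D2. 0 <= D1 & 0 <= D2 & (\<forall>\<mu> U V R t. T1 <= R --> R <= t --> \<mu> <= \<mu>0 + 1 --> descending \<mu> U V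
   --> (\<forall>t. 0 < U t) --> yl <= exp (n * R) * U R --> (\<forall>t\<ge>R. exp (\<theta>1 * t) * U t <= s1)
   --> exp (n * t) * U t <= exp (n * R) * U R + D1 * (exp (n * R) * U R) powr p + D2)"
  and bd: "!!\<mu> U V t. descending \<mu> U V ==> \<mu> <= \<mu>0 + 1 ==> 0 < U t ==> T <= t ==>
   exp (\<theta>1 * t) * U t <= Wmax l k1 & \<bar>err \<theta>1 l k1 \<mu> t (exp (\<theta>1 * t) * U t)\<bar> <= \<epsilon>"
  by (fact top_constants[OF B])
 have c: "0 < w0" "0 < \<sigma>" using tr by (auto simp: trapping_def)
 \<comment> \<open>By monotonicity of exp (n t) U a value at T bounds all later ones from below; the
   factor 1/2 leaves room for varying \<mu>.\<close>
 define yl where "yl = exp (n * T) * US \<mu>0 T / 2"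
 have yl: "0 < yl" using U0 by (simp add: yl_def)
 from sm[OF yl] obtain T1 D1 D2 where D12: "0 <= D1" "0 <= D2" and T1: "!!\<mu> U V R t. T1 <= R ==> R <= t ==> \<mu> <= \<mu>0 + 1 ==> descending \<mu> U V
  ==> \<forall>t. 0 < U t ==> yl <= exp (n * R) * U R ==> \<forall>t\<ge>R. exp (\<theta>1 * t) * U t <= s1
  ==> exp (n * t) * U t <= exp (n * R) * U R + D1 * (exp (n * R) * U R) powr p + D2" by blast
 have "0 < n - \<theta>1" using theta by simp
 \<comment> \<open>Fast decay at \<open>\<mu>0\<close> means that the scaled solution is at most C
   exp (-(n - \<theta>1) t); R is chosen so late that this lies below \<sigma>.\<close>
 from exp_mult_unbounded[OF this c(2)] obtain R where R: "max T T1 <= R" "C < \<sigma> * exp ((n - \<theta>1) * R)" by blast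
 have RT: "T <= R" "T1 <= R" using R by auto
 have WR: "exp (\<theta>1 * R) * US \<mu>0 R < \<sigma>"
 proof -
  have "exp ((n - \<theta>1) * R) * (exp (\<theta>1 * R) * US \<mu>0 R) = exp (n * R) * US \<mu>0 R"
  proof -
   have "(n - \<theta>1) * R + \<theta>1 * R = n * R" by (simp add: algebra_simps)
   then have "exp ((n - \<theta>1) * R) * exp (\<theta>1 * R) = exp (n * R)" by (simp only: exp_add[symmetric])
   then show ?thesis by (simp only: mult.assoc[symmetric])
  qed
  also have "... < exp ((n - \<theta>1) * R) * \<sigma>" using C[of R] R(2) by (simp add: mult.commute)
  finally show ?thesis by simp
 qed
 define Y where "Y = exp (n * R) * US \<mu>0 R + 1"
 have "\<forall>\<^sub>F \<mu> in at \<mu>0 within {0..}. exp (\<theta>1 * R) * US \<mu> R < \<sigma>"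
  using WR by (intro order_tendstoD(2)[OF tendsto_mult_left[OF energy_isCont(1)[OF \<mu>0]]])
 moreover have "\<forall>\<^sub>F \<mu> in at \<mu>0 within {0..}. exp (n * R) * US \<mu> R < Y"
  by (intro order_tendstoD(2)[OF tendsto_mult_left[OF energy_isCont(1)[OF \<mu>0]]]) (simp add: Y_def)
 moreover have "\<forall>\<^sub>F \<mu> in at \<mu>0 within {0..}. yl < exp (n * T) * US \<mu> T"
  using U0[of T] by (intro order_tendstoD(1)[OF tendsto_mult_left[OF energy_isCont(1)[OF \<mu>0]]]) (simp add: yl_def)
 ultimately have "\<forall>\<^sub>F \<mu> in at \<mu>0 within {0..}. exp (\<theta>1 * R) * US \<mu> R < \<sigma> & exp (n * R) * US \<mu> R < Y & yl < exp (n * T) * US \<mu> T"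
  by eventually_elim simp
 then obtain d where d0: "0 < d" "\<forall>\<mu>\<in>{0..}. \<mu> \<noteq> \<mu>0 & dist \<mu> \<mu>0 < d --> exp (\<theta>1 * R) * US \<mu> R < \<sigma> & exp (n * R) * US \<mu> R < Y & yl < exp (n * T) * US \<mu> T"
  unfolding eventually_at by blast
 have d: "exp (\<theta>1 * R) * US \<mu> R < \<sigma> & exp (n * R) * US \<mu> R < Y & yl < exp (n * T) * US \<mu> T" if "0 <= \<mu>" "\<bar>\<mu> - \<mu>0\<bar> < d" for \<mu>
 proof (cases "\<mu> = \<mu>0")
  case True
  then show ?thesis using WR U0[of T] by (simp add: Y_def yl_def)
 next
  case False
  then show ?thesis using d0(2) that by (simp add: dist_real_def)
 qed
 show ?thesis
 proof (rule that[OF yl, of "min d 1" R "Y + D1 * Y powr p + D2"])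
  show "0 < min d 1" using d0 by simp
  fix \<mu> t assume mf: "\<mu> \<in> fastset" and md: "\<bar>\<mu> - \<mu>0\<bar> < min d 1" and t: "R <= t"
  have M: "\<mu> \<in> Mset" using mf by (simp add: fastset_def)
  note D = MsetD(3)[OF M] and U = MsetD(2)[OF M] and \<mu> = MsetD(1)[OF M]
  have mB: "\<mu> <= \<mu>0 + 1" and md': "\<bar>\<mu> - \<mu>0\<bar> < d" using md by auto
  note h = d[OF \<mu> md']
  have W: "exp (\<theta>1 * s) * US \<mu> s <= \<sigma>" if s: "R <= s" for s
  proof (rule ccontr)
   assume "\<not> exp (\<theta>1 * s) * US \<mu> s <= \<sigma>"
   then have s2: "\<sigma> < exp (\<theta>1 * s) * US \<mu> s" by simp
   have "w0 <= exp (\<theta>1 * r) * US \<mu> r" if r: "s <= r" for r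
   proof (rule rise_traps(2)[OF tr D theta(6) U _ _ \<epsilon> s r less_imp_le[OF conjunct1[OF h]] s2])
    fix q assume "R <= q" "q <= r"
    then have "T <= q" using RT by simp
    from bd[OF D mB U this] show "exp (\<theta>1 * q) * US \<mu> q <= Wmax l k1" "\<bar>err \<theta>1 l k1 \<mu> q (exp (\<theta>1 * q) * US \<mu> q)\<bar> <= \<epsilon>" by auto
   qed
   then show False using bounded_below_not_fast[OF c(1)] mf by blast
  qed
  have low: "yl <= exp (n * s) * US \<mu> s" if "T <= s" for s using kelvin_mono[OF D U that] h by simp
  have "exp (n * t) * US \<mu> t <= exp (n * R) * US \<mu> R + D1 * (exp (n * R) * US \<mu> R) powr p + D2"
  proof (rule T1[OF RT(2) t mB D])
   show "\<forall>t\<ge>R. exp (\<theta>1 * t) * US \<mu> t <= s1" using W \<sigma>s by force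
  qed (use U low[OF RT(1)] in auto)
  also have "... <= Y + D1 * Y powr p + D2" using h D12 p U[of R] by (intro add_mono mult_left_mono powr_mono2) auto
  finally show "yl <= exp (n * t) * US \<mu> t & exp (n * t) * US \<mu> t <= Y + D1 * Y powr p + D2" using low[of t] RT t by simp
 qed
qed

end

section \<open>Analyticity of the fast-decay condition\<close>

lemma ramp_weight:
 assumes "0 <= C"
 shows "weight I T0 (%t. C * max 0 (t - T0)) (%t. if t <= T0 then 0 else C)" unfolding weight_def
proof (intro conjI ballI allI impI)
 show "continuous_on I (%t. C * max 0 (t - T0))" by (intro continuous_intros)
 show "((%t. C * max 0 (t - T0)) has_real_derivative (if t <= T0 then 0 else C)) (at t)" if "t \<in> I - {T0}" for t
 proof (cases "t < T0")
  case True
  have "((%t. 0) has_real_derivative 0) (at t)" by simp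
  then have "((%t. C * max 0 (t - T0)) has_real_derivative 0) (at t)"
   by (rule has_field_derivative_transform_within_open[where S = "{..<T0}"]) (use True in auto)
  then show ?thesis using True by simp
 next
  case False
  then have t: "T0 < t" using that by simp
  have "((%t. C * (t - T0)) has_real_derivative C) (at t)" by (auto intro!: derivative_eq_intros)
  then have "((%t. C * max 0 (t - T0)) has_real_derivative C) (at t)"
   by (rule has_field_derivative_transform_within_open[where S = "{T0<..}"]) (use t in auto)
  then show ?thesis using t by simp
 qed
 show "\<exists>C'. \<forall>s\<le>t. C * max 0 (s - T0) <= C' & (if s <= T0 then 0 else C) <= C'" for t
 proof (intro exI[of _ "C * max 0 (t - T0) + C"] allI impI conjI)
  fix s assume "s <= t"
  then have "C * max 0 (s - T0) <= C * max 0 (t - T0)" using assms by (intro mult_left_mono) auto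
  then show "C * max 0 (s - T0) <= C * max 0 (t - T0) + C" using assms by linarith
  have "0 <= C * max 0 (t - T0)" using assms by simp
  then show "(if s <= T0 then 0 else C) <= C * max 0 (t - T0) + C" using assms by auto
 qed
qed (use assms in auto)

lemma has_vector_derivative_complex_of_real:
 "(f has_real_derivative f') (at t) ==> ((%t. complex_of_real (f t)) has_vector_derivative of_real f') (at t)"
 unfolding has_real_derivative_iff_has_vector_derivative by (rule bounded_linear.has_vector_derivative[OF bounded_linear_of_real])

lemma continuous_bound_Icc:
 fixes f :: "real => real"
 assumes "continuous_on UNIV f"
 obtains B where "0 <= B" "!!t. a <= t ==> t <= b ==> \<bar>f t\<bar> <= B"
proof -
 have "compact (f ` {a..b})" by (intro compact_continuous_image continuous_on_subset[OF assms]) auto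
 then obtain B where "!!y. y \<in> f ` {a..b} ==> norm y <= B" by (meson compact_imp_bounded bounded_iff)
 then show ?thesis by (intro that[of "max B 0"]) (auto simp: max.coboundedI1)
qed

context emden_fowler
begin

lemma scaled_ode:
 assumes S: "solves \<mu> U V" and U: "0 < U t"
 shows "((%t. exp (\<theta> * t) * U t) has_real_derivative exp (\<theta> * t) * (V t + \<theta> * U t)) (at t)"
  "((%t. exp (\<theta> * t) * (V t + \<theta> * U t)) has_real_derivative
   - aa * (exp (\<theta> * t) * (V t + \<theta> * U t)) + \<theta> * (n - \<theta>) * (exp (\<theta> * t) * U t)
    - rho t * (exp (\<theta> * t) * U t) powr p - \<mu> * gg t) (at t)"
proof -
 show "((%t. exp (\<theta> * t) * U t) has_real_derivative exp (\<theta> * t) * (V t + \<theta> * U t)) (at t)"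
  by (rule emden_ode(1)[OF S U theta(3)])
 show "((%t. exp (\<theta> * t) * (V t + \<theta> * U t)) has_real_derivative
   - aa * (exp (\<theta> * t) * (V t + \<theta> * U t)) + \<theta> * (n - \<theta>) * (exp (\<theta> * t) * U t)
    - rho t * (exp (\<theta> * t) * U t) powr p - \<mu> * gg t) (at t)" by (rule DERIV_cong[OF emden_ode(2)[OF S U theta(3), of k0]])
   (simp add: err_def rho_def gg_def aa_def algebra_simps)
qed

text \<open>The centre of the ball is the branch at \<open>\<mu>0\<close> itself, with residual (z -
  \<mu>0) \<open>gg\<close>. Its positivity yields a tube of radius \<open>\<eta>\<close> in the
  right half-plane, where the complex power is holomorphic. For real parameters the fixed point is
  identified with the branch: \<open>oscillator_decay\<close> without forcing gives equality at T0,
  and \<open>oscillator_growth\<close> carries it to R.\<close>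

lemma inner_family:
 assumes M0: "\<mu>0 \<in> Mset"
 obtains r X X1 where "0 < r" "X holomorphic_on ball (of_real \<mu>0) r" "X1 holomorphic_on ball (of_real \<mu>0) r"
  "!!\<mu>. 0 <= \<mu> ==> \<bar>\<mu> - \<mu>0\<bar> < r ==> X (of_real \<mu>) = of_real (US \<mu> R) & X1 (of_real \<mu>) = of_real (VS \<mu> R)"
proof -
 note \<mu>0 = MsetD(1)[OF M0] and U0 = MsetD(2)[OF M0] and D0 = MsetD(3)[OF M0] and S0 = MsetD(4)[OF M0]
 obtain l1 l2 :: complex and e :: real where l: "l1 + l2 = of_real aa" "l1 * l2 = of_real cc" and e: "0 < e" "e <= Re l1" "e <= Re l2"
  using characteristic_roots[OF A0(3,4)] by blast
 obtain \<epsilon>o Ko where \<epsilon>o: "0 < \<epsilon>o" and Ko: "0 <= Ko" and dec: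
  "!!(d :: real => complex) d1 h T M \<sigma> t.
   (!!t. t <= T ==> (d has_vector_derivative d1 t) (at t)) ==>
   (!!t. t <= T ==> (d1 has_vector_derivative (- (aa *\<^sub>R d1 t) - cc *\<^sub>R d t + h t)) (at t)) ==>
   (!!t. t <= T ==> norm (h t) <= \<epsilon>o * norm (d t) + \<sigma>) ==>
   (!!t. t <= T ==> norm (d t) <= M & norm (d1 t) <= M) ==> t <= T ==>
   (norm (d1 t))^2 + (norm (d t))^2 <= Ko * \<sigma>^2" by (fact oscillator_decay[OF A0(3,4)])
 define \<epsilon> where "\<epsilon> = min \<epsilon>o (e^2 / 4)"
 have \<epsilon>: "0 < \<epsilon>" "\<epsilon> <= \<epsilon>o" "\<epsilon> <= e^2 / 4" using \<epsilon>o e by (auto simp: \<epsilon>_def)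
 define mm where "mm = 4 / e"
 have mm: "0 < mm" using e by (simp add: mm_def)
 have cond1: "(\<epsilon> / e + 1 / mm) / e <= 1 / 2"
 proof -
  have "\<epsilon> / e <= (e^2 / 4) / e" using \<epsilon>(3) e by (intro divide_right_mono) auto
  moreover have "(e^2 / 4) / e = e / 4" using e by (simp add: power2_eq_square)
  moreover have "1 / mm = e / 4" by (simp add: mm_def)
  ultimately have "\<epsilon> / e + 1 / mm <= e / 4 + e / 4" by linarith
  then have "(\<epsilon> / e + 1 / mm) / e <= (e / 4 + e / 4) / e" using e by (intro divide_right_mono) auto
  then show ?thesis using e by simp
 qed
 obtain \<delta> where \<delta>: "0 < \<delta>" "\<delta> <= A0 / 2" and lip:
  "!!k (x::complex) y. \<bar>k - k0\<bar> <= \<delta> ==> norm (x - of_real A0) <= \<delta> ==> norm (y - of_real A0) <= \<delta> ==>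
   norm (of_real k * (x powr of_real p - y powr of_real p) - of_real (p * (k0 * A0 powr (p - 1))) * (x - y)) <= \<epsilon> * norm (x - y)"
  by (fact complex_small_lipschitz[OF p A0(1) k0 \<epsilon>(1)])
 define Wb where "Wb t = exp (\<theta> * t) * US \<mu>0 t" for t
 define Zb where "Zb t = exp (\<theta> * t) * (VS \<mu>0 t + \<theta> * US \<mu>0 t)" for t
 obtain Ta where Ta: "!!t. t <= Ta ==> \<bar>rho t - k0\<bar> <= \<delta>" "!!t. t <= Ta ==> gg t <= 1"
  using near_bot[OF \<delta>(1) zero_less_one] by blast
 have d2: "0 < \<delta> / 2" using \<delta> by simp
 obtain Tc M1 where Tc: "!!t. t <= Tc ==> \<bar>Wb t - A0\<bar> <= \<delta> / 2" "!!t. t <= Tc ==> \<bar>Zb t\<bar> <= M1"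
  using branch_near[OF branch_sol[OF \<mu>0] d2] unfolding Wb_def Zb_def by blast
 define T0 where "T0 = min (min Ta Tc) R"
 have T0: "T0 <= Ta" "T0 <= Tc" "T0 <= R" by (auto simp: T0_def)
 \<comment> \<open>One unit beyond R, so that R is an interior point of the time set.\<close>
 define I where "I = {..<R + 1}"
 have I: "lower_ray I" by (simp add: I_def lower_ray_lessThan)
 define Wlo where "Wlo = exp (\<theta> * T0) * US \<mu>0 (R + 1)"
 define Whi where "Whi = exp (\<theta> * (R + 1)) * US \<mu>0 T0"
 have Wlo: "0 < Wlo" using U0 by (simp add: Wlo_def)
 have Wr: "Wlo <= Wb s & Wb s <= Whi" if "T0 <= s" "s <= R + 1" for s unfolding Wlo_def Whi_def Wb_def
  using that descending_mono[OF D0 that(1)] descending_mono[OF D0 that(2)] U0[of "R + 1"] U0[of s] theta(1)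
  by (intro conjI mult_mono) (auto intro: less_imp_le)
 \<comment> \<open>Half of \<open>Wlo\<close> keeps the tube off the imaginary axis after T0;
   \<delta>/2, added to the \<delta>/2 of \<open>Tc\<close>, keeps it in the disc of the linearised
   estimate before T0.\<close>
 define \<eta> where "\<eta> = min (Wlo / 2) (\<delta> / 2)"
 have \<eta>: "0 < \<eta>" "\<eta> <= Wlo / 2" "\<eta> <= \<delta> / 2" using Wlo \<delta> by (auto simp: \<eta>_def)
 define M where "M = Whi + Wlo"
 have Mlo: "Wlo <= M" using Wr[of T0] T0 Wlo by (auto simp: M_def)
 have M: "0 < M" using Mlo Wlo by linarith
 obtain Br where Br: "0 <= Br" "!!t. T0 <= t ==> t <= R + 1 ==> \<bar>rho t\<bar> <= Br"
  using continuous_bound_Icc[OF rho_cont] by blast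
 obtain Bg where Bg: "0 <= Bg" "!!t. T0 <= t ==> t <= R + 1 ==> \<bar>gg t\<bar> <= Bg"
  using continuous_bound_Icc[OF gg_cont] by blast
 define c0 where "c0 = p * (k0 * A0 powr (p - 1))"
 have c0: "0 <= c0" using p k0 by (simp add: c0_def)
 define C where "C = Br * (p * M powr (p - 1)) + c0"
 have C: "0 <= C" unfolding C_def using Br c0 p by (intro add_nonneg_nonneg mult_nonneg_nonneg) auto
 define Wt where "Wt t = C * max 0 (t - T0)" for t
 define Wt' where "Wt' t = (if t <= T0 then 0 else C)" for t
 have weight: "weight I T0 Wt Wt'" unfolding Wt_def[abs_def] Wt'_def[abs_def] by (rule ramp_weight[OF C])
 have Wt'0: "0 <= Wt' t" for t using C by (simp add: Wt'_def)
 have om1: "1 <= exp (mm * Wt t)" for t using C mm by (simp add: Wt_def)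
 have omb: "exp (mm * Wt t) = 1" if "t <= T0" for t using that by (simp add: Wt_def)
 \<comment> \<open>On I the weight inflates the ball by at most the inverse of this exponential, so
   the weighted ball lies in the tube.\<close>
 define \<rho> where "\<rho> = \<eta> * exp (- (mm * (C * (R + 1 - T0))))"
 have \<rho>: "0 < \<rho>" using \<eta> by (simp add: \<rho>_def)
 have small: "\<rho> * exp (mm * Wt s) <= \<eta>" if "s \<in> I" for s
 proof -
  have "Wt s <= C * (R + 1 - T0)" unfolding Wt_def using that T0 C by (intro mult_left_mono) (auto simp: I_def)
  then have "exp (mm * Wt s) <= exp (mm * (C * (R + 1 - T0)))" using mm by simp
  then have "\<rho> * exp (mm * Wt s) <= \<rho> * exp (mm * (C * (R + 1 - T0)))" using \<rho> by (intro mult_left_mono) auto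
  also have "... = \<eta>" by (simp add: \<rho>_def exp_minus)
  finally show ?thesis .
 qed
 define eR where "eR = max 1 Bg"
 have eR: "0 < eR" "!!s. s \<in> I ==> \<bar>gg s\<bar> <= eR"
 proof -
  show "0 < eR" by (simp add: eR_def less_max_iff_disj)
  fix s assume s: "s \<in> I"
  show "\<bar>gg s\<bar> <= eR"
  proof (cases "s <= T0")
   case True
   then show ?thesis using Ta(2)[of s] T0 gg_nonneg[of s] by (simp add: eR_def)
  next
   case False
   then show ?thesis using Bg(2)[of s] s by (auto simp: I_def eR_def)
  qed
 qed
 define Q where "Q = (eR / e + 1 / mm) / e"
 have Q: "0 < Q" unfolding Q_def using eR e mm by (intro divide_pos_pos add_pos_pos) auto
 have B1: "0 <= \<mu>0 + 1" using \<mu>0 by simp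
 obtain K where K: "0 <= K" and Kb: "!!\<mu>1 \<mu>2 t. 0 <= \<mu>1 ==> \<mu>1 <= \<mu>0 + 1 ==> 0 <= \<mu>2 ==> \<mu>2 <= \<mu>0 + 1 ==> t <= R + 1 ==>
  exp (\<theta> * t) * \<bar>US \<mu>1 t - US \<mu>2 t\<bar> <= K * \<bar>\<mu>1 - \<mu>2\<bar> & exp (\<theta> * t) * \<bar>VS \<mu>1 t - VS \<mu>2 t\<bar> <= K * \<bar>\<mu>1 - \<mu>2\<bar>"
  by (fact branch_continuity[OF B1])
 \<comment> \<open>\<open>\<rho> / (K + 1)\<close> keeps the real branches in the tube through
   \<open>branch_continuity\<close>; \<open>\<rho> / (2 * Q)\<close> makes the residual
   admissible.\<close>
 define r where "r = min 1 (min (\<rho> / (K + 1)) (\<rho> / (2 * Q)))"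
 have r: "0 < r" "r <= 1" "r <= \<rho> / (K + 1)" "r <= \<rho> / (2 * Q)" using \<rho> K Q by (auto simp: r_def)
 have rK: "K * x <= \<rho>" if "0 <= x" "x <= r" for x
 proof -
  have "K * x <= (K + 1) * x" using that K by (intro mult_right_mono) auto
  also have "... <= (K + 1) * (\<rho> / (K + 1))" using that r K by (intro mult_left_mono) auto
  also have "... = \<rho>" using K by simp
  finally show ?thesis .
 qed
 have cond2: "r * (eR / e + 1 / mm) / e <= \<rho> / 2"
 proof -
  have "r * Q <= \<rho> / (2 * Q) * Q" using r Q by (intro mult_right_mono) auto
  moreover have "\<rho> / (2 * Q) * Q = \<rho> / 2" using Q by simp
  moreover have "r * (eR / e + 1 / mm) / e = r * Q" by (simp add: Q_def)
  ultimately show ?thesis by linarith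
 qed
 define D where "D = ball (complex_of_real \<mu>0) r"
 have oD: "open D" by (simp add: D_def)
 have zD: "norm (z - of_real \<mu>0) <= r" "norm z <= \<mu>0 + 1" if "z \<in> D" for z
 proof -
  show a: "norm (z - of_real \<mu>0) <= r" using that by (simp add: D_def dist_norm norm_minus_commute)
  show "norm z <= \<mu>0 + 1" using norm_triangle_ineq2[of z "of_real \<mu>0"] a r(2) \<mu>0 by simp
 qed
 have zone1: "norm (y - of_real A0) <= \<delta>" if "s <= T0" "norm (y - of_real (Wb s)) <= \<eta>" for s and y :: complex
 proof -
  have "norm (complex_of_real (Wb s) - of_real A0) = \<bar>Wb s - A0\<bar>" by (simp only: of_real_diff[symmetric] norm_of_real)
  then show ?thesis using that Tc(1)[of s] T0 \<eta>(3) norm_triangle_ineq[of "y - of_real (Wb s)" "of_real (Wb s) - of_real A0"] by simp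
 qed
 have zone2: "0 < Re y & norm y <= M" if "T0 <= s" "s \<in> I" "norm (y - of_real (Wb s)) <= \<eta>" for s and y :: complex
 proof
  have w: "Wlo <= Wb s" "Wb s <= Whi" using Wr[of s] that by (auto simp: I_def)
  have "\<bar>Re y - Wb s\<bar> <= \<eta>" using that(3) abs_Re_le_cmod[of "y - of_real (Wb s)"] by simp
  then show "0 < Re y" using w \<eta>(2) Wlo by linarith
  have "norm y <= norm (y - of_real (Wb s)) + Wb s" using norm_triangle_sub[of y "of_real (Wb s)"] w Wlo by simp
  then show "norm y <= M" using that(3) \<eta>(2) w Wlo by (simp add: M_def)
 qed
 have Rey: "0 < Re y" if "s \<in> I" "norm (y - of_real (Wb s)) <= \<eta>" for s and y :: complex
 proof (cases "s <= T0")
  case True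
  have "\<bar>Re y - A0\<bar> <= \<delta>" using zone1[OF True that(2)] abs_Re_le_cmod[of "y - of_real A0"] by simp
  then show ?thesis using \<delta> A0(1) by linarith
 qed (use zone2[of s y] that in auto)
 define H where "H z s x = of_real (rho s) * x powr of_real p - of_real (\<theta> * (n - \<theta>)) * x - of_real cc * (x - of_real A0) + z * of_real (gg s)"
  for z :: complex and s :: real and x :: complex
 have Hdiff: "H z s x - H z s y = of_real (rho s) * (x powr of_real p - y powr of_real p) - of_real c0 * (x - y)" for z s x y
 proof -
  have "complex_of_real c0 = of_real (\<theta> * (n - \<theta>)) + of_real cc" unfolding c0_def A0(5)[symmetric] by simp
  then show ?thesis unfolding H_def by (simp only:) (simp add: algebra_simps)
 qed
 have Hlip: "norm (H z s x - H z s y) <= (\<epsilon> + Wt' s) * norm (x - y)"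
  if s: "s \<in> I" and x: "norm (x - of_real (Wb s)) <= \<eta>" and y: "norm (y - of_real (Wb s)) <= \<eta>" for z s x y
 proof (cases "s <= T0")
  case True
  have "s <= Ta" using True T0 by simp
  from lip[OF Ta(1)[OF this] zone1[OF True x] zone1[OF True y]] show ?thesis using True by (simp add: Hdiff c0_def Wt'_def)
 next
  case False
  then have sT: "T0 <= s" by simp
  have "norm (x powr of_real p - y powr of_real p) <= p * M powr (p - 1) * norm (x - y)"
   using zone2[OF sT s x] zone2[OF sT s y] p by (intro complex_powr_lipschitz) auto
  then have "norm (of_real (rho s) * (x powr of_real p - y powr of_real p)) <= Br * (p * M powr (p - 1) * norm (x - y))"
   unfolding norm_mult norm_of_real using Br s sT by (intro mult_mono) (auto simp: I_def)
  moreover have "norm (of_real c0 * (x - y)) = c0 * norm (x - y)" using c0 by (simp add: norm_mult)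
  ultimately have "norm (H z s x - H z s y) <= Br * (p * M powr (p - 1) * norm (x - y)) + c0 * norm (x - y)"
   unfolding Hdiff using norm_triangle_ineq4[of "of_real (rho s) * (x powr of_real p - y powr of_real p)" "of_real c0 * (x - y)"] by linarith
  also have "... = C * norm (x - y)" by (simp add: C_def algebra_simps)
  also have "... <= (\<epsilon> + Wt' s) * norm (x - y)" using False \<epsilon> by (intro mult_right_mono) (auto simp: Wt'_def)
  finally show ?thesis .
 qed
 have Hcont: "continuous_on I (%s. H z s (x s))" if "continuous_on I x" "!!s. s \<in> I ==> 0 < Re (x s)" for z x
  unfolding H_def by (intro continuous_intros that(1) rho_cont gg_cont continuous_on_powr_complex) (use that(2) in \<open>force+\<close>)
 define Mx where "Mx = max M (2 * A0)"
 define Bx where "Bx = (max Br (k0 + \<delta>)) * Mx powr p + \<bar>\<theta> * (n - \<theta>)\<bar> * Mx + cc * (Mx + A0) + (\<mu>0 + 1) * eR"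
 have Mx: "0 < Mx" using M by (simp add: Mx_def less_max_iff_disj)
 have Wbx: "0 < Wb s" "Wb s <= Mx" "\<bar>rho s\<bar> <= max Br (k0 + \<delta>)" if s: "s \<in> I" for s
 proof -
  show "0 < Wb s" using U0 by (simp add: Wb_def)
  show "Wb s <= Mx"
  proof (cases "s <= T0")
   case True
   have "\<bar>Wb s - A0\<bar> <= \<delta> / 2" using Tc(1) True T0 by simp
   then have "Wb s <= 2 * A0" using \<delta> A0(1) by linarith
   then show ?thesis by (simp add: Mx_def)
  next
   case False
   then have "Wb s <= M" using Wr[of s] s Wlo by (simp add: I_def M_def)
   then show ?thesis by (simp add: Mx_def)
  qed
  show "\<bar>rho s\<bar> <= max Br (k0 + \<delta>)"
  proof (cases "s <= T0")
   case True
   have "\<bar>rho s - k0\<bar> <= \<delta>" using Ta(1) True T0 by simp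
   then have "\<bar>rho s\<bar> <= k0 + \<delta>" using rho_pos[of s] by linarith
   then show ?thesis by simp
  next
   case False
   then have "\<bar>rho s\<bar> <= Br" using Br s by (simp add: I_def)
   then show ?thesis by simp
  qed
 qed
 have Bx0: "0 <= Bx" unfolding Bx_def using Mx Br A0 \<mu>0 eR by (intro add_nonneg_nonneg mult_nonneg_nonneg) (auto simp: le_max_iff_disj)
 have HB: "norm (H z s (of_real (Wb s))) <= Bx" if z: "z \<in> D" and s: "s \<in> I" for z s
 proof -
  note w = Wbx[OF s]
  have t1: "norm (of_real (rho s) * complex_of_real (Wb s) powr of_real p) <= max Br (k0 + \<delta>) * Mx powr p"
  proof -
   have "norm (complex_of_real (Wb s) powr of_real p) = Wb s powr p" using w by (simp add: norm_powr_real_powr')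
   also have "... <= Mx powr p" using w p by (intro powr_mono2) auto
   finally show ?thesis unfolding norm_mult norm_of_real using w by (intro mult_mono) auto
  qed
  have t2: "norm (of_real (\<theta> * (n - \<theta>)) * complex_of_real (Wb s)) <= \<bar>\<theta> * (n - \<theta>)\<bar> * Mx"
   unfolding norm_mult[of "of_real _" "of_real _"] norm_of_real using w by (intro mult_left_mono) auto
  have t3: "norm (of_real cc * (complex_of_real (Wb s) - of_real A0)) <= cc * (Mx + A0)"
  proof -
   have "norm (complex_of_real (Wb s) - of_real A0) <= Mx + A0" unfolding of_real_diff[symmetric] norm_of_real using w A0(1) by linarith
   then show ?thesis unfolding norm_mult norm_of_real using A0(4) by (simp add: mult_left_mono)
  qed
  have t4: "norm (z * complex_of_real (gg s)) <= (\<mu>0 + 1) * eR"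
   unfolding norm_mult norm_of_real using zD[OF z] eR(2)[OF s] \<mu>0 by (intro mult_mono) auto
  show ?thesis unfolding H_def Bx_def by (intro order_trans[OF norm_triangle_ineq] order_trans[OF norm_triangle_ineq4] add_mono t1 t2 t3 t4)
 qed
 define xb where "xb s = complex_of_real (Wb s)" for s
 define xb1 where "xb1 s = complex_of_real (Zb s)" for s
 have sc: "(Wb has_real_derivative Zb s) (at s)"
  "(Zb has_real_derivative - aa * Zb s + \<theta> * (n - \<theta>) * Wb s - rho s * Wb s powr p - \<mu>0 * gg s) (at s)" for s
  using scaled_ode[OF S0 U0] unfolding Wb_def[abs_def] Zb_def[abs_def] .
 have form: "complex_of_real (- aa * z + \<theta> * (n - \<theta>) * w - rho s * w powr p - \<mu> * gg s)
   = - (l1 + l2) * of_real z - l1 * l2 * (of_real w - of_real A0) - H (of_real \<mu>) s (of_real w)" if "0 <= w" for z w s \<mu>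
  using that by (simp add: l H_def powr_of_real algebra_simps)
 have xd: "(xb has_vector_derivative xb1 s) (at s)" for s unfolding xb_def[abs_def] xb1_def by (rule has_vector_derivative_complex_of_real[OF sc(1)])
 have xd1: "(xb1 has_vector_derivative - (l1 + l2) * xb1 s - l1 * l2 * (xb s - of_real A0) - H (of_real \<mu>0) s (xb s)) (at s)" if "s \<in> I" for s
  unfolding xb_def xb1_def[abs_def]
  by (rule has_vector_derivative_complex_of_real[OF sc(2)[of s], unfolded form[OF less_imp_le[OF Wbx(1)[OF that]]]])
 have xc: "continuous_on I xb" by (rule continuous_on_vector_derivative[OF has_vector_derivative_at_within[OF xd]])
 define om where "om s = exp (mm * Wt s)" for s
 have eta: "norm (y - xb s) <= \<rho> * om s ==> s \<in> I ==> norm (y - of_real (Wb s)) <= \<eta>" for y s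
  using small[of s] by (simp add: xb_def om_def)
 have "\<exists>x x1. holo_family D I x & holo_family D I x1 & near D I (%s. exp (mm * Wt s)) \<rho> x (%z. xb) &
  (\<forall>z\<in>D. \<forall>t\<in>I. (x z has_vector_derivative x1 z t) (at t) &
   (x1 z has_vector_derivative (- (l1 + l2) * x1 z t - l1 * l2 * (x z t - of_real A0) - H z t (x z t))) (at t)) &
  (\<exists>C. \<forall>z\<in>D. \<forall>t\<in>I. norm (x1 z t) <= C * exp (mm * Wt t))"
 proof (rule second_order_family[OF I e mm less_imp_le[OF \<epsilon>(1)] cond1 weight less_imp_le[OF \<rho>] Bx0 xc _ _ _ xd,
    where R = "%z s. (z - of_real \<mu>0) * of_real (gg s)" and dR = r and eR = eR and Mb = "max (2 * A0) M1"])
  show "holo_family D I (%z s. H z s (x z s))" if x: "holo_family D I x" "near D I (%s. exp (mm * Wt s)) \<rho> x (%z. xb)" for x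
  proof -
   have pos: "0 < Re (x z s)" if "z \<in> D" "s \<in> I" for z s
    by (rule Rey[OF that(2)], rule eta) (use x(2) that in \<open>auto simp: near_def om_def\<close>)
   show ?thesis unfolding holo_family_def
   proof (intro conjI ballI impI)
    fix z assume z: "z \<in> D"
    show "continuous_on I (%s. H z s (x z s))" by (rule Hcont) (use x(1) z pos in \<open>auto simp: holo_family_def\<close>)
   next
    fix s assume s: "s \<in> I"
    have xh: "(%z. x z s) holomorphic_on D" using x(1) oD s by (simp add: holo_family_def)
    have np: "x z s \<notin> \<real>\<^sub>\<le>\<^sub>0" if "z \<in> D" for z using pos[OF that s] complex_nonpos_Reals_iff by fastforce
    show "(%z. H z s (x z s)) holomorphic_on D" unfolding H_def by (intro holomorphic_intros xh np)
   qed
  qed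
  show "norm (H z s x - H z s y) <= (\<epsilon> + Wt' s) * norm (x - y)"
   if "s \<in> I" "norm (x - xb s) <= \<rho> * exp (mm * Wt s)" "norm (y - xb s) <= \<rho> * exp (mm * Wt s)" for z s x y
   by (rule Hlip[OF that(1)]) (use eta that in \<open>auto simp: om_def\<close>)
  show "norm (H z s (xb s)) <= Bx * (1 + Wt' s) * exp (mm * Wt s)" if "z \<in> D" "s \<in> I" for z s
  proof -
   have "Bx <= Bx * (1 + Wt' s)" using Bx0 Wt'0[of s] by (simp add: distrib_left)
   also have "... <= Bx * (1 + Wt' s) * exp (mm * Wt s)" using mult_left_mono[OF om1[of s], of "Bx * (1 + Wt' s)"] Bx0 Wt'0[of s] by simp
   finally show ?thesis using HB[OF that] by (simp add: xb_def)
  qed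
  show "(xb1 has_vector_derivative - (l1 + l2) * xb1 s - l1 * l2 * (xb s - of_real A0) - H z s (xb s) + (z - of_real \<mu>0) * of_real (gg s)) (at s)"
   if "s \<in> I" for z s
  proof -
   have "- H z s (xb s) + (z - of_real \<mu>0) * of_real (gg s) = - H (of_real \<mu>0) s (xb s)" by (simp add: H_def algebra_simps)
   then have "- (l1 + l2) * xb1 s - l1 * l2 * (xb s - of_real A0) - H z s (xb s) + (z - of_real \<mu>0) * of_real (gg s)
    = - (l1 + l2) * xb1 s - l1 * l2 * (xb s - of_real A0) - H (of_real \<mu>0) s (xb s)" by (simp add: algebra_simps)
   then show ?thesis using xd1[OF that] by (simp only:)
  qed
  show "norm (xb s) <= max (2 * A0) M1 & norm (xb1 s) <= max (2 * A0) M1" if "s <= T0" for s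
  proof -
   have "\<bar>Wb s - A0\<bar> <= \<delta> / 2" "\<bar>Zb s\<bar> <= M1" using Tc that T0 by auto
   then have "\<bar>Wb s\<bar> <= 2 * A0" using \<delta> A0(1) by linarith
   then show ?thesis using \<open>\<bar>Zb s\<bar> <= M1\<close> by (simp add: xb_def xb1_def le_max_iff_disj)
  qed
  show "continuous_on I (%s. (z - of_real \<mu>0) * of_real (gg s))" for z :: complex by (intro continuous_intros gg_cont)
  show "0 <= r" "0 <= eR" using r eR by auto
  show "r * (eR / e + 1 / mm) / e <= \<rho> / 2" by (rule cond2)
  show "norm ((z - of_real \<mu>0) * of_real (gg s)) <= r * (eR + Wt' s) * exp (mm * Wt s)" if "z \<in> D" "s \<in> I" for z s
  proof -
   have "norm ((z - of_real \<mu>0) * of_real (gg s)) <= r * eR"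
    unfolding norm_mult norm_of_real using zD[OF that(1)] eR(2)[OF that(2)] r(1) by (intro mult_mono) auto
   also have "... <= r * (eR + Wt' s)" using r Wt'0[of s] by (intro mult_left_mono) auto
   also have "... <= r * (eR + Wt' s) * exp (mm * Wt s)" using mult_left_mono[OF om1[of s], of "r * (eR + Wt' s)"] r eR Wt'0[of s] by simp
   finally show ?thesis .
  qed
 qed
 then obtain x x1 C1 where hx: "holo_family D I x" "holo_family D I x1" and nx: "near D I (%s. exp (mm * Wt s)) \<rho> x (%z. xb)"
  and dx: "!!z t. z \<in> D ==> t \<in> I ==> (x z has_vector_derivative x1 z t) (at t)"
   "!!z t. z \<in> D ==> t \<in> I ==> (x1 z has_vector_derivative (- (l1 + l2) * x1 z t - l1 * l2 * (x z t - of_real A0) - H z t (x z t))) (at t)"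
  and C1: "!!z t. z \<in> D ==> t \<in> I ==> norm (x1 z t) <= C1 * exp (mm * Wt t)" by blast
 have RI: "R \<in> I" by (simp add: I_def)
 have ident: "x (of_real \<mu>) R = of_real (exp (\<theta> * R) * US \<mu> R) & x1 (of_real \<mu>) R = of_real (exp (\<theta> * R) * (VS \<mu> R + \<theta> * US \<mu> R))"
  if m: "0 <= \<mu>" "\<bar>\<mu> - \<mu>0\<bar> < r" for \<mu>
 proof -
  have zD': "of_real \<mu> \<in> D"
   using m(2) by (simp add: D_def dist_norm abs_minus_commute of_real_diff[symmetric] norm_of_real del: of_real_diff)
  define W where "W t = exp (\<theta> * t) * US \<mu> t" for t
  define Z where "Z t = exp (\<theta> * t) * (VS \<mu> t + \<theta> * US \<mu> t)" for t
  have S: "solves \<mu> (US \<mu>) (VS \<mu>)" using branchD(2)[OF branch_sol[OF m(1)]] .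
  have cl: "\<bar>W t - Wb t\<bar> <= \<rho>" "\<bar>Z t - Zb t\<bar> <= (1 + \<theta>) * \<rho>" if t: "t \<in> I" for t
  proof -
   have k: "exp (\<theta> * t) * \<bar>US \<mu> t - US \<mu>0 t\<bar> <= \<rho>" "exp (\<theta> * t) * \<bar>VS \<mu> t - VS \<mu>0 t\<bar> <= \<rho>"
   proof -
    have "\<mu> <= \<mu>0 + 1" "t <= R + 1" using m(2) r(2) t by (auto simp: I_def)
    from Kb[OF m(1) this(1) \<mu>0 _ this(2)]
    have "exp (\<theta> * t) * \<bar>US \<mu> t - US \<mu>0 t\<bar> <= K * \<bar>\<mu> - \<mu>0\<bar> & exp (\<theta> * t) * \<bar>VS \<mu> t - VS \<mu>0 t\<bar> <= K * \<bar>\<mu> - \<mu>0\<bar>" by simp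
    moreover have "K * \<bar>\<mu> - \<mu>0\<bar> <= \<rho>" using m by (intro rK) auto
    ultimately show "exp (\<theta> * t) * \<bar>US \<mu> t - US \<mu>0 t\<bar> <= \<rho>" "exp (\<theta> * t) * \<bar>VS \<mu> t - VS \<mu>0 t\<bar> <= \<rho>" by auto
   qed
   have eq: "W t - Wb t = exp (\<theta> * t) * (US \<mu> t - US \<mu>0 t)" by (simp add: W_def Wb_def algebra_simps)
   show a: "\<bar>W t - Wb t\<bar> <= \<rho>" using k(1) unfolding eq by (simp add: abs_mult)
   have "Z t - Zb t = exp (\<theta> * t) * (VS \<mu> t - VS \<mu>0 t) + \<theta> * (W t - Wb t)" by (simp add: Z_def Zb_def W_def Wb_def algebra_simps)
   also have "\<bar>...\<bar> <= exp (\<theta> * t) * \<bar>VS \<mu> t - VS \<mu>0 t\<bar> + \<theta> * \<bar>W t - Wb t\<bar>"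
    using abs_triangle_ineq[of "exp (\<theta> * t) * (VS \<mu> t - VS \<mu>0 t)" "\<theta> * (W t - Wb t)"] theta(1) by (simp add: abs_mult)
   also have "... <= \<rho> + \<theta> * \<rho>" using k(2) a theta(1) by (intro add_mono mult_left_mono) auto
   finally show "\<bar>Z t - Zb t\<bar> <= (1 + \<theta>) * \<rho>" by (simp add: algebra_simps)
  qed
  have \<rho>\<eta>: "\<rho> <= \<eta>"
  proof -
   have "T0 \<in> I" using T0 by (simp add: I_def)
   from small[OF this] show ?thesis using omb[OF order_refl] by simp
  qed
  have Wn: "norm (complex_of_real (W t) - of_real (Wb t)) <= \<eta>" if "t \<in> I" for t
   using cl(1)[OF that] \<rho>\<eta> by (simp add: of_real_diff[symmetric] norm_of_real del: of_real_diff)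
  have Wp: "0 < W t" if "t \<in> I" for t using Rey[OF that Wn[OF that]] by simp
  have Up: "0 < US \<mu> t" if "t \<in> I" for t using Wp[OF that] by (simp add: W_def zero_less_mult_iff)
  define d where "d t = x (of_real \<mu>) t - of_real (W t)" for t
  define d1 where "d1 t = x1 (of_real \<mu>) t - of_real (Z t)" for t
  define h where "h t = - (H (of_real \<mu>) t (x (of_real \<mu>) t) - H (of_real \<mu>) t (of_real (W t)))" for t
  have dd: "(d has_vector_derivative d1 t) (at t)" if t: "t \<in> I" for t unfolding d_def[abs_def] d1_def W_def[abs_def] Z_def
   by (intro has_vector_derivative_diff dx(1)[OF zD' t] has_vector_derivative_complex_of_real scaled_ode(1)[OF S Up[OF t]])
  have dd1: "(d1 has_vector_derivative (- (aa *\<^sub>R d1 t) - cc *\<^sub>R d t + h t)) (at t)" if t: "t \<in> I" for t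
  proof -
   have zz: "((%t. complex_of_real (Z t)) has_vector_derivative
     - (l1 + l2) * of_real (Z t) - l1 * l2 * (of_real (W t) - of_real A0) - H (of_real \<mu>) t (of_real (W t))) (at t)"
    using has_vector_derivative_complex_of_real[OF scaled_ode(2)[OF S Up[OF t]]]
    unfolding form[OF less_imp_le[OF Wp[OF t]], symmetric] unfolding W_def Z_def[abs_def] .
   have "(d1 has_vector_derivative ((- (l1 + l2) * x1 (of_real \<mu>) t - l1 * l2 * (x (of_real \<mu>) t - of_real A0) - H (of_real \<mu>) t (x (of_real \<mu>) t))
     - (- (l1 + l2) * of_real (Z t) - l1 * l2 * (of_real (W t) - of_real A0) - H (of_real \<mu>) t (of_real (W t))))) (at t)"
    unfolding d1_def[abs_def] by (intro has_vector_derivative_diff dx(2)[OF zD' t] zz)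
   moreover have "(- (l1 + l2) * x1 (of_real \<mu>) t - l1 * l2 * (x (of_real \<mu>) t - of_real A0) - H (of_real \<mu>) t (x (of_real \<mu>) t))
     - (- (l1 + l2) * of_real (Z t) - l1 * l2 * (of_real (W t) - of_real A0) - H (of_real \<mu>) t (of_real (W t)))
     = - (aa *\<^sub>R d1 t) - cc *\<^sub>R d t + h t" by (simp add: l d_def d1_def h_def scaleR_conv_of_real algebra_simps)
   ultimately show ?thesis by (simp only:)
  qed
  have xn: "norm (x (of_real \<mu>) t - xb t) <= \<rho> * om t" if "t \<in> I" for t using nx zD' that by (simp add: near_def om_def)
  have hb: "norm (h t) <= (\<epsilon> + Wt' t) * norm (d t)" if t: "t \<in> I" for t
   unfolding h_def d_def norm_minus_cancel by (rule Hlip[OF t eta[OF xn[OF t] t] Wn[OF t]])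
  have tI: "t \<in> I" if "t <= R" for t using that by (simp add: I_def)
  \<comment> \<open>Both solutions have the same parameter, so there is no inhomogeneity and the
    decay estimate yields equality instead of closeness.\<close>
  have z0: "(norm (d1 T0))^2 + (norm (d T0))^2 <= Ko * 0^2"
  proof (rule dec[OF dd dd1, where M = "max (2 * \<rho>) (C1 + M1 + (1 + \<theta>) * \<rho>)"])
   fix t assume t: "t <= T0"
   show tt: "t \<in> I" "t \<in> I" using t T0 by (auto simp: I_def)
   have "(\<epsilon> + Wt' t) * norm (d t) <= \<epsilon>o * norm (d t)" using t \<epsilon>(2) by (intro mult_right_mono) (auto simp: Wt'_def)
   then show "norm (h t) <= \<epsilon>o * norm (d t) + 0" using hb[OF tt(1)] by simp
   have "norm (xb t - of_real (W t)) <= \<rho>"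
    using cl(1)[OF tt(1)] by (simp add: xb_def abs_minus_commute of_real_diff[symmetric] norm_of_real del: of_real_diff)
   then have "norm (d t) <= 2 * \<rho>"
    using norm_triangle_ineq[of "x (of_real \<mu>) t - xb t" "xb t - of_real (W t)"] xn[OF tt(1)] omb[OF t] by (simp add: d_def om_def)
   moreover have "norm (d1 t) <= C1 + M1 + (1 + \<theta>) * \<rho>"
   proof -
    have "norm (x1 (of_real \<mu>) t) <= C1" using C1[OF zD' tt(1)] omb[OF t] by simp
    moreover have "\<bar>Z t\<bar> <= M1 + (1 + \<theta>) * \<rho>" using cl(2)[OF tt(1)] Tc(2)[of t] t T0 by linarith
    ultimately show ?thesis using norm_triangle_ineq4[of "x1 (of_real \<mu>) t" "of_real (Z t)"] by (simp add: d1_def)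
   qed
   ultimately show "norm (d t) <= max (2 * \<rho>) (C1 + M1 + (1 + \<theta>) * \<rho>) & norm (d1 t) <= max (2 * \<rho>) (C1 + M1 + (1 + \<theta>) * \<rho>)"
    by (simp add: le_max_iff_disj)
  qed simp
  have "(norm (d1 R))^2 + (norm (d R))^2 \<le>
    exp ((2 * \<bar>aa\<bar> + \<bar>cc\<bar> + (\<epsilon> + C) + 2) * (R - T0)) * ((norm (d1 T0))^2 + (norm (d T0))^2 + 0^2)"
  proof (rule oscillator_growth[where h = h and b = R])
   fix t assume t: "T0 <= t" "t <= R"
   show "(d has_vector_derivative d1 t) (at t)" "(d1 has_vector_derivative (- (aa *\<^sub>R d1 t) - cc *\<^sub>R d t + h t)) (at t)"
    using dd dd1 tI t by auto
   have "(\<epsilon> + Wt' t) * norm (d t) <= (\<epsilon> + C) * norm (d t)" using C by (intro mult_right_mono) (auto simp: Wt'_def)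
   then show "norm (h t) <= (\<epsilon> + C) * norm (d t) + 0" using hb[OF tI[OF t(2)]] by simp
  qed (use \<epsilon> C T0 in auto)
  moreover have "(norm (d1 T0))^2 + (norm (d T0))^2 = 0" using z0 by (intro antisym) auto
  ultimately have "(norm (d1 R))^2 + (norm (d R))^2 <= 0" by simp
  then have "d1 R = 0" "d R = 0" by (simp_all add: sum_power2_le_zero_iff)
  then show ?thesis by (simp add: d_def d1_def W_def Z_def)
 qed
 define X where "X z = of_real (exp (- \<theta> * R)) * x z R" for z
 define X1 where "X1 z = of_real (exp (- \<theta> * R)) * (x1 z R - of_real \<theta> * x z R)" for z
 show ?thesis
 proof (rule that[of r X X1])
  show "0 < r" by (rule r(1))
  have hR: "(%z. x z R) holomorphic_on D" "(%z. x1 z R) holomorphic_on D" using hx oD RI by (auto simp: holo_family_def)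
  show "X holomorphic_on ball (of_real \<mu>0) r" "X1 holomorphic_on ball (of_real \<mu>0) r"
   unfolding X_def[abs_def] X1_def[abs_def] D_def[symmetric] by (intro holomorphic_intros hR)+
  fix \<mu> assume m: "0 <= \<mu>" "\<bar>\<mu> - \<mu>0\<bar> < r"
  note i = ident[OF m]
  have a: "exp (- \<theta> * R) * (exp (\<theta> * R) * y) = y" for y by (rule exp_neg_cancel)
  have "X (of_real \<mu>) = of_real (exp (- \<theta> * R) * (exp (\<theta> * R) * US \<mu> R))" using i by (simp only: X_def of_real_mult)
  moreover have "x1 (of_real \<mu>) R - of_real \<theta> * x (of_real \<mu>) R = of_real (exp (\<theta> * R) * VS \<mu> R)"
   using i by (simp add: algebra_simps)
  then have "X1 (of_real \<mu>) = of_real (exp (- \<theta> * R) * (exp (\<theta> * R) * VS \<mu> R))" by (simp only: X1_def of_real_mult)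
  ultimately show "X (of_real \<mu>) = of_real (US \<mu> R) & X1 (of_real \<mu>) = of_real (VS \<mu> R)" unfolding a by simp
 qed
qed

end

section \<open>Bounded solutions of the Kelvin-transformed equation\<close>

lemma majorant_exp:
 assumes "0 < m" "0 <= e" "0 <= a"
 shows "majorant I e (%s. a * exp (m * s)) (%s. a / (e + m) * exp (m * s))" unfolding majorant_def
proof (intro conjI exI)
 have em: "0 < e + m" using assms by simp
 show "continuous_on I (%s. a / (e + m) * exp (m * s))" by (intro continuous_intros)
 show "\<forall>s\<in>I. 0 <= a / (e + m) * exp (m * s)" using assms by simp
 have "((%s. a / (e + m) * exp ((e + m) * s)) \<longlongrightarrow> a / (e + m) * 0) at_bot" by (intro tendsto_intros exp_mult_at_bot em)
 moreover have "(%s. a / (e + m) * exp ((e + m) * s)) = (%s. exp (e * s) * (a / (e + m) * exp (m * s)))"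
  by (rule ext) (simp add: exp_add distrib_right)
 ultimately show "((%s. exp (e * s) * (a / (e + m) * exp (m * s))) \<longlongrightarrow> 0) at_bot" by simp
 show "finite {}" by simp
 show "\<forall>s\<in>I - {}. ((%s. a / (e + m) * exp (m * s)) has_real_derivative a / (e + m) * (m * exp (m * s))) (at s)"
  using em by (auto intro!: derivative_eq_intros)
 show "\<forall>s\<in>I. a * exp (m * s) <= a / (e + m) * (m * exp (m * s)) + e * (a / (e + m) * exp (m * s))"
 proof
  fix s
  have "a / (e + m) * (m * exp (m * s)) + e * (a / (e + m) * exp (m * s)) = (e + m) * (a / (e + m)) * exp (m * s)"
   by (simp only: ac_simps distrib_right distrib_left)
  also have "(e + m) * (a / (e + m)) = a" using em by simp
  finally show "a * exp (m * s) <= a / (e + m) * (m * exp (m * s)) + e * (a / (e + m) * exp (m * s))" by simp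
 qed
qed

text \<open>The operator y'' + n y' has the factors n and 0. The factor 0 has no damping of its own;
  the decay exp (m s) of the integrand at -\<infinity> takes its place.\<close>

lemma double_causal:
 fixes n m a :: real
 assumes I: "lower_ray I" and n: "0 < n" and m: "0 < m" and a: "0 <= a" and h: "continuous_on I h" "!!s. s \<in> I ==> norm (h s) <= a * exp (m * s)"
  and t: "t \<in> I"
 shows "(causal (of_real n) h has_vector_derivative h t - of_real n * causal (of_real n) h t) (at t)"
  "continuous_on I (causal (of_real n) h)"
  "norm (causal (of_real n) h t) <= a / (n + m) * exp (m * t)"
  "(causal 0 (causal (of_real n) h) has_vector_derivative causal (of_real n) h t) (at t)"
  "norm (causal 0 (causal (of_real n) h) t) <= a / (n + m) / m * exp (m * t)"
proof -
 have rn: "n <= Re (of_real n)" and r0: "0 <= Re 0" by simp_all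
 have mj: "majorant I n (%s. a * exp (m * s)) (%s. a / (n + m) * exp (m * s))" using m n a by (intro majorant_exp) auto
 have mj2: "majorant I 0 (%s. a / (n + m) * exp (m * s)) (%s. a / (n + m) / m * exp (m * s))"
  using majorant_exp[of m 0 "a / (n + m)" I] m n a by simp
 show d: "(causal (of_real n) h has_vector_derivative h t - of_real n * causal (of_real n) h t) (at t)"
  by (rule causal_has_vector_derivative[OF I rn h mj t])
 show c: "continuous_on I (causal (of_real n) h)"
  by (rule continuous_on_vector_derivative[OF has_vector_derivative_at_within[OF causal_has_vector_derivative[OF I rn h mj]]])
 have b: "norm (causal (of_real n) h s) <= a / (n + m) * exp (m * s)" if "s \<in> I" for s by (rule causal_bound[OF I rn h mj that])
 show "norm (causal (of_real n) h t) <= a / (n + m) * exp (m * t)" by (rule b[OF t])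
 show "(causal 0 (causal (of_real n) h) has_vector_derivative causal (of_real n) h t) (at t)"
  using causal_has_vector_derivative[OF I r0 c b mj2 t] by simp
 show "norm (causal 0 (causal (of_real n) h) t) <= a / (n + m) / m * exp (m * t)" by (rule causal_bound[OF I r0 c b mj2 t])
qed

lemma double_causal_diff:
 fixes n m a b :: real
 assumes I: "lower_ray I" and n: "0 < n" and m: "0 < m" and a: "0 <= a" and b: "0 <= b"
  and h: "continuous_on I h" "!!s. s \<in> I ==> norm (h s) <= a * exp (m * s)"
  and k: "continuous_on I k" "!!s. s \<in> I ==> norm (k s) <= a * exp (m * s)"
  and hk: "!!s. s \<in> I ==> norm (h s - k s) <= b * exp (m * s)"
  and t: "t \<in> I"
 shows "norm (causal 0 (causal (of_real n) h) t - causal 0 (causal (of_real n) k) t) <= b / (n + m) / m * exp (m * t)"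
proof -
 have rn: "n <= Re (of_real n)" and r0: "0 <= Re 0" by simp_all
 have mj: "majorant I n (%s. a * exp (m * s)) (%s. a / (n + m) * exp (m * s))" using m n a by (intro majorant_exp) auto
 have mj2: "majorant I 0 (%s. a / (n + m) * exp (m * s)) (%s. a / (n + m) / m * exp (m * s))"
  using majorant_exp[of m 0 "a / (n + m)" I] m n a by simp
 have "causal 0 (causal (of_real n) h) t - causal 0 (causal (of_real n) k) t
   = causal 0 (%s. causal (of_real n) h s - causal (of_real n) k s) t"
  by (rule causal_diff[OF I r0 double_causal(2)[OF I n m a h t] double_causal(3)[OF I n m a h] mj2
     double_causal(2)[OF I n m a k t] double_causal(3)[OF I n m a k] mj2 t])
 also have "... = causal 0 (causal (of_real n) (%s. h s - k s)) t"
  by (rule causal_cong[OF I r0 _ t]) (rule causal_diff[OF I rn h mj k mj])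
 finally show ?thesis using double_causal(5)[OF I n m b continuous_on_diff[OF h(1) k(1)] hk t] by simp
qed

text \<open>Bounded solutions are told apart by their value at S0. The map \<open>T\<close> builds
  the prescribed value \<open>y0 z\<close> in by adding the double convolution at S0 before
  subtracting it at s. Contraction comes from the smallness of the coefficients far to the left, so
  the constant weight 1 is enough.\<close>

lemma outer_family:
 fixes n m p C B c \<rho> M S0 :: real and k2 g2 :: "real => real" and y0 :: "complex => complex"
 defines "I \<equiv> {..<S0 + 1}" and "E \<equiv> exp (m * (S0 + 1)) / (m * (n + m))"
 assumes n: "0 < n" and m: "0 < m" and p: "1 <= p" and C: "0 <= C" and D: "open D" "!!z. z \<in> D ==> norm z <= B" and B: "0 <= B"
  and k2: "continuous_on I k2" "!!s. s \<in> I ==> \<bar>k2 s\<bar> <= C * exp (m * s)"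
  and g2: "continuous_on I g2" "!!s. s \<in> I ==> \<bar>g2 s\<bar> <= C * exp (m * s)"
  and y0: "y0 holomorphic_on D" "!!z. z \<in> D ==> norm (y0 z - of_real c) <= \<rho> / 4"
  and \<rho>: "0 < \<rho>" "\<rho> < c" "c + \<rho> <= M"
  and small: "2 * (C * (M powr p + B)) * E <= \<rho> / 4" "2 * (C * (p * M powr (p - 1))) * E <= 1 / 2"
 obtains x x1 N where "holo_family D I x" "holo_family D I x1"
  "!!z s. z \<in> D ==> s \<in> I ==> norm (x z s - of_real c) <= \<rho>" "!!z. z \<in> D ==> x z S0 = y0 z"
  "!!z s. z \<in> D ==> s \<in> I ==> (x z has_vector_derivative x1 z s) (at s)"
  "!!z s. z \<in> D ==> s \<in> I ==> (x1 z has_vector_derivative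
    - (n *\<^sub>R x1 z s) - (of_real (k2 s) * x z s powr of_real p + z * of_real (g2 s))) (at s)"
  "!!z s. z \<in> D ==> s \<in> I ==> norm (x1 z s) <= N"
proof -
 have I: "lower_ray I" and SI: "S0 \<in> I" by (simp_all add: I_def lower_ray_lessThan)
 have mn: "0 < n + m" "0 < m * (n + m)" using n m by simp_all
 have E0: "0 < E" using mn by (simp add: E_def)
 have ME: "a / (n + m) / m * exp (m * s) <= a * E" if "0 <= a" "s \<in> I" for a s
 proof -
  have "exp (m * s) <= exp (m * (S0 + 1))" using that m by (simp add: I_def)
  then have "a / (n + m) / m * exp (m * s) <= a / (n + m) / m * exp (m * (S0 + 1))" using that m n by (intro mult_left_mono) auto
  then show ?thesis by (simp add: E_def mult.commute)
 qed
 define a where "a = C * (M powr p + B)"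
 have a: "0 <= a" using C B by (simp add: a_def)
 define Q where "Q x z s = of_real (k2 s) * x z s powr of_real p + z * of_real (g2 s)" for x :: "complex => real => complex" and z s
 define P where "P x z = causal 0 (causal (of_real n) (Q x z))" for x z
 define T where "T x z s = y0 z + P x z S0 - P x z s" for x z s
 define ball' where "ball' x = near D I (%_. 1) \<rho> x (%z s. of_real c)" for x
 have xr: "0 < Re (x z s)" "norm (x z s) <= M" if "ball' x" "z \<in> D" "s \<in> I" for x z s
 proof -
  have h: "norm (x z s - of_real c) <= \<rho>" using that by (simp add: ball'_def near_def)
  have "\<bar>Re (x z s) - c\<bar> <= \<rho>" using h abs_Re_le_cmod[of "x z s - of_real c"] by simp
  then show "0 < Re (x z s)" using \<rho> by linarith
  have "norm (x z s) <= norm (x z s - of_real c) + c" using norm_triangle_sub[of "x z s" "of_real c"] \<rho> by simp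
  then show "norm (x z s) <= M" using h \<rho> by linarith
 qed
 have Qc: "continuous_on I (Q x z)" if "holo_family D I x" "ball' x" "z \<in> D" for x z
 proof -
  have "continuous_on I (x z)" using that by (simp add: holo_family_def)
  then show ?thesis unfolding Q_def by (intro continuous_intros k2 g2 continuous_on_powr_complex) (use xr(1)[OF that(2,3)] in \<open>force+\<close>)
 qed
 have Qb: "norm (Q x z s) <= a * exp (m * s)" if "ball' x" "z \<in> D" "s \<in> I" for x z s
 proof -
  have "norm (x z s powr of_real p) = norm (x z s) powr p" by (simp add: norm_powr_real_powr')
  also have "... <= M powr p" using xr(2)[OF that] p by (intro powr_mono2) auto
  finally have "norm (of_real (k2 s) * x z s powr of_real p) <= C * exp (m * s) * M powr p"
   unfolding norm_mult norm_of_real using k2(2)[OF that(3)] by (intro mult_mono) auto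
  moreover have "norm (z * of_real (g2 s)) <= B * (C * exp (m * s))"
   unfolding norm_mult norm_of_real using g2(2)[OF that(3)] D(2)[OF that(2)] B by (intro mult_mono) auto
  ultimately have "norm (Q x z s) <= C * exp (m * s) * M powr p + B * (C * exp (m * s))" unfolding Q_def by (rule norm_triangle_mono)
  then show ?thesis by (simp add: a_def algebra_simps)
 qed
 have Qh: "(%z. Q x z s) holomorphic_on D" if "holo_family D I x" "ball' x" "s \<in> I" for x s
 proof -
  have "(%z. x z s) holomorphic_on D" using that D by (simp add: holo_family_def)
  moreover have "x z s \<notin> \<real>\<^sub>\<le>\<^sub>0" if "z \<in> D" for z
   using xr(1)[OF \<open>ball' x\<close> that \<open>s \<in> I\<close>] complex_nonpos_Reals_iff by fastforce
  ultimately show ?thesis unfolding Q_def by (intro holomorphic_intros)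
 qed
 note dc = double_causal[OF I n m a]
 have Pd: "(P x z has_vector_derivative causal (of_real n) (Q x z) s) (at s)"
  if "holo_family D I x" "ball' x" "z \<in> D" "s \<in> I" for x z s unfolding P_def by (rule dc(4)[OF Qc[OF that(1-3)] Qb[OF that(2,3)] that(4)])
 have rn: "n <= Re (of_real n)" and r0: "0 <= Re 0" by simp_all
 have mj: "majorant I n (%s. a * exp (m * s)) (%s. a / (n + m) * exp (m * s))" using m n a by (intro majorant_exp) auto
 have mj2: "majorant I 0 (%s. a / (n + m) * exp (m * s)) (%s. a / (n + m) / m * exp (m * s))"
  using majorant_exp[of m 0 "a / (n + m)" I] m n a by simp
 have eb: "\<exists>B. \<forall>s\<le>t. a * exp (m * s) <= B" if "0 <= a" for a t
  using that m by (intro exI[of _ "a * exp (m * t)"]) (auto intro: mult_left_mono)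
 have Yh: "(%z. causal (of_real n) (Q x z) s) holomorphic_on D" if "holo_family D I x" "ball' x" "s \<in> I" for x s
  by (rule causal_holomorphic[OF I rn D(1) Qc[OF that(1,2)] Qh[OF that(1,2)] Qb[OF that(2)] eb[OF a] mj that(3)])
 have an: "0 <= a / (n + m)" using a mn by simp
 have Ph: "(%z. P x z s) holomorphic_on D" if "holo_family D I x" "ball' x" "s \<in> I" for x s unfolding P_def
  by (rule causal_holomorphic[OF I r0 D(1) dc(2)[OF Qc[OF that(1,2)] Qb[OF that(2)] SI] Yh[OF that(1,2)]
     dc(3)[OF Qc[OF that(1,2)] Qb[OF that(2)]] eb[OF an] mj2 that(3)])
 have TX: "holo_family D I (T x)" if x: "holo_family D I x" "ball' x" for x unfolding holo_family_def
 proof (intro conjI ballI impI)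
  fix z assume "z \<in> D"
  then have "continuous_on I (P x z)" by (intro continuous_on_vector_derivative[OF has_vector_derivative_at_within[OF Pd[OF x]]])
  then show "continuous_on I (T x z)" unfolding T_def by (intro continuous_intros)
 next
  fix s assume s: "s \<in> I"
  show "(%z. T x z s) holomorphic_on D" unfolding T_def by (intro holomorphic_intros y0 Ph x s SI)
 qed
 have Tlip: "near D I (%_. 1) (d / 2) (T x) (T y)"
  if x: "holo_family D I x" "ball' x" and y: "holo_family D I y" "ball' y" and d: "0 <= d" and xy: "near D I (%_. 1) d x y" for x y d
  unfolding near_def
 proof (intro ballI)
  fix z s assume z: "z \<in> D" and s: "s \<in> I"
  define b where "b = C * (p * M powr (p - 1)) * d"
  have b: "0 <= b" using C p d by (simp add: b_def)
  have Qd: "norm (Q x z r - Q y z r) <= b * exp (m * r)" if r: "r \<in> I" for r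
  proof -
   have "norm (x z r powr of_real p - y z r powr of_real p) <= p * M powr (p - 1) * norm (x z r - y z r)"
    using xr[OF x(2) z r] xr[OF y(2) z r] by (intro complex_powr_lipschitz p)
   also have "... <= p * M powr (p - 1) * d" using xy z r p by (intro mult_left_mono) (auto simp: near_def)
   finally have "norm (of_real (k2 r) * (x z r powr of_real p - y z r powr of_real p)) <= C * exp (m * r) * (p * M powr (p - 1) * d)"
    unfolding norm_mult norm_of_real using k2(2)[OF r] by (intro mult_mono) auto
   moreover have "Q x z r - Q y z r = of_real (k2 r) * (x z r powr of_real p - y z r powr of_real p)" by (simp add: Q_def algebra_simps)
   ultimately show ?thesis by (simp add: b_def ac_simps)
  qed
  have Pdiff: "norm (P x z r - P y z r) <= b * E" if r: "r \<in> I" for r unfolding P_def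
   by (rule order_trans[OF double_causal_diff[OF I n m a b Qc[OF x z] Qb[OF x(2) z] Qc[OF y z] Qb[OF y(2) z] Qd r] ME[OF b r]])
  have "T x z s - T y z s = (P x z S0 - P y z S0) - (P x z s - P y z s)" by (simp add: T_def)
  also have "norm ... <= norm (P x z S0 - P y z S0) + norm (P x z s - P y z s)" by (rule norm_triangle_ineq4)
  also have "... <= b * E + b * E" by (intro add_mono Pdiff SI s)
  also have "... = (2 * (C * (p * M powr (p - 1))) * E) * d" by (simp add: b_def)
  also have "... <= 1 / 2 * d" using small(2) d by (rule mult_right_mono)
  finally show "norm (T x z s - T y z s) <= d / 2 * 1" by simp
 qed
 have cb: "ball' (%z s. of_real c)" using \<rho> by (simp add: ball'_def near_def)
 have ch: "holo_family D I (%z s. of_real c)" by (simp add: holo_family_def)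
 have T0: "near D I (%_. 1) (\<rho> / 2) (T (%z s. of_real c)) (%z s. of_real c)" unfolding near_def
 proof (intro ballI)
  fix z s assume z: "z \<in> D" and s: "s \<in> I"
  define x where "x = (%(z::complex) (s::real). complex_of_real c)"
  have Pb: "norm (P x z r) <= a * E" if r: "r \<in> I" for r unfolding P_def x_def
   by (rule order_trans[OF dc(5)[OF Qc[OF ch cb z] Qb[OF cb z] r] ME[OF a r]])
  have "norm (T x z s - of_real c) <= norm (y0 z - of_real c) + norm (P x z S0 - P x z s)"
  proof -
   have "T x z s - of_real c = (y0 z - of_real c) + (P x z S0 - P x z s)" by (simp add: T_def)
   then show ?thesis by (simp only: norm_triangle_ineq)
  qed
  also have "... <= \<rho> / 4 + (a * E + a * E)"
   using y0(2)[OF z] norm_triangle_ineq4[of "P x z S0" "P x z s"] Pb[OF SI] Pb[OF s] by linarith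
  also have "a * E + a * E <= \<rho> / 4" using small(1) unfolding a_def[symmetric] by linarith
  finally show "norm (T (%z s. of_real c) z s - of_real c) <= \<rho> / 2 * 1" by (simp add: x_def)
 qed
 have "\<exists>x. holo_family D I x & near D I (%_. 1) \<rho> x (%z s. of_real c) & (\<forall>z\<in>D. \<forall>t\<in>I. T x z t = x z t)"
 proof (rule holo_family_fixed_point[where T = T])
  show "0 <= \<rho>" using \<rho> by simp
 qed (use ch TX Tlip T0 in \<open>simp_all add: ball'_def\<close>)
 then obtain x where x: "holo_family D I x" "ball' x" and fixp: "!!z t. z \<in> D ==> t \<in> I ==> T x z t = x z t"
  unfolding ball'_def by blast
 define x1 where "x1 z s = - causal (of_real n) (Q x z) s" for z s
 have dx: "(x z has_vector_derivative x1 z t) (at t)" if z: "z \<in> D" and t: "t \<in> I" for z t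
 proof -
  have "(T x z has_vector_derivative 0 - causal (of_real n) (Q x z) t) (at t)"
   unfolding T_def by (intro has_vector_derivative_diff has_vector_derivative_const Pd x z t)
  then have "(T x z has_vector_derivative x1 z t) (at t)" by (simp add: x1_def)
  then show ?thesis by (rule has_vector_derivative_transform_within_open) (use I t fixp[OF z] in \<open>auto simp: lower_ray_def\<close>)
 qed
 have dx1: "(x1 z has_vector_derivative - (n *\<^sub>R x1 z t) - (of_real (k2 t) * x z t powr of_real p + z * of_real (g2 t))) (at t)"
  if z: "z \<in> D" and t: "t \<in> I" for z t
 proof -
  have "(x1 z has_vector_derivative - (Q x z t - of_real n * causal (of_real n) (Q x z) t)) (at t)"
   unfolding x1_def[abs_def] by (intro has_vector_derivative_minus dc(1) Qc Qb x z t)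
  then show ?thesis by (simp add: x1_def Q_def scaleR_conv_of_real algebra_simps)
 qed
 show ?thesis
 proof (rule that[of x x1 "a / (n + m) * exp (m * (S0 + 1))"])
  show "holo_family D I x" by (rule x(1))
  show "holo_family D I x1" unfolding holo_family_def
  proof (intro conjI ballI impI)
   show "continuous_on I (x1 z)" if "z \<in> D" for z
    by (rule continuous_on_vector_derivative[OF has_vector_derivative_at_within[OF dx1[OF that]]])
   show "(%z. x1 z t) holomorphic_on D" if "t \<in> I" for t unfolding x1_def by (intro holomorphic_intros Yh x that)
  qed
  show "norm (x z s - of_real c) <= \<rho>" if "z \<in> D" "s \<in> I" for z s using x(2) that by (simp add: ball'_def near_def)
  show "x z S0 = y0 z" if "z \<in> D" for z using fixp[OF that SI] by (simp add: T_def)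
  show "norm (x1 z s) <= a / (n + m) * exp (m * (S0 + 1))" if "z \<in> D" "s \<in> I" for z s
  proof -
   have "norm (x1 z s) <= a / (n + m) * exp (m * s)"
    unfolding x1_def norm_minus_cancel by (rule dc(3)[OF Qc[OF x that(1)] Qb[OF x(2) that(1)] that(2)])
   also have "... <= a / (n + m) * exp (m * (S0 + 1))" using that m an by (intro mult_left_mono) (auto simp: I_def)
   finally show ?thesis .
  qed
 qed (use dx dx1 in auto)
qed

text \<open>The difference vanishes at S0 and falls under \<open>outer_uniqueness\<close>. The
  velocities agree as well: the difference is zero on the closed half-line, and a one-sided
  derivative at S0 determines the derivative there.\<close>

lemma outer_unique:
 fixes n m p C M N S0 :: real and x x1 y y1 q :: "real => complex"
 assumes n: "0 < n" and m: "0 < m" and p: "1 <= p" and C: "0 <= C"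
  and k2: "!!s. s <= S0 ==> \<bar>k2 s\<bar> <= C * exp (m * s)"
  and small: "C * (p * M powr (p - 1)) * exp (m * S0) <= m * (n + m) / 2"
  and x: "!!s. s <= S0 ==> (x has_vector_derivative x1 s) (at s)"
   "!!s. s <= S0 ==> (x1 has_vector_derivative - (n *\<^sub>R x1 s) - (of_real (k2 s) * x s powr of_real p + q s)) (at s)"
   "!!s. s <= S0 ==> 0 < Re (x s) & norm (x s) <= M & norm (x1 s) <= N"
  and y: "!!s. s <= S0 ==> (y has_vector_derivative y1 s) (at s)"
   "!!s. s <= S0 ==> (y1 has_vector_derivative - (n *\<^sub>R y1 s) - (of_real (k2 s) * y s powr of_real p + q s)) (at s)"
   "!!s. s <= S0 ==> 0 < Re (y s) & norm (y s) <= M & norm (y1 s) <= N"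
  and eq: "x S0 = y S0"
 shows "s <= S0 ==> x s = y s" "s <= S0 ==> x1 s = y1 s"
proof -
 define d where "d s = x s - y s" for s
 define d1 where "d1 s = x1 s - y1 s" for s
 define h where "h s = - (of_real (k2 s) * (x s powr of_real p - y s powr of_real p))" for s
 have dd: "(d has_vector_derivative d1 s) (at s)" if "s <= S0" for s
  unfolding d_def[abs_def] d1_def using that by (intro has_vector_derivative_diff x y)
 have z: "d s = 0" if s: "s <= S0" for s
 proof (rule outer_uniqueness[OF n m dd _ _ _ _ _ small s, where h = h and M = "2 * (\<bar>M\<bar> + \<bar>N\<bar>)"])
  show "d S0 = 0" using eq by (simp add: d_def)
  show "0 <= C * (p * M powr (p - 1))" using C p by simp
  fix s assume s: "s <= S0"
  have "(d1 has_vector_derivative (- (n *\<^sub>R x1 s) - (of_real (k2 s) * x s powr of_real p + q s))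
   - (- (n *\<^sub>R y1 s) - (of_real (k2 s) * y s powr of_real p + q s))) (at s)"
   unfolding d1_def[abs_def] by (intro has_vector_derivative_diff x(2)[OF s] y(2)[OF s])
  then show "(d1 has_vector_derivative (- (n *\<^sub>R d1 s) + h s)) (at s)"
   by (rule has_vector_derivative_eq_rhs) (simp add: d1_def h_def algebra_simps)
  have "norm (x s powr of_real p - y s powr of_real p) <= p * M powr (p - 1) * norm (d s)"
   unfolding d_def using x(3)[OF s] y(3)[OF s] by (intro complex_powr_lipschitz p) auto
  then have "norm (h s) <= C * exp (m * s) * (p * M powr (p - 1) * norm (d s))"
   unfolding h_def norm_minus_cancel norm_mult norm_of_real using k2[OF s] by (intro mult_mono) auto
  then show "norm (h s) <= C * (p * M powr (p - 1)) * exp (m * s) * norm (d s)" by (simp add: ac_simps)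
  show "norm (d s) <= 2 * (\<bar>M\<bar> + \<bar>N\<bar>) & norm (d1 s) <= 2 * (\<bar>M\<bar> + \<bar>N\<bar>)"
  proof
   have b: "norm (x s) <= M" "norm (y s) <= M" "norm (x1 s) <= N" "norm (y1 s) <= N" using x(3)[OF s] y(3)[OF s] by auto
   show "norm (d s) <= 2 * (\<bar>M\<bar> + \<bar>N\<bar>)" using b norm_triangle_ineq4[of "x s" "y s"] abs_ge_self[of M] abs_ge_self[of N] abs_ge_zero[of M] abs_ge_zero[of N] unfolding distrib_left d_def by linarith
   show "norm (d1 s) <= 2 * (\<bar>M\<bar> + \<bar>N\<bar>)" using b norm_triangle_ineq4[of "x1 s" "y1 s"] abs_ge_self[of M] abs_ge_self[of N] abs_ge_zero[of M] abs_ge_zero[of N] unfolding distrib_left d1_def by linarith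
  qed
 qed
 show xy: "s <= S0 ==> x s = y s" for s using z[of s] by (simp add: d_def)
 show "s <= S0 ==> x1 s = y1 s"
 proof -
  assume s: "s <= S0"
  have "(d has_vector_derivative d1 s) (at s within {..S0})" by (rule has_vector_derivative_at_within[OF dd[OF s]])
  moreover have "((%s. 0) has_vector_derivative d1 s) (at s within {..S0})"
   using calculation by (rule has_vector_derivative_transform[rotated 2]) (use z s in auto)
  moreover have "((%s. 0) has_vector_derivative (0::complex)) (at s within {..S0})" by simp
  moreover have "at s within {..S0} \<noteq> bot"
  proof -
   have "at_left s <= at s within {..S0}" using s by (intro at_le) auto
   then show ?thesis using trivial_limit_at_left_real[of s] by (metis bot.extremum_uniqueI)
  qed
  ultimately have "d1 s = 0" by (metis vector_derivative_within)
  then show "x1 s = y1 s" by (simp add: d1_def)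
 qed
qed

context emden_fowler
begin

text \<open>The coefficients of the equation for the Kelvin transform $v(s) = e^{-ns}U(-s)$, with $s = -t$.\<close>

definition kk :: "real => real" where "kk s = \<kappa> (- s) * exp (n * (p - 1) * s)"
definition gk :: "real => real" where "gk s = exp (- n * s) * \<phi> (- s)"

lemma kk_cont: "continuous_on S kk" and gk_cont: "continuous_on S gk" unfolding kk_def gk_def
 by (auto intro!: continuous_intros continuous_on_compose2[OF \<kappa>_cont] continuous_on_compose2[OF \<phi>_cont])

lemma kk_pos: "0 < kk s" and gk_nonneg: "0 <= gk s" using \<kappa>_pos \<phi>_nonneg by (auto simp: kk_def gk_def)

text \<open>Both coefficients decay at -\<infinity>: \<open>kk\<close> at the rate n (p - 1) - l,
  positive by \<open>super_top\<close>, and \<open>gk\<close> at the rate \<open>q2\<close>.\<close>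

lemma outer_bounds:
 obtains m3 C S1 where "0 < m3" "0 <= C" "!!s. s <= S1 ==> \<bar>kk s\<bar> <= C * exp (m3 * s) & \<bar>gk s\<bar> <= C * exp (m3 * s)"
proof -
 define m1 where "m1 = n * (p - 1) - l"
 have m1: "0 < m1" using super_top l by (simp add: m1_def)
 define m3 where "m3 = min m1 q2"
 have m3: "0 < m3" "m3 <= m1" "m3 <= q2" using m1 q2 by (auto simp: m3_def)
 obtain Cf T' where C: "!!t. T' <= t ==> \<phi> t <= Cf * exp (- (n + q2) * t)" using \<phi>_top by blast
 have "\<forall>\<^sub>F t in at_top. \<kappa> t * exp (- l * t) <= 2 * k1 & T' <= t & 0 <= t"
  using kappa_eventually_top eventually_ge_at_top[of T'] eventually_ge_at_top[of 0] by eventually_elim auto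
 then obtain T where T: "!!t. T <= t ==> \<kappa> t * exp (- l * t) <= 2 * k1 & T' <= t & 0 <= t"
  by (auto simp: eventually_at_top_linorder)
 show ?thesis
 proof (rule that[OF m3(1), of "2 * k1 + max 0 Cf" "- T"])
  show "0 <= 2 * k1 + max 0 Cf" using k1 by simp
  fix s assume "s <= - T"
  then have t: "\<kappa> (- s) * exp (- l * (- s)) <= 2 * k1" "T' <= - s" "s <= 0" using T[of "- s"] by auto
  have e: "exp (m1 * s) <= exp (m3 * s)" "exp (q2 * s) <= exp (m3 * s)" using t m3 by (auto intro: mult_right_mono_neg)
  have "kk s = (\<kappa> (- s) * exp (- l * (- s))) * exp (m1 * s)"
  proof -
   have "- l * (- s) + m1 * s = n * (p - 1) * s" by (simp add: m1_def algebra_simps)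
   then have "exp (- l * (- s)) * exp (m1 * s) = exp (n * (p - 1) * s)" by (simp only: exp_add[symmetric])
   then show ?thesis by (simp only: kk_def mult.assoc)
  qed
  also have "... <= 2 * k1 * exp (m1 * s)" using t by (intro mult_right_mono) auto
  also have "... <= 2 * k1 * exp (m3 * s)" using e k1 by (intro mult_left_mono) auto
  also have "... <= (2 * k1 + max 0 Cf) * exp (m3 * s)" by (intro mult_right_mono) auto
  finally have a: "kk s <= (2 * k1 + max 0 Cf) * exp (m3 * s)" .
  have "gk s <= exp (- n * s) * (Cf * exp (- (n + q2) * (- s)))" unfolding gk_def using C[OF t(2)] by (intro mult_left_mono) auto
  also have "... = Cf * exp (q2 * s)"
  proof -
   have "- n * s + - (n + q2) * (- s) = q2 * s" by (simp add: algebra_simps)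
   then have "exp (- n * s) * exp (- (n + q2) * (- s)) = exp (q2 * s)" by (simp only: exp_add[symmetric])
   then show ?thesis by (simp only: mult.left_commute)
  qed
  also have "... <= max 0 Cf * exp (q2 * s)" by (intro mult_right_mono) auto
  also have "... <= max 0 Cf * exp (m3 * s)" using e by (intro mult_left_mono) auto
  also have "... <= (2 * k1 + max 0 Cf) * exp (m3 * s)" using k1 by (intro mult_right_mono) auto
  finally have b: "gk s <= (2 * k1 + max 0 Cf) * exp (m3 * s)" .
  show "\<bar>kk s\<bar> <= (2 * k1 + max 0 Cf) * exp (m3 * s) & \<bar>gk s\<bar> <= (2 * k1 + max 0 Cf) * exp (m3 * s)"
   using a b kk_pos[of s] gk_nonneg[of s] by simp
 qed
qed

lemma kelvin_force:
 assumes "0 <= v"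
 shows "exp (- n * s) * (\<kappa> (- s) * (exp (n * s) * v) powr p + \<mu> * \<phi> (- s)) = kk s * v powr p + \<mu> * gk s"
proof -
 have "(exp (n * s) * v) powr p = exp (n * s * p) * v powr p" using assms by (simp add: powr_mult powr_def[of "exp _"] ac_simps)
 moreover have "- n * s + n * s * p = n * (p - 1) * s" by (simp add: algebra_simps)
 then have "exp (- n * s) * exp (n * s * p) = exp (n * (p - 1) * s)" by (simp only: exp_add[symmetric])
 ultimately have "exp (- n * s) * (\<kappa> (- s) * (exp (n * s) * v) powr p) = kk s * v powr p"
  by (simp only: kk_def mult.assoc mult.left_commute) (simp only: mult.assoc[symmetric])
 then show ?thesis by (simp add: gk_def distrib_left mult.left_commute)
qed

lemma kelvin_ode:
 assumes S: "solves \<mu> U V" and U: "0 < U (- s)"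
 shows "((%s. exp (- n * s) * U (- s)) has_real_derivative - (exp (- n * s) * (n * U (- s) + V (- s)))) (at s)"
  "((%s. - (exp (- n * s) * (n * U (- s) + V (- s)))) has_real_derivative
   - n * (- (exp (- n * s) * (n * U (- s) + V (- s)))) - (kk s * (exp (- n * s) * U (- s)) powr p + \<mu> * gk s)) (at s)"
proof -
 have du: "(uminus has_real_derivative - 1) (at s)" by (auto intro!: derivative_eq_intros)
 have dU: "((%s. U (- s)) has_real_derivative - V (- s)) (at s)"
  using DERIV_chain2[where f = U and g = uminus, OF solvesD(1)[OF S] du] by simp
 have dV: "((%s. V (- s)) has_real_derivative n * V (- s) + force \<mu> U (- s)) (at s)"
  using DERIV_chain2[where f = V and g = uminus, OF solvesD(2)[OF S] du] by (simp add: add.commute)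
 show "((%s. exp (- n * s) * U (- s)) has_real_derivative - (exp (- n * s) * (n * U (- s) + V (- s)))) (at s)"
  using dU by (auto intro!: derivative_eq_intros simp: algebra_simps)
 have can: "exp (n * s) * (exp (- n * s) * U (- s)) = U (- s)" using exp_neg_cancel[of "- n" s] by simp
 have f: "exp (- n * s) * force \<mu> U (- s) = kk s * (exp (- n * s) * U (- s)) powr p + \<mu> * gk s"
  using kelvin_force[of "exp (- n * s) * U (- s)" s \<mu>, unfolded can] U by (simp add: force_def)
 have "((%s. - (exp (- n * s) * (n * U (- s) + V (- s)))) has_real_derivative
   - n * (- (exp (- n * s) * (n * U (- s) + V (- s)))) - exp (- n * s) * force \<mu> U (- s)) (at s)"
  using dU dV by (auto intro!: derivative_eq_intros simp: algebra_simps)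
 then show "((%s. - (exp (- n * s) * (n * U (- s) + V (- s)))) has_real_derivative
   - n * (- (exp (- n * s) * (n * U (- s) + V (- s)))) - (kk s * (exp (- n * s) * U (- s)) powr p + \<mu> * gk s)) (at s)" unfolding f .
qed

text \<open>Transforming v back gives a positive solution on t >= R with the data of the branch at
  R. The two agree there by Gronwall, so the branch inherits positivity and the bound M on exp (n t)
  U; for t < R both follow from monotonicity.\<close>

lemma fast_continuation:
 assumes \<mu>: "0 <= \<mu>"
  and v: "!!s. s <= - R ==> (v has_real_derivative v1 s) (at s)"
   "!!s. s <= - R ==> (v1 has_real_derivative - n * v1 s - (kk s * v s powr p + \<mu> * gk s)) (at s)"
   "!!s. s <= - R ==> 0 < v s & v s <= M"
  and init: "v (- R) = exp (n * R) * US \<mu> R" "v1 (- R) = - (exp (n * R) * (n * US \<mu> R + VS \<mu> R))"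
 shows "\<mu> \<in> fastset"
proof -
 have D: "descending \<mu> (US \<mu>) (VS \<mu>)" and S: "solves \<mu> (US \<mu>) (VS \<mu>)" using branchD[OF branch_sol[OF \<mu>]] by auto
 define U where "U t = exp (- n * t) * v (- t)" for t
 define V where "V t = - n * U t - exp (- n * t) * v1 (- t)" for t
 have du: "(uminus has_real_derivative - 1) (at t)" for t :: real by (auto intro!: derivative_eq_intros)
 have dv: "((%t. v (- t)) has_real_derivative - v1 (- t)) (at t)" if "R <= t" for t
  using DERIV_chain2[where f = v and g = uminus, OF v(1) du[of t]] that by simp
 have dv1: "((%t. v1 (- t)) has_real_derivative n * v1 (- t) + (kk (- t) * v (- t) powr p + \<mu> * gk (- t))) (at t)" if "R <= t" for t
  using DERIV_chain2[where f = v1 and g = uminus, OF v(2) du[of t]] that by (simp add: add.commute)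
 have dU: "(U has_real_derivative V t) (at t)" if "R <= t" for t
  unfolding U_def[abs_def] V_def using dv[OF that] by (auto intro!: derivative_eq_intros simp: algebra_simps)
 have dV: "(V has_real_derivative - n * V t - (\<kappa> t * U t powr p + \<mu> * \<phi> t)) (at t)" if t: "R <= t" for t
 proof -
  have "(V has_real_derivative - n * V t - (- n * (exp (- n * t) * v1 (- t)) + exp (- n * t) * (n * v1 (- t) + (kk (- t) * v (- t) powr p + \<mu> * gk (- t))))) (at t)"
   unfolding V_def[abs_def] by (rule derivative_eq_intros dU[OF t] dv1[OF t] refl)+ (simp add: V_def algebra_simps)
  moreover have "exp (- n * t) * (kk (- t) * v (- t) powr p + \<mu> * gk (- t)) = \<kappa> t * U t powr p + \<mu> * \<phi> t"
  proof -
   have "0 <= v (- t)" using v(3)[of "- t"] t by simp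
   from kelvin_force[OF this, of "- t" \<mu>]
   have "kk (- t) * v (- t) powr p + \<mu> * gk (- t) = exp (n * t) * (\<kappa> t * U t powr p + \<mu> * \<phi> t)" by (simp add: U_def)
   then show ?thesis using exp_neg_cancel by simp
  qed
  then have "- n * V t - (- n * (exp (- n * t) * v1 (- t)) + exp (- n * t) * (n * v1 (- t) + (kk (- t) * v (- t) powr p + \<mu> * gk (- t))))
    = - n * V t - (\<kappa> t * U t powr p + \<mu> * \<phi> t)" by (simp add: distrib_left)
  ultimately show ?thesis by (simp only:)
 qed
 have Up: "0 < U t" "exp (n * t) * U t <= M" if "R <= t" for t
  using v(3)[of "- t"] that by (auto simp: U_def mult.assoc[symmetric] exp_add[symmetric])
 have V0: "V R = VS \<mu> R" "U R = US \<mu> R"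
 proof -
  show u: "U R = US \<mu> R" unfolding U_def init(1) by (rule exp_neg_cancel)
  have "exp (- n * R) * v1 (- R) = - (n * US \<mu> R + VS \<mu> R)" unfolding init(2) mult_minus_right by (simp only: exp_neg_cancel)
  then show "V R = VS \<mu> R" unfolding V_def u by simp
 qed
 have M0: "0 < M" using v(3)[of "- R"] by simp
 have eq: "US \<mu> t = U t" if t: "R <= t" for t
 proof -
  obtain Bk where Bk: "0 <= Bk" "!!r. R <= r ==> r <= t ==> \<bar>\<kappa> r\<bar> <= Bk" using continuous_bound_Icc[OF \<kappa>_cont] by blast
  define Mx where "Mx = \<bar>US \<mu> R\<bar> + exp (- n * R) * M"
  define C where "C = Bk * (p * Mx powr (p - 1))"
  have C: "0 <= C" using Bk p by (simp add: C_def)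
  define h where "h r = - (\<kappa> r * ((max 0 (US \<mu> r)) powr p - U r powr p))" for r
  have "(norm (VS \<mu> t - V t))^2 + (norm (US \<mu> t - U t))^2 \<le>
    exp ((2 * \<bar>n\<bar> + \<bar>0\<bar> + C + 2) * (t - R)) * ((norm (VS \<mu> R - V R))^2 + (norm (US \<mu> R - U R))^2 + 0^2)"
  proof (rule oscillator_growth[where h = h and b = t and d = "%r. US \<mu> r - U r" and ?d1.0 = "%r. VS \<mu> r - V r"])
   fix r assume r: "R <= r" "r <= t"
   show "((%r. US \<mu> r - U r) has_vector_derivative VS \<mu> r - V r) (at r)"
    unfolding has_real_derivative_iff_has_vector_derivative[symmetric] by (intro DERIV_diff solvesD(1)[OF S] dU r)
   have "((%r. VS \<mu> r - V r) has_real_derivative (- n * VS \<mu> r - force \<mu> (US \<mu>) r) - (- n * V r - (\<kappa> r * U r powr p + \<mu> * \<phi> r))) (at r)"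
    by (intro DERIV_diff solvesD(2)[OF S] dV r)
   moreover have "(- n * VS \<mu> r - force \<mu> (US \<mu>) r) - (- n * V r - (\<kappa> r * U r powr p + \<mu> * \<phi> r))
    = - (n *\<^sub>R (VS \<mu> r - V r)) - 0 *\<^sub>R (US \<mu> r - U r) + h r" by (simp add: h_def force_def algebra_simps)
   ultimately show "((%r. VS \<mu> r - V r) has_vector_derivative - (n *\<^sub>R (VS \<mu> r - V r)) - 0 *\<^sub>R (US \<mu> r - U r) + h r) (at r)"
    unfolding has_real_derivative_iff_has_vector_derivative[symmetric] by (simp only:)
   have "0 <= exp (- n * R) * M" using M0 by simp
   then have "US \<mu> r <= Mx" using descending_mono[OF D r(1)] abs_ge_self[of "US \<mu> R"] unfolding Mx_def by linarith
   moreover have "0 <= Mx" using M0 by (simp add: Mx_def)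
   moreover have "U r <= Mx"
   proof -
    have "exp (- n * r) * (exp (n * r) * U r) <= exp (- n * R) * M" using Up[OF r(1)] r n M0 by (intro mult_mono) auto
    then show ?thesis by (simp only: exp_neg_cancel) (simp add: Mx_def)
   qed
   ultimately have "\<bar>(max 0 (US \<mu> r)) powr p - U r powr p\<bar> <= p * Mx powr (p - 1) * \<bar>max 0 (US \<mu> r) - U r\<bar>"
    using Up(1)[OF r(1)] by (intro real_powr_lipschitz p) auto
   also have "... <= p * Mx powr (p - 1) * \<bar>US \<mu> r - U r\<bar>" using Up(1)[OF r(1)] p by (intro mult_left_mono) auto
   finally have "\<bar>\<kappa> r\<bar> * \<bar>(max 0 (US \<mu> r)) powr p - U r powr p\<bar> <= Bk * (p * Mx powr (p - 1) * \<bar>US \<mu> r - U r\<bar>)"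
    using Bk(2)[OF r] Bk(1) by (intro mult_mono) auto
   then show "norm (h r) <= C * norm (US \<mu> r - U r) + 0" by (simp add: h_def abs_mult C_def mult.assoc)
  qed (use C t in auto)
  then have "(VS \<mu> t - V t)^2 + (US \<mu> t - U t)^2 <= 0" using V0 by simp
  then show ?thesis by (simp add: sum_power2_le_zero_iff)
 qed
 have pos: "0 < US \<mu> t" for t
 proof (cases "R <= t")
  case True then show ?thesis using eq Up by simp
 next
  case False
  then show ?thesis using descending_mono[OF D, of t R] eq[OF order_refl] Up(1)[OF order_refl] by simp
 qed
 have "exp (n * t) * US \<mu> t <= M" for t
 proof (cases "R <= t")
  case True then show ?thesis using eq Up by simp
 next
  case False
  then show ?thesis using kelvin_mono[OF D pos, of t R] eq[OF order_refl] Up(2)[OF order_refl] by simp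
 qed
 then show ?thesis using \<mu> pos by (auto simp: fastset_def Mset_def)
qed

section \<open>The matching function and its zeros\<close>

text \<open>\<open>G\<close> is the mismatch of derivatives, at the matching time, between the
  branch and the bounded solution with the same value. A fast solution has a bounded Kelvin
  transform, which is that solution by \<open>outer_unique\<close>; conversely, at a zero of
  \<open>G\<close> the bounded solution continues the branch. The bounds \<open>yl\<close> and
  \<open>Bd\<close> fix the radius \<rho> and the size M before the matching time is chosen, so
  there is no circularity.\<close>

lemma fast_analytic:
 assumes m0: "\<mu>0 \<in> fastset"
 obtains r G where "0 < r" "G holomorphic_on ball (complex_of_real \<mu>0) r"
  "!!\<mu>. \<mu> \<in> fastset ==> \<bar>\<mu> - \<mu>0\<bar> < r ==> G (of_real \<mu>) = 0"
  "!!\<mu>. 0 <= \<mu> ==> \<bar>\<mu> - \<mu>0\<bar> < r ==> G (of_real \<mu>) = 0 ==> \<mu> \<in> fastset"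
proof -
 have M0: "\<mu>0 \<in> Mset" using m0 by (simp add: fastset_def)
 have \<mu>0: "0 <= \<mu>0" by (rule MsetD(1)[OF M0])
 obtain yl e R1 Bd where yl: "0 < yl" and e: "0 < e" and nf:
  "!!\<mu> t. \<mu> \<in> fastset ==> \<bar>\<mu> - \<mu>0\<bar> < e ==> R1 <= t ==> yl <= exp (n * t) * US \<mu> t & exp (n * t) * US \<mu> t <= Bd"
  by (fact near_fast[OF m0])
 have yB: "yl <= Bd" using nf[OF m0 _ order_refl] e by force
 obtain m3 C S1 where m3: "0 < m3" and C: "0 <= C" and ob: "!!s. s <= S1 ==> \<bar>kk s\<bar> <= C * exp (m3 * s) & \<bar>gk s\<bar> <= C * exp (m3 * s)"
  using outer_bounds by blast
 define M where "M = 2 * Bd"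
 have M: "0 < M" using yl yB by (simp add: M_def)
 define B where "B = \<mu>0 + 1"
 have B: "0 <= B" using \<mu>0 by (simp add: B_def)
 define \<rho> where "\<rho> = yl / 2"
 have \<rho>: "0 < \<rho>" using yl by (simp add: \<rho>_def)
 define q where "q = m3 * (n + m3)"
 have q: "0 < q" using m3 n by (simp add: q_def)
 have sm: "\<forall>\<^sub>F s in at_bot. X * exp (m3 * s) < y" if "0 < y" for X y
 proof -
  have "((%s. X * exp (m3 * s)) \<longlongrightarrow> X * 0) at_bot" by (intro tendsto_intros exp_mult_at_bot m3)
  then show ?thesis using that by (intro order_tendstoD(2)) auto
 qed
 have "\<forall>\<^sub>F s in at_bot. 2 * (C * (M powr p + B)) * exp (m3 * s) < q * (\<rho> / 4) & 2 * (C * (p * M powr (p - 1))) * exp (m3 * s) < q * (1 / 2)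
   & C * (p * M powr (p - 1)) * exp (m3 * s) < q / 2 & s <= S1 & s <= - R1"
  by (intro eventually_conj sm eventually_le_at_bot) (use q \<rho> in auto)
 then obtain S where S: "!!s. s <= S ==> 2 * (C * (M powr p + B)) * exp (m3 * s) < q * (\<rho> / 4) & 2 * (C * (p * M powr (p - 1))) * exp (m3 * s) < q * (1 / 2)
   & C * (p * M powr (p - 1)) * exp (m3 * s) < q / 2 & s <= S1 & s <= - R1" by (auto simp: eventually_at_bot_linorder)
 \<comment> \<open>One unit to the left of S, because \<open>outer_family\<close> works on times up
   to S0 + 1.\<close>
 define S0 where "S0 = S - 1"
 define R where "R = - S0"
 have SS: "S0 + 1 = S" "- R = S0" "S0 <= S" by (auto simp: S0_def R_def)
 have RR: "R1 <= R" using S[OF SS(3)] by (simp add: R_def)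
 obtain r1 X X1 where r1: "0 < r1" and X: "X holomorphic_on ball (of_real \<mu>0) r1" "X1 holomorphic_on ball (of_real \<mu>0) r1"
  and XU: "!!\<mu>. 0 <= \<mu> ==> \<bar>\<mu> - \<mu>0\<bar> < r1 ==> X (of_real \<mu>) = of_real (US \<mu> R) & X1 (of_real \<mu>) = of_real (VS \<mu> R)"
  using inner_family[OF M0, of R] by blast
 define y0 where "y0 z = of_real (exp (n * R)) * X z" for z
 define c where "c = exp (n * R) * US \<mu>0 R"
 have c: "yl <= c" "c <= Bd" using nf[OF m0 _ RR] e by (auto simp: c_def)
 have y0c: "y0 (of_real \<mu>0) = of_real c" using XU[OF \<mu>0] r1 by (simp add: y0_def c_def)
 have y0h: "y0 holomorphic_on ball (of_real \<mu>0) r1" unfolding y0_def[abs_def] by (intro holomorphic_intros X)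
 have y0cont: "isCont y0 (of_real \<mu>0)" using holomorphic_on_imp_continuous_on[OF y0h] r1 by (simp add: continuous_on_eq_continuous_at)
 have \<rho>4: "0 < \<rho> / 4" using \<rho> by simp
 from y0cont[unfolded continuous_at_eps_delta, rule_format, OF \<rho>4]
 obtain r2 where r2': "0 < r2" "\<forall>z. dist z (of_real \<mu>0) < r2 --> dist (y0 z) (y0 (of_real \<mu>0)) < \<rho> / 4"
  by (elim exE conjE)
 have r2: "0 < r2" "!!z. dist z (of_real \<mu>0) < r2 ==> dist (y0 z) (of_real c) < \<rho> / 4" using r2' unfolding y0c by blast+
 define r where "r = min (min r1 r2) (min 1 e)"
 have r: "0 < r" "r <= r1" "r <= r2" "r <= 1" "r <= e" using r1 r2 e by (auto simp: r_def)
 define D where "D = ball (complex_of_real \<mu>0) r"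
 define I where "I = {..<S0 + 1}"
 have DI: "D \<subseteq> ball (of_real \<mu>0) r1" unfolding D_def using r by (intro subset_ball) auto
 have zD: "of_real \<mu> \<in> D" if "\<bar>\<mu> - \<mu>0\<bar> < r" for \<mu>
  using that by (simp add: D_def dist_norm abs_minus_commute of_real_diff[symmetric] norm_of_real del: of_real_diff)
 have p1: "1 <= p" using p by simp
 have oD: "open D" by (simp add: D_def)
 have zB: "norm z <= B" if "z \<in> D" for z
 proof -
  have "norm (z - of_real \<mu>0) < r" using that by (simp add: D_def dist_norm norm_minus_commute)
  then show ?thesis using norm_triangle_sub[of z "of_real \<mu>0"] r(4) \<mu>0 by (simp add: B_def)
 qed
 have kI: "\<bar>kk s\<bar> <= C * exp (m3 * s)" and gI: "\<bar>gk s\<bar> <= C * exp (m3 * s)" if "s \<in> {..<S0 + 1}" for s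
 proof -
  have "s <= S" using that SS by simp
  then have "s <= S1" using S by blast
  then show "\<bar>kk s\<bar> <= C * exp (m3 * s)" "\<bar>gk s\<bar> <= C * exp (m3 * s)" using ob by blast+
 qed
 have yD: "y0 holomorphic_on D" by (rule holomorphic_on_subset[OF y0h DI])
 have yc: "norm (y0 z - of_real c) <= \<rho> / 4" if "z \<in> D" for z
  using r2(2)[of z] that r(3) by (simp add: D_def dist_norm norm_minus_commute)
 have rr: "0 < \<rho>" "\<rho> < c" "c + \<rho> <= M" using \<rho> c yl yB by (auto simp: \<rho>_def M_def)
 have b: "X * (exp (m3 * (S0 + 1)) / (m3 * (n + m3))) <= y" if "X * exp (m3 * S) < q * y" for X y
  using that q unfolding SS q_def[symmetric] by (simp add: divide_le_eq mult.commute)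
 have s1: "2 * (C * (M powr p + B)) * (exp (m3 * (S0 + 1)) / (m3 * (n + m3))) <= \<rho> / 4"
  and s2: "2 * (C * (p * M powr (p - 1))) * (exp (m3 * (S0 + 1)) / (m3 * (n + m3))) <= 1 / 2" by (rule b, use S[OF order_refl] in blast)+
 obtain x x1 N where xh: "holo_family D I x" "holo_family D I x1"
  and xc: "!!z s. z \<in> D ==> s \<in> I ==> norm (x z s - of_real c) <= \<rho>" and xS: "!!z. z \<in> D ==> x z S0 = y0 z"
  and dx: "!!z s. z \<in> D ==> s \<in> I ==> (x z has_vector_derivative x1 z s) (at s)"
  "!!z s. z \<in> D ==> s \<in> I ==> (x1 z has_vector_derivative
    - (n *\<^sub>R x1 z s) - (of_real (kk s) * x z s powr of_real p + z * of_real (gk s))) (at s)"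
  and N: "!!z s. z \<in> D ==> s \<in> I ==> norm (x1 z s) <= N" unfolding I_def
 proof (rule outer_family[OF n m3 p1 C oD zB B kk_cont kI gk_cont gI yD yc rr s1 s2], goal_cases)
  case (5 x x1 N)
  show ?case by (rule 5(1)[OF 5(2-)])
 qed
 have SI: "S0 \<in> I" and sI: "!!s. s <= S0 ==> s \<in> I" by (auto simp: I_def)
 have xr: "0 < Re (x z s)" "norm (x z s) <= M" if "z \<in> D" "s \<in> I" for z s
 proof -
  have h: "norm (x z s - of_real c) <= \<rho>" by (rule xc[OF that])
  have "\<bar>Re (x z s) - c\<bar> <= \<rho>" using h abs_Re_le_cmod[of "x z s - of_real c"] by simp
  then show "0 < Re (x z s)" using rr by linarith
  have "norm (x z s) <= norm (x z s - of_real c) + c" using norm_triangle_sub[of "x z s" "of_real c"] c yl by simp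
  then show "norm (x z s) <= M" using h rr by linarith
 qed
 have kb: "\<bar>kk s\<bar> <= C * exp (m3 * s)" if "s <= S0" for s using ob[of s] S[of s] that SS by auto
 have us: "C * (p * M powr (p - 1)) * exp (m3 * S0) <= m3 * (n + m3) / 2" using S[OF SS(3)] by (simp add: q_def)
 \<comment> \<open>Under v(s) = exp (-n s) U(-s) the branch has v'(-R) = -exp (n R) (n U(R) + V(R)),
   hence the plus sign.\<close>
 define G where "G z = x1 z S0 + of_real (exp (n * R)) * (of_real n * X z + X1 z)" for z
 show ?thesis
 proof (rule that[OF r(1), of G])
  have "(%z. x1 z S0) holomorphic_on D" using xh(2) SI by (simp add: holo_family_def D_def)
  then have "G holomorphic_on D" unfolding G_def[abs_def] by (intro holomorphic_intros holomorphic_on_subset[OF X(1) DI] holomorphic_on_subset[OF X(2) DI])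
  then show "G holomorphic_on ball (complex_of_real \<mu>0) r" by (simp add: D_def)
 next
  fix \<mu> assume mf: "\<mu> \<in> fastset" and mr: "\<bar>\<mu> - \<mu>0\<bar> < r"
  have MM: "\<mu> \<in> Mset" using mf by (simp add: fastset_def)
  note U = MsetD(2)[OF MM] and DD = MsetD(3)[OF MM] and SM = MsetD(4)[OF MM] and m = MsetD(1)[OF MM]
  define v where "v s = exp (- n * s) * US \<mu> (- s)" for s
  define v1 where "v1 s = - (exp (- n * s) * (n * US \<mu> (- s) + VS \<mu> (- s)))" for s
  have vb: "0 < v s" "v s <= Bd" if "s <= S0" for s
  proof -
   have "R1 <= - s" using that RR by (simp add: R_def)
   from nf[OF mf _ this] mr r(5) show "0 < v s" "v s <= Bd" using yl by (auto simp: v_def)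
  qed
  have v1b: "\<bar>v1 s\<bar> <= n * Bd" if "s <= S0" for s
  proof -
   have "0 <= n * US \<mu> (- s) + VS \<mu> (- s)" "VS \<mu> (- s) < 0" using cone[OF DD U, of "- s"] DD by (auto simp: descending_def)
   then have "\<bar>n * US \<mu> (- s) + VS \<mu> (- s)\<bar> <= n * US \<mu> (- s)" by linarith
   then have "exp (- n * s) * \<bar>n * US \<mu> (- s) + VS \<mu> (- s)\<bar> <= exp (- n * s) * (n * US \<mu> (- s))" by (intro mult_left_mono) auto
   also have "... = n * v s" by (simp add: v_def)
   also have "... <= n * Bd" using vb(2)[OF that] n by (intro mult_left_mono) auto
   finally show ?thesis by (simp add: v1_def abs_mult)
  qed
  have mr1: "\<bar>\<mu> - \<mu>0\<bar> < r1" using mr r by simp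
  have "x1 (of_real \<mu>) S0 = of_real (v1 S0)"
  proof (rule outer_unique(2)[OF n m3 p1 C kb us, where x = "x (of_real \<mu>)" and ?x1.0 = "x1 (of_real \<mu>)" and y = "%s. of_real (v s)" and ?y1.0 = "%s. of_real (v1 s)"
     and q = "%s. of_real \<mu> * of_real (gk s)" and N = "max N (n * Bd)"])
   show "x (of_real \<mu>) S0 = of_real (v S0)" unfolding xS[OF zD[OF mr]] y0_def using XU[OF m mr1] by (simp add: v_def R_def)
   fix s assume s: "s <= S0"
   show "0 < Re (x (of_real \<mu>) s) & norm (x (of_real \<mu>) s) <= M & norm (x1 (of_real \<mu>) s) <= max N (n * Bd)"
    using xr[OF zD[OF mr] sI[OF s]] N[OF zD[OF mr] sI[OF s]] by auto
   show "0 < Re (complex_of_real (v s)) & norm (complex_of_real (v s)) <= M & norm (complex_of_real (v1 s)) <= max N (n * Bd)"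
    using vb[OF s] v1b[OF s] by (auto simp: M_def)
   show "((%s. complex_of_real (v s)) has_vector_derivative of_real (v1 s)) (at s)"
    unfolding v_def[abs_def] v1_def by (intro has_vector_derivative_complex_of_real kelvin_ode(1)[OF SM U])
   have "((%s. complex_of_real (v1 s)) has_vector_derivative of_real (- n * v1 s - (kk s * v s powr p + \<mu> * gk s))) (at s)"
    unfolding v_def v1_def[abs_def] by (intro has_vector_derivative_complex_of_real kelvin_ode(2)[OF SM U])
   then show "((%s. complex_of_real (v1 s)) has_vector_derivative - (n *\<^sub>R complex_of_real (v1 s)) -
     (of_real (kk s) * of_real (v s) powr of_real p + of_real \<mu> * of_real (gk s))) (at s)"
    by (rule has_vector_derivative_eq_rhs) (use vb(1)[OF s] in \<open>simp add: powr_of_real scaleR_conv_of_real\<close>)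
  qed (use dx zD[OF mr] sI in auto)
  then show "G (of_real \<mu>) = 0" using XU[OF m mr1] by (simp add: G_def v1_def R_def)
 next
  fix \<mu> assume m: "0 <= \<mu>" and mr: "\<bar>\<mu> - \<mu>0\<bar> < r" and G0: "G (of_real \<mu>) = 0"
  have mr1: "\<bar>\<mu> - \<mu>0\<bar> < r1" using mr r by simp
  define w where "w s = x (of_real \<mu>) s" for s
  define w1 where "w1 s = x1 (of_real \<mu>) s" for s
  have dw: "(w has_vector_derivative w1 s) (at s)"
   "(w1 has_vector_derivative - (n *\<^sub>R w1 s) - (of_real (kk s) * w s powr of_real p + of_real \<mu> * of_real (gk s))) (at s)"
   "0 < Re (w s)" "norm (w s) <= M" "norm (w1 s) <= N" if "s <= S0" for s
   using dx xr N zD[OF mr] sI[OF that] unfolding w_def[abs_def] w1_def[abs_def] by auto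
  have w0: "w S0 = of_real (exp (n * R) * US \<mu> R)" unfolding w_def xS[OF zD[OF mr]] y0_def using XU[OF m mr1] by simp
  \<comment> \<open>With a real parameter and real data the conjugate solves the same problem, so
    uniqueness makes the solution real.\<close>
  have real: "w s = cnj (w s)" if "s <= S0" for s
  proof (rule outer_unique(1)[OF n m3 p1 C kb us, where x = w and ?x1.0 = w1 and y = "%s. cnj (w s)" and ?y1.0 = "%s. cnj (w1 s)"
     and q = "%s. of_real \<mu> * of_real (gk s)" and N = N, OF _ dw(1,2) _ _ _ _ _ that])
   show "w S0 = cnj (w S0)" by (simp add: w0)
   fix s assume s: "s <= S0"
   show "s <= S0" "s <= S0" by fact+
   show "((%s. cnj (w s)) has_vector_derivative cnj (w1 s)) (at s)"
    by (rule bounded_linear.has_vector_derivative[OF bounded_linear_cnj dw(1)[OF s]])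
   have "((%s. cnj (w1 s)) has_vector_derivative cnj (- (n *\<^sub>R w1 s) - (of_real (kk s) * w s powr of_real p + of_real \<mu> * of_real (gk s)))) (at s)"
    by (rule bounded_linear.has_vector_derivative[OF bounded_linear_cnj dw(2)[OF s]])
   then show "((%s. cnj (w1 s)) has_vector_derivative - (n *\<^sub>R cnj (w1 s)) - (of_real (kk s) * cnj (w s) powr of_real p + of_real \<mu> * of_real (gk s))) (at s)"
    by (rule has_vector_derivative_eq_rhs) (use dw(3)[OF s] in \<open>simp add: cnj_powr\<close>)
  qed (use dw in auto)
  have wre: "w s = of_real (Re (w s))" if "s <= S0" for s using real[OF that] by (simp add: complex_eq_iff)
  show "\<mu> \<in> fastset"
  proof (rule fast_continuation[OF m, where R = R and v = "%s. Re (w s)" and ?v1.0 = "%s. Re (w1 s)" and M = M])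
   fix s assume "s <= - R"
   then have s: "s <= S0" by (simp add: SS)
   show "((%s. Re (w s)) has_real_derivative Re (w1 s)) (at s)" unfolding has_real_derivative_iff_has_vector_derivative
    by (rule bounded_linear.has_vector_derivative[OF bounded_linear_Re dw(1)[OF s]])
   have "((%s. Re (w1 s)) has_real_derivative Re (- (n *\<^sub>R w1 s) - (of_real (kk s) * w s powr of_real p + of_real \<mu> * of_real (gk s)))) (at s)"
    unfolding has_real_derivative_iff_has_vector_derivative by (rule bounded_linear.has_vector_derivative[OF bounded_linear_Re dw(2)[OF s]])
   moreover have "w s powr of_real p = of_real (Re (w s) powr p)" using dw(3)[OF s] by (subst wre[OF s]) (simp add: powr_of_real)
   ultimately show "((%s. Re (w1 s)) has_real_derivative - n * Re (w1 s) - (kk s * Re (w s) powr p + \<mu> * gk s)) (at s)" by simp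
   show "0 < Re (w s) & Re (w s) <= M" using dw(3,4)[OF s] complex_Re_le_cmod[of "w s"] by simp
  next
   show "Re (w (- R)) = exp (n * R) * US \<mu> R" unfolding SS w0 by simp
   have "w1 S0 = - (of_real (exp (n * R)) * (of_real n * X (of_real \<mu>) + X1 (of_real \<mu>)))"
    using G0 unfolding G_def w1_def by (simp add: eq_neg_iff_add_eq_0)
   then have "w1 S0 = of_real (- (exp (n * R) * (n * US \<mu> R + VS \<mu> R)))" using XU[OF m mr1] by simp
   then show "Re (w1 (- R)) = - (exp (n * R) * (n * US \<mu> R + VS \<mu> R))" unfolding SS by simp
  qed
 qed
qed

text \<open>By the identity theorem \<open>G\<close> vanishes on the whole disc, and the converse
  half of \<open>fast_analytic\<close> turns this into fast decay for all nearby \<mu> >= 0.\<close>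

lemma fast_accumulation:
 assumes m0: "\<mu>0 \<in> fastset" and lp: "\<mu>0 islimpt fastset"
 obtains e where "0 < e" "!!\<mu>. 0 <= \<mu> ==> \<bar>\<mu> - \<mu>0\<bar> < e ==> \<mu> \<in> fastset"
proof -
 obtain r G where r: "0 < r" and G: "G holomorphic_on ball (complex_of_real \<mu>0) r"
  and z: "!!\<mu>. \<mu> \<in> fastset ==> \<bar>\<mu> - \<mu>0\<bar> < r ==> G (of_real \<mu>) = 0"
  and conv: "!!\<mu>. 0 <= \<mu> ==> \<bar>\<mu> - \<mu>0\<bar> < r ==> G (of_real \<mu>) = 0 ==> \<mu> \<in> fastset"
  using fast_analytic[OF m0] by blast
 have ball: "complex_of_real \<mu> \<in> ball (of_real \<mu>0) r \<longleftrightarrow> \<bar>\<mu> - \<mu>0\<bar> < r" for \<mu>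
  by (simp add: dist_norm abs_minus_commute of_real_diff[symmetric] norm_of_real del: of_real_diff)
 define Z where "Z = complex_of_real ` {\<mu> \<in> fastset. \<bar>\<mu> - \<mu>0\<bar> < r}"
 have lim: "of_real \<mu>0 islimpt Z" unfolding islimpt_approachable
 proof (intro allI impI)
  fix d :: real assume d: "0 < d"
  then have "0 < min d r" using r by simp
  then obtain \<mu> where \<mu>: "\<mu> \<in> fastset" "\<mu> \<noteq> \<mu>0" "dist \<mu> \<mu>0 < min d r" using lp unfolding islimpt_approachable by blast
  then have "complex_of_real \<mu> \<in> Z" "dist (complex_of_real \<mu>) (of_real \<mu>0) < d"
   by (auto simp: Z_def dist_real_def dist_norm of_real_diff[symmetric] norm_of_real simp del: of_real_diff)
  then show "\<exists>x'\<in>Z. x' \<noteq> of_real \<mu>0 & dist x' (of_real \<mu>0) < d" using \<mu>(2) by (intro bexI[of _ "of_real \<mu>"]) auto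
 qed
 have "G w = 0" if "w \<in> ball (of_real \<mu>0) r" for w
  by (rule analytic_continuation[OF G open_ball connected_ball _ _ lim _ that]) (use z r in \<open>auto simp: Z_def dist_real_def abs_minus_commute\<close>)
 then show ?thesis using that[OF r] conv ball by blast
qed

lemma fastset_subset: "fastset \<subseteq> Mset" by (auto simp: fastset_def)

text \<open>Limit points of fast parameters are fast, because the slow parameters and the complement
  of \<open>Mset\<close> are open in [0, \<infinity>). The set \<open>L\<close> of limit points is
  closed and bounded; at its supremum \<open>fast_accumulation\<close> provides an interval of fast
  parameters to the right, which contains further points of \<open>L\<close>.\<close>

lemma finite_fastset: "finite fastset"
proof (rule ccontr)
 assume inf: "infinite fastset"
 obtain B where B: "0 < B" "!!\<mu>. \<mu> \<in> Mset ==> \<mu> <= B" using Mset_bounded by blast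
 have sub: "fastset \<subseteq> {0..B}" using fastset_subset MsetD(1) B(2) by auto
 have lp_fast: "x \<in> fastset" if x: "x islimpt fastset" for x
 proof (rule ccontr)
  assume nf: "x \<notin> fastset"
  have "x islimpt {0..B}" by (rule islimpt_subset[OF x sub])
  then have "x \<in> {0..B}" using closed_limpt[of "{0..B}"] closed_atLeastAtMost[of 0 B] by blast
  then have x0: "0 <= x" by simp
  have "\<exists>e>0. \<forall>\<mu>\<ge>0. \<bar>\<mu> - x\<bar> < e --> \<mu> \<notin> fastset"
  proof (cases "x \<in> Mset")
   case True
   show ?thesis by (rule slow_open[OF True nf]) blast
  next
   case False
   show ?thesis by (rule complement_open[OF x0 False]) (use fastset_subset in blast)
  qed
  then obtain e where e: "0 < e" "!!\<mu>. 0 <= \<mu> ==> \<bar>\<mu> - x\<bar> < e ==> \<mu> \<notin> fastset" by blast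
  obtain \<mu> where "\<mu> \<in> fastset" "dist \<mu> x < e" using x e(1) unfolding islimpt_approachable by blast
  then show False using e(2)[of \<mu>] sub by (auto simp: dist_real_def)
 qed
 define L where "L = {x. x islimpt fastset}"
 have "bounded fastset" by (rule bounded_subset[OF _ sub]) simp
 then obtain x where x: "x \<in> L" unfolding L_def using bounded_infinite_imp_islimpt[OF order_refl _ inf] by blast
 have Lb: "L \<subseteq> {0..B}" unfolding L_def using lp_fast sub by blast
 have Lbd: "bdd_above L" by (rule bdd_above_mono[OF _ Lb]) simp
 have "closed L" unfolding L_def by (rule closed_limpts)
 then have sL: "Sup L \<in> L" using x Lbd by (intro closed_contains_Sup) auto
 then have sf: "Sup L \<in> fastset" "Sup L islimpt fastset" using lp_fast by (auto simp: L_def)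
 obtain e where e: "0 < e" "!!\<mu>. 0 <= \<mu> ==> \<bar>\<mu> - Sup L\<bar> < e ==> \<mu> \<in> fastset" using fast_accumulation[OF sf] by blast
 have s0: "0 <= Sup L" using sf(1) sub by auto
 have "Sup L + e / 2 islimpt fastset"
 proof (rule islimpt_subset)
  show "Sup L + e / 2 islimpt {Sup L<..<Sup L + e}" by (rule interior_limit_point) (use e(1) in \<open>simp add: interior_open\<close>)
  show "{Sup L<..<Sup L + e} \<subseteq> fastset"
  proof
   fix y assume "y \<in> {Sup L<..<Sup L + e}"
   then show "y \<in> fastset" using s0 by (intro e(2)) auto
  qed
 qed
 then have "Sup L + e / 2 <= Sup L" by (intro cSup_upper Lbd) (simp add: L_def)
 then show False using e(1) by simp
qed

end

section \<open>Structure of the parameter set\<close>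

lemma filterlim_exp_at_right_0: "filterlim exp (at_right (0::real)) at_bot" by (auto simp: filterlim_at exp_at_bot)

context emden_fowler
begin

text \<open>Off \<open>fastset\<close>, membership in \<open>Mset\<close> is locally constant:
  \<open>slow_open\<close> treats the members, \<open>complement_open\<close> the others.\<close>

lemma interval_dichotomy:
 assumes S: "connected S" "S \<subseteq> {0..}" "S \<inter> fastset = {}"
 shows "S \<subseteq> Mset - fastset \<or> S \<inter> Mset = {}"
proof -
 have "\<forall>\<^sub>F b in at a within S. (a \<in> Mset) = (b \<in> Mset)" if a: "a \<in> S" for a
 proof -
  have a0: "0 <= a" "a \<notin> fastset" using a S by auto
  have "\<exists>e>0. \<forall>b\<ge>0. \<bar>b - a\<bar> < e --> (a \<in> Mset) = (b \<in> Mset)"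
  proof (cases "a \<in> Mset")
   case True
   show ?thesis by (rule slow_open[OF True a0(2)]) (use True in blast)
  next
   case False
   show ?thesis by (rule complement_open[OF a0(1) False]) (use False in blast)
  qed
  then obtain e where e: "0 < e" "\<forall>b\<ge>0. \<bar>b - a\<bar> < e --> (a \<in> Mset) = (b \<in> Mset)" by blast
  have "\<forall>b\<in>S. b \<noteq> a & dist b a < e --> (a \<in> Mset) = (b \<in> Mset)"
   using e(2) S(2) by (auto simp: dist_real_def)
  then show ?thesis unfolding eventually_at using e(1) by blast
 qed
 then have "(a \<in> Mset) = (b \<in> Mset)" if "a \<in> S" "b \<in> S" for a b
  using connected_local_const[OF S(1) that, of "%x. x \<in> Mset"] by blast
 then show ?thesis using S(3) by blast
qed

text \<open>A fast parameter exists whenever \<open>Mset\<close> is nonempty: otherwise the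
  dichotomy on the connected set [0, \<infinity>) would put all of it into \<open>Mset\<close>,
  which is bounded. The same argument decides the last, unbounded interval.\<close>

lemma fastset_structure:
 assumes ne: "Mset \<noteq> {}"
 obtains Nf :: nat and \<mu>s :: "nat => real" where "1 <= Nf" "!!i. i \<in> {1..<Nf} ==> \<mu>s i < \<mu>s (i + 1)"
  "!!i. i \<in> {1..Nf} ==> \<mu>s i \<in> fastset"
  "!!i. i \<in> {1..<Nf} ==> {\<mu>s i<..<\<mu>s (i + 1)} \<subseteq> Mset - fastset \<or> {\<mu>s i<..<\<mu>s (i + 1)} \<inter> Mset = {}"
  "{0..<\<mu>s 1} \<subseteq> Mset - fastset \<or> {0..<\<mu>s 1} \<inter> Mset = {}"
  "!!\<mu>. \<mu>s Nf < \<mu> ==> \<mu> \<notin> Mset"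
proof -
 obtain B where B: "0 < B" "!!\<mu>. \<mu> \<in> Mset ==> \<mu> <= B" using Mset_bounded by blast
 have pos: "0 <= \<mu>" if "\<mu> \<in> Mset" for \<mu> by (rule MsetD(1)[OF that])
 have Fne: "fastset \<noteq> {}"
 proof
  assume "fastset = {}"
  then have "{0..} \<subseteq> Mset - fastset \<or> {0..} \<inter> Mset = {}" by (intro interval_dichotomy) auto
  then show False
  proof
   assume a: "{0..} \<subseteq> Mset - fastset"
   have "B + 1 \<in> {0..}" using B(1) by simp
   then have "B + 1 \<in> Mset" using a by blast
   then show False using B(2)[of "B + 1"] by simp
  next
   assume "{0..} \<inter> Mset = {}"
   then show False using ne pos by auto
  qed
 qed
 define xs where "xs = sorted_list_of_set fastset"
 have xs: "set xs = fastset" "sorted_wrt (<) xs" "length xs = card fastset" using finite_fastset by (auto simp: xs_def)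
 define Nf where "Nf = length xs"
 \<comment> \<open>List positions start at 0, the numbering of the parameters at 1.\<close>
 define \<mu>s where "\<mu>s i = xs ! (i - 1)" for i
 have Nf: "1 <= Nf" using Fne finite_fastset xs(3) by (simp add: Nf_def Suc_le_eq card_gt_0_iff)
 have less: "\<mu>s i < \<mu>s j" if "1 <= i" "i < j" "j <= Nf" for i j
  unfolding \<mu>s_def using that by (intro sorted_wrt_nth_less[OF xs(2)]) (auto simp: Nf_def)
 have mem: "\<mu>s i \<in> fastset" if "i \<in> {1..Nf}" for i
  unfolding \<mu>s_def xs(1)[symmetric] using that by (intro nth_mem) (auto simp: Nf_def)
 have ex: "\<exists>i\<in>{1..Nf}. x = \<mu>s i" if "x \<in> fastset" for x
 proof -
  have "x \<in> set xs" using that xs(1) by simp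
  then obtain j where j: "j < length xs" "xs ! j = x" unfolding in_set_conv_nth by blast
  then have "Suc j \<in> {1..Nf}" "x = \<mu>s (Suc j)" by (simp_all add: \<mu>s_def Nf_def Suc_le_eq)
  then show ?thesis by blast
 qed
 have sub0: "0 <= \<mu>s i" if "i \<in> {1..Nf}" for i using mem[OF that] fastset_subset pos by blast
 show ?thesis
 proof (rule that[OF Nf])
  show "\<mu>s i < \<mu>s (i + 1)" if "i \<in> {1..<Nf}" for i using that by (intro less) auto
  show "\<mu>s i \<in> fastset" if "i \<in> {1..Nf}" for i by (rule mem[OF that])
  show "{\<mu>s i<..<\<mu>s (i + 1)} \<subseteq> Mset - fastset \<or> {\<mu>s i<..<\<mu>s (i + 1)} \<inter> Mset = {}" if i: "i \<in> {1..<Nf}" for i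
  proof (rule interval_dichotomy)
   show "connected {\<mu>s i<..<\<mu>s (i + 1)}" by simp
   show "{\<mu>s i<..<\<mu>s (i + 1)} \<subseteq> {0..}" using sub0[of i] i by auto
   show "{\<mu>s i<..<\<mu>s (i + 1)} \<inter> fastset = {}"
   proof (rule ccontr)
    assume "\<not> ?thesis"
    then obtain x where x: "x \<in> fastset" "\<mu>s i < x" "x < \<mu>s (i + 1)" by auto
    obtain j where j: "j \<in> {1..Nf}" "x = \<mu>s j" using ex[OF x(1)] by blast
    show False
    proof (cases "j <= i")
     case True
     then have "\<mu>s j <= \<mu>s i" using less[of j i] j i by (cases "j = i") auto
     then show False using x j by simp
    next
     case False
     then have "\<mu>s (i + 1) <= \<mu>s j" using less[of "i + 1" j] j i by (cases "j = i + 1") auto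
     then show False using x j by simp
    qed
   qed
  qed
  show "{0..<\<mu>s 1} \<subseteq> Mset - fastset \<or> {0..<\<mu>s 1} \<inter> Mset = {}"
  proof (rule interval_dichotomy)
   show "{0..<\<mu>s 1} \<inter> fastset = {}"
   proof (rule ccontr)
    assume "\<not> ?thesis"
    then obtain x where x: "x \<in> fastset" "x < \<mu>s 1" by auto
    obtain j where j: "j \<in> {1..Nf}" "x = \<mu>s j" using ex[OF x(1)] by blast
    then have "\<mu>s 1 <= \<mu>s j" using less[of 1 j] by (cases "j = 1") auto
    then show False using x j by simp
   qed
  qed auto
  fix \<mu> assume m: "\<mu>s Nf < \<mu>"
  have "{\<mu>s Nf<..} \<subseteq> Mset - fastset \<or> {\<mu>s Nf<..} \<inter> Mset = {}"
  proof (rule interval_dichotomy)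
   show "{\<mu>s Nf<..} \<subseteq> {0..}" using sub0[of Nf] Nf by auto
   show "{\<mu>s Nf<..} \<inter> fastset = {}"
   proof (rule ccontr)
    assume "\<not> ?thesis"
    then obtain x where x: "x \<in> fastset" "\<mu>s Nf < x" by auto
    obtain j where j: "j \<in> {1..Nf}" "x = \<mu>s j" using ex[OF x(1)] by blast
    then have "\<mu>s j <= \<mu>s Nf" using less[of j Nf] by (cases "j = Nf") auto
    then show False using x j by simp
   qed
  qed simp
  moreover have "\<not> {\<mu>s Nf<..} \<subseteq> Mset - fastset"
  proof
   assume a: "{\<mu>s Nf<..} \<subseteq> Mset - fastset"
   have "max (\<mu>s Nf) B + 1 \<in> {\<mu>s Nf<..}" unfolding greaterThan_iff by linarith
   then have "max (\<mu>s Nf) B + 1 \<in> Mset" using a by blast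
   then show False using B(2)[of "max (\<mu>s Nf) B + 1"] by simp
  qed
  ultimately show "\<mu> \<notin> Mset" using m by auto
 qed
qed

text \<open>exp (n t) U is nondecreasing, so exceeding C once means exceeding it for good.\<close>

lemma kelvin_unbounded:
 assumes "\<mu> \<in> Mset" "\<mu> \<notin> fastset"
 shows "filterlim (%t. exp (n * t) * US \<mu> t) at_top at_top" unfolding filterlim_at_top_dense
proof
 fix C
 obtain t0 where t0: "C < exp (n * t0) * US \<mu> t0" using assms by (auto simp: fastset_def not_le)
 show "\<forall>\<^sub>F t in at_top. C < exp (n * t) * US \<mu> t" using eventually_ge_at_top[of t0]
 proof eventually_elim
  case (elim t)
  then show ?case using kelvin_mono[OF MsetD(3)[OF assms(1)] MsetD(2)[OF assms(1)] elim] t0 by simp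
 qed
qed

context
 fixes N :: nat and K f :: "real => real"
 assumes nN: "n = real N - 2" and N3: "3 <= N"
  and \<kappa>K: "!!t. \<kappa> t = exp (2 * t) * K (exp t)" and \<phi>f: "!!t. \<phi> t = exp (2 * t) * f (exp t)"
  and Kc: "continuous_on {0<..} K" and fc: "continuous_on {0<..} f"
begin

lemma singular_of_solution:
 assumes \<mu>: "0 <= \<mu>" and u: "singular_solution N K f p \<mu> u"
 shows "\<mu> \<in> Mset"
proof -
 obtain u' u'' where d: "!!r. 0 < r ==> (u has_real_derivative u' r) (at r)"
   "!!r. 0 < r ==> (u' has_real_derivative u'' r) (at r)"
  and ode: "!!r. 0 < r ==> u'' r + (real N - 1) / r * u' r + K r * (u r) powr p + \<mu> * f r = 0"
  and pos: "!!r. 0 < r ==> 0 < u r" and top: "filterlim u at_top (at_right 0)" using u unfolding singular_solution_def by blast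
 define U where "U t = u (exp t)" for t
 define V where "V t = exp t * u' (exp t)" for t
 have dU: "(U has_real_derivative V t) (at t)" for t
  unfolding U_def[abs_def] V_def using DERIV_chain2[OF d(1)[of "exp t"] DERIV_exp] by (simp add: mult.commute)
 have "((%t. u' (exp t)) has_real_derivative u'' (exp t) * exp t) (at t)" for t using DERIV_chain2[OF d(2)[of "exp t"] DERIV_exp] by simp
 then have dV: "(V has_real_derivative exp t * u' (exp t) + exp t * (u'' (exp t) * exp t)) (at t)" for t
  unfolding V_def[abs_def] by (auto intro!: derivative_eq_intros)
 have "exp t * u' (exp t) + exp t * (u'' (exp t) * exp t) = - n * V t - force \<mu> U t" for t
 proof -
  have e: "exp (2 * t) = exp t * exp t" by (simp add: exp_add[symmetric])
  define a y X where "a = exp t" and "y = u' (exp t)" and "X = K (exp t) * (U t) powr p + \<mu> * f (exp t)"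
  have a: "0 < a" by (simp add: a_def)
  have "u'' (exp t) = - ((real N - 1) / a * y + X)" using ode[of "exp t"] by (simp add: U_def a_def y_def X_def)
  then have "a * (u'' (exp t) * a) = a * (- ((real N - 1) / a * y + X) * a)" by (simp only:)
  also have "... = - ((real N - 1) * (a * y) + a * a * X)" using a by (simp add: field_simps)
  finally have "exp t * (u'' (exp t) * exp t) = - ((real N - 1) * (exp t * u' (exp t)) + exp t * exp t * (K (exp t) * (U t) powr p + \<mu> * f (exp t)))"
   by (simp only: a_def y_def X_def)
  moreover have "0 < U t" using pos by (simp add: U_def)
  ultimately show ?thesis unfolding nN V_def force_def \<kappa>K \<phi>f e by (simp add: algebra_simps)
 qed
 then have "solves \<mu> U V" using dU dV by (simp add: solves_def)
 moreover have "filterlim U at_top at_bot" unfolding U_def[abs_def] by (rule filterlim_compose[OF top filterlim_exp_at_right_0])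
 ultimately have "singular \<mu> U V" using \<mu> pos by (simp add: singular_def U_def)
 then show ?thesis by (simp add: singular_iff)
qed

lemma solution_of_singular:
 assumes m: "\<mu> \<in> Mset"
 shows "singular_solution N K f p \<mu> (%r. US \<mu> (ln r))"
proof -
 have "singular \<mu> (US \<mu>) (VS \<mu>)" using m by (simp add: singular_iff)
 then have S: "solves \<mu> (US \<mu>) (VS \<mu>)" and U: "!!t. 0 < US \<mu> t" and top: "filterlim (US \<mu>) at_top at_bot"
  by (auto simp: singular_def)
 define u' where "u' r = VS \<mu> (ln r) / r" for r
 define u'' where "u'' r = ((- n * VS \<mu> (ln r) - (r^2 * (K r * US \<mu> (ln r) powr p + \<mu> * f r))) - VS \<mu> (ln r)) / r^2" for r
 have fo: "force \<mu> (US \<mu>) (ln r) = r^2 * (K r * US \<mu> (ln r) powr p + \<mu> * f r)" if r: "0 < r" for r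
 proof -
  have "exp (2 * ln r) = r^2" using r by (simp add: exp_double)
  then show ?thesis using r U[of "ln r"] by (simp add: force_def \<kappa>K \<phi>f algebra_simps)
 qed
 have dU: "((%r. US \<mu> (ln r)) has_real_derivative u' r) (at r)" if r: "0 < r" for r
  using DERIV_chain2[OF solvesD(1)[OF S] DERIV_ln[OF r]] by (simp add: u'_def divide_inverse)
 have dV: "((%r. VS \<mu> (ln r)) has_real_derivative (- n * VS \<mu> (ln r) - force \<mu> (US \<mu>) (ln r)) * inverse r) (at r)" if r: "0 < r" for r
  by (rule DERIV_chain2[OF solvesD(2)[OF S] DERIV_ln[OF r]])
 have du': "(u' has_real_derivative u'' r) (at r)" if r: "0 < r" for r
 proof -
  have "(u' has_real_derivative (((- n * VS \<mu> (ln r) - force \<mu> (US \<mu>) (ln r)) * inverse r) * r - VS \<mu> (ln r) * 1) / (r * r)) (at r)"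
   unfolding u'_def[abs_def] by (rule DERIV_divide[OF dV[OF r] DERIV_ident]) (use r in simp)
  moreover have "(((- n * VS \<mu> (ln r) - force \<mu> (US \<mu>) (ln r)) * inverse r) * r - VS \<mu> (ln r) * 1) / (r * r) = u'' r"
   using r unfolding fo[OF r] u''_def by (simp add: power2_eq_square)
  ultimately show ?thesis by simp
 qed
 have cont: "continuous_on {0<..} u''"
 proof -
  have c1: "continuous_on {0<..} (%r. US \<mu> (ln r))"
   by (rule DERIV_continuous_on[of _ _ u']) (use dU in \<open>auto intro: has_field_derivative_at_within\<close>)
  have c2: "continuous_on {0<..} (%r. VS \<mu> (ln r))"
   by (rule DERIV_continuous_on) (use dV in \<open>auto intro: has_field_derivative_at_within\<close>)
  have c3: "continuous_on {0<..} (%r. US \<mu> (ln r) powr p)"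
   by (intro continuous_on_powr c1 continuous_on_const) (use U less_imp_neq[symmetric] in blast)
  show ?thesis unfolding u''_def[abs_def]
   by (intro continuous_on_divide continuous_on_diff continuous_on_mult continuous_on_add continuous_on_const continuous_on_power continuous_on_id c1 c2 c3 Kc fc) auto
 qed
 have ode: "u'' r + (real N - 1) / r * u' r + K r * (US \<mu> (ln r)) powr p + \<mu> * f r = 0" if r: "0 < r" for r
 proof -
  define Q where "Q = K r * US \<mu> (ln r) powr p + \<mu> * f r"
  have N1: "real N - 1 = n + 1" using nN by simp
  have "u'' r = - ((real N - 1) * VS \<mu> (ln r) / r^2) - Q" using r unfolding u''_def Q_def[symmetric] N1 by (simp add: field_simps)
  moreover have "(real N - 1) / r * u' r = (real N - 1) * VS \<mu> (ln r) / r^2" by (simp add: u'_def power2_eq_square)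
  ultimately show ?thesis unfolding Q_def by linarith
 qed
 show ?thesis unfolding singular_solution_def
 proof (rule conjI, rule exI[of _ u'], rule exI[of _ u''], intro conjI allI impI)
  show "filterlim (%r. US \<mu> (ln r)) at_top (at_right 0)" by (rule filterlim_compose[OF top ln_at_0])
 qed (use dU du' cont ode U in auto)
qed

lemma kelvin_radial: "0 < r ==> r ^ (N - 2) * US \<mu> (ln r) = exp (n * ln r) * US \<mu> (ln r)"
proof -
 assume r: "0 < r"
 have "exp (n * ln r) = r powr real (N - 2)" using r N3 by (simp add: powr_def nN of_nat_diff)
 then show ?thesis using r by (simp add: powr_realpow)
qed

lemma fast_decay_of_fastset:
 assumes "\<mu> \<in> fastset"
 shows "fast_decay N (%r. US \<mu> (ln r))"
proof -
 obtain C where C: "!!t. exp (n * t) * US \<mu> t <= C" using assms by (auto simp: fastset_def)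
 have "Limsup at_top (%r. ereal (r ^ (N - 2) * US \<mu> (ln r))) <= ereal C"
  by (rule Limsup_bounded, rule eventually_mono[OF eventually_gt_at_top[of 0]]) (simp add: kelvin_radial C)
 then show ?thesis unfolding fast_decay_def by (rule order_le_less_trans) simp
qed

lemma slow_decay_of_slow:
 assumes "\<mu> \<in> Mset" "\<mu> \<notin> fastset"
 shows "slow_decay N (%r. US \<mu> (ln r))"
proof -
 have "filterlim (%r. exp (n * ln r) * US \<mu> (ln r)) at_top at_top" by (rule filterlim_compose[OF kelvin_unbounded[OF assms] ln_at_top])
 then have "\<forall>\<^sub>F r in at_top. C < exp (n * ln r) * US \<mu> (ln r)" for C by (simp add: filterlim_at_top_dense)
 then have ev: "\<forall>\<^sub>F r in at_top. ereal C < ereal (r ^ (N - 2) * US \<mu> (ln r))" for C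
  using eventually_gt_at_top[of 0] by eventually_elim (simp add: kelvin_radial)
 have "((%r. ereal (r ^ (N - 2) * US \<mu> (ln r))) \<longlongrightarrow> \<infinity>) at_top" unfolding tendsto_PInfty using ev by blast
 then show ?thesis unfolding slow_decay_def by (rule lim_imp_Limsup[OF trivial_limit_at_top_linorder])
qed

end

end

theorem theorem1p5:
  fixes N :: nat and p \<alpha> \<beta> k0 k_inf \<nu> q :: real
    and K f :: "real \<Rightarrow> real"
  assumes N: "N \<ge> 3" and p1: "p > 1"
    and K_cont: "continuous_on {0<..} K" and K_pos: "\<forall>r>0. K r > 0"
    and K0: "\<alpha> > -2" "k0 > 0" "((\<lambda>r. K r / r powr \<alpha>) \<longlongrightarrow> k0) (at_right 0)"
    and Kinf: "\<beta> > -2" "k_inf > 0" "((\<lambda>r. K r / r powr \<beta>) \<longlongrightarrow> k_inf) at_top"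
    and f_cont: "continuous_on {0<..} f" and f_nonneg: "\<forall>r>0. f r \<ge> 0"
    and f_nz: "\<exists>r>0. f r \<noteq> 0"
    and F0: "\<nu> > -2" "f \<in> O[at_right 0](\<lambda>r. r powr \<nu>)"
    and Finf: "q > real N" "f \<in> O[at_top](\<lambda>r. r powr (- q))"
    and p_big: "p > max (p_S N \<alpha>) (p_S N \<beta>)"
  defines "E1 \<equiv> (\<forall>\<mu>\<ge>0. \<not> (\<exists>u. singular_solution N K f p \<mu> u))"
    and "E2 \<equiv> (\<exists>Nf::nat. \<exists>\<mu>s::nat \<Rightarrow> real.
          Nf \<ge> 1 \<and> 0 \<le> \<mu>s 1 \<and> (\<forall>i\<in>{1..<Nf}. \<mu>s i < \<mu>s (i + 1)) \<and>
          (\<forall>i\<in>{1..Nf}. \<exists>u. singular_solution N K f p (\<mu>s i) u \<and> fast_decay N u) \<and>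
          (\<forall>i\<in>{1..<Nf}.
             (\<forall>\<mu>\<in>{\<mu>s i<..<\<mu>s (i + 1)}. \<exists>u. singular_solution N K f p \<mu> u \<and> slow_decay N u) \<or>
             (\<forall>\<mu>\<in>{\<mu>s i<..<\<mu>s (i + 1)}. \<not> (\<exists>u. singular_solution N K f p \<mu> u))) \<and>
          (\<mu>s 1 > 0 \<longrightarrow>
             (\<forall>\<mu>\<in>{0..<\<mu>s 1}. \<exists>u. singular_solution N K f p \<mu> u \<and> slow_decay N u) \<or>
             (\<forall>\<mu>\<in>{0..<\<mu>s 1}. \<not> (\<exists>u. singular_solution N K f p \<mu> u))) \<and>
          (\<forall>\<mu>>\<mu>s Nf. \<not> (\<exists>u. singular_solution N K f p \<mu> u)))"
  shows "(E1 \<and> \<not> E2) \<or> (\<not> E1 \<and> E2)"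
proof -
 define n where "n = real N - 2"
 define \<kappa> where "\<kappa> t = exp (2 * t) * K (exp t)" for t
 define \<phi> where "\<phi> t = exp (2 * t) * f (exp t)" for t
 have n: "0 < n" using N by (simp add: n_def)
 \<comment> \<open>Since N + 2 = n + 4, the inequality p n > N + 2 + 2 s is the supercriticality
   condition of the locale.\<close>
 have crit: "2 * (2 + s) < n * (p - 1)" if "p > p_S N s" for s
 proof -
  have "real N + 2 + 2 * s < p * n" using that n by (simp add: p_S_def n_def divide_less_eq)
  then show ?thesis by (simp add: n_def algebra_simps)
 qed
 have scale: "exp (2 * t) * K (exp t) * exp (- (2 + s) * t) = K (exp t) / exp t powr s" for t s
 proof -
  have "exp t powr s = exp (s * t)" by (simp add: powr_def)
  moreover have "2 * t + - (2 + s) * t = - (s * t)" by (simp add: algebra_simps)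
  then have "exp (2 * t) * exp (- (2 + s) * t) = exp (- (s * t))" by (simp only: exp_add[symmetric])
  ultimately show ?thesis by (simp add: exp_minus divide_inverse mult.assoc mult.left_commute)
 qed
 interpret emden_fowler n p "2 + \<alpha>" "2 + \<beta>" k0 k_inf "2 + \<nu>" "q - real N" \<kappa> \<phi>
 proof
  show "0 < n" by (rule n)
  show "1 < p" "0 < 2 + \<alpha>" "0 < 2 + \<beta>" "0 < k0" "0 < k_inf" "0 < 2 + \<nu>" "0 < q - real N" using p1 K0 Kinf F0 Finf by auto
  show "continuous_on UNIV \<kappa>" "continuous_on UNIV \<phi>" unfolding \<kappa>_def \<phi>_def
   by (auto intro!: continuous_intros continuous_on_compose2[OF K_cont] continuous_on_compose2[OF f_cont])
  show "0 < \<kappa> t" "0 <= \<phi> t" for t using K_pos f_nonneg by (auto simp: \<kappa>_def \<phi>_def)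
  obtain r where r: "0 < r" "f r \<noteq> 0" using f_nz by blast
  then have "0 < f r" using f_nonneg by (simp add: less_le)
  then have "0 < \<phi> (ln r)" using r by (simp add: \<phi>_def)
  then show "\<exists>t. 0 < \<phi> t" by blast
  show "((%t. \<kappa> t * exp (- (2 + \<alpha>) * t)) \<longlongrightarrow> k0) at_bot"
   unfolding \<kappa>_def scale by (rule filterlim_compose[OF K0(3) filterlim_exp_at_right_0])
  show "((%t. \<kappa> t * exp (- (2 + \<beta>) * t)) \<longlongrightarrow> k_inf) at_top"
   unfolding \<kappa>_def scale by (rule filterlim_compose[OF Kinf(3) exp_at_top])
  show "\<exists>C T. \<forall>t\<le>T. \<phi> t <= C * exp ((2 + \<nu>) * t)"
  proof -
   obtain c where "\<forall>\<^sub>F r in at_right 0. norm (f r) <= c * norm (r powr \<nu>)" using F0(2) by (elim landau_o.bigE)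
   then have "\<forall>\<^sub>F t in at_bot. norm (f (exp t)) <= c * norm (exp t powr \<nu>)"
    using filterlim_exp_at_right_0 unfolding filterlim_iff by blast
   then obtain T where T: "!!t. t <= T ==> norm (f (exp t)) <= c * norm (exp t powr \<nu>)" by (auto simp: eventually_at_bot_linorder)
   have "\<phi> t <= c * exp ((2 + \<nu>) * t)" if "t <= T" for t
   proof -
    have "f (exp t) <= c * exp (\<nu> * t)" using T[OF that] by (simp add: powr_def)
    then have "exp (2 * t) * f (exp t) <= exp (2 * t) * (c * exp (\<nu> * t))" by (intro mult_left_mono) auto
    then show ?thesis by (simp add: \<phi>_def distrib_right exp_add mult.left_commute)
   qed
   then show ?thesis by blast
  qed
  show "\<exists>C T. \<forall>t\<ge>T. \<phi> t <= C * exp (- (n + (q - real N)) * t)"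
  proof -
   obtain c where "\<forall>\<^sub>F r in at_top. norm (f r) <= c * norm (r powr (- q))" using Finf(2) by (elim landau_o.bigE)
   then have "\<forall>\<^sub>F t in at_top. norm (f (exp t)) <= c * norm (exp t powr (- q))" using exp_at_top unfolding filterlim_iff by blast
   then obtain T where T: "!!t. T <= t ==> norm (f (exp t)) <= c * norm (exp t powr (- q))" by (auto simp: eventually_at_top_linorder)
   have "\<phi> t <= c * exp (- (n + (q - real N)) * t)" if "T <= t" for t
   proof -
    have "f (exp t) <= c * exp (- q * t)" using T[OF that] by (simp add: powr_def)
    then have "exp (2 * t) * f (exp t) <= exp (2 * t) * (c * exp (- q * t))" by (intro mult_left_mono) auto
    also have "... = c * (exp (2 * t) * exp (- q * t))" by simp
    also have "exp (2 * t) * exp (- q * t) = exp (- (n + (q - real N)) * t)"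
    proof -
     have "2 * t + - q * t = - (n + (q - real N)) * t" by (simp add: n_def algebra_simps)
     then show ?thesis by (simp only: exp_add[symmetric])
    qed
    finally show ?thesis by (simp add: \<phi>_def)
   qed
   then show ?thesis by blast
  qed
  show "2 * (2 + \<alpha>) < n * (p - 1)" "2 * (2 + \<beta>) < n * (p - 1)" using crit p_big by auto
 qed
 note tr = n_def N \<kappa>_def \<phi>_def K_cont f_cont
 have none: "\<not> (\<exists>u. singular_solution N K f p \<mu> u)" if "0 <= \<mu>" "\<mu> \<notin> Mset" for \<mu>
  using singular_of_solution[OF tr that(1)] that(2) by blast
 have fast: "\<exists>u. singular_solution N K f p \<mu> u & fast_decay N u" if "\<mu> \<in> fastset" for \<mu>
  using solution_of_singular[OF tr] fast_decay_of_fastset[OF tr that] fastset_subset that by blast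
 have slow: "\<exists>u. singular_solution N K f p \<mu> u & slow_decay N u" if "\<mu> \<in> Mset - fastset" for \<mu>
  using solution_of_singular[OF tr, of \<mu>] slow_decay_of_slow[OF tr, of \<mu>] that by blast
 \<comment> \<open>As Nf >= 1, the second alternative contains a singular solution at \<mu>s 1 >= 0,
   which the first one forbids.\<close>
 have exclusive: False if e1: E1 and e2: E2
 proof -
  obtain Nf :: nat and \<mu>s :: "nat => real" where "1 <= Nf" "0 <= \<mu>s 1"
   and s: "\<forall>i\<in>{1..Nf}. \<exists>u. singular_solution N K f p (\<mu>s i) u & fast_decay N u"
   using e2 unfolding E2_def by (elim exE conjE) (rule that)
  then have "\<exists>u. singular_solution N K f p (\<mu>s 1) u" by fastforce
  then show False using e1 \<open>0 <= \<mu>s 1\<close> unfolding E1_def by blast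
 qed
 have "E1 \<or> E2"
 proof (cases "Mset = {}")
  case True
  then show ?thesis unfolding E1_def using none by blast
 next
  case False
  obtain Nf :: nat and \<mu>s :: "nat => real" where Nf: "1 <= Nf" and inc: "!!i. i \<in> {1..<Nf} ==> \<mu>s i < \<mu>s (i + 1)"
   and mem: "!!i. i \<in> {1..Nf} ==> \<mu>s i \<in> fastset"
   and dich: "!!i. i \<in> {1..<Nf} ==> {\<mu>s i<..<\<mu>s (i + 1)} \<subseteq> Mset - fastset \<or> {\<mu>s i<..<\<mu>s (i + 1)} \<inter> Mset = {}"
   and first: "{0..<\<mu>s 1} \<subseteq> Mset - fastset \<or> {0..<\<mu>s 1} \<inter> Mset = {}"
   and last: "!!\<mu>. \<mu>s Nf < \<mu> ==> \<mu> \<notin> Mset" by (fact fastset_structure[OF False])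
  have pos: "0 <= \<mu>s i" if "i \<in> {1..Nf}" for i using mem[OF that] fastset_subset MsetD(1) by blast
  have E2 unfolding E2_def
  proof (intro exI[of _ Nf] exI[of _ \<mu>s] conjI ballI allI impI)
   show "1 <= Nf" by (rule Nf)
   show "0 <= \<mu>s 1" using pos Nf by simp
   show "\<mu>s i < \<mu>s (i + 1)" if "i \<in> {1..<Nf}" for i by (rule inc[OF that])
   show "\<exists>u. singular_solution N K f p (\<mu>s i) u & fast_decay N u" if "i \<in> {1..Nf}" for i by (rule fast[OF mem[OF that]])
   show "(\<forall>\<mu>\<in>{\<mu>s i<..<\<mu>s (i + 1)}. \<exists>u. singular_solution N K f p \<mu> u & slow_decay N u) \<or>
     (\<forall>\<mu>\<in>{\<mu>s i<..<\<mu>s (i + 1)}. \<not> (\<exists>u. singular_solution N K f p \<mu> u))" if i: "i \<in> {1..<Nf}" for i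
    using dich[OF i]
   proof
    assume "{\<mu>s i<..<\<mu>s (i + 1)} \<subseteq> Mset - fastset"
    then show ?thesis using slow by blast
   next
    assume d: "{\<mu>s i<..<\<mu>s (i + 1)} \<inter> Mset = {}"
    have "\<not> (\<exists>u. singular_solution N K f p \<mu> u)" if "\<mu> \<in> {\<mu>s i<..<\<mu>s (i + 1)}" for \<mu>
     by (rule none) (use that d pos[of i] i in auto)
    then show ?thesis by blast
   qed
   show "(\<forall>\<mu>\<in>{0..<\<mu>s 1}. \<exists>u. singular_solution N K f p \<mu> u & slow_decay N u) \<or>
     (\<forall>\<mu>\<in>{0..<\<mu>s 1}. \<not> (\<exists>u. singular_solution N K f p \<mu> u))" using first
   proof
    assume "{0..<\<mu>s 1} \<subseteq> Mset - fastset"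
    then show ?thesis using slow by blast
   next
    assume d: "{0..<\<mu>s 1} \<inter> Mset = {}"
    have "\<not> (\<exists>u. singular_solution N K f p \<mu> u)" if "\<mu> \<in> {0..<\<mu>s 1}" for \<mu> by (rule none) (use that d in auto)
    then show ?thesis by blast
   qed
   fix \<mu> assume m: "\<mu>s Nf < \<mu>"
   show "\<not> (\<exists>u. singular_solution N K f p \<mu> u)" by (rule none) (use m last pos[of Nf] Nf in auto)
  qed
  then show ?thesis by blast
 qed
 then show ?thesis using exclusive by blast
qed

end
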